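(* Let $f\in L^1(\mathbb{R}^N)\cap L^\infty(\mathbb{R}^N)$, $f\ge0$ a.e., be such that $\operatorname{supp}_{\mathcal D'}(f)=\operatorname{supp}_{\mathcal D'}((f-1)_+)$. For $\varepsilon>0$ let $J_\varepsilon=\varepsilon^{-N}J(\cdot/\varepsilon)$, let $u^\varepsilon$ be the $L^1$-solution of $\partial_t u^\varepsilon=\varepsilon^{-2}(J_\varepsilon*v^\varepsilon-v^\varepsilon)$, $v^\varepsilon=(u^\varepsilon-1)_+$, $u^\varepsilon(\cdot,0)=f$, and let $\mathcal M^\varepsilon(t)$ be its mushy region at time $t$. Then for any $t>0$ the set $$\mathcal M^*(t)=\limsup_{\varepsilon\to0}\mathcal M^\varepsilon(t)=\bigcap_{\eta>0}\ \bigcup_{0<\varepsilon<\eta}\mathcal M^\varepsilon(t)$$ has zero $N$-dimensional Lebesgue measure.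
   Context: Standing assumptions: $J:\mathbb{R}^N\to[0,\infty)$ is continuous, compactly supported, radially symmetric, and $\int_{\mathbb{R}^N}J=1$. Here $*$ is convolution in space and $s_+=\max\{s,0\}$. The $L^1$-solution $u^\varepsilon$ is the unique $u^\varepsilon\in C([0,\infty);L^1(\mathbb{R}^N))$ such that for every $t>0$, $u^\varepsilon(t)=f+\varepsilon^{-2}\int_0^t(J_\varepsilon*v^\varepsilon(s)-v^\varepsilon(s))\,ds$ with $v^\varepsilon=(u^\varepsilon-1)_+$ a.e. For a locally integrable $g\ge0$, $\operatorname{supp}_{\mathcal D'}(g)$ is the complement of the largest open set $\mathcal O$ such that the distribution associated to $g$ vanishes on $\mathcal O$. The mushy region of $u^\varepsilon$ at time $t$ is $$\mathcal M^\varepsilon(t)=\operatorname{Int}\Big(\operatorname{supp}_{\mathcal D'}(u^\varepsilon(t))\setminus\operatorname{supp}_{\mathcal D'}((u^\varepsilon(t)-1)_+)\Big).$$ *)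

theory Defs
  imports "HOL-Analysis.Analysis"
begin

definition L1_rel :: "('a::euclidean_space \<Rightarrow> real) \<Rightarrow> ('a \<Rightarrow> real) \<Rightarrow> bool"
  where "L1_rel f g \<longleftrightarrow>
    integrable lebesgue f \<and> integrable lebesgue g \<and> (AE x in lebesgue. f x = g x)"

lemma L1_rel_refl_iff: "L1_rel f f \<longleftrightarrow> integrable lebesgue f"
  by (simp add: L1_rel_def)

lemma part_equivp_L1_rel: "part_equivp (L1_rel :: ('a::euclidean_space \<Rightarrow> real) \<Rightarrow> _)"
proof (rule part_equivpI)
  show "\<exists>f. L1_rel f f"
    by (rule exI[of _ "\<lambda>_. 0"]) (simp add: L1_rel_def)
  show "symp L1_rel"
    by (rule sympI) (auto simp: L1_rel_def eq_commute)
  show "transp (L1_rel :: ('a \<Rightarrow> real) \<Rightarrow> _)"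
  proof (rule transpI)
    fix f g h :: "'a \<Rightarrow> real"
    assume fg: "L1_rel f g" and gh: "L1_rel g h"
    have "AE x in lebesgue. f x = h x"
      using fg[unfolded L1_rel_def, THEN conjunct2, THEN conjunct2]
        gh[unfolded L1_rel_def, THEN conjunct2, THEN conjunct2]
      by eventually_elim simp
    with fg gh show "L1_rel f h"
      by (simp add: L1_rel_def)
  qed
qed

quotient_type (overloaded) 'a L1 = "'a::euclidean_space \<Rightarrow> real" / partial: L1_rel
  by (rule part_equivp_L1_rel)

lemma integrable_rep_L1: "integrable lebesgue (rep_L1 u)"
  using Quotient3_rep_reflp[OF Quotient3_L1] by (simp add: L1_rel_refl_iff)

lemma rep_abs_L1:
  assumes "integrable lebesgue f"
  shows "AE x in lebesgue. rep_L1 (abs_L1 f) x = f x"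
  using Quotient3_rep_abs[OF Quotient3_L1, of f] assms by (simp add: L1_rel_def)

lemma L1_rel_map2:
  assumes "L1_rel f f'" "L1_rel g g'"
    and "integrable lebesgue (\<lambda>x. h (f x) (g x))" "integrable lebesgue (\<lambda>x. h (f' x) (g' x))"
  shows "L1_rel (\<lambda>x. h (f x) (g x)) (\<lambda>x. h (f' x) (g' x))"
proof -
  have "AE x in lebesgue. f x = f' x" "AE x in lebesgue. g x = g' x"
    using assms by (auto simp: L1_rel_def)
  then have "AE x in lebesgue. h (f x) (g x) = h (f' x) (g' x)"
    by eventually_elim simp
  with assms show ?thesis
    by (simp add: L1_rel_def)
qed

lemma integrable_pos_part_minus_one:
  fixes f :: "'a::euclidean_space \<Rightarrow> real"
  assumes "integrable lebesgue f"
  shows "integrable lebesgue (\<lambda>x. max (f x - 1) 0)"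
proof (rule Bochner_Integration.integrable_bound[OF assms])
  have [measurable]: "f \<in> borel_measurable lebesgue"
    using assms by (rule borel_measurable_integrable)
  show "(\<lambda>x. max (f x - 1) 0) \<in> borel_measurable lebesgue"
    by measurable
qed (auto intro!: AE_I2)

instantiation L1 :: (euclidean_space) real_normed_vector
begin

lift_definition zero_L1 :: "'a L1" is "\<lambda>_. 0"
  by (simp add: L1_rel_def)

lift_definition plus_L1 :: "'a L1 \<Rightarrow> 'a L1 \<Rightarrow> 'a L1" is "\<lambda>f g x. f x + g x"
  by (rule L1_rel_map2) (auto simp: L1_rel_def)

lift_definition minus_L1 :: "'a L1 \<Rightarrow> 'a L1 \<Rightarrow> 'a L1" is "\<lambda>f g x. f x - g x"
  by (rule L1_rel_map2) (auto simp: L1_rel_def)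

lift_definition uminus_L1 :: "'a L1 \<Rightarrow> 'a L1" is "\<lambda>f x. - f x"
  by (rule L1_rel_map2[where h="\<lambda>a _. - a"]) (auto simp: L1_rel_def)

lift_definition scaleR_L1 :: "real \<Rightarrow> 'a L1 \<Rightarrow> 'a L1" is "\<lambda>c f x. c * f x"
  by (rule L1_rel_map2[where h="\<lambda>a _. _ * a"]) (auto simp: L1_rel_def)

lift_definition norm_L1 :: "'a L1 \<Rightarrow> real" is "\<lambda>f. LINT x|lebesgue. \<bar>f x\<bar>"
proof -
  fix f g :: "'a \<Rightarrow> real"
  assume fg: "L1_rel f g"
  then have "AE x in lebesgue. \<bar>f x\<bar> = \<bar>g x\<bar>"
    unfolding L1_rel_def by (auto elim: AE_mp)
  with fg show "(LINT x|lebesgue. \<bar>f x\<bar>) = (LINT x|lebesgue. \<bar>g x\<bar>)"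
    by (intro integral_cong_AE) (auto simp: L1_rel_def)
qed

definition sgn_L1 :: "'a L1 \<Rightarrow> 'a L1"
  where "sgn_L1 u = inverse (norm u) *\<^sub>R u"

definition dist_L1 :: "'a L1 \<Rightarrow> 'a L1 \<Rightarrow> real"
  where "dist_L1 u v = norm (u - v)"

definition uniformity_L1 :: "('a L1 \<times> 'a L1) filter"
  where "uniformity_L1 = (INF e\<in>{0<..}. principal {(u, v). dist u v < e})"

definition open_L1 :: "'a L1 set \<Rightarrow> bool"
  where "open_L1 U \<longleftrightarrow> (\<forall>u\<in>U. \<forall>\<^sub>F (u', v) in uniformity. u' = u \<longrightarrow> v \<in> U)"

instance
proof
  fix u v w :: "'a L1" and a b :: real and U :: "'a L1 set"
  show "u + v + w = u + (v + w)"
    by transfer (auto simp: L1_rel_def)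
  show "u + v = v + u"
    by transfer (auto simp: L1_rel_def)
  show "0 + u = u"
    by transfer (auto simp: L1_rel_def)
  show "- u + u = 0"
    by transfer (auto simp: L1_rel_def)
  show "u - v = u + - v"
    by transfer (auto simp: L1_rel_def)
  show "a *\<^sub>R (u + v) = a *\<^sub>R u + a *\<^sub>R v"
    by transfer (auto simp: L1_rel_def algebra_simps)
  show "(a + b) *\<^sub>R u = a *\<^sub>R u + b *\<^sub>R u"
    by transfer (auto simp: L1_rel_def algebra_simps)
  show "a *\<^sub>R b *\<^sub>R u = (a * b) *\<^sub>R u"
    by transfer (auto simp: L1_rel_def algebra_simps)
  show "1 *\<^sub>R u = u"
    by transfer (auto simp: L1_rel_def)
  show "dist u v = norm (u - v)"
    by (rule dist_L1_def)
  show "sgn u = inverse (norm u) *\<^sub>R u"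
    by (rule sgn_L1_def)
  show "uniformity = (INF e\<in>{0<..}. principal {(u, v::'a L1). dist u v < e})"
    by (rule uniformity_L1_def)
  show "open U \<longleftrightarrow> (\<forall>u\<in>U. \<forall>\<^sub>F (u', v) in uniformity. u' = u \<longrightarrow> v \<in> U)"
    by (rule open_L1_def)
  show "norm u = 0 \<longleftrightarrow> u = 0"
    by transfer (auto simp: L1_rel_def integral_nonneg_eq_0_iff_AE)
  show "norm (u + v) \<le> norm u + norm v"
  proof transfer
    fix f g :: "'a \<Rightarrow> real"
    assume "L1_rel f f" "L1_rel g g"
    then have f: "integrable lebesgue f" and g: "integrable lebesgue g"
      by (simp_all add: L1_rel_refl_iff)
    have "(LINT x|lebesgue. \<bar>f x + g x\<bar>) \<le> (LINT x|lebesgue. \<bar>f x\<bar> + \<bar>g x\<bar>)"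
      using f g by (intro integral_mono) auto
    also have "\<dots> = (LINT x|lebesgue. \<bar>f x\<bar>) + (LINT x|lebesgue. \<bar>g x\<bar>)"
      using f g by (intro Bochner_Integration.integral_add) auto
    finally show "(LINT x|lebesgue. \<bar>f x + g x\<bar>) \<le> \<dots>" .
  qed
  show "norm (a *\<^sub>R u) = \<bar>a\<bar> * norm u"
    by transfer (simp add: abs_mult)
qed

end

lift_definition pos_part_minus_one :: "'a::euclidean_space L1 \<Rightarrow> 'a L1"
  is "\<lambda>f x. max (f x - 1) 0"
  by (rule L1_rel_map2[where h="\<lambda>a _. max (a - 1) 0"])
    (auto simp: L1_rel_def intro: integrable_pos_part_minus_one)

lemma distr_lborel_reflect:
  fixes x :: "'a::euclidean_space"
  shows "distr lborel borel (\<lambda>y. x - y) = lborel"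
  using lborel_affine[of "-1" x] by (simp add: density_1)

lemma AE_reflect:
  fixes x :: "'a::euclidean_space"
  assumes "AE z in lebesgue. P z"
  shows "AE y in lebesgue. P (x - y)"
proof -
  have "AE z in distr lborel borel (\<lambda>y. x - y). P z"
    using assms unfolding distr_lborel_reflect AE_completion_iff .
  then have "AE y in lborel. P (x - y)"
    by (rule AE_distrD[rotated]) simp
  then show ?thesis
    by (rule AE_completion)
qed

lemma ex_borel_representative:
  fixes f :: "'a::euclidean_space \<Rightarrow> real"
  assumes "integrable lebesgue f"
  obtains g where "integrable lborel g" "AE x in lebesgue. f x = g x"
proof -
  obtain g where g: "g \<in> borel_measurable lborel" "AE x in lborel. f x = g x"
    using completion_ex_borel_measurable_real[of f lborel] assms
    by (auto dest: borel_measurable_integrable)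
  then have ae: "AE x in lebesgue. f x = g x"
    by (auto intro: AE_completion)
  have "integrable lebesgue g"
    using assms ae g(1) by (subst integrable_cong_AE[of _ _ f])
      (auto simp: measurable_completion eq_commute dest: borel_measurable_integrable)
  with g(1) have "integrable lborel g"
    by (simp add: integrable_completion)
  then show ?thesis
    using ae that by blast
qed

lemma reflect_measurable_lebesgue:
  fixes x :: "'a::euclidean_space"
  shows "(\<lambda>y. x - y) \<in> lebesgue \<rightarrow>\<^sub>M lebesgue"
proof -
  have "(\<lambda>y. x - y) = (\<lambda>y. x + (\<Sum>j\<in>Basis. (- 1 * (y \<bullet> j)) *\<^sub>R j))"
    by (simp add: sum_negf euclidean_representation)
  also have "\<dots> \<in> lebesgue \<rightarrow>\<^sub>M lebesgue"
    by (rule lebesgue_affine_measurable) simp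
  finally show ?thesis .
qed

lemma convolution_cong_AE:
  fixes f f' g g' :: "'a::euclidean_space \<Rightarrow> real"
  assumes "L1_rel f f'" "L1_rel g g'"
  shows "(LINT y|lebesgue. f (x - y) * g y) = (LINT y|lebesgue. f' (x - y) * g' y)"
proof (rule integral_cong_AE)
  have "AE y in lebesgue. f (x - y) = f' (x - y)" "AE y in lebesgue. g y = g' y"
    using assms AE_reflect[of "\<lambda>z. f z = f' z" x] by (auto simp: L1_rel_def)
  then show "AE y in lebesgue. f (x - y) * g y = f' (x - y) * g' y"
    by eventually_elim simp
  have "(\<lambda>y. h (x - y) * k y) \<in> borel_measurable lebesgue"
    if "integrable lebesgue h" "integrable lebesgue k" for h k :: "'a \<Rightarrow> real"
    using that measurable_compose[OF reflect_measurable_lebesgue]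
    by (intro borel_measurable_times) (auto dest: borel_measurable_integrable)
  then show "(\<lambda>y. f (x - y) * g y) \<in> borel_measurable lebesgue"
    "(\<lambda>y. f' (x - y) * g' y) \<in> borel_measurable lebesgue"
    using assms by (auto simp: L1_rel_def)
qed

lemma integrable_convolution:
  fixes f g :: "'a::euclidean_space \<Rightarrow> real"
  assumes f: "integrable lebesgue f" and g: "integrable lebesgue g"
  shows "integrable lebesgue (\<lambda>x. LINT y|lebesgue. f (x - y) * g y)"
proof -
  obtain f' where f': "integrable lborel f'" "AE x in lebesgue. f x = f' x"
    by (rule ex_borel_representative[OF f])
  obtain g' where g': "integrable lborel g'" "AE x in lebesgue. g x = g' x"
    by (rule ex_borel_representative[OF g])
  have [measurable]: "f' \<in> borel_measurable borel" "g' \<in> borel_measurable borel"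
    using f' g' by (auto dest: borel_measurable_integrable)
  have shift: "distr lborel borel (\<lambda>x. - y + x) = lborel" for y :: 'a
    by (rule lborel_distr_plus)
  have shift_integrable: "integrable lborel (\<lambda>x. f' (x - y))" for y
  proof -
    have "integrable (distr lborel borel (\<lambda>x. - y + x)) f'"
      unfolding shift by (rule f')
    then show ?thesis
      by (subst (asm) integrable_distr_eq) simp_all
  qed
  have shift_integral: "(LINT x|lborel. \<bar>f' (x - y)\<bar>) = (LINT x|lborel. \<bar>f' x\<bar>)" for y
  proof -
    have "(LINT x|distr lborel borel (\<lambda>x. - y + x). \<bar>f' x\<bar>) = (LINT x|lborel. \<bar>f' (- y + x)\<bar>)"
      by (rule integral_distr) simp_all
    then show ?thesis
      unfolding shift by simp
  qed
  have "integrable (lborel \<Otimes>\<^sub>M lborel) (\<lambda>(y, x). f' (x - y) * g' y)"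
  proof (rule lborel_pair.Fubini_integrable)
    show "integrable lborel (\<lambda>y. LINT x|lborel. norm (case (y, x) of (y, x) \<Rightarrow> f' (x - y) * g' y))"
      using g' by (simp add: abs_mult shift_integral)
    show "AE y in lborel. integrable lborel (\<lambda>x. case (y, x) of (y, x) \<Rightarrow> f' (x - y) * g' y)"
      using shift_integrable by (intro AE_I2) simp
  qed measurable
  then have "integrable lborel (\<lambda>x. LINT y|lborel. f' (x - y) * g' y)"
    by (rule lborel_pair.integrable_snd)
  then have "integrable lebesgue (\<lambda>x. LINT y|lborel. f' (x - y) * g' y)"
    by (subst integrable_completion) (auto dest: borel_measurable_integrable)
  also have "(\<lambda>x. LINT y|lborel. f' (x - y) * g' y) = (\<lambda>x. LINT y|lebesgue. f' (x - y) * g' y)"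
    by (intro ext integral_completion[symmetric]) measurable
  also have "\<dots> = (\<lambda>x. LINT y|lebesgue. f (x - y) * g y)"
  proof (intro ext convolution_cong_AE)
    show "L1_rel f' f" "L1_rel g' g"
      using f g f' g' by (auto simp: L1_rel_def eq_commute integrable_completion)
  qed
  finally show ?thesis .
qed

lift_definition convolution_L1 :: "'a::euclidean_space L1 \<Rightarrow> 'a L1 \<Rightarrow> 'a L1"
  is "\<lambda>f g x. LINT y|lebesgue. f (x - y) * g y"
proof -
  fix f f' g g' :: "'a \<Rightarrow> real"
  assume "L1_rel f f'" "L1_rel g g'"
  then show "L1_rel (\<lambda>x. LINT y|lebesgue. f (x - y) * g y) (\<lambda>x. LINT y|lebesgue. f' (x - y) * g' y)"
    using convolution_cong_AE[of f f' g g'] integrable_convolution[of f g] integrable_convolution[of f' g']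
    by (simp add: L1_rel_def)
qed

text \<open>
  The derivatives quantified over are directional derivatives; in finite dimension,
  \<^term>\<open>C_k k \<phi>\<close> is the usual class $C^k(\mathbb{R}^N)$.
\<close>

primrec C_k :: "nat \<Rightarrow> ('a::euclidean_space \<Rightarrow> real) \<Rightarrow> bool"
  where
    "C_k 0 \<phi> \<longleftrightarrow> continuous_on UNIV \<phi>"
  | "C_k (Suc k) \<phi> \<longleftrightarrow>
      (\<forall>x. \<phi> differentiable at x) \<and> (\<forall>h. C_k k (\<lambda>x. frechet_derivative \<phi> (at x) h))"

definition test_function_on :: "'a::euclidean_space set \<Rightarrow> ('a \<Rightarrow> real) \<Rightarrow> bool"
  where "test_function_on O' \<phi> \<longleftrightarrow>
    (\<forall>k. C_k k \<phi>) \<and> compact (closure {x. \<phi> x \<noteq> 0}) \<and> closure {x. \<phi> x \<noteq> 0} \<subseteq> O'"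

definition distribution_vanishes_on :: "('a::euclidean_space \<Rightarrow> real) \<Rightarrow> 'a set \<Rightarrow> bool"
  where "distribution_vanishes_on g O' \<longleftrightarrow>
    (\<forall>\<phi>. test_function_on O' \<phi> \<longrightarrow> (LINT x|lebesgue. g x * \<phi> x) = 0)"

text \<open>
  The largest open set on which a distribution vanishes is the union of all such sets.
\<close>

definition supp_D :: "('a::euclidean_space \<Rightarrow> real) \<Rightarrow> 'a set"
  where "supp_D g = - \<Union>{O'. open O' \<and> distribution_vanishes_on g O'}"

definition admissible_kernel :: "('a::euclidean_space \<Rightarrow> real) \<Rightarrow> bool"
  where "admissible_kernel J \<longleftrightarrow>
    continuous_on UNIV J \<and> (\<forall>x. 0 \<le> J x) \<and> compact (closure {x. J x \<noteq> 0}) \<and>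
    (\<forall>x y. norm x = norm y \<longrightarrow> J x = J y) \<and> (LINT x|lebesgue. J x) = 1"

definition rescaled_kernel :: "(real ^ 'n \<Rightarrow> real) \<Rightarrow> real \<Rightarrow> real ^ 'n \<Rightarrow> real"
  where "rescaled_kernel J \<epsilon> x = J (x /\<^sub>R \<epsilon>) / \<epsilon> ^ CARD('n)"

text \<open>
  For $u \in C([0,\infty); L^1)$ the integrand below is norm continuous in time, so that its
  Henstock-Kurzweil integral over \<^term>\<open>{0..t}\<close> is its Bochner (and Riemann) integral.
  The values of \<^term>\<open>u\<close> at negative times are irrelevant.
\<close>

definition L1_solution ::
    "(real ^ 'n \<Rightarrow> real) \<Rightarrow> real \<Rightarrow> (real ^ 'n \<Rightarrow> real) \<Rightarrow> (real \<Rightarrow> (real ^ 'n) L1) \<Rightarrow> bool"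
  where "L1_solution J \<epsilon> f u \<longleftrightarrow>
    continuous_on {0..} u \<and>
    (\<forall>t>0. \<exists>I.
      ((\<lambda>s. convolution_L1 (abs_L1 (rescaled_kernel J \<epsilon>)) (pos_part_minus_one (u s))
            - pos_part_minus_one (u s)) has_integral I) {0..t} \<and>
      u t = abs_L1 f + (1 / \<epsilon>\<^sup>2) *\<^sub>R I)"

definition mushy_region :: "'a::euclidean_space L1 \<Rightarrow> 'a set"
  where "mushy_region w =
    interior (supp_D (rep_L1 w) - supp_D (rep_L1 (pos_part_minus_one w)))"

end

theory Submission imports Defs begin

text \<open>
  Let \<open>w\<^sup>\<epsilon>(t) = \<integral>\<^sub>0\<^sup>t v\<^sup>\<epsilon>\<close>, so that \<open>u\<^sup>\<epsilon> - f\<close> is the discrete Laplacian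
  \<open>\<epsilon>\<^sup>-\<^sup>2 (J\<^sub>\<epsilon> * w\<^sup>\<epsilon> - w\<^sup>\<epsilon>)\<close>. A point where \<open>u\<^sup>\<epsilon>(s) > 1\<close> keeps this property for ever, hence
  \<open>w\<^sup>\<epsilon> = 0\<close> and \<open>f \<le> 1\<close> on the mushy region, which by the support hypothesis is therefore disjoint
  from the support of \<open>f\<close>. Off that support the discrete Laplacian of \<open>w\<^sup>\<epsilon>\<close> is at least \<open>1\<close>
  wherever \<open>w\<^sup>\<epsilon> > 0\<close>, as in the obstacle problem, and \<open>w\<^sup>\<epsilon>\<close> is positive within distance \<open>O(\<epsilon>)\<close>
  of every mushy point \<open>x\<close>. Nondegeneracy then gives a point \<open>y\<close> at a small distance \<open>d\<close> from \<open>x\<close>, where \<open>d\<close> is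
  bounded below uniformly in \<open>\<epsilon>\<close>, such that the mean of \<open>w\<^sup>\<epsilon>\<close> over the ball of radius \<open>\<kappa> d\<close> about
  \<open>y\<close> is at least \<open>c d\<^sup>2\<close>. If this ball contained a point of the mushy region for another small
  scale \<open>\<epsilon>'\<close>, then quadratic growth away from the zeros would bound the mean of \<open>w\<close> at scale \<open>\<epsilon>'\<close> by
  \<open>C \<kappa>\<^sup>2 d\<^sup>2\<close>; for small \<open>\<kappa>\<close> this contradicts the Cauchy property of \<open>w\<^sup>\<epsilon>\<close> in \<open>L\<^sup>1\<close> on bounded
  sets as \<open>\<epsilon>\<close> tends to \<open>0\<close>. So the limsup set is porous, hence null by Lebesgue density.
\<close>

section \<open>Convolution with a compactly supported kernel\<close>

text \<open>The limit problem is never formed: scales are compared in pairs, with estimates uniform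
  in the scale. The obstacle is that averaging over a fixed range does not smooth, so
  \<open>w\<close> has no modulus of continuity and the inequalities hold only almost everywhere.
  Growth and nondegeneracy are therefore stated for means over balls, and the classical comparison
  arguments are replaced by a power barrier, strictly subharmonic for the averaging operator away
  from its centre, that is moved onto \<open>w\<close> by symmetry. The penalty in the nondegeneracy
  argument is quartic because one function must do two things: be large enough at a given radius to
  keep the maximum inside, and have a Laplacian so small near the centre that it cannot cancel the
  lower bound \<open>1\<close> for that of \<open>w\<close>; hence the maximum is pushed away by a
  definite distance. That distance depends on the point, but the ratio \<kappa> does not, which is
  what porosity asks for. In the final comparison \<kappa> has exponent \<open>N + 2\<close> on the
  growth side and \<open>N\<close> on the nondegeneracy side, so a small \<kappa> separates the
  two.\<close>

definition conv :: "('a::euclidean_space \<Rightarrow> real) \<Rightarrow> ('a \<Rightarrow> real) \<Rightarrow> 'a \<Rightarrow> real"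
  where "conv k g x = (LINT y|lborel. k (x - y) * g y)"

text \<open>Sign, symmetry and mass are left out so that differences of kernels and their discrete
  Laplacians qualify as well.\<close>

definition kern :: "('a::euclidean_space \<Rightarrow> real) \<Rightarrow> real \<Rightarrow> bool"
  where "kern k R \<longleftrightarrow> continuous_on UNIV k \<and> 0 < R \<and> (\<forall>x. R \<le> norm x \<longrightarrow> k x = 0)"

lemma kern_measurable: "kern k R \<Longrightarrow> k \<in> borel_measurable borel"
  unfolding kern_def by (auto intro: borel_measurable_continuous_onI)

lemma kern_bounded:
  assumes "kern k R"
  obtains B where "0 < B" "\<And>x. \<bar>k x\<bar> \<le> B"
proof -
  have "compact (k ` cball 0 R)"
    using assms unfolding kern_def
    by (intro compact_continuous_image) (auto intro: continuous_on_subset)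
  then obtain B where B: "\<And>x. x \<in> cball 0 R \<Longrightarrow> norm (k x) \<le> B"
    using compact_imp_bounded[of "k ` cball 0 R"] unfolding bounded_iff by blast
  have "\<bar>k x\<bar> \<le> max B 1" for x
    using B[of x] assms unfolding kern_def by (cases "norm x \<le> R") auto
  then show ?thesis using that[of "max B 1"] by auto
qed

lemma kern_integrable_mult:
  assumes k: "kern k R" and g: "continuous_on UNIV g"
  shows "integrable lborel (\<lambda>x. k x * g x :: real)"
proof -
  have "integrable lborel (\<lambda>x. indicator (cball 0 R) x *\<^sub>R (k x * g x))"
    using assms unfolding kern_def
    by (intro borel_integrable_compact) (auto intro!: continuous_intros intro: continuous_on_subset)
  moreover have "(\<lambda>x. indicator (cball 0 R) x *\<^sub>R (k x * g x)) = (\<lambda>x. k x * g x)"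
    using k unfolding kern_def by (auto simp: indicator_def fun_eq_iff)
  ultimately show ?thesis by simp
qed

lemma kern_integrable: "kern k R \<Longrightarrow> integrable lborel k"
  using kern_integrable_mult[of k R "\<lambda>_. 1"] by simp

lemma
  fixes g :: "'a::euclidean_space \<Rightarrow> real"
  assumes [measurable]: "g \<in> borel_measurable borel"
  shows lborel_integral_reflect: "(LINT y|lborel. g (x - y)) = (LINT y|lborel. g y)"
    and lborel_integrable_reflect: "integrable lborel (\<lambda>y. g (x - y)) \<longleftrightarrow> integrable lborel g"
proof -
  have "(LINT y|distr lborel borel (\<lambda>y. x - y). g y) = (LINT y|lborel. g (x - y))"
    by (rule integral_distr) auto
  then show "(LINT y|lborel. g (x - y)) = (LINT y|lborel. g y)"
    by (simp add: distr_lborel_reflect)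
  have "integrable (distr lborel borel (\<lambda>y. x - y)) g \<longleftrightarrow> integrable lborel (\<lambda>y. g (x - y))"
    by (rule integrable_distr_eq) auto
  then show "integrable lborel (\<lambda>y. g (x - y)) \<longleftrightarrow> integrable lborel g"
    by (simp add: distr_lborel_reflect)
qed

lemma
  fixes g :: "'a::euclidean_space \<Rightarrow> real"
  assumes [measurable]: "g \<in> borel_measurable borel"
  shows lborel_integral_shift: "(LINT y|lborel. g (y + x)) = (LINT y|lborel. g y)"
    and lborel_integrable_shift: "integrable lborel (\<lambda>y. g (y + x)) \<longleftrightarrow> integrable lborel g"
proof -
  have eq: "distr lborel borel (\<lambda>y. y + x) = lborel"
    using lborel_distr_plus[of x] by (subst add.commute)
  have "(LINT y|distr lborel borel (\<lambda>y. y + x). g y) = (LINT y|lborel. g (y + x))"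
    by (rule integral_distr) auto
  then show "(LINT y|lborel. g (y + x)) = (LINT y|lborel. g y)"
    by (simp add: eq)
  have "integrable (distr lborel borel (\<lambda>y. y + x)) g \<longleftrightarrow> integrable lborel (\<lambda>y. g (y + x))"
    by (rule integrable_distr_eq) auto
  then show "integrable lborel (\<lambda>y. g (y + x)) \<longleftrightarrow> integrable lborel g"
    by (simp add: eq)
qed

lemma integrable_bounded_mult:
  fixes \<phi> g :: "'a \<Rightarrow> real"
  assumes "integrable M g" "\<phi> \<in> borel_measurable M" "\<And>x. \<bar>\<phi> x\<bar> \<le> B"
  shows "integrable M (\<lambda>x. \<phi> x * g x)"
proof (rule Bochner_Integration.integrable_bound[of M "\<lambda>x. B * g x"])
  show "AE x in M. norm (\<phi> x * g x) \<le> norm (B * g x)"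
    using assms(3) by (auto simp: abs_mult intro!: AE_I2 mult_right_mono order_trans[OF assms(3)])
qed (use assms in auto)

lemma conv_integrable_pt:
  assumes k: "kern k R" and g: "integrable lborel g"
  shows "integrable lborel (\<lambda>y. k (x - y) * g y)"
proof -
  obtain B where B: "\<And>x. \<bar>k x\<bar> \<le> B" using kern_bounded[OF k] by metis
  have [measurable]: "k \<in> borel_measurable borel" by (rule kern_measurable[OF k])
  show ?thesis by (rule integrable_bounded_mult[OF g _ B]) measurable
qed

lemma conv_reflect:
  assumes k: "kern k R" and [measurable]: "g \<in> borel_measurable borel"
  shows "conv k g x = (LINT z|lborel. k z * g (x - z))"
proof -
  have [measurable]: "k \<in> borel_measurable borel" by (rule kern_measurable[OF k])
  show ?thesis
    unfolding conv_def
    by (subst lborel_integral_reflect[symmetric, of _ x]) (auto simp: )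
qed

lemma conv_plus:
  assumes k: "kern k R" and e: "\<And>x. k (- x) = k x" and [measurable]: "g \<in> borel_measurable borel"
  shows "conv k g x = (LINT z|lborel. k z * g (x + z))"
proof -
  have [measurable]: "k \<in> borel_measurable borel" by (rule kern_measurable[OF k])
  show ?thesis
    unfolding conv_reflect[OF k assms(3)]
    by (subst lborel_integral_reflect[symmetric, of _ 0]) (auto simp: e)
qed

lemma conv_measurable:
  assumes k: "kern k R" and [measurable]: "g \<in> borel_measurable borel"
  shows "conv k g \<in> borel_measurable borel"
proof -
  have [measurable]: "k \<in> borel_measurable borel" by (rule kern_measurable[OF k])
  show ?thesis unfolding conv_def by measurable
qed

lemma conv_Fubini_integrable:
  fixes k g \<phi> :: "'a::euclidean_space \<Rightarrow> real"
  assumes k: "kern k R" and g: "integrable lborel g"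
    and [measurable]: "\<phi> \<in> borel_measurable borel" and \<phi>: "\<And>x. \<bar>\<phi> x\<bar> \<le> B"
  shows "integrable (lborel \<Otimes>\<^sub>M lborel) (\<lambda>(y, x). \<phi> x * (k (x - y) * g y))"
proof (rule lborel_pair.Fubini_integrable)
  have [measurable]: "k \<in> borel_measurable borel" by (rule kern_measurable[OF k])
  have [measurable]: "g \<in> borel_measurable borel" using g by (auto dest: borel_measurable_integrable)
  have ki: "integrable lborel (\<lambda>x. k (x - y))" for y
    using lborel_integrable_shift[of k "- y"] kern_integrable[OF k] by simp
  have sh: "(LINT x|lborel. \<bar>k (x - y)\<bar>) = (LINT x|lborel. \<bar>k x\<bar>)" for y
    using lborel_integral_shift[of "\<lambda>x. \<bar>k x\<bar>" "- y"] by simp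
  have int: "integrable lborel (\<lambda>x. \<phi> x * (k (x - y) * g y))" for y
    using ki by (intro integrable_bounded_mult[OF _ _ \<phi>]) auto
  have B: "0 \<le> B" using \<phi>[of 0] by linarith
  show "AE y in lborel. integrable lborel (\<lambda>x. case (y, x) of (y, x) \<Rightarrow> \<phi> x * (k (x - y) * g y))"
    using int by simp
  show "integrable lborel (\<lambda>y. LINT x|lborel. norm (case (y, x) of (y, x) \<Rightarrow> \<phi> x * (k (x - y) * g y)))"
  proof (rule Bochner_Integration.integrable_bound[of _ "\<lambda>y. (B * (LINT x|lborel. \<bar>k x\<bar>)) * g y"])
    show "AE y in lborel. norm (LINT x|lborel. norm (case (y, x) of (y, x) \<Rightarrow> \<phi> x * (k (x - y) * g y)))
            \<le> norm ((B * (LINT x|lborel. \<bar>k x\<bar>)) * g y)"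
    proof (rule AE_I2)
      fix y
      have "(LINT x|lborel. \<bar>\<phi> x * (k (x - y) * g y)\<bar>) \<le> (LINT x|lborel. (B * \<bar>g y\<bar>) * \<bar>k (x - y)\<bar>)"
      proof (rule integral_mono)
        show "\<bar>\<phi> x * (k (x - y) * g y)\<bar> \<le> (B * \<bar>g y\<bar>) * \<bar>k (x - y)\<bar>" for x
          using mult_right_mono[OF \<phi>, of "\<bar>k (x - y)\<bar> * \<bar>g y\<bar>" x] by (simp add: abs_mult mult_ac)
      qed (use int ki in \<open>auto intro: integrable_abs\<close>)
      also have "\<dots> = norm ((B * (LINT x|lborel. \<bar>k x\<bar>)) * g y)"
        using B by (simp add: sh abs_mult)
      finally show "norm (LINT x|lborel. norm (case (y, x) of (y, x) \<Rightarrow> \<phi> x * (k (x - y) * g y)))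
            \<le> norm ((B * (LINT x|lborel. \<bar>k x\<bar>)) * g y)" by simp
    qed
  qed (use g in auto)
  show "(\<lambda>(y, x). \<phi> x * (k (x - y) * g y)) \<in> borel_measurable (lborel \<Otimes>\<^sub>M lborel)"
    by measurable
qed

text \<open>Moves a bounded weight onto the kernel. The absolute integrand has mass at most
  \<open>B\<close> times the product of the \<open>L1\<close> norms of \<open>k\<close> and
  \<open>g\<close>, so the order of integration may be exchanged.\<close>

lemma conv_Fubini:
  fixes k g \<phi> :: "'a::euclidean_space \<Rightarrow> real"
  assumes k: "kern k R" and g: "integrable lborel g"
    and [measurable]: "\<phi> \<in> borel_measurable borel" and \<phi>: "\<And>x. \<bar>\<phi> x\<bar> \<le> B"
  shows "(LINT x|lborel. \<phi> x * conv k g x) = (LINT y|lborel. (LINT x|lborel. \<phi> x * k (x - y)) * g y)"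
    and "integrable lborel (\<lambda>x. \<phi> x * conv k g x)"
proof -
  note F = conv_Fubini_integrable[OF k g \<open>\<phi> \<in> _\<close> \<phi>]
  show "(LINT x|lborel. \<phi> x * conv k g x) = (LINT y|lborel. (LINT x|lborel. \<phi> x * k (x - y)) * g y)"
    unfolding conv_def using lborel_pair.Fubini_integral[OF F]
    by (simp only: mult.assoc[symmetric] integral_mult_left_zero integral_mult_right_zero[symmetric])
  show "integrable lborel (\<lambda>x. \<phi> x * conv k g x)"
    using lborel_pair.integrable_snd[OF F] by (simp add: conv_def)
qed

lemma conv_integrable:
  assumes k: "kern k R" and g: "integrable lborel g"
  shows "integrable lborel (conv k g)"
  using conv_Fubini(2)[OF k g, of "\<lambda>_. 1" 1] by simp

text \<open>An even kernel gives a symmetric operator, also between integrable and bounded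
  functions; this is how barriers and mollifiers pass from one factor to the other.\<close>

lemma conv_symmetric:
  fixes k g \<phi> :: "'a::euclidean_space \<Rightarrow> real"
  assumes "kern k R" "\<And>x. k (- x) = k x" "integrable lborel g"
    and "\<phi> \<in> borel_measurable borel" "\<And>x. \<bar>\<phi> x\<bar> \<le> B"
  shows "(LINT x|lborel. \<phi> x * conv k g x) = (LINT y|lborel. conv k \<phi> y * g y)"
proof -
  have "k (y - x) = k (x - y)" for x y using assms(2)[of "x - y"] by simp
  then show ?thesis
    unfolding conv_Fubini(1)[OF assms(1,3,4,5)] by (simp add: conv_def[abs_def] mult.commute)
qed

text \<open>Young's inequality in \<open>L1\<close>, from Fubini after passing to absolute
  values.\<close>

lemma conv_norm:
  assumes k: "kern k R" and g: "integrable lborel g"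
  shows "(LINT x|lborel. \<bar>conv k g x\<bar>) \<le> (LINT x|lborel. \<bar>k x\<bar>) * (LINT x|lborel. \<bar>g x\<bar>)"
proof -
  have k': "kern (\<lambda>x. \<bar>k x\<bar>) R" using k unfolding kern_def by (auto intro!: continuous_intros)
  have [measurable]: "k \<in> borel_measurable borel" by (rule kern_measurable[OF k])
  have sh: "(LINT x|lborel. \<bar>k (x - y)\<bar>) = (LINT x|lborel. \<bar>k x\<bar>)" for y
    using lborel_integral_shift[of "\<lambda>x. \<bar>k x\<bar>" "- y"] by simp
  have "\<bar>conv k g x\<bar> \<le> conv (\<lambda>x. \<bar>k x\<bar>) (\<lambda>x. \<bar>g x\<bar>) x" for x
    unfolding conv_def using integral_norm_bound[of lborel "\<lambda>y. k (x - y) * g y"]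
    by (simp add: abs_mult)
  then have "(LINT x|lborel. \<bar>conv k g x\<bar>) \<le> (LINT x|lborel. conv (\<lambda>x. \<bar>k x\<bar>) (\<lambda>x. \<bar>g x\<bar>) x)"
    using conv_integrable[OF k g] conv_integrable[OF k', of "\<lambda>x. \<bar>g x\<bar>"] g by (intro integral_mono) auto
  also have "\<dots> = (LINT x|lborel. \<bar>k x\<bar>) * (LINT x|lborel. \<bar>g x\<bar>)"
    using conv_Fubini(1)[OF k', of "\<lambda>x. \<bar>g x\<bar>" "\<lambda>_. 1" 1] g by (simp add: sh)
  finally show ?thesis .
qed

lemma conv_bound:
  assumes k: "kern k R" and g: "integrable lborel g" and B: "\<And>x. \<bar>k x\<bar> \<le> B"
  shows "\<bar>conv k g x\<bar> \<le> B * (LINT x|lborel. \<bar>g x\<bar>)"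
proof -
  have "\<bar>conv k g x\<bar> \<le> (LINT y|lborel. \<bar>k (x - y) * g y\<bar>)"
    unfolding conv_def using integral_norm_bound[of lborel "\<lambda>y. k (x - y) * g y"] by simp
  also have "\<dots> \<le> (LINT y|lborel. B * \<bar>g y\<bar>)"
  proof (rule integral_mono)
    show "\<bar>k (x - y) * g y\<bar> \<le> B * \<bar>g y\<bar>" for y
      using mult_right_mono[OF B, of "\<bar>g y\<bar>" "x - y"] by (simp add: abs_mult)
  qed (use conv_integrable_pt[OF k g] g in \<open>auto intro: integrable_abs\<close>)
  finally show ?thesis by simp
qed

text \<open>Substituting \<open>x + z - y\<close> for \<open>y\<close> exchanges the two kernels
  inside the iterated kernel.\<close>

lemma conv_left_commute:
  fixes k l g :: "'a::euclidean_space \<Rightarrow> real"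
  assumes k: "kern k R" and l: "kern l S" and g: "integrable lborel g"
  shows "conv k (conv l g) x = conv l (conv k g) x"
proof -
  have [measurable]: "k \<in> borel_measurable borel" "l \<in> borel_measurable borel"
    using kern_measurable k l by auto
  obtain B where B: "\<And>x. \<bar>k x\<bar> \<le> B" using kern_bounded[OF k] by metis
  obtain C where C: "\<And>x. \<bar>l x\<bar> \<le> C" using kern_bounded[OF l] by metis
  have "(LINT y|lborel. k (x - y) * l (y - z)) = (LINT y|lborel. l (x - y) * k (y - z))" for z
    by (subst lborel_integral_reflect[symmetric, of _ "x + z"]) (auto simp: algebra_simps)
  then show ?thesis
    using conv_Fubini(1)[OF l g, of "\<lambda>y. k (x - y)" B] conv_Fubini(1)[OF k g, of "\<lambda>y. l (x - y)" C] B C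
    by (simp add: conv_def[of _ "conv _ _"])
qed

section \<open>Local integral estimates at unit scale\<close>

text \<open>The radius may be enlarged at will; taking it at least \<open>1\<close> lets higher
  powers of \<open>R\<close> absorb lower ones in the moment bounds.\<close>

locale unit_kernel =
  fixes J :: "real ^ 'n \<Rightarrow> real" and R :: real
  assumes kern: "kern J R" and R1: "1 \<le> R"
    and J_nonneg: "\<And>x. 0 \<le> J x"
    and radial: "\<And>x y. norm x = norm y \<Longrightarrow> J x = J y"
    and mass: "(LINT x|lborel. J x) = 1"
begin

section \<open>Moments of the radial kernel\<close>

lemma even: "J (- x) = J x"
  by (rule radial) simp

lemma J_meas [measurable]: "J \<in> borel_measurable borel"
  by (rule kern_measurable[OF kern])

lemma J_outside: "R \<le> norm x \<Longrightarrow> J x = 0"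
  using kern unfolding kern_def by auto

lemma J_integrable_mult: "continuous_on UNIV g \<Longrightarrow> integrable lborel (\<lambda>x. J x * g x)"
  by (rule kern_integrable_mult[OF kern])

lemma odd_moment:
  assumes [measurable]: "g \<in> borel_measurable borel" and "\<And>z. g (- z) = - g z"
  shows "(LINT z|lborel. J z * g z) = 0"
proof -
  have "(LINT z|lborel. J z * g z) = (LINT z|lborel. J (0 - z) * g (0 - z))"
    by (rule lborel_integral_reflect[symmetric]) measurable
  then show ?thesis by (simp add: assms even)
qed

lemma moment_isometry:
  assumes T: "T \<in> borel \<rightarrow>\<^sub>M borel" "distr lborel borel T = (lborel :: (real ^ 'n) measure)"
    and n: "\<And>z. norm (T z) = norm z" and [measurable]: "g \<in> borel_measurable borel"
  shows "(LINT z|lborel. J z * g (T z)) = (LINT z|lborel. J z * g z)"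
proof -
  have [measurable]: "T \<in> borel \<rightarrow>\<^sub>M borel" by (rule T)
  have "(LINT z|lborel. J z * g z) = (LINT z|distr lborel borel T. J z * g z)"
    by (simp add: T)
  also have "\<dots> = (LINT z|lborel. J (T z) * g (T z))"
    by (rule integral_distr) auto
  finally show ?thesis using radial[OF n] by simp
qed

text \<open>Changing the sign of one coordinate preserves norms and Lebesgue measure and reverses
  the integrand.\<close>

lemma mixed_moment:
  assumes "i \<noteq> j"
  shows "(LINT z|lborel. J z * (z $ i * z $ j)) = 0"
proof -
  let ?c = "\<lambda>b :: real ^ 'n. if b = axis i 1 then - 1 else 1 :: real"
  let ?T = "\<lambda>z :: real ^ 'n. 0 + (\<Sum>b\<in>Basis. (?c b * (z \<bullet> b)) *\<^sub>R b)"
  have p: "(\<Prod>b\<in>Basis. \<bar>?c b\<bar>) = 1" by (intro prod.neutral) auto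
  have d: "distr lborel borel ?T = lborel"
    using lborel_affine_euclidean[of ?c 0] unfolding p by (simp add: density_1)
  have Tk: "?T z $ k = (if k = i then - (z $ k) else z $ k)" for z k
  proof -
    have "?T z $ k = ?T z \<bullet> axis k 1" by (simp add: inner_axis)
    also have "\<dots> = (\<Sum>b\<in>Basis. (?c b * (z \<bullet> b)) * (b \<bullet> axis k 1))"
      by (simp add: inner_sum_left)
    also have "\<dots> = ?c (axis k 1) * (z \<bullet> axis k 1)"
      by (subst sum.remove[of _ "axis k 1"]) (auto simp: axis_inverse inner_Basis intro!: sum.neutral)
    finally show ?thesis by (simp add: inner_axis axis_eq_axis)
  qed
  have n: "norm (?T z) = norm z" for z
    unfolding norm_vec_def L2_set_def by (intro arg_cong[where f=sqrt] sum.cong) (simp_all only: Tk, auto)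
  have "(LINT z|lborel. J z * (?T z $ i * ?T z $ j)) = (LINT z|lborel. J z * (z $ i * z $ j))"
    by (rule moment_isometry[OF _ d n]) auto
  then show ?thesis unfolding Tk using assms by simp
qed

text \<open>\<open>undefined\<close> merely selects a coordinate; radial symmetry makes the second
  moment the same in each. Half of it is the diffusion constant of the Laplacian approximated at
  small scales.\<close>

definition m1 :: real
  where "m1 = (LINT z|lborel. J z * (z $ undefined)\<^sup>2)"

text \<open>Transposing two coordinates is a measure-preserving isometry. Invariance of Lebesgue
  measure is checked on boxes, whose volume is a product that a permutation of the factors leaves
  unchanged.\<close>

lemma coordinate_moment: "(LINT z|lborel. J z * (z $ i)\<^sup>2) = m1"
proof -
  let ?j = "undefined :: 'n"
  let ?s = "Transposition.transpose i ?j"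
  let ?T = "\<lambda>z :: real ^ 'n. \<chi> k. z $ ?s k"
  have s: "bij ?s" by simp
  have [measurable]: "?T \<in> borel \<rightarrow>\<^sub>M borel"
    by (intro borel_measurable_continuous_onI continuous_intros)
  have d: "distr lborel borel ?T = lborel"
  proof (rule lborel_eqI[symmetric])
    fix l u :: "real ^ 'n" assume lu: "\<And>b. b \<in> Basis \<Longrightarrow> l \<bullet> b \<le> u \<bullet> b"
    have box: "z \<in> box a b \<longleftrightarrow> (\<forall>k. a $ k < z $ k \<and> z $ k < b $ k)" for z a b :: "real ^ 'n"
      by (auto simp: mem_box Basis_vec_def inner_axis)
    have all: "(\<forall>k. P (?s k)) \<longleftrightarrow> (\<forall>k. P k)" for P
      using bij_is_surj[OF s] by (metis surjD)
    have "?T z \<in> box l u \<longleftrightarrow> z \<in> box (?T l) (?T u)" for z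
      unfolding box using all[of "\<lambda>k. l $ ?s k < z $ k \<and> z $ k < u $ ?s k"] by simp
    then have v: "?T -` box l u = box (?T l) (?T u)" by auto
    have le: "l $ k \<le> u $ k" for k using lu[of "axis k 1"] by (simp add: inner_axis)
    have "emeasure (distr lborel borel ?T) (box l u) = emeasure lborel (box (?T l) (?T u))"
      by (simp add: emeasure_distr v)
    also have "\<dots> = (\<Prod>b\<in>Basis. (?T u - ?T l) \<bullet> b)"
      by (intro emeasure_lborel_box) (auto simp: Basis_vec_def inner_axis le)
    also have "(\<Prod>b\<in>Basis. (?T u - ?T l) \<bullet> b) = (\<Prod>k\<in>UNIV. u $ ?s k - l $ ?s k)"
      unfolding Basis_vec_def by (subst prod.reindex_bij_betw[of "\<lambda>k. axis k 1" UNIV, symmetric])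
        (auto simp: inner_axis bij_betw_def inj_on_def axis_eq_axis)
    also have "\<dots> = (\<Prod>k\<in>UNIV. u $ k - l $ k)"
      using prod.reindex_bij_betw[OF s, of "\<lambda>k. u $ k - l $ k"] by simp
    also have "\<dots> = (\<Prod>b\<in>Basis. (u - l) \<bullet> b)"
      unfolding Basis_vec_def by (subst prod.reindex_bij_betw[of "\<lambda>k. axis k 1" UNIV, symmetric])
        (auto simp: inner_axis bij_betw_def inj_on_def axis_eq_axis)
    finally show "emeasure (distr lborel borel ?T) (box l u) = (\<Prod>b\<in>Basis. (u - l) \<bullet> b)" .
  qed simp
  have n: "norm (?T z) = norm z" for z
    unfolding norm_vec_def L2_set_def
    using sum.reindex_bij_betw[OF s, of "\<lambda>k. (norm (z $ k))\<^sup>2"] by simp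
  have "(LINT z|lborel. J z * (?T z $ ?j)\<^sup>2) = (LINT z|lborel. J z * (z $ ?j)\<^sup>2)"
    by (rule moment_isometry[OF _ d n]) auto
  then show ?thesis by (simp add: m1_def)
qed

text \<open>Isotropy: the matrix of second moments is \<open>m1\<close> times the identity.\<close>

lemma second_moment: "(LINT z|lborel. J z * (y \<bullet> z)\<^sup>2) = m1 * (y \<bullet> y)"
proof -
  have i: "integrable lborel (\<lambda>z. J z * (z $ i * z $ j))" for i j
    by (intro J_integrable_mult continuous_intros)
  have m: "(LINT z|lborel. J z * (z $ i * z $ j)) = (if i = j then m1 else 0)" for i j
    using mixed_moment[of i j] coordinate_moment[of i] by (cases "i = j") (simp_all add: power2_eq_square)
  have "(LINT z|lborel. J z * (y \<bullet> z)\<^sup>2)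
      = (LINT z|lborel. (\<Sum>i\<in>UNIV. \<Sum>j\<in>UNIV. (y $ i * y $ j) * (J z * (z $ i * z $ j))))"
    by (simp add: inner_vec_def power2_eq_square sum_product sum_distrib_left mult_ac)
  also have "\<dots> = (\<Sum>i\<in>UNIV. \<Sum>j\<in>UNIV. (y $ i * y $ j) * (if i = j then m1 else 0))"
    using i by (simp add: Bochner_Integration.integral_sum m)
  also have "\<dots> = m1 * (y \<bullet> y)"
    by (simp add: inner_vec_def sum_distrib_left mult_ac if_distrib cong: if_cong)
  finally show ?thesis .
qed

lemma norm_moment: "(LINT z|lborel. J z * (z \<bullet> z)) = real CARD('n) * m1"
proof -
  have "(LINT z|lborel. J z * (z \<bullet> z)) = (LINT z|lborel. (\<Sum>i\<in>Basis. J z * (i \<bullet> z)\<^sup>2))"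
    by (subst euclidean_inner) (simp add: sum_distrib_left power2_eq_square inner_commute)
  also have "\<dots> = (\<Sum>i\<in>Basis. LINT z|lborel. J z * (i \<bullet> z)\<^sup>2)"
    by (intro Bochner_Integration.integral_sum J_integrable_mult continuous_intros)
  also have "\<dots> = real CARD('n) * m1"
    by (simp add: second_moment inner_Basis)
  finally show ?thesis .
qed

text \<open>Otherwise \<open>J\<close> would vanish almost everywhere off the origin and could not
  have mass one.\<close>

lemma m1_pos: "0 < m1"
proof -
  have n: "\<And>z. 0 \<le> J z * (z \<bullet> z)" using J_nonneg by simp
  have i: "integrable lborel (\<lambda>z. J z * (z \<bullet> z))"
    by (intro J_integrable_mult continuous_intros)
  have "(LINT z|lborel. J z * (z \<bullet> z)) \<noteq> 0"
  proof
    assume "(LINT z|lborel. J z * (z \<bullet> z)) = 0"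
    then have "AE z in lborel. J z * (z \<bullet> z) = 0"
      using integral_nonneg_eq_0_iff_AE[OF i] n by auto
    moreover have "AE z in lborel. z \<noteq> (0 :: real ^ 'n)"
      by (rule AE_lborel_singleton)
    ultimately have "AE z in lborel. J z = 0"
      by eventually_elim auto
    then have "(LINT z|lborel. J z) = (LINT z|(lborel :: (real ^ 'n) measure). 0)"
      by (intro integral_cong_AE) auto
    then show False using mass by simp
  qed
  moreover have "0 \<le> (LINT z|lborel. J z * (z \<bullet> z))"
    using n by (intro Bochner_Integration.integral_nonneg) auto
  ultimately have "0 < real CARD('n) * m1" unfolding norm_moment by linarith
  then show ?thesis by (simp add: zero_less_mult_iff)
qed

end

text \<open>Taylor expansion with Lagrange remainder. The second derivative at \<open>0\<close> is
  \<open>p * (p + 1)\<close>, so by continuity any \<open>q\<close> strictly below half of it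
  survives on a small interval.\<close>

lemma powr_quadratic_lower:
  fixes p q :: real
  assumes p: "0 < p" and q: "q < p * (p + 1) / 2"
  obtains x0 where "0 < x0" "x0 < 1" "\<And>x. \<bar>x\<bar> \<le> x0 \<Longrightarrow> 1 - p * x + q * x\<^sup>2 \<le> (1 + x) powr (- p)"
proof -
  let ?g = "\<lambda>t. p * (p + 1) * (1 + t) powr (- p - 2)"
  have "isCont ?g 0" by (auto intro!: continuous_intros)
  then have "(?g \<longlongrightarrow> p * (p + 1)) (at 0)" by (simp add: isCont_def)
  then have "\<forall>\<^sub>F t in at 0. 2 * q < ?g t"
    using q by (intro order_tendstoD(1)[where y="p * (p+1)"]) auto
  then obtain d where d: "0 < d" "\<And>t. t \<noteq> 0 \<Longrightarrow> \<bar>t\<bar> < d \<Longrightarrow> 2 * q < ?g t"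
    unfolding eventually_at by (auto simp: dist_real_def)
  define x0 where "x0 = min (d / 2) (1 / 2)"
  have x0: "0 < x0" "x0 < 1" "x0 < d" using d(1) by (auto simp: x0_def)
  show ?thesis
  proof (rule that[OF x0(1,2)])
    fix x :: real assume x: "\<bar>x\<bar> \<le> x0"
    show "1 - p * x + q * x\<^sup>2 \<le> (1 + x) powr (- p)"
    proof (cases "x = 0")
      case False
      define diff where "diff = (\<lambda>m::nat. if m = 0 then (\<lambda>t. (1 + t) powr (- p))
         else if m = 1 then (\<lambda>t. - p * (1 + t) powr (- p - 1)) else ?g)"
      have D: "\<forall>m t. m < 2 \<and> - x0 \<le> t \<and> t \<le> x0 \<longrightarrow> (diff m has_real_derivative diff (Suc m) t) (at t)"
      proof (intro allI impI, elim conjE)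
        fix m :: nat and t :: real
        assume m: "m < 2" and t: "- x0 \<le> t" "t \<le> x0"
        have "0 < 1 + t" using t x0 by linarith
        then show "(diff m has_real_derivative diff (Suc m) t) (at t)"
          using m by (cases "m = 0")
            (auto simp: diff_def less_2_cases_iff intro!: derivative_eq_intros simp: algebra_simps)
      qed
      have "\<exists>t. (if x < 0 then x < t \<and> t < 0 else 0 < t \<and> t < x) \<and>
         (1 + x) powr (- p) = (\<Sum>m<2. diff m 0 / fact m * (x - 0) ^ m) + diff 2 t / fact 2 * (x - 0)\<^sup>2"
        using x x0 False by (intro Taylor[OF _ _ D]) (auto simp: diff_def)
      then obtain t where t: "if x < 0 then x < t \<and> t < 0 else 0 < t \<and> t < x"
         "(1 + x) powr (- p) = (\<Sum>m<2. diff m 0 / fact m * (x - 0) ^ m) + diff 2 t / fact 2 * (x - 0)\<^sup>2"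
        by blast
      have "t \<noteq> 0" "\<bar>t\<bar> < d" using t(1) x x0(3) False by (auto split: if_splits)
      then have "2 * q < ?g t" by (rule d(2))
      then have "q * x\<^sup>2 \<le> ?g t / 2 * x\<^sup>2" by (intro mult_right_mono) auto
      then show ?thesis using t(2) by (simp add: diff_def numeral_2_eq_2)
    qed simp
  qed
qed

section \<open>The power barrier\<close>

context unit_kernel
begin

text \<open>
  The exponent is chosen so that \<open>CARD('n) - 2 < 2 * p < CARD('n)\<close>: the lower bound makes
  \<open>\<bar>x\<bar>\<close> to the power \<open>- 2 * p\<close> subharmonic away from the origin, the upper one integrable near it.
\<close>

definition pexp :: real where "pexp = (2 * real CARD('n) - 1) / 4"

text \<open>The power of \<open>norm x\<close> with exponent \<open>- 2 * pexp\<close>, flattened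
  inside the unit ball so that it is bounded and continuous.\<close>

definition barrier :: "real ^ 'n \<Rightarrow> real"
  where "barrier x = max 1 (x \<bullet> x) powr (- pexp)"

lemma card_ge1: "1 \<le> real CARD('n)"
  by (simp add: Suc_leI)

lemma pexp_pos: "0 < pexp"
proof -
  have "0 < 2 * real CARD('n) - 1" using card_ge1 by linarith
  then show ?thesis by (simp add: pexp_def)
qed

lemma barrier_pos: "0 < barrier x"
  by (simp add: barrier_def)

lemma barrier_le_1: "barrier x \<le> 1"
  unfolding barrier_def using pexp_pos by (auto simp: powr_minus intro!: inverse_le_1_iff[THEN iffD2] ge_one_powr_ge_zero)

lemma barrier_cont: "continuous_on UNIV barrier"
  unfolding barrier_def[abs_def] by (intro continuous_intros) auto

lemma barrier_meas [measurable]: "barrier \<in> borel_measurable borel"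
  by (rule borel_measurable_continuous_onI[OF barrier_cont])

text \<open>With \<open>s = y \<bullet> y\<close> and
  \<open>d = 2 * (y \<bullet> z) + z \<bullet> z\<close>, the barrier at \<open>y + z\<close> is its
  value at \<open>y\<close> times \<open>(1 + d / s) powr (- pexp)\<close>. Once the quadratic lower
  bound is averaged over \<open>z\<close>, the odd terms vanish and the second moments leave the net
  gain \<open>pexp * m1 / s\<close>.\<close>

lemma barrier_subharmonic:
  obtains M c where "R + 1 \<le> M" "0 < c"
    "\<And>y. M \<le> norm y \<Longrightarrow> barrier y + c * (y \<bullet> y) powr (- pexp - 1) \<le> conv J barrier y"
proof -
  let ?N = "real CARD('n)"
  \<comment> \<open>The first-order term loses \<open>pexp * ?N\<close> and the second-order one
    gains \<open>4 * q\<close>, in units of \<open>m1 / s\<close>; this \<open>q\<close> leaves a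
    surplus of exactly \<open>pexp\<close>. It is admissible because
    \<open>pexp > (?N - 1) / 2\<close>.\<close>
  define q where "q = pexp * (?N + 1) / 4"
  have "(?N + 1) / 4 < (pexp + 1) / 2" by (simp add: pexp_def field_simps)
  then have "pexp * ((?N + 1) / 4) < pexp * ((pexp + 1) / 2)"
    using pexp_pos by (rule mult_strict_left_mono)
  then have "q < pexp * (pexp + 1) / 2" by (simp add: q_def)
  from powr_quadratic_lower[OF pexp_pos this] obtain x0
    where x0: "0 < x0" "x0 < 1" "\<And>x. \<bar>x\<bar> \<le> x0 \<Longrightarrow> 1 - pexp * x + q * x\<^sup>2 \<le> (1 + x) powr (- pexp)"
    by metis
  have q0: "0 \<le> q" using pexp_pos card_ge1 by (simp add: q_def)
  \<comment> \<open>The first entry keeps \<open>y + z\<close> outside the unit ball, where the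
    barrier is a pure power; the second makes the relative increment \<open>d / s\<close> at most
    \<open>x0\<close>.\<close>
  define M where "M = max (R + 1) (3 * R / x0)"
  show ?thesis
  proof (rule that[of M "pexp * m1"])
    show "R + 1 \<le> M" by (simp add: M_def)
    show "0 < pexp * m1" using pexp_pos m1_pos by simp
    fix y :: "real ^ 'n" assume y: "M \<le> norm y"
    define s where "s = y \<bullet> y"
    have yR: "R + 1 \<le> norm y" "3 * R \<le> x0 * norm y"
      using y x0 by (auto simp: M_def field_simps)
    have s: "s = (norm y)\<^sup>2" by (simp add: s_def power2_norm_eq_inner)
    have s1: "1 \<le> s" "0 < s" using yR R1 unfolding s by (auto intro: one_le_power)
    have bry: "barrier y = s powr (- pexp)"
      using s1 by (simp add: barrier_def s_def[symmetric] max_def)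
    \<comment> \<open>The quadratic polynomial in \<open>d / s\<close>, except that the square of
      \<open>d\<close> has lost its nonnegative term \<open>(z \<bullet> z)\<^sup>2\<close>; of what
      is left only the part even in \<open>z\<close> contributes to the integral.\<close>
    let ?L = "\<lambda>z. s powr (- pexp) * (1 - pexp * ((2 * (y \<bullet> z) + z \<bullet> z) / s) + q * (4 * (y \<bullet> z)\<^sup>2 + 4 * ((y \<bullet> z) * (z \<bullet> z))) / s\<^sup>2)"
    have pt: "J z * ?L z \<le> J z * barrier (y + z)" for z
    proof (cases "norm z < R")
      case True
      define d where "d = 2 * (y \<bullet> z) + z \<bullet> z"
      have sd: "(y + z) \<bullet> (y + z) = s + d" by (simp add: s_def d_def algebra_simps inner_commute)
      have "norm y \<le> norm (y + z) + norm z" using norm_triangle_ineq4[of "y + z" z] by simp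
      then have "1 \<le> norm (y + z)" using yR True by linarith
      then have sd1: "1 \<le> s + d"
        unfolding sd[symmetric] power2_norm_eq_inner[symmetric] by (rule one_le_power)
      have "\<bar>y \<bullet> z\<bar> \<le> norm y * norm z" by (rule Cauchy_Schwarz_ineq2)
      also have "\<dots> \<le> norm y * R" using True by (intro mult_left_mono) auto
      finally have a: "\<bar>y \<bullet> z\<bar> \<le> norm y * R" .
      have "z \<bullet> z = norm z * norm z" by (simp add: power2_norm_eq_inner[symmetric] power2_eq_square)
      also have "\<dots> \<le> norm y * R" using True yR by (intro mult_mono) auto
      finally have b: "z \<bullet> z \<le> norm y * R" .
      have "0 \<le> z \<bullet> z" by simp
      then have "\<bar>d\<bar> \<le> norm y * (3 * R)" using a b unfolding d_def by (simp only: mult.commute[of "norm y"] mult.assoc)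
      also have "\<dots> \<le> norm y * (x0 * norm y)" using yR by (intro mult_left_mono) auto
      also have "\<dots> = x0 * s" by (simp add: s power2_eq_square)
      finally have "\<bar>d / s\<bar> \<le> x0" using s1 by (simp add: abs_divide pos_divide_le_eq)
      then have "1 - pexp * (d / s) + q * (d / s)\<^sup>2 \<le> (1 + d / s) powr (- pexp)" by (rule x0(3))
      moreover have "q * (4 * (y \<bullet> z)\<^sup>2 + 4 * ((y \<bullet> z) * (z \<bullet> z))) / s\<^sup>2 \<le> q * (d / s)\<^sup>2"
      proof -
        have "4 * (y \<bullet> z)\<^sup>2 + 4 * ((y \<bullet> z) * (z \<bullet> z)) \<le> d\<^sup>2"
          unfolding d_def by (simp add: power2_sum power_mult_distrib)
        then have "q * (4 * (y \<bullet> z)\<^sup>2 + 4 * ((y \<bullet> z) * (z \<bullet> z))) / s\<^sup>2 \<le> q * d\<^sup>2 / s\<^sup>2"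
          using q0 by (intro divide_right_mono mult_left_mono) auto
        then show ?thesis by (simp add: power_divide)
      qed
      ultimately have "?L z \<le> s powr (- pexp) * (1 + d / s) powr (- pexp)"
        unfolding d_def by (intro mult_left_mono) auto
      also have "\<dots> = (s + d) powr (- pexp)"
      proof -
        have "s * (1 + d / s) = s + d" using s1 by (simp add: field_simps)
        moreover have "0 \<le> 1 + d / s" using s1 sd1 by (simp add: field_simps)
        ultimately show ?thesis using s1 by (subst powr_mult[symmetric]) auto
      qed
      also have "\<dots> = barrier (y + z)"
        using sd1 by (simp add: barrier_def sd max_def)
      finally show ?thesis by (rule mult_left_mono) (rule J_nonneg)
    qed (simp add: J_outside)
    have i1: "integrable lborel (\<lambda>z. J z * 1)" "integrable lborel (\<lambda>z. J z * (y \<bullet> z))"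
      "integrable lborel (\<lambda>z. J z * (z \<bullet> z))" "integrable lborel (\<lambda>z. J z * (y \<bullet> z)\<^sup>2)"
      "integrable lborel (\<lambda>z. J z * ((y \<bullet> z) * (z \<bullet> z)))"
      by (intro J_integrable_mult continuous_intros)+
    have exp: "J z * ?L z = s powr (- pexp) * (J z * 1 + (- 2 * pexp / s) * (J z * (y \<bullet> z)) + (- pexp / s) * (J z * (z \<bullet> z))
        + (4 * q / s\<^sup>2) * (J z * (y \<bullet> z)\<^sup>2) + (4 * q / s\<^sup>2) * (J z * ((y \<bullet> z) * (z \<bullet> z))))" for z
      using s1 by (simp add: algebra_simps add_divide_distrib diff_divide_distrib)
    have odd: "(LINT z|lborel. J z * (y \<bullet> z)) = 0" "(LINT z|lborel. J z * ((y \<bullet> z) * (z \<bullet> z))) = 0"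
      by (rule odd_moment; simp)+
    have "(LINT z|lborel. J z * ?L z) = s powr (- pexp) * (1 + (- pexp / s) * (?N * m1) + (4 * q / s\<^sup>2) * (m1 * s))"
      unfolding exp using i1
      by (simp add: odd norm_moment second_moment s_def mass)
    also have "(4 * q / s\<^sup>2) * (m1 * s) = (4 * q * m1) / s"
      using s1 by (simp add: power2_eq_square)
    also have "s powr (- pexp) * (1 + (- pexp / s) * (?N * m1) + (4 * q * m1) / s)
       = s powr (- pexp) + (pexp * m1) * (s powr (- pexp) / s)"
      using s1 by (simp add: q_def field_simps)
    also have "s powr (- pexp) / s = s powr (- pexp - 1)"
      using s1 by (simp add: powr_diff)
    finally have "s powr (- pexp) + (pexp * m1) * s powr (- pexp - 1) = (LINT z|lborel. J z * ?L z)" by simp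
    also have "\<dots> \<le> (LINT z|lborel. J z * barrier (y + z))"
    proof (rule integral_mono[OF _ _ pt])
      show "integrable lborel (\<lambda>z. J z * ?L z)"
        unfolding exp by (intro Bochner_Integration.integrable_add integrable_mult_right i1)
      show "integrable lborel (\<lambda>z. J z * barrier (y + z))"
        by (intro J_integrable_mult continuous_on_compose2[OF barrier_cont]) (auto intro: continuous_intros)
    qed
    also have "\<dots> = conv J barrier y"
      by (rule conv_plus[OF kern even, symmetric]) auto
    finally show "barrier y + pexp * m1 * (y \<bullet> y) powr (- pexp - 1) \<le> conv J barrier y"
      by (simp add: bry s_def)
  qed
qed

end

section \<open>Integrals over balls, and propagation of bounds by repeated averaging\<close>

lemma set_integral_mono_sets:
  fixes Z :: "'a \<Rightarrow> real"
  assumes "integrable M Z" "\<And>x. 0 \<le> Z x" "A \<in> sets M" "B \<in> sets M" "A \<subseteq> B"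
  shows "(LINT x:A|M. Z x) \<le> (LINT x:B|M. Z x)"
  unfolding set_lebesgue_integral_def
  using assms by (intro integral_mono integrable_mult_indicator) (auto simp: indicator_def)

lemma set_integral_nonneg':
  fixes Z :: "'a \<Rightarrow> real"
  assumes "\<And>x. 0 \<le> Z x"
  shows "0 \<le> (LINT x:A|M. Z x)"
  unfolding set_lebesgue_integral_def
  using assms by (intro Bochner_Integration.integral_nonneg) (auto simp: indicator_def)

lemma content_ball_pos':
  "0 < r \<Longrightarrow> 0 < measure lborel (ball (x::'a::euclidean_space) r)"
  using content_ball_pos[of r x] by simp

lemma ball_lborel_fin: "emeasure lborel (ball (x::'a::euclidean_space) r) < \<infinity>"
  by (intro emeasure_bounded_finite) auto

text \<open>If every point with property \<open>Q\<close> had a value above the mean, the mean would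
  be exceeded almost everywhere on the ball. This turns inequalities known almost everywhere into a
  usable starting point.\<close>

lemma ex_good_point:
  fixes Z :: "'a::euclidean_space \<Rightarrow> real"
  assumes Z: "integrable lborel Z" "\<And>x. 0 \<le> Z x" and ae: "AE x in lborel. x \<in> ball z r \<longrightarrow> Q x" and r: "0 < r"
  obtains x where "x \<in> ball z r" "Q x" "Z x \<le> (LINT x:ball z r|lborel. Z x) / measure lborel (ball z r)"
proof (rule ccontr)
  assume no: "\<not> thesis"
  let ?I = "(LINT x:ball z r|lborel. Z x)" and ?m = "measure lborel (ball z r)"
  let ?k = "?I / ?m"
  have m: "0 < ?m" using content_ball_pos'[OF r] .
  have gt: "AE x in lborel. x \<in> ball z r \<longrightarrow> ?k < Z x"
    using ae
  proof eventually_elim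
    fix x assume "x \<in> ball z r \<longrightarrow> Q x"
    then show "x \<in> ball z r \<longrightarrow> ?k < Z x" using no that[of x] by fastforce
  qed
  have i: "integrable lborel (\<lambda>x. indicator (ball z r) x *\<^sub>R (Z x - ?k))"
    unfolding scaleR_right_diff_distrib
    using Z ball_lborel_fin[of z r] integrable_mult_indicator[OF _ Z(1), of "ball z r"]
    by (intro Bochner_Integration.integrable_diff) auto
  have "(LINT x|lborel. indicator (ball z r) x *\<^sub>R (Z x - ?k)) = ?I - ?m * ?k"
    using Z ball_lborel_fin[of z r] integrable_mult_indicator[OF _ Z(1), of "ball z r"]
    unfolding set_lebesgue_integral_def
    by (simp add: algebra_simps)
  also have "\<dots> = 0" using m by simp
  finally have "AE x in lborel. indicator (ball z r) x *\<^sub>R (Z x - ?k) = 0"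
    using gt by (subst (asm) integral_nonneg_eq_0_iff_AE[OF i]) (auto elim!: eventually_mono simp: indicator_def)
  with gt have "AE x in lborel. x \<notin> ball z r"
    by eventually_elim (auto simp: indicator_def)
  then have "emeasure lborel (ball z r) = 0"
    by (subst (asm) AE_iff_measurable[of "ball z r"]) auto
  then have "?m = 0" by (simp add: measure_def)
  with m show False by simp
qed

context unit_kernel
begin

text \<open>The shape of a weak Harnack inequality for the averaging operator. The datum at the
  centre is an average rather than a value of \<open>Z\<close>, and the one-sided inequality is
  assumed almost everywhere on a larger ball only.\<close>

definition local_estimate :: "real \<Rightarrow> real \<Rightarrow> real \<Rightarrow> bool"
  where "local_estimate r S C \<longleftrightarrow>
    (\<forall>Z y b \<Lambda>. integrable lborel Z \<longrightarrow> (\<forall>x. 0 \<le> Z x) \<longrightarrow> 0 \<le> b \<longrightarrow> 0 \<le> \<Lambda> \<longrightarrow> conv J Z y \<le> b \<longrightarrow>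
       (AE x in lborel. x \<in> ball y S \<longrightarrow> conv J Z x \<le> Z x + \<Lambda>) \<longrightarrow>
       (LINT x:ball y r|lborel. Z x) \<le> C * (b + \<Lambda>))"

lemma local_estimateD:
  assumes "local_estimate r S C" "integrable lborel Z" "\<And>x. 0 \<le> Z x" "0 \<le> b" "0 \<le> \<Lambda>" "conv J Z y \<le> b"
    and "AE x in lborel. x \<in> ball y S \<longrightarrow> conv J Z x \<le> Z x + \<Lambda>"
  shows "(LINT x:ball y r|lborel. Z x) \<le> C * (b + \<Lambda>)"
  using assms unfolding local_estimate_def by blast

text \<open>
  If \<open>J\<close> is large near \<open>z0\<close>, then by symmetry it is also large near \<open>- z0\<close>: two steps of the
  averaging lead from \<open>y\<close> to points near \<open>y + z0\<close> and back to a full neighbourhood of \<open>y\<close>.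
\<close>

lemma near_estimate:
  obtains \<rho> C where "0 < \<rho>" "\<rho> \<le> 1" "0 < C"
    "local_estimate \<rho> (2 * R) C"
proof -
  obtain z0 where z0: "0 < J z0"
  proof (rule ccontr)
    assume "\<not> thesis"
    then have "J z = 0" for z using that[of z] J_nonneg[of z] by linarith
    then show False using mass by simp
  qed
  define c where "c = J z0 / 4"
  have c: "0 < c" using z0 by (simp add: c_def)
  have "isCont J z0" using kern unfolding kern_def by (simp add: continuous_on_eq_continuous_at)
  then obtain d where d: "0 < d" "\<And>z. dist z z0 < d \<Longrightarrow> dist (J z) (J z0) < J z0 / 2"
    using z0 unfolding continuous_at_eps_delta by (metis half_gt_zero)
  define \<rho> where "\<rho> = min 1 (d / 2)"
  have \<rho>: "0 < \<rho>" "\<rho> \<le> 1" "2 * \<rho> \<le> d" using d(1) by (auto simp: \<rho>_def)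
  have Jbig: "2 * c \<le> J z" if "dist z0 z < 2 * \<rho>" for z
    using d(2)[of z] that \<rho> by (simp add: dist_commute c_def dist_real_def abs_if split: if_splits)
  have Jbig': "2 * c \<le> J z" if "dist (- z0) z < 2 * \<rho>" for z
    using Jbig[of "- z"] that even[of z] by (simp add: dist_norm norm_minus_commute add.commute)
  have z0R: "norm z0 < R" using z0 J_outside[of z0] by force
  \<comment> \<open>\<open>J\<close> is at least \<open>2 * c\<close> from \<open>y\<close> towards
    the whole ball, so the average at \<open>y\<close> already controls the mass there.\<close>
  have move: "(LINT x:ball w (2 * \<rho>)|lborel. Z x) \<le> b / (2 * c)"
    if Z: "integrable lborel Z" "\<And>x. 0 \<le> Z x" and b: "conv J Z y \<le> b"
      and w: "\<And>x. x \<in> ball w (2 * \<rho>) \<Longrightarrow> 2 * c \<le> J (y - x)" for Z y w b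
  proof -
    have "2 * c * (LINT x:ball w (2 * \<rho>)|lborel. Z x) = (LINT x|lborel. 2 * c * (indicator (ball w (2 * \<rho>)) x *\<^sub>R Z x))"
      unfolding set_lebesgue_integral_def by simp
    also have "\<dots> \<le> (LINT x|lborel. J (y - x) * Z x)"
    proof (rule integral_mono)
      show "integrable lborel (\<lambda>x. J (y - x) * Z x)" by (rule conv_integrable_pt[OF kern Z(1)])
      show "integrable lborel (\<lambda>x. 2 * c * (indicator (ball w (2 * \<rho>)) x *\<^sub>R Z x))"
        using Z(1) by (intro integrable_mult_right integrable_mult_indicator) auto
      show "2 * c * (indicator (ball w (2 * \<rho>)) x *\<^sub>R Z x) \<le> J (y - x) * Z x" for x
        using w[of x] Z(2)[of x] J_nonneg[of "y - x"] by (auto simp: indicator_def intro: mult_right_mono)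
    qed
    also have "\<dots> \<le> b" using b by (simp add: conv_def)
    finally show ?thesis using c by (simp add: field_simps)
  qed
  define V where "V = measure lborel (ball (0 :: real ^ 'n) \<rho>)"
  have V: "0 < V" unfolding V_def using content_ball_pos'[OF \<rho>(1)] .
  have Vx: "measure lborel (ball (x :: real ^ 'n) \<rho>) = V" for x
    unfolding V_def using \<rho> by (simp add: content_ball)
  define C where "C = max 1 (1 / (2 * c * V)) / (2 * c)"
  show ?thesis
  proof (rule that[OF \<rho>(1,2), of C])
    show "0 < C" using c by (simp add: C_def)
    show "local_estimate \<rho> (2 * R) C"
      unfolding local_estimate_def
    proof (intro allI impI)
    fix Z y b \<Lambda>
    assume Z': "integrable lborel Z" "\<forall>x. 0 \<le> Z x" and b': "0 \<le> b" and \<Lambda>: "0 \<le> \<Lambda>" and b'': "conv J Z y \<le> b"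
      and ae: "AE x in lborel. x \<in> ball y (2 * R) \<longrightarrow> conv J Z x \<le> Z x + \<Lambda>"
    note Z = Z'(1) Z'(2)[rule_format] and b = b' b''
    let ?w = "y + z0"
    have 1: "(LINT x:ball ?w (2 * \<rho>)|lborel. Z x) \<le> b / (2 * c)"
    proof (rule move[OF Z b(2)])
      fix x assume "x \<in> ball (y + z0) (2 * \<rho>)"
      then show "2 * c \<le> J (y - x)" by (intro Jbig') (simp add: dist_norm algebra_simps norm_minus_commute)
    qed
    have sub: "ball ?w \<rho> \<subseteq> ball y (2 * R)"
    proof
      fix x assume "x \<in> ball ?w \<rho>"
      then have "dist ?w x < \<rho>" by simp
      moreover have "dist y ?w = norm z0" by (simp add: dist_norm)
      ultimately show "x \<in> ball y (2 * R)" using dist_triangle[of y x ?w] z0R \<rho> R1 by auto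
    qed
    have ae': "AE x in lborel. x \<in> ball ?w \<rho> \<longrightarrow> conv J Z x \<le> Z x + \<Lambda>"
      using ae by eventually_elim (use sub in auto)
    \<comment> \<open>At \<open>y'\<close> the one-sided inequality holds and \<open>Z\<close> is at
      most its mean. Hence the mass near \<open>y + z0\<close> bounds the average at
      \<open>y'\<close>, from which the second move starts.\<close>
    obtain y' where y': "y' \<in> ball ?w \<rho>" "conv J Z y' \<le> Z y' + \<Lambda>"
       "Z y' \<le> (LINT x:ball ?w \<rho>|lborel. Z x) / measure lborel (ball ?w \<rho>)"
      by (rule ex_good_point[OF Z ae' \<rho>(1)])
    have "(LINT x:ball ?w \<rho>|lborel. Z x) \<le> (LINT x:ball ?w (2 * \<rho>)|lborel. Z x)"
      using Z \<rho> by (intro set_integral_mono_sets) auto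
    with 1 have "(LINT x:ball ?w \<rho>|lborel. Z x) / V \<le> b / (2 * c) / V"
      using V by (intro divide_right_mono) auto
    with y' have Zy': "conv J Z y' \<le> b * (1 / (2 * c * V)) + \<Lambda>" by (simp add: Vx mult.assoc)
    have 2: "(LINT x:ball (y' - z0) (2 * \<rho>)|lborel. Z x) \<le> (b * (1 / (2 * c * V)) + \<Lambda>) / (2 * c)"
    proof (rule move[OF Z Zy'])
      fix x assume "x \<in> ball (y' - z0) (2 * \<rho>)"
      then show "2 * c \<le> J (y' - x)" by (intro Jbig) (simp add: dist_norm algebra_simps norm_minus_commute)
    qed
    have "ball y \<rho> \<subseteq> ball (y' - z0) (2 * \<rho>)"
    proof
      fix x assume x: "x \<in> ball y \<rho>"
      have "dist (y' - z0) y < \<rho>" using y'(1) by (simp add: dist_norm algebra_simps norm_minus_commute)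
      then show "x \<in> ball (y' - z0) (2 * \<rho>)" using x dist_triangle[of "y' - z0" x y] by simp
    qed
    then have "(LINT x:ball y \<rho>|lborel. Z x) \<le> (LINT x:ball (y' - z0) (2 * \<rho>)|lborel. Z x)"
      using Z by (intro set_integral_mono_sets) auto
    also note 2
    also have "(b * (1 / (2 * c * V)) + \<Lambda>) / (2 * c) \<le> (b * max 1 (1 / (2 * c * V)) + \<Lambda> * max 1 (1 / (2 * c * V))) / (2 * c)"
      using c b \<Lambda> by (intro divide_right_mono add_mono mult_left_mono) (auto intro: mult_left_mono[of 1 _ \<Lambda>, simplified])
    also have "\<dots> = C * (b + \<Lambda>)" by (simp add: C_def algebra_simps)
    finally show "(LINT x:ball y \<rho>|lborel. Z x) \<le> C * (b + \<Lambda>)" .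
    qed
  qed
qed

text \<open>A Harnack chain with steps of length \<open>\<rho> / 4\<close>. The next starting point
  is a good point within \<open>\<rho> / 4\<close> of the previous centre, hence within
  \<open>\<rho> / 2\<close> of the new one, so that its ball of radius \<rho> contains the next ball
  of radius \<open>\<rho> / 2\<close>. The constant depends on \<open>n\<close> only, not on the
  function or the points.\<close>

lemma chain_estimate:
  assumes \<rho>: "0 < \<rho>" "\<rho> \<le> 1" and C: "0 < C"
    and near: "local_estimate \<rho> (2 * R) C"
  shows "\<exists>D>0. \<forall>Z y x b \<Lambda>. integrable lborel Z \<longrightarrow> (\<forall>x. 0 \<le> Z x) \<longrightarrow> 0 \<le> b \<longrightarrow> 0 \<le> \<Lambda> \<longrightarrow> conv J Z y \<le> b \<longrightarrow>
       (AE x in lborel. x \<in> ball y (real n + 2 * R) \<longrightarrow> conv J Z x \<le> Z x + \<Lambda>) \<longrightarrow>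
       dist y x \<le> real n * (\<rho> / 4) \<longrightarrow> (LINT x:ball x (\<rho> / 2)|lborel. Z x) \<le> D * (b + \<Lambda>)"
proof (induction n)
  case 0
  show ?case
  proof (intro exI[of _ C] conjI allI impI C)
    fix Z y x b \<Lambda>
    assume Z: "integrable lborel Z" "\<forall>x. 0 \<le> Z x" and b: "0 \<le> b" "0 \<le> \<Lambda>" "conv J Z y \<le> b"
      and ae: "AE x in lborel. x \<in> ball y (real 0 + 2 * R) \<longrightarrow> conv J Z x \<le> Z x + \<Lambda>"
      and xy: "dist y x \<le> real 0 * (\<rho> / 4)"
    have "(LINT x:ball x (\<rho> / 2)|lborel. Z x) \<le> (LINT x:ball y \<rho>|lborel. Z x)"
      using Z xy \<rho> by (intro set_integral_mono_sets) auto
    also have "\<dots> \<le> C * (b + \<Lambda>)" using Z b ae by (intro local_estimateD[OF near]) auto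
    finally show "(LINT x:ball x (\<rho> / 2)|lborel. Z x) \<le> C * (b + \<Lambda>)" .
  qed
next
  case (Suc n)
  from Suc.IH obtain D where D: "0 < D"
    and IH: "\<forall>Z y x b \<Lambda>. integrable lborel Z \<longrightarrow> (\<forall>x. 0 \<le> Z x) \<longrightarrow> 0 \<le> b \<longrightarrow> 0 \<le> \<Lambda> \<longrightarrow> conv J Z y \<le> b \<longrightarrow>
       (AE x in lborel. x \<in> ball y (real n + 2 * R) \<longrightarrow> conv J Z x \<le> Z x + \<Lambda>) \<longrightarrow>
       dist y x \<le> real n * (\<rho> / 4) \<longrightarrow> (LINT x:ball x (\<rho> / 2)|lborel. Z x) \<le> D * (b + \<Lambda>)"
    by (elim exE conjE) (rule that)
  define V where "V = measure lborel (ball (0 :: real ^ 'n) (\<rho> / 4))"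
  have V: "0 < V" unfolding V_def using \<rho> by (intro content_ball_pos') auto
  have Vx: "measure lborel (ball (x :: real ^ 'n) (\<rho> / 4)) = V" for x
    unfolding V_def using \<rho> by (simp add: content_ball)
  show ?case
  proof (intro exI[of _ "C * (D / V + 2)"] conjI allI impI)
    show "0 < C * (D / V + 2)" using C D V by (simp add: add_pos_pos)
    fix Z y x b \<Lambda>
    assume Z: "integrable lborel Z" "\<forall>x. 0 \<le> Z x" and b: "0 \<le> b" "0 \<le> \<Lambda>" "conv J Z y \<le> b"
      and ae: "AE x in lborel. x \<in> ball y (real (Suc n) + 2 * R) \<longrightarrow> conv J Z x \<le> Z x + \<Lambda>"
      and xy: "dist y x \<le> real (Suc n) * (\<rho> / 4)"
    have ae1: "AE x in lborel. x \<in> ball y (real n + 2 * R) \<longrightarrow> conv J Z x \<le> Z x + \<Lambda>"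
      using ae by eventually_elim auto
    \<comment> \<open>The point dividing the segment from \<open>y\<close> to \<open>x\<close> in
      the ratio \<open>n : 1\<close>; it is within reach of \<open>n\<close> steps, and one further
      step leads to \<open>x\<close>.\<close>
    define x' where "x' = y + (real n / real (Suc n)) *\<^sub>R (x - y)"
    have "y - x' = (real n / real (Suc n)) *\<^sub>R (y - x)" by (simp add: x'_def algebra_simps)
    then have d1: "dist y x' = (real n / real (Suc n)) * dist y x" by (simp add: dist_norm)
    also have "\<dots> \<le> (real n / real (Suc n)) * (real (Suc n) * (\<rho> / 4))"
      using xy by (intro mult_left_mono) auto
    also have "\<dots> = real n * (\<rho> / 4)" by (simp del: of_nat_Suc)
    finally have yx': "dist y x' \<le> real n * (\<rho> / 4)" .
    have q: "1 - real n / real (Suc n) = 1 / real (Suc n)" by (simp add: field_simps)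
    have "x - x' = (1 - real n / real (Suc n)) *\<^sub>R (x - y)"
      unfolding x'_def by (simp add: scaleR_left_diff_distrib del: of_nat_Suc)
    then have "dist x' x = (1 / real (Suc n)) * dist y x"
      unfolding q by (simp add: dist_norm norm_minus_commute[of x' x] norm_minus_commute[of y x] del: of_nat_Suc)
    also have "\<dots> \<le> (1 / real (Suc n)) * (real (Suc n) * (\<rho> / 4))"
      using xy by (intro mult_left_mono) auto
    also have "\<dots> = \<rho> / 4" by (simp del: of_nat_Suc)
    finally have x'x: "dist x' x \<le> \<rho> / 4" .
    have I: "(LINT x:ball x' (\<rho> / 2)|lborel. Z x) \<le> D * (b + \<Lambda>)"
      using IH Z b ae1 yx' by blast
    have n4: "real n * (\<rho> / 4) \<le> real n * (1 / 4)" using \<rho> by (intro mult_left_mono) auto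
    have near_y: "dist y w < real n + 2 * R" if "dist x' w < \<rho> / 4" for w
      using that yx' n4 dist_triangle[of y w x'] R1 \<rho> by linarith
    have ae2: "AE w in lborel. w \<in> ball x' (\<rho> / 4) \<longrightarrow> conv J Z w \<le> Z w + \<Lambda>"
      using ae1 by eventually_elim (use near_y in auto)
    obtain y' where y': "y' \<in> ball x' (\<rho> / 4)" "conv J Z y' \<le> Z y' + \<Lambda>"
       "Z y' \<le> (LINT x:ball x' (\<rho> / 4)|lborel. Z x) / measure lborel (ball x' (\<rho> / 4))"
      using ex_good_point[OF Z(1) _ ae2] Z(2) \<rho> by auto
    have "(LINT x:ball x' (\<rho> / 4)|lborel. Z x) \<le> (LINT x:ball x' (\<rho> / 2)|lborel. Z x)"
      using Z \<rho> by (intro set_integral_mono_sets) auto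
    with I have "(LINT x:ball x' (\<rho> / 4)|lborel. Z x) / V \<le> D * (b + \<Lambda>) / V"
      using V by (intro divide_right_mono) auto
    with y' have c: "conv J Z y' \<le> D * (b + \<Lambda>) / V + \<Lambda>" by (simp add: Vx)
    have "dist y y' \<le> real n * (1/4) + \<rho> / 4"
      using y'(1) yx' n4 dist_triangle[of y y' x'] by simp
    then have yy': "dist y y' \<le> real n + 1" using \<rho> by linarith
    have ae3: "AE w in lborel. w \<in> ball y' (2 * R) \<longrightarrow> conv J Z w \<le> Z w + \<Lambda>"
      using ae
    proof eventually_elim
      fix w assume "w \<in> ball y (real (Suc n) + 2 * R) \<longrightarrow> conv J Z w \<le> Z w + \<Lambda>"
      then show "w \<in> ball y' (2 * R) \<longrightarrow> conv J Z w \<le> Z w + \<Lambda>"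
        using dist_triangle[of y w y'] yy' by auto
    qed
    have "dist y' x \<le> \<rho> / 2" using y'(1) x'x dist_triangle[of y' x x'] by (simp add: dist_commute)
    then have "ball x (\<rho> / 2) \<subseteq> ball y' \<rho>"
      using \<rho> by (simp add: ball_subset_ball_iff dist_commute)
    then have "(LINT x:ball x (\<rho> / 2)|lborel. Z x) \<le> (LINT x:ball y' \<rho>|lborel. Z x)"
      using Z by (intro set_integral_mono_sets) auto
    also have "\<dots> \<le> C * ((D * (b + \<Lambda>) / V + \<Lambda>) + \<Lambda>)"
      using Z b c ae3 D V by (intro local_estimateD[OF near]) auto
    also have "\<dots> \<le> C * ((D * (b + \<Lambda>) / V + (b + \<Lambda>)) + (b + \<Lambda>))"
      using C b by (intro mult_left_mono add_mono) auto
    also have "\<dots> = C * (D / V + 2) * (b + \<Lambda>)" by (simp add: algebra_simps)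
    finally show "(LINT x:ball x (\<rho> / 2)|lborel. Z x) \<le> C * (D / V + 2) * (b + \<Lambda>)" .
  qed
qed

text \<open>By compactness finitely many balls of radius \<open>\<rho> / 2\<close> cover the ball of
  radius \<open>M\<close>, and a chain of one fixed length reaches each of them.\<close>

lemma finite_range_estimate:
  obtains C \<rho> where "0 < C" "M \<le> \<rho>"
    "local_estimate M \<rho> C"
proof -
  obtain \<rho> C0 where r: "0 < \<rho>" "\<rho> \<le> 1" "0 < C0" and near:
    "local_estimate \<rho> (2 * R) C0"
    using near_estimate by blast
  define n where "n = nat \<lceil>4 * \<bar>M\<bar> / \<rho>\<rceil>"
  have "4 * \<bar>M\<bar> / \<rho> \<le> real n" unfolding n_def by linarith
  then have n: "\<bar>M\<bar> \<le> real n * (\<rho> / 4)" using r by (simp add: field_simps)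
  from chain_estimate[OF r near, of n] obtain D where D: "0 < D"
    and ch: "\<forall>Z y x b \<Lambda>. integrable lborel Z \<longrightarrow> (\<forall>x. 0 \<le> Z x) \<longrightarrow> 0 \<le> b \<longrightarrow> 0 \<le> \<Lambda> \<longrightarrow> conv J Z y \<le> b \<longrightarrow>
       (AE x in lborel. x \<in> ball y (real n + 2 * R) \<longrightarrow> conv J Z x \<le> Z x + \<Lambda>) \<longrightarrow>
       dist y x \<le> real n * (\<rho> / 4) \<longrightarrow> (LINT x:ball x (\<rho> / 2)|lborel. Z x) \<le> D * (b + \<Lambda>)"
    by (elim exE conjE) (rule that)
  have "compact (cball (0 :: real ^ 'n) M)" by simp
  then obtain F where F: "F \<subseteq> cball (0 :: real ^ 'n) M" "finite F" "cball 0 M \<subseteq> (\<Union>x\<in>F. ball x (\<rho> / 2))"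
    using compactE_image[of "cball (0::real^'n) M" "cball 0 M" "\<lambda>x. ball x (\<rho> / 2)"] r by force
  show ?thesis
  \<comment> \<open>The \<open>1\<close> added to the number of balls keeps the constant positive
    when the cover is empty.\<close>
  proof (rule that[of "real (card F + 1) * D" "real n + 2 * R"])
    show "0 < real (card F + 1) * D" using D by simp
    have "real n * (\<rho> / 4) \<le> real n * 1" using r by (intro mult_left_mono) auto
    then show "M \<le> real n + 2 * R" using n R1 by linarith
    show "local_estimate M (real n + 2 * R) (real (card F + 1) * D)"
      unfolding local_estimate_def
    proof (intro allI impI)
    fix Z y b \<Lambda>
    assume Z: "integrable lborel Z" "\<forall>x. 0 \<le> Z x" and b: "0 \<le> b" "0 \<le> \<Lambda>" "conv J Z y \<le> b"
      and ae: "AE x in lborel. x \<in> ball y (real n + 2 * R) \<longrightarrow> conv J Z x \<le> Z x + \<Lambda>"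
    have iF: "integrable lborel (\<lambda>x. indicator (ball (y + f) (\<rho> / 2)) x *\<^sub>R Z x)" for f
      by (rule integrable_mult_indicator) (use Z in auto)
    have "(LINT x:ball y M|lborel. Z x) \<le> (LINT x|lborel. (\<Sum>f\<in>F. indicator (ball (y + f) (\<rho> / 2)) x *\<^sub>R Z x))"
      unfolding set_lebesgue_integral_def
    proof (rule integral_mono)
      fix x
      have nn: "0 \<le> (\<Sum>f\<in>F. indicator (ball (y + f) (\<rho> / 2)) x *\<^sub>R Z x)"
        using Z by (intro sum_nonneg) auto
      show "indicator (ball y M) x *\<^sub>R Z x \<le> (\<Sum>f\<in>F. indicator (ball (y + f) (\<rho> / 2)) x *\<^sub>R Z x)"
      proof (cases "x \<in> ball y M")
        case True
        then have "x - y \<in> cball 0 M" by (simp add: dist_norm norm_minus_commute)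
        with F(3) obtain f where f: "f \<in> F" "x - y \<in> ball f (\<rho> / 2)" by blast
        then have "x \<in> ball (y + f) (\<rho> / 2)" by (simp add: dist_norm algebra_simps)
        then have "indicator (ball y M) x *\<^sub>R Z x = indicator (ball (y + f) (\<rho> / 2)) x *\<^sub>R Z x" using True by simp
        also have "\<dots> \<le> (\<Sum>f\<in>F. indicator (ball (y + f) (\<rho> / 2)) x *\<^sub>R Z x)"
          using f F(2) Z by (intro member_le_sum) auto
        finally show ?thesis .
      qed (use nn in auto)
    qed (use iF integrable_mult_indicator[OF _ Z(1), of "ball y M"] in auto)
    also have "\<dots> = (\<Sum>f\<in>F. LINT x:ball (y + f) (\<rho> / 2)|lborel. Z x)"
      unfolding set_lebesgue_integral_def using iF by (intro Bochner_Integration.integral_sum)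
    also have "\<dots> \<le> (\<Sum>f\<in>F. D * (b + \<Lambda>))"
    proof (rule sum_mono)
      fix f assume "f \<in> F"
      then have "norm f \<le> M" using F(1) by auto
      then have "dist y (y + f) \<le> real n * (\<rho> / 4)" using n by (simp add: dist_norm)
      then show "(LINT x:ball (y + f) (\<rho> / 2)|lborel. Z x) \<le> D * (b + \<Lambda>)"
        using Z b ae by (intro ch[rule_format]) auto
    qed
    also have "\<dots> = real (card F) * D * (b + \<Lambda>)" by simp
    also have "\<dots> \<le> real (card F + 1) * D * (b + \<Lambda>)"
      using D b by (intro mult_right_mono) auto
    finally show "(LINT x:ball y M|lborel. Z x) \<le> real (card F + 1) * D * (b + \<Lambda>)" .
    qed
  qed
qed

end

section \<open>Quadratic growth at all scales\<close>

lemma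
  fixes g :: "'a::euclidean_space \<Rightarrow> real"
  assumes [measurable]: "g \<in> borel_measurable borel" and e: "0 < e"
  shows lborel_integral_scale: "(LINT y|lborel. g y) = e ^ DIM('a) * (LINT y|lborel. g (e *\<^sub>R y))"
    and lborel_integrable_scale: "integrable lborel (\<lambda>y. g (e *\<^sub>R y)) \<longleftrightarrow> integrable lborel g"
proof -
  have l: "lborel = density (distr lborel borel (\<lambda>x::'a. e *\<^sub>R x)) (\<lambda>x. ennreal (e ^ DIM('a)))"
    using lborel_affine[of e "0::'a"] e by simp
  have "(LINT y|lborel. g y) = (LINT y|density (distr lborel borel (\<lambda>x::'a. e *\<^sub>R x)) (\<lambda>x. ennreal (e ^ DIM('a))). g y)"
    by (subst l) simp
  also have "\<dots> = (LINT y|distr lborel borel (\<lambda>x::'a. e *\<^sub>R x). e ^ DIM('a) * g y)"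
    using e by (subst integral_density) auto
  also have "\<dots> = e ^ DIM('a) * (LINT y|lborel. g (e *\<^sub>R y))"
    by (subst integral_distr) auto
  finally show "(LINT y|lborel. g y) = e ^ DIM('a) * (LINT y|lborel. g (e *\<^sub>R y))" .
  have "integrable lborel g \<longleftrightarrow> integrable (density (distr lborel borel (\<lambda>x::'a. e *\<^sub>R x)) (\<lambda>x. ennreal (e ^ DIM('a)))) g"
    by (subst l) simp
  also have "\<dots> \<longleftrightarrow> integrable (distr lborel borel (\<lambda>x::'a. e *\<^sub>R x)) (\<lambda>y. e ^ DIM('a) * g y)"
    using e by (subst integrable_density) auto
  also have "\<dots> \<longleftrightarrow> integrable lborel (\<lambda>y. e ^ DIM('a) * g (e *\<^sub>R y))"
    by (subst integrable_distr_eq) auto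
  also have "\<dots> \<longleftrightarrow> integrable lborel (\<lambda>y. g (e *\<^sub>R y))"
    using e integrable_mult_left_iff[of lborel "e ^ DIM('a)" "\<lambda>y. g (e *\<^sub>R y)"] by simp
  finally show "integrable lborel (\<lambda>y. g (e *\<^sub>R y)) \<longleftrightarrow> integrable lborel g" ..
qed

lemma power2_powr: "0 < x \<Longrightarrow> (x\<^sup>2) powr a = x powr (2 * a)" for x a :: real
  using powr_powr[of x 2 a] by simp

lemma AE_lborel_scale:
  assumes "AE x in lborel. P (x :: 'a::euclidean_space)" and e: "0 < e"
  shows "AE x in lborel. P (e *\<^sub>R x)"
proof -
  have l: "lborel = density (distr lborel borel (\<lambda>x::'a. e *\<^sub>R x)) (\<lambda>x. ennreal (e ^ DIM('a)))"
    using lborel_affine[of e "0::'a"] e by simp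
  have "AE x in density (distr lborel borel (\<lambda>x::'a. e *\<^sub>R x)) (\<lambda>x. ennreal (e ^ DIM('a))). P x"
    using assms(1) by (subst l[symmetric])
  then have "AE x in distr lborel borel (\<lambda>x::'a. e *\<^sub>R x). P x"
    using e by (subst (asm) AE_density) auto
  then show ?thesis by (rule AE_distrD[rotated]) simp
qed

context unit_kernel
begin

text \<open>Dyadic summation. Since \<open>?N - 2 * pexp = 1 / 2\<close>, the shell between the
  radii \<open>2 ^ k\<close> and \<open>2 ^ Suc k\<close> contributes at most
  \<open>V * 2 ^ ?N * (2 ^ k) powr (1 / 2)\<close>, a geometric sequence.\<close>

lemma barrier_integral:
  obtains K where "0 < K"
    "\<And>k. (LINT x:ball 0 (2 ^ k)|lborel. barrier x) \<le> K * (2 ^ k) powr (1 / 2)"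
proof -
  let ?N = "CARD('n)"
  define V where "V = unit_ball_vol (real ?N)"
  have V: "0 < V" by (simp add: V_def)
  have vol: "measure lborel (ball (0 :: real ^ 'n) r) = V * r ^ ?N" if "0 \<le> r" for r
    using content_ball[OF that, of "0 :: real ^ 'n"] by (simp add: V_def)
  \<comment> \<open>The solution of \<open>K + V * 2 ^ ?N = K * 2 powr (1 / 2)\<close>, the relation
    that closes the induction.\<close>
  define K where "K = V * 2 ^ ?N / (2 powr (1 / 2) - 1)"
  have s2: "0 < 2 powr (1 / 2) - (1 :: real)" by simp
  have s2': "2 powr (1 / 2) - 1 \<le> (1 :: real)" by (simp add: powr_half_sqrt real_le_lsqrt)
  have K: "0 < K" using V s2 by (simp add: K_def)
  have VK: "V \<le> K"
  proof -
    have "V * (2 powr (1 / 2) - 1) \<le> V * 2 ^ ?N"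
      using V s2' by (intro mult_left_mono) (auto intro: order_trans[OF _ one_le_power])
    then show ?thesis using s2 by (simp add: K_def pos_le_divide_eq)
  qed
  have i: "integrable lborel (\<lambda>x. indicator (ball 0 r) x *\<^sub>R barrier x)" for r
  proof (rule Bochner_Integration.integrable_bound[of _ "indicator (ball 0 r) :: _ \<Rightarrow> real"])
    show "integrable lborel (indicator (ball 0 r) :: real ^ 'n \<Rightarrow> real)"
      using ball_lborel_fin[of 0 r] by (simp add: integrable_indicator_iff)
    show "AE x in lborel. norm (indicator (ball 0 r) x *\<^sub>R barrier x) \<le> norm (indicator (ball 0 r) x :: real)"
      using barrier_le_1 barrier_pos by (auto simp: indicator_def less_imp_le)
  qed (rule borel_measurable_scaleR[OF borel_measurable_indicator], simp, measurable)
  have ib: "integrable lborel (\<lambda>x. indicator (ball (0 :: real ^ 'n) r) x :: real)" for r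
    using ball_lborel_fin[of "0 :: real ^ 'n" r] by (simp add: integrable_indicator_iff)
  have "(LINT x:ball 0 (2 ^ k)|lborel. barrier x) \<le> K * (2 ^ k) powr (1 / 2)" for k
  proof (induction k)
    case 0
    have "(LINT x:ball 0 1|lborel. barrier x) \<le> (LINT x|lborel. indicator (ball (0 :: real ^ 'n) 1) x)"
      unfolding set_lebesgue_integral_def
    proof (rule integral_mono[OF i ib])
      show "indicator (ball 0 1) x *\<^sub>R barrier x \<le> indicator (ball 0 1) x" for x :: "real ^ 'n"
        using barrier_le_1 by (simp add: indicator_def)
    qed
    also have "\<dots> = V" using vol[of 1] by simp
    finally show ?case using VK by simp
  next
    case (Suc k)
    let ?h = "(2 ^ k) powr (- 2 * pexp) :: real"
    have pt: "indicator (ball 0 (2 ^ Suc k)) x *\<^sub>R barrier x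
       \<le> indicator (ball 0 (2 ^ k)) x *\<^sub>R barrier x + ?h * indicator (ball 0 (2 ^ Suc k)) x" for x :: "real ^ 'n"
    proof (cases "norm x < 2 ^ k")
      case False
      have "(2 ^ k)\<^sup>2 \<le> (norm x)\<^sup>2" using False by (intro power_mono) auto
      then have "barrier x \<le> ((2 ^ k)\<^sup>2) powr (- pexp)"
        unfolding barrier_def power2_norm_eq_inner using pexp_pos by (intro powr_mono2') auto
      also have "((2 ^ k)\<^sup>2) powr (- pexp) = ?h"
        by (simp add: power2_powr)
      finally show ?thesis using False by (auto simp: indicator_def)
    qed (use barrier_pos[of x] in \<open>auto simp: indicator_def less_imp_le\<close>)
    have "(LINT x:ball 0 (2 ^ Suc k)|lborel. barrier x) \<le>
       (LINT x|lborel. indicator (ball 0 (2 ^ k)) x *\<^sub>R barrier x + ?h * indicator (ball (0 :: real ^ 'n) (2 ^ Suc k)) x)"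
      unfolding set_lebesgue_integral_def
      by (intro integral_mono[OF _ _ pt] Bochner_Integration.integrable_add integrable_mult_right i ib)
    also have "\<dots> = (LINT x:ball 0 (2 ^ k)|lborel. barrier x) + ?h * (V * (2 ^ Suc k) ^ ?N)"
      unfolding set_lebesgue_integral_def
      using i[of "2 ^ k"] ib[of "2 ^ Suc k"] vol[of "2 ^ Suc k"]
      by (subst Bochner_Integration.integral_add) (simp_all del: power_Suc)
    also have "\<dots> \<le> K * (2 ^ k) powr (1 / 2) + ?h * (V * (2 ^ Suc k) ^ ?N)"
      using Suc by simp
    also have "?h * (V * (2 ^ Suc k) ^ ?N) = V * 2 ^ ?N * (2 ^ k) powr (1 / 2)"
    proof -
      have "?h * (2 ^ k) ^ ?N = ?h * (2 ^ k) powr (real ?N)" by (simp add: powr_realpow)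
      also have "\<dots> = (2 ^ k) powr (1 / 2)" by (simp add: powr_add[symmetric] pexp_def field_simps)
      finally show ?thesis by (simp add: power_mult_distrib)
    qed
    also have "K * (2 ^ k) powr (1 / 2) + V * 2 ^ ?N * (2 ^ k) powr (1 / 2) = K * ((2 ^ k) powr (1 / 2) * 2 powr (1 / 2))"
    proof -
      have "K + V * 2 ^ ?N = K * 2 powr (1 / 2)" using s2 by (simp add: K_def field_simps)
      then have "(K + V * 2 ^ ?N) * (2 ^ k) powr (1 / 2) = K * 2 powr (1 / 2) * (2 ^ k) powr (1 / 2)" by simp
      then show ?thesis by (simp only: distrib_right mult_ac)
    qed
    also have "(2 ^ k) powr (1 / 2) * 2 powr (1 / 2) = (2 ^ Suc k :: real) powr (1 / 2)"
      by (subst powr_mult[symmetric]) (auto simp: mult.commute)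
    finally show ?case .
  qed
  then show ?thesis using that K by blast
qed

text \<open>The test function \<psi> is the barrier cut off at its value on the sphere of radius
  \<open>H\<close>. By symmetry the integral of \<open>(conv J \<psi> - \<psi>) * Z\<close> equals
  that of \<open>\<psi> * (conv J Z - Z)\<close>, which is at most \<Lambda> times the integral of
  \<psi>. Subharmonicity makes the first integrand at least \<open>c1 * Z\<close> between the radii
  \<open>M\<close> and \<open>H\<close>; the inner ball is left to the unit-scale estimate.\<close>

lemma growth_dyadic:
  obtains C where "1 \<le> C"
    "\<And>Z y \<Lambda> k. integrable lborel Z \<Longrightarrow> (\<And>x. 0 \<le> Z x) \<Longrightarrow> 0 \<le> \<Lambda> \<Longrightarrow> conv J Z y \<le> 2 * \<Lambda> \<Longrightarrow>
       (AE x in lborel. x \<in> ball y (C * 2 ^ k) \<longrightarrow> conv J Z x \<le> Z x + \<Lambda>) \<Longrightarrow>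
       (LINT x:ball y (2 ^ k)|lborel. Z x) \<le> C * \<Lambda> * (2 ^ k) ^ (CARD('n) + 2)"
proof -
  obtain M c where M: "R + 1 \<le> M" and c: "0 < c"
    and sub: "\<And>y. M \<le> norm y \<Longrightarrow> barrier y + c * (y \<bullet> y) powr (- pexp - 1) \<le> conv J barrier y"
    using barrier_subharmonic by blast
  obtain C1 \<rho> where C1: "0 < C1" "M \<le> \<rho>" and loc: "local_estimate M \<rho> C1"
    using finite_range_estimate by blast
  obtain K where K: "0 < K" "\<And>k. (LINT x:ball 0 (2 ^ k)|lborel. barrier x) \<le> K * (2 ^ k) powr (1 / 2)"
    using barrier_integral by blast
  \<comment> \<open>The first two entries make the ball of the assumed inequality contain those of
    radius \<rho> and \<open>H\<close>; the last one collects the constants of the final division by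
    \<open>c1\<close>.\<close>
  define C where "C = max (max 1 \<rho>) ((K + (1 + c) * C1 * 3) / c)"
  show ?thesis
  proof (rule that[of C])
    show "1 \<le> C" by (simp add: C_def)
    fix Z y \<Lambda> and k :: nat
    assume Z: "integrable lborel Z" "\<And>x. 0 \<le> Z x" and \<Lambda>: "0 \<le> \<Lambda>" and b: "conv J Z y \<le> 2 * \<Lambda>"
      and ae: "AE x in lborel. x \<in> ball y (C * 2 ^ k) \<longrightarrow> conv J Z x \<le> Z x + \<Lambda>"
    define H :: real where "H = 2 ^ k"
    have H: "1 \<le> H" by (simp add: H_def)
    have CH: "\<rho> \<le> C * H" "H \<le> C * H"
    proof -
      have "\<rho> * 1 \<le> C * H" using H M C1 R1 by (intro mult_mono) (auto simp: C_def)
      then show "\<rho> \<le> C * H" by simp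
      have "1 * H \<le> C * H" using H by (intro mult_right_mono) (auto simp: C_def)
      then show "H \<le> C * H" by simp
    qed
    have Zm [measurable]: "Z \<in> borel_measurable borel" using Z(1) by (auto dest: borel_measurable_integrable)
    have IM: "(LINT x:ball y M|lborel. Z x) \<le> C1 * (2 * \<Lambda> + \<Lambda>)"
    proof (rule local_estimateD[OF loc Z _ \<Lambda> b])
      show "AE x in lborel. x \<in> ball y \<rho> \<longrightarrow> conv J Z x \<le> Z x + \<Lambda>"
        using ae by eventually_elim (use CH in \<open>auto simp: H_def\<close>)
    qed (use \<Lambda> in auto)
    \<comment> \<open>The value of the barrier at distance \<open>H\<close>.\<close>
    define h where "h = H powr (- 2 * pexp)"
    define \<psi> where "\<psi> x = max 0 (barrier (x - y) - h)" for x
    have h0: "0 \<le> h" by (simp add: h_def)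
    have hH: "h = (H\<^sup>2) powr (- pexp)"
      using H by (simp add: h_def power2_powr)
    have \<psi>m [measurable]: "\<psi> \<in> borel_measurable borel" unfolding \<psi>_def by measurable
    have \<psi>0: "0 \<le> \<psi> x" "\<psi> x \<le> 1" "\<psi> x \<le> barrier (x - y)" for x
      using barrier_le_1[of "x - y"] barrier_pos[of "x - y"] h0 by (auto simp: \<psi>_def)
    have out: "\<psi> x = 0" if "x \<notin> ball y H" for x
    proof -
      have "H\<^sup>2 \<le> (norm (x - y))\<^sup>2" using that H by (intro power_mono) (auto simp: dist_norm norm_minus_commute)
      then have "barrier (x - y) \<le> h"
        unfolding barrier_def hH power2_norm_eq_inner using pexp_pos H by (intro powr_mono2') auto
      then show ?thesis by (simp add: \<psi>_def)
    qed
    have inside: "\<psi> x = barrier (x - y) - h" if "x \<in> ball y H" for x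
    proof -
      have "(norm (x - y))\<^sup>2 \<le> H\<^sup>2" using that H by (intro power_mono) (auto simp: dist_norm norm_minus_commute)
      moreover have "1 \<le> H\<^sup>2" using H by (simp add: one_le_power)
      ultimately have le: "max 1 ((x - y) \<bullet> (x - y)) \<le> H\<^sup>2"
        by (simp only: power2_norm_eq_inner max.bounded_iff)
      have "h \<le> barrier (x - y)"
        unfolding barrier_def hH by (rule powr_mono2'[OF _ _ le]) (use pexp_pos in simp_all)
      then show ?thesis by (simp add: \<psi>_def)
    qed
    have bc: "continuous_on UNIV (\<lambda>z. barrier (x + z - y))" for x
      by (rule continuous_on_compose2[OF barrier_cont, of UNIV "\<lambda>z. x + z - y"]) (intro continuous_intros, simp)
    have conv_eq: "conv J \<psi> x = (LINT z|lborel. J z * \<psi> (x + z))" for x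
      by (rule conv_plus[OF kern even]) auto
    have conv0: "0 \<le> conv J \<psi> x" for x
      unfolding conv_eq using J_nonneg \<psi>0 by (intro Bochner_Integration.integral_nonneg) auto
    \<comment> \<open>Passing to the positive part only raises the function, so the cut-off does not
      spoil subharmonicity.\<close>
    have convb: "conv J barrier (x - y) - h \<le> conv J \<psi> x" for x
    proof -
      have "conv J barrier (x - y) - h = (LINT z|lborel. J z * barrier (x + z - y)) - (LINT z|lborel. J z * h)"
        using conv_plus[OF kern even barrier_meas, of "x - y"] mass by (simp add: algebra_simps)
      also have "\<dots> = (LINT z|lborel. J z * (barrier (x + z - y) - h))"
        using J_integrable_mult[OF bc] J_integrable_mult[of "\<lambda>_. h"]
        by (simp add: right_diff_distrib)
      also have "\<dots> \<le> conv J \<psi> x"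
        unfolding conv_eq
      proof (rule integral_mono)
        show "integrable lborel (\<lambda>z. J z * (barrier (x + z - y) - h))"
          by (intro J_integrable_mult continuous_intros bc)
        show "integrable lborel (\<lambda>z. J z * \<psi> (x + z))"
          unfolding \<psi>_def by (intro J_integrable_mult continuous_intros bc)
        show "J z * (barrier (x + z - y) - h) \<le> J z * \<psi> (x + z)" for z
          unfolding \<psi>_def using J_nonneg[of z] by (intro mult_left_mono) auto
      qed
      finally show ?thesis .
    qed
    \<comment> \<open>A lower bound, on the ball of radius \<open>H\<close>, for the gain in
      \<open>sub\<close>: that gain decreases with the distance.\<close>
    define c1 where "c1 = c * H powr (- 2 * pexp - 2)"
    have c1: "0 < c1" using c H by (simp add: c1_def)
    have c1c: "c1 \<le> c"
    proof -
      have "H powr (- 2 * pexp - 2) \<le> H powr 0" using H pexp_pos by (intro powr_mono) auto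
      then show ?thesis using c H by (simp add: c1_def)
    qed
    have c1H: "c1 = c * (H\<^sup>2) powr (- pexp - 1)"
      using H by (simp add: c1_def power2_powr algebra_simps)
    have pt: "c1 * (indicator (ball y H) x *\<^sub>R Z x) - (1 + c1) * (indicator (ball y M) x *\<^sub>R Z x)
        \<le> conv J \<psi> x * Z x - \<psi> x * Z x" for x
    proof (cases "x \<in> ball y H")
      case False
      have "0 \<le> conv J \<psi> x * Z x" using conv0 Z by simp
      moreover have "0 \<le> (1 + c1) * (indicator (ball y M) x *\<^sub>R Z x)" using c1 Z(2)[of x] by simp
      ultimately show ?thesis using False out[OF False] by simp
    next
      case xH: True
      show ?thesis
      proof (cases "x \<in> ball y M")
        case True
        have "0 \<le> conv J \<psi> x * Z x" using conv0 Z by simp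
        moreover have "\<psi> x * Z x \<le> 1 * Z x" using \<psi>0 Z by (intro mult_right_mono) auto
        ultimately show ?thesis using True xH by (simp add: algebra_simps)
      next
        case False
        then have n: "M \<le> norm (x - y)" by (simp add: dist_norm norm_minus_commute)
        have "(norm (x - y))\<^sup>2 \<le> H\<^sup>2" using xH H by (intro power_mono) (auto simp: dist_norm norm_minus_commute)
        then have le: "(x - y) \<bullet> (x - y) \<le> H\<^sup>2" by (simp only: power2_norm_eq_inner)
        have "0 < norm (x - y)" using n M R1 by linarith
        then have "0 < (x - y) \<bullet> (x - y)" by simp
        then have "(H\<^sup>2) powr (- pexp - 1) \<le> ((x - y) \<bullet> (x - y)) powr (- pexp - 1)"
          by (intro powr_mono2'[OF _ _ le]) (use pexp_pos in simp_all)
        then have "c1 \<le> c * ((x - y) \<bullet> (x - y)) powr (- pexp - 1)" using c by (simp add: c1H)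
        then have "c1 \<le> conv J \<psi> x - \<psi> x"
          using sub[OF n] convb[of x] inside[OF xH] by linarith
        then have "c1 * Z x \<le> (conv J \<psi> x - \<psi> x) * Z x" using Z by (intro mult_right_mono) auto
        then show ?thesis using xH False by (simp add: left_diff_distrib)
      qed
    qed
    have iH: "integrable lborel (\<lambda>x. indicator (ball y r) x *\<^sub>R Z x)" for r
      by (rule integrable_mult_indicator) (use Z in auto)
    have \<psi>b: "\<bar>\<psi> x\<bar> \<le> 1" for x using \<psi>0[of x] by simp
    have cb: "\<bar>conv J \<psi> x\<bar> \<le> 1" for x
    proof -
      have "conv J \<psi> x \<le> (LINT z|lborel. J z * 1)"
        unfolding conv_eq
      proof (rule integral_mono)
        show "integrable lborel (\<lambda>z. J z * \<psi> (x + z))"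
          unfolding \<psi>_def by (intro J_integrable_mult continuous_intros bc)
        show "integrable lborel (\<lambda>z. J z * 1)" by (intro J_integrable_mult continuous_intros)
        show "J z * \<psi> (x + z) \<le> J z * 1" for z
          using J_nonneg \<psi>0 by (intro mult_left_mono) auto
      qed
      then show ?thesis using conv0[of x] mass by simp
    qed
    have i1: "integrable lborel (\<lambda>x. \<psi> x * Z x)" "integrable lborel (\<lambda>x. conv J \<psi> x * Z x)"
      using \<psi>b cb by (auto intro!: integrable_bounded_mult[OF Z(1)] conv_measurable[OF kern])
    have "c1 * (LINT x:ball y H|lborel. Z x) - (1 + c1) * (LINT x:ball y M|lborel. Z x)
        = (LINT x|lborel. c1 * (indicator (ball y H) x *\<^sub>R Z x) - (1 + c1) * (indicator (ball y M) x *\<^sub>R Z x))"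
      unfolding set_lebesgue_integral_def
      by (subst Bochner_Integration.integral_diff) (simp_all only: integrable_mult_right iH integral_mult_right_zero)
    also have "\<dots> \<le> (LINT x|lborel. conv J \<psi> x * Z x - \<psi> x * Z x)"
    proof (rule integral_mono[OF _ _ pt])
      show "integrable lborel (\<lambda>x. c1 * (indicator (ball y H) x *\<^sub>R Z x) - (1 + c1) * (indicator (ball y M) x *\<^sub>R Z x))"
        by (intro Bochner_Integration.integrable_diff integrable_mult_right iH)
    qed (use i1 in auto)
    also have "\<dots> = (LINT x|lborel. conv J \<psi> x * Z x) - (LINT x|lborel. \<psi> x * Z x)"
      using i1 by (rule Bochner_Integration.integral_diff[rotated])
    also have "(LINT x|lborel. conv J \<psi> x * Z x) = (LINT x|lborel. \<psi> x * conv J Z x)"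
      by (rule conv_symmetric[OF kern even Z(1) \<psi>m \<psi>b, symmetric])
    finally have A: "c1 * (LINT x:ball y H|lborel. Z x) - (1 + c1) * (LINT x:ball y M|lborel. Z x)
      \<le> (LINT x|lborel. \<psi> x * conv J Z x) - (LINT x|lborel. \<psi> x * Z x)" .
    have i2: "integrable lborel (\<lambda>x. indicator (ball y H) x *\<^sub>R barrier (x - y))"
    proof (rule Bochner_Integration.integrable_bound[of _ "indicator (ball y H) :: _ \<Rightarrow> real"])
      show "integrable lborel (indicator (ball y H) :: real ^ 'n \<Rightarrow> real)"
        using ball_lborel_fin[of y H] by (simp add: integrable_indicator_iff)
      show "AE x in lborel. norm (indicator (ball y H) x *\<^sub>R barrier (x - y)) \<le> norm (indicator (ball y H) x :: real)"
        using barrier_le_1 barrier_pos by (auto simp: indicator_def less_imp_le)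
    qed (rule borel_measurable_scaleR[OF borel_measurable_indicator], simp, measurable)
    have le2: "\<psi> x \<le> indicator (ball y H) x *\<^sub>R barrier (x - y)" for x
      using \<psi>0[of x] out[of x] by (cases "x \<in> ball y H") auto
    have i3: "integrable lborel \<psi>"
      using le2 \<psi>0 by (intro Bochner_Integration.integrable_bound[OF i2]) (auto intro!: AE_I2 order_trans[OF _ abs_ge_self])
    have "(LINT x|lborel. \<psi> x * conv J Z x) \<le> (LINT x|lborel. \<psi> x * Z x + \<Lambda> * \<psi> x)"
    proof (rule integral_mono_AE)
      show "integrable lborel (\<lambda>x. \<psi> x * conv J Z x)" by (rule conv_Fubini(2)[OF kern Z(1) \<psi>m \<psi>b])
      show "integrable lborel (\<lambda>x. \<psi> x * Z x + \<Lambda> * \<psi> x)" using i1 i3 by auto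
      show "AE x in lborel. \<psi> x * conv J Z x \<le> \<psi> x * Z x + \<Lambda> * \<psi> x"
        using ae
      proof eventually_elim
        fix x assume x: "x \<in> ball y (C * 2 ^ k) \<longrightarrow> conv J Z x \<le> Z x + \<Lambda>"
        show "\<psi> x * conv J Z x \<le> \<psi> x * Z x + \<Lambda> * \<psi> x"
        proof (cases "x \<in> ball y H")
          case True
          then have "dist y x < C * H" using CH(2) by simp
          then have "conv J Z x \<le> Z x + \<Lambda>" using x by (simp add: H_def)
          then have "\<psi> x * conv J Z x \<le> \<psi> x * (Z x + \<Lambda>)" using \<psi>0 by (intro mult_left_mono)
          then show ?thesis by (simp add: algebra_simps)
        qed (simp add: out)
      qed
    qed
    also have "\<dots> = (LINT x|lborel. \<psi> x * Z x) + \<Lambda> * (LINT x|lborel. \<psi> x)"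
      using i1 i3 by simp
    also have "(LINT x|lborel. \<psi> x) \<le> (LINT x|lborel. indicator (ball y H) x *\<^sub>R barrier (x - y))"
      by (rule integral_mono[OF i3 i2 le2])
    also have "\<dots> = (LINT x:ball 0 H|lborel. barrier x)"
      unfolding set_lebesgue_integral_def
      by (subst lborel_integral_shift[symmetric, of _ y]) (auto simp: indicator_def dist_norm)
    also have "\<dots> \<le> K * H powr (1 / 2)" unfolding H_def by (rule K(2))
    finally have Bd: "(LINT x|lborel. \<psi> x * conv J Z x) \<le> (LINT x|lborel. \<psi> x * Z x) + \<Lambda> * (K * H powr (1 / 2))"
      using \<Lambda> by (simp add: mult_left_mono)
    have hp: "1 \<le> H powr (1 / 2)" using H by (simp add: ge_one_powr_ge_zero)
    have "(1 + c1) * (LINT x:ball y M|lborel. Z x) \<le> (1 + c) * (C1 * (2 * \<Lambda> + \<Lambda>))"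
      using IM c1c c1 c Z \<Lambda> C1 by (intro mult_mono) (auto intro: set_integral_nonneg')
    also have "\<dots> = \<Lambda> * ((1 + c) * C1 * 3) * 1" by (simp add: algebra_simps)
    also have "\<dots> \<le> \<Lambda> * ((1 + c) * C1 * 3) * H powr (1 / 2)"
      using hp \<Lambda> c C1 by (intro mult_left_mono) auto
    finally have "(1 + c1) * (LINT x:ball y M|lborel. Z x) \<le> \<Lambda> * ((1 + c) * C1 * 3) * H powr (1 / 2)" .
    moreover have "\<Lambda> * ((K + (1 + c) * C1 * 3) * H powr (1 / 2))
       = \<Lambda> * (K * H powr (1 / 2)) + \<Lambda> * ((1 + c) * C1 * 3) * H powr (1 / 2)"
      by (simp only: distrib_left distrib_right mult.assoc)
    ultimately have "c1 * (LINT x:ball y H|lborel. Z x) \<le> \<Lambda> * ((K + (1 + c) * C1 * 3) * H powr (1 / 2))"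
      using A Bd by linarith
    also have "\<dots> \<le> \<Lambda> * ((c * C) * H powr (1 / 2))"
    proof -
      have "(K + (1 + c) * C1 * 3) / c \<le> C" by (simp add: C_def)
      then have "K + (1 + c) * C1 * 3 \<le> c * C" using c by (simp add: field_simps)
      then show ?thesis using \<Lambda> by (intro mult_left_mono mult_right_mono) auto
    qed
    finally have "(LINT x:ball y H|lborel. Z x) \<le> (\<Lambda> * ((c * C) * H powr (1 / 2))) / c1"
      using c1 by (simp add: field_simps)
    also have "\<dots> = C * \<Lambda> * (H powr (1 / 2) / H powr (- 2 * pexp - 2))"
      using c by (simp add: c1_def)
    \<comment> \<open>The exponent \<open>1 / 2\<close> comes from the mass of the barrier and
      \<open>2 * pexp + 2\<close> from its gain; \<open>pexp\<close> drops out of the sum and the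
      natural power \<open>CARD('n) + 2\<close> remains.\<close>
    also have "H powr (1 / 2) / H powr (- 2 * pexp - 2) = H powr (real (CARD('n) + 2))"
    proof -
      have "1 / 2 - (- 2 * pexp - 2) = real (CARD('n) + 2)" by (simp add: pexp_def field_simps)
      then show ?thesis by (simp only: powr_diff[symmetric])
    qed
    also have "\<dots> = H ^ (CARD('n) + 2)" using H by (intro powr_realpow) simp
    finally show "(LINT x:ball y (2 ^ k)|lborel. Z x) \<le> C * \<Lambda> * (2 ^ k) ^ (CARD('n) + 2)"
      by (simp add: H_def)
  qed
qed

end

text \<open>For continuous weights that are not integrable on the whole space, such as constants and
  the quartic penalty.\<close>

lemma conv_integrable_cont:
  assumes k: "kern k R" and q: "continuous_on UNIV q"
  shows "integrable lborel (\<lambda>u. k (x - u) * q u)"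
proof -
  have [measurable]: "k \<in> borel_measurable borel" "q \<in> borel_measurable borel"
    using kern_measurable[OF k] borel_measurable_continuous_onI[OF q] by auto
  have "integrable lborel (\<lambda>z. k z * q (x - z))"
    by (intro kern_integrable_mult[OF k] continuous_on_compose2[OF q]) (auto intro: continuous_intros)
  then show ?thesis
    using lborel_integrable_reflect[of "\<lambda>z. k z * q (x - z)" x] by simp
qed

section \<open>Rescaling to range \<open>e\<close>\<close>

context unit_kernel
begin

abbreviation Jeps :: "real \<Rightarrow> real ^ 'n \<Rightarrow> real" where "Jeps \<equiv> rescaled_kernel J"

lemma Jeps_nonneg: "0 < e \<Longrightarrow> 0 \<le> Jeps e x"
  by (simp add: rescaled_kernel_def J_nonneg)

lemma Jeps_even: "Jeps e (- x) = Jeps e x"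
  by (simp add: rescaled_kernel_def even)

lemma kern_Jeps:
  assumes "0 < e"
  shows "kern (Jeps e) (e * R)"
proof -
  have "continuous_on UNIV (\<lambda>x. J (x /\<^sub>R e))"
    using kern unfolding kern_def
    by (intro continuous_on_compose2[of UNIV J UNIV "\<lambda>x. x /\<^sub>R e"]) (auto intro: continuous_on_scaleR)
  then have "continuous_on UNIV (Jeps e)"
    unfolding rescaled_kernel_def[abs_def] using assms by (intro continuous_on_divide continuous_on_const) auto
  moreover have "Jeps e x = 0" if "e * R \<le> norm x" for x
  proof -
    have "R \<le> norm x / e" using that assms by (simp add: pos_le_divide_eq mult.commute)
    then have "R \<le> norm (x /\<^sub>R e)" using assms by (simp add: divide_inverse mult.commute)
    then show ?thesis by (simp add: rescaled_kernel_def J_outside)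
  qed
  ultimately show ?thesis using assms R1 by (auto simp: kern_def)
qed

lemma conv_Jeps:
  assumes e: "0 < e" and [measurable]: "g \<in> borel_measurable borel"
  shows "conv (Jeps e) g x = (LINT z|lborel. J z * g (x + e *\<^sub>R z))"
proof -
  have [measurable]: "Jeps e \<in> borel_measurable borel" using kern_measurable[OF kern_Jeps[OF e]] .
  have "conv (Jeps e) g x = (LINT z|lborel. Jeps e z * g (x + z))"
    by (rule conv_plus[OF kern_Jeps[OF e] Jeps_even]) auto
  also have "\<dots> = e ^ DIM(real ^ 'n) * (LINT z|lborel. Jeps e (e *\<^sub>R z) * g (x + e *\<^sub>R z))"
    using e by (intro lborel_integral_scale) auto
  also have "\<dots> = (LINT z|lborel. e ^ CARD('n) * (Jeps e (e *\<^sub>R z) * g (x + e *\<^sub>R z)))"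
    by simp
  also have "\<dots> = (LINT z|lborel. J z * g (x + e *\<^sub>R z))"
    using e by (simp add: rescaled_kernel_def)
  finally show ?thesis .
qed

lemma mass_Jeps: "0 < e \<Longrightarrow> (LINT x|lborel. Jeps e x) = 1"
  using conv_reflect[OF kern_Jeps, of e "\<lambda>_. 1"] conv_Jeps[of e "\<lambda>_. 1"] mass by simp

text \<open>Dilation by \<open>e\<close> leads back to unit range with \<Lambda> replaced by
  \<open>\<Lambda> * e\<^sup>2\<close>. The powers of \<open>e\<close> cancel against the volume
  factor, which leaves \<open>r ^ (CARD('n) + 2)\<close> at every scale.\<close>

lemma growth:
  obtains C where "1 \<le> C"
    "\<And>Z y \<Lambda> r e. integrable lborel Z \<Longrightarrow> (\<And>x. 0 \<le> Z x) \<Longrightarrow> 0 \<le> \<Lambda> \<Longrightarrow> 0 < e \<Longrightarrow> e \<le> r \<Longrightarrow>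
       conv (Jeps e) Z y \<le> 2 * \<Lambda> * e\<^sup>2 \<Longrightarrow>
       (AE x in lborel. x \<in> ball y (C * r) \<longrightarrow> conv (Jeps e) Z x \<le> Z x + \<Lambda> * e\<^sup>2) \<Longrightarrow>
       (LINT x:ball y r|lborel. Z x) \<le> C * \<Lambda> * r ^ (CARD('n) + 2)"
proof -
  obtain C where C: "1 \<le> C" and dy: "\<And>Z y \<Lambda> k. integrable lborel Z \<Longrightarrow> (\<And>x. 0 \<le> Z x) \<Longrightarrow> 0 \<le> \<Lambda> \<Longrightarrow> conv J Z y \<le> 2 * \<Lambda> \<Longrightarrow>
       (AE x in lborel. x \<in> ball y (C * 2 ^ k) \<longrightarrow> conv J Z x \<le> Z x + \<Lambda>) \<Longrightarrow>
       (LINT x:ball y (2 ^ k)|lborel. Z x) \<le> C * \<Lambda> * (2 ^ k) ^ (CARD('n) + 2)"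
    using growth_dyadic by blast
  let ?N = "CARD('n)"
  show ?thesis
  proof (rule that[of "C * 2 ^ (?N + 2)"])
    have "1 * 1 \<le> C * 2 ^ (?N + 2)" using C by (intro mult_mono one_le_power) auto
    then show "1 \<le> C * 2 ^ (?N + 2)" by simp
    fix Z y \<Lambda> and r e :: real
    assume Z: "integrable lborel Z" "\<And>x. 0 \<le> Z x" and \<Lambda>: "0 \<le> \<Lambda>" and e: "0 < e" "e \<le> r"
      and b: "conv (Jeps e) Z y \<le> 2 * \<Lambda> * e\<^sup>2"
      and ae: "AE x in lborel. x \<in> ball y (C * 2 ^ (?N + 2) * r) \<longrightarrow> conv (Jeps e) Z x \<le> Z x + \<Lambda> * e\<^sup>2"
    have [measurable]: "Z \<in> borel_measurable borel" using Z(1) by (auto dest: borel_measurable_integrable)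
    define Z' where "Z' x = Z (e *\<^sub>R x)" for x
    define y' where "y' = y /\<^sub>R e"
    \<comment> \<open>The smallest dyadic radius not below \<open>r / e\<close>. It is at most twice
      as large, because \<open>e \<le> r\<close> excludes a ratio below \<open>1\<close>, and this
      costs the factor \<open>2 ^ (?N + 2)\<close>.\<close>
    define k where "k = (LEAST k::nat. r / e \<le> 2 ^ k)"
    have ex: "\<exists>k::nat. r / e \<le> 2 ^ k" using real_arch_pow[of 2 "r / e"] by (auto intro: less_imp_le)
    have k1: "r / e \<le> 2 ^ k" unfolding k_def by (rule LeastI_ex[OF ex])
    have k2: "2 ^ k \<le> 2 * (r / e)"
    proof (cases k)
      case 0
      have "1 \<le> r / e" using e by (simp add: field_simps)
      then show ?thesis using 0 by simp
    next
      case (Suc j)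
      then have "\<not> r / e \<le> 2 ^ j" unfolding k_def using not_less_Least[of j "\<lambda>k. r / e \<le> 2 ^ k"] by simp
      then show ?thesis using Suc by simp
    qed
    have Z'm [measurable]: "Z' \<in> borel_measurable borel" unfolding Z'_def by measurable
    have Z': "integrable lborel Z'" "\<And>x. 0 \<le> Z' x"
      using Z lborel_integrable_scale[of Z e] e by (auto simp: Z'_def[abs_def])
    have cv: "conv J Z' x = conv (Jeps e) Z (e *\<^sub>R x)" for x
    proof -
      have "conv J Z' x = (LINT z|lborel. J z * Z' (x + z))" by (rule conv_plus[OF kern even Z'm])
      then show ?thesis using conv_Jeps[OF e(1), of Z "e *\<^sub>R x"] by (simp add: Z'_def scaleR_add_right)
    qed
    have d: "e * dist y' x = dist y (e *\<^sub>R x)" for x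
    proof -
      have "y - e *\<^sub>R x = e *\<^sub>R (y' - x)" using e by (simp add: y'_def algebra_simps)
      then show ?thesis using e by (simp add: dist_norm)
    qed
    have "(LINT x:ball y' (2 ^ k)|lborel. Z' x) \<le> C * (\<Lambda> * e\<^sup>2) * (2 ^ k) ^ (?N + 2)"
    proof (rule dy[OF Z'])
      show "conv J Z' y' \<le> 2 * (\<Lambda> * e\<^sup>2)" using b e by (simp add: cv y'_def)
      show "AE x in lborel. x \<in> ball y' (C * 2 ^ k) \<longrightarrow> conv J Z' x \<le> Z' x + \<Lambda> * e\<^sup>2"
        using AE_lborel_scale[OF ae e(1)]
      proof eventually_elim
        fix x assume x: "e *\<^sub>R x \<in> ball y (C * 2 ^ (?N + 2) * r) \<longrightarrow> conv (Jeps e) Z (e *\<^sub>R x) \<le> Z (e *\<^sub>R x) + \<Lambda> * e\<^sup>2"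
        show "x \<in> ball y' (C * 2 ^ k) \<longrightarrow> conv J Z' x \<le> Z' x + \<Lambda> * e\<^sup>2"
        proof
          assume "x \<in> ball y' (C * 2 ^ k)"
          then have "dist y (e *\<^sub>R x) < e * (C * 2 ^ k)" using e by (simp add: d[symmetric])
          also have "\<dots> \<le> e * (C * (2 * (r / e)))" using k2 C e by (intro mult_left_mono) auto
          also have "\<dots> = C * 2 ^ 1 * r" using e by simp
          also have "\<dots> \<le> C * 2 ^ (?N + 2) * r"
            using C e by (intro mult_right_mono mult_left_mono power_increasing) auto
          finally show "conv J Z' x \<le> Z' x + \<Lambda> * e\<^sup>2" using x by (simp add: cv Z'_def)
        qed
      qed
    qed (use \<Lambda> in auto)
    also have "C * (\<Lambda> * e\<^sup>2) * (2 ^ k) ^ (?N + 2) \<le> C * (\<Lambda> * e\<^sup>2) * (2 * (r / e)) ^ (?N + 2)"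
      using k2 C \<Lambda> by (intro mult_left_mono power_mono) auto
    finally have le: "(LINT x:ball y' (2 ^ k)|lborel. Z' x) \<le> C * (\<Lambda> * e\<^sup>2) * (2 * (r / e)) ^ (?N + 2)" .
    have m: "(\<lambda>x. indicator (ball y r) x *\<^sub>R Z x) \<in> borel_measurable borel"
      by (rule borel_measurable_scaleR[OF borel_measurable_indicator]) auto
    have bl: "e *\<^sub>R x \<in> ball y r \<longleftrightarrow> x \<in> ball y' (r / e)" for x
      using e by (simp add: d[symmetric] pos_less_divide_eq mult.commute)
    have "(LINT x:ball y r|lborel. Z x) = e ^ ?N * (LINT x|lborel. indicator (ball y r) (e *\<^sub>R x) *\<^sub>R Z (e *\<^sub>R x))"
      unfolding set_lebesgue_integral_def
      using lborel_integral_scale[OF m e(1)] by simp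
    also have "(\<lambda>x. indicator (ball y r) (e *\<^sub>R x) *\<^sub>R Z (e *\<^sub>R x)) = (\<lambda>x. indicator (ball y' (r / e)) x *\<^sub>R Z' x)"
      using bl by (auto simp: fun_eq_iff Z'_def indicator_def)
    also have "(LINT x|lborel. indicator (ball y' (r / e)) x *\<^sub>R Z' x) \<le> (LINT x:ball y' (2 ^ k)|lborel. Z' x)"
      unfolding set_lebesgue_integral_def[symmetric]
      using Z' k1 by (intro set_integral_mono_sets) auto
    also note le
    also have "e ^ ?N * (C * (\<Lambda> * e\<^sup>2) * (2 * (r / e)) ^ (?N + 2)) = C * 2 ^ (?N + 2) * \<Lambda> * r ^ (?N + 2)"
    proof -
      have "e ^ ?N * (e\<^sup>2 * (2 * (r / e)) ^ (?N + 2)) = (e * (2 * (r / e))) ^ (?N + 2)"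
        unfolding power_mult_distrib by (simp only: power_add mult_ac)
      also have "\<dots> = 2 ^ (?N + 2) * r ^ (?N + 2)" using e by (simp only: power_mult_distrib[symmetric]) simp
      finally have "C * \<Lambda> * (e ^ ?N * (e\<^sup>2 * (2 * (r / e)) ^ (?N + 2))) = C * \<Lambda> * (2 ^ (?N + 2) * r ^ (?N + 2))" by simp
      then show ?thesis by (simp only: mult_ac)
    qed
    finally show "(LINT x:ball y r|lborel. Z x) \<le> C * 2 ^ (?N + 2) * \<Lambda> * r ^ (?N + 2)"
      using e by (simp add: mult_left_mono)
  qed
qed

text \<open>The squared distance after a jump is
  \<open>s + 2 * e * (D \<bullet> z) + e\<^sup>2 * (z \<bullet> z)\<close> with
  \<open>s = D \<bullet> D\<close>. In its square the terms odd in \<open>z\<close> average to zero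
  and the others are bounded through \<open>R\<close>. The increase is of order
  \<open>e\<^sup>2 * (s + e\<^sup>2)\<close>, hence small relative to \<open>e\<^sup>2\<close> near
  the centre \<open>a\<close>.\<close>

lemma quartic_moment:
  assumes e: "0 < e"
  shows "conv (Jeps e) (\<lambda>u. K * ((u - a) \<bullet> (u - a))\<^sup>2) x
    = K * (LINT z|lborel. J z * ((x + e *\<^sub>R z - a) \<bullet> (x + e *\<^sub>R z - a))\<^sup>2)"
    and "(LINT z|lborel. J z * ((x + e *\<^sub>R z - a) \<bullet> (x + e *\<^sub>R z - a))\<^sup>2)
    \<le> ((x - a) \<bullet> (x - a))\<^sup>2 + 6 * R ^ 4 * (e\<^sup>2 * ((x - a) \<bullet> (x - a)) + e ^ 4)"
proof -
  have [measurable]: "(\<lambda>u. K * ((u - a) \<bullet> (u - a))\<^sup>2) \<in> borel_measurable borel"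
    by (intro borel_measurable_continuous_onI continuous_intros)
  show "conv (Jeps e) (\<lambda>u. K * ((u - a) \<bullet> (u - a))\<^sup>2) x
    = K * (LINT z|lborel. J z * ((x + e *\<^sub>R z - a) \<bullet> (x + e *\<^sub>R z - a))\<^sup>2)"
    by (subst conv_Jeps[OF e]) (auto simp: mult.left_commute)
  define D where "D = x - a"
  define s where "s = D \<bullet> D"
  have s: "0 \<le> s" by (simp add: s_def)
  have R2: "1 \<le> R\<^sup>2" "R\<^sup>2 \<le> R ^ 4" using R1 by (auto intro: one_le_power power_increasing)
  let ?b = "s\<^sup>2 + 6 * R ^ 4 * (e\<^sup>2 * s + e ^ 4)"
  have pt: "J z * ((x + e *\<^sub>R z - a) \<bullet> (x + e *\<^sub>R z - a))\<^sup>2 \<le> J z * ?b + (4 * s * e) * (J z * (D \<bullet> z)) + (4 * e ^ 3) * (J z * ((D \<bullet> z) * (z \<bullet> z)))" for z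
  proof (cases "norm z < R")
    case True
    have eq: "x + e *\<^sub>R z - a = D + e *\<^sub>R z" by (simp add: D_def)
    have sq: "(D + e *\<^sub>R z) \<bullet> (D + e *\<^sub>R z) = s + 2 * e * (D \<bullet> z) + e\<^sup>2 * (z \<bullet> z)"
      by (simp add: s_def algebra_simps inner_commute power2_eq_square)
    have zz: "z \<bullet> z \<le> R\<^sup>2" unfolding power2_norm_eq_inner[symmetric] using True by (intro power_mono) auto
    have "(D \<bullet> z)\<^sup>2 \<le> s * (z \<bullet> z)" unfolding s_def by (rule Cauchy_Schwarz_ineq)
    also have "\<dots> \<le> s * R\<^sup>2" using zz s by (rule mult_left_mono)
    finally have Dz: "(D \<bullet> z)\<^sup>2 \<le> s * R\<^sup>2" .
    have "(z \<bullet> z)\<^sup>2 \<le> (R\<^sup>2)\<^sup>2" using zz by (intro power_mono) auto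
    then have z4: "(z \<bullet> z)\<^sup>2 \<le> R ^ 4" by simp
    have "((D + e *\<^sub>R z) \<bullet> (D + e *\<^sub>R z))\<^sup>2 = s\<^sup>2 + (4 * s * e) * (D \<bullet> z) + 2 * e\<^sup>2 * (s * (z \<bullet> z)) + 4 * e\<^sup>2 * (D \<bullet> z)\<^sup>2
        + (4 * e ^ 3) * ((D \<bullet> z) * (z \<bullet> z)) + e ^ 4 * (z \<bullet> z)\<^sup>2"
      unfolding sq by (simp add: power2_eq_square power3_eq_cube power4_eq_xxxx algebra_simps)
    also have "2 * e\<^sup>2 * (s * (z \<bullet> z)) \<le> 2 * e\<^sup>2 * (s * R ^ 4)"
      using zz R2 s by (intro mult_left_mono) auto
    also have "4 * e\<^sup>2 * (D \<bullet> z)\<^sup>2 \<le> 4 * e\<^sup>2 * (s * R ^ 4)"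
      using Dz R2 s by (intro mult_left_mono order_trans[OF Dz]) auto
    also have "e ^ 4 * (z \<bullet> z)\<^sup>2 \<le> e ^ 4 * (6 * R ^ 4)"
      using z4 R1 by (intro mult_left_mono order_trans[OF z4]) auto
    finally have "((D + e *\<^sub>R z) \<bullet> (D + e *\<^sub>R z))\<^sup>2 \<le> ?b + (4 * s * e) * (D \<bullet> z) + (4 * e ^ 3) * ((D \<bullet> z) * (z \<bullet> z))"
      by (simp add: algebra_simps)
    then have "J z * ((D + e *\<^sub>R z) \<bullet> (D + e *\<^sub>R z))\<^sup>2 \<le> J z * (?b + (4 * s * e) * (D \<bullet> z) + (4 * e ^ 3) * ((D \<bullet> z) * (z \<bullet> z)))"
      by (rule mult_left_mono) (rule J_nonneg)
    then show ?thesis unfolding eq by (simp only: distrib_left mult_ac)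
  qed (simp add: J_outside)
  have i: "integrable lborel (\<lambda>z. J z * ?b)" "integrable lborel (\<lambda>z. J z * (D \<bullet> z))" "integrable lborel (\<lambda>z. J z * ((D \<bullet> z) * (z \<bullet> z)))"
     "integrable lborel (\<lambda>z. J z * ((x + e *\<^sub>R z - a) \<bullet> (x + e *\<^sub>R z - a))\<^sup>2)"
    by (intro J_integrable_mult continuous_intros)+
  have "(LINT z|lborel. J z * ((x + e *\<^sub>R z - a) \<bullet> (x + e *\<^sub>R z - a))\<^sup>2)
     \<le> (LINT z|lborel. J z * ?b + (4 * s * e) * (J z * (D \<bullet> z)) + (4 * e ^ 3) * (J z * ((D \<bullet> z) * (z \<bullet> z))))"
    by (rule integral_mono[OF i(4) _ pt]) (intro Bochner_Integration.integrable_add integrable_mult_right i)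
  also have "\<dots> = ?b + (4 * s * e) * (LINT z|lborel. J z * (D \<bullet> z)) + (4 * e ^ 3) * (LINT z|lborel. J z * ((D \<bullet> z) * (z \<bullet> z)))"
    using i mass by simp
  also have "(LINT z|lborel. J z * (D \<bullet> z)) = 0" by (rule odd_moment) auto
  also have "(LINT z|lborel. J z * ((D \<bullet> z) * (z \<bullet> z))) = 0" by (rule odd_moment) auto
  finally show "(LINT z|lborel. J z * ((x + e *\<^sub>R z - a) \<bullet> (x + e *\<^sub>R z - a))\<^sup>2)
    \<le> ((x - a) \<bullet> (x - a))\<^sup>2 + 6 * R ^ 4 * (e\<^sup>2 * ((x - a) \<bullet> (x - a)) + e ^ 4)"
    by (simp add: s_def D_def)
qed

end

section \<open>Nondegeneracy\<close>

context unit_kernel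
begin

text \<open>
  An almost maximal point \<open>y\<close> of \<open>W - K * \<bar>\<cdot> - x\<bar>\<close> to the fourth power on the positivity set cannot be close
  to \<open>x\<close>, since there the averaging operator would strictly increase this function. Around \<open>y\<close> the deficit to
  the maximum satisfies the hypotheses of the growth estimate, so \<open>W\<close> stays comparable to \<open>K * \<bar>y - x\<bar>\<close> to the fourth power.
\<close>

lemma nondegeneracy:
  fixes C0 :: real
  assumes C0: "1 \<le> C0"
  obtains \<kappa>0 c where "0 < \<kappa>0" "\<kappa>0 < 1" "0 < c"
    "\<And>\<kappa> r0 B K. 0 < \<kappa> \<Longrightarrow> \<kappa> \<le> \<kappa>0 \<Longrightarrow> 0 < r0 \<Longrightarrow> 0 \<le> B \<Longrightarrow> 0 < K \<Longrightarrow> B + 1 \<le> K * (r0 / 2) ^ 4 \<Longrightarrow>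
      \<exists>e0>0. \<forall>e W x. 0 < e \<longrightarrow> e < e0 \<longrightarrow> integrable lborel W \<longrightarrow> (\<forall>y. 0 \<le> W y \<and> W y \<le> B) \<longrightarrow>
        (AE y in lborel. W y - C0 * e\<^sup>2 \<le> conv (Jeps e) W y) \<longrightarrow>
        (AE y in lborel. y \<in> ball x r0 \<longrightarrow> 0 < W y \<longrightarrow> W y + e\<^sup>2 \<le> conv (Jeps e) W y) \<longrightarrow>
        \<not> (AE y in lborel. y \<in> ball x (2 * R * e) \<longrightarrow> W y = 0) \<longrightarrow>
        (\<exists>y. c \<le> K * (dist x y)\<^sup>2 \<and> K * dist x y ^ 4 \<le> B + 1 \<and>
          c * \<kappa> ^ CARD('n) * dist x y ^ (CARD('n) + 2) \<le> (LINT u:ball y (\<kappa> * dist x y)|lborel. W u))"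
proof -
  let ?N = "CARD('n)"
  obtain CG where CG: "1 \<le> CG" and gr: "\<And>Z y \<Lambda> r e. integrable lborel Z \<Longrightarrow> (\<And>x. 0 \<le> Z x) \<Longrightarrow> 0 \<le> \<Lambda> \<Longrightarrow> 0 < e \<Longrightarrow> e \<le> r \<Longrightarrow>
       conv (Jeps e) Z y \<le> 2 * \<Lambda> * e\<^sup>2 \<Longrightarrow>
       (AE x in lborel. x \<in> ball y (CG * r) \<longrightarrow> conv (Jeps e) Z x \<le> Z x + \<Lambda> * e\<^sup>2) \<Longrightarrow>
       (LINT x:ball y r|lborel. Z x) \<le> CG * \<Lambda> * r ^ (?N + 2)"
    using growth by blast
  \<comment> \<open>\<open>a0\<close> is the lower bound to be obtained for
    \<open>K * d\<^sup>2\<close>, where \<open>d\<close> is the distance from \<open>x\<close> to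
    the point found. Given it, \<open>A * (K * d\<^sup>2)\<close> dominates \<open>C0\<close>
    together with \<open>30 * R ^ 4 * (K * d\<^sup>2)\<close>, the contribution of the penalty
    within distance \<open>2 * d\<close>.\<close>
  define A where "A = (12 * C0 + 30) * R ^ 4"
  define a0 where "a0 = 1 / (12 * R ^ 4)"
  define V where "V = unit_ball_vol (real ?N)"
  have R4: "1 \<le> R ^ 4" using R1 by (rule one_le_power)
  have A: "0 < A" and a0: "0 < a0" using C0 R4 by (auto simp: A_def a0_def intro!: mult_pos_pos)
  have V: "0 < V" by (simp add: V_def)
  \<comment> \<open>In order: distances to \<open>x\<close> on the small ball stay above
    \<open>7 / 8 * d\<close>; the enlarged ball of the growth estimate stays within
    \<open>d / 4\<close> of its centre; the growth error is at most half of the main term.\<close>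
  define \<kappa>0 where "\<kappa>0 = min (1 / 8) (min (1 / (4 * CG)) (V / (4 * (CG * A))))"
  define c where "c = min a0 (a0 * V / 4)"
  show ?thesis
  proof (rule that[of \<kappa>0 c])
    show "0 < \<kappa>0" using CG A V by (simp add: \<kappa>0_def)
    show "\<kappa>0 < 1" by (simp add: \<kappa>0_def)
    show "0 < c" using a0 V by (simp add: c_def)
    fix \<kappa> r0 B K :: real
    assume \<kappa>: "0 < \<kappa>" "\<kappa> \<le> \<kappa>0" and r0: "0 < r0" and B: "0 \<le> B" and K: "0 < K" and KB: "B + 1 \<le> K * (r0 / 2) ^ 4"
    have \<kappa>8: "\<kappa> \<le> 1 / 8" "\<kappa> \<le> 1 / (4 * CG)" "\<kappa> \<le> V / (4 * (CG * A))" using \<kappa> by (auto simp: \<kappa>0_def)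
    \<comment> \<open>In order: \<open>e\<^sup>2 \<le> e\<close>;
      \<open>23 * K * R ^ 4 * e\<^sup>2 \<le> 1 / 2\<close>; \<open>e * R \<le> r0 / 8\<close>; and
      \<open>e \<le> \<kappa> * d\<close> as soon as \<open>K * d\<^sup>2\<close> is at least
      \<open>a0\<close>.\<close>
    define e0 where "e0 = min (min 1 (1 / (46 * K * R ^ 4))) (min (r0 / (8 * R)) (\<kappa> * sqrt (a0 / K)))"
    have e0: "0 < e0" using K r0 R1 R4 \<kappa> a0 by (simp add: e0_def)
    have main: "\<exists>y. c \<le> K * (dist x y)\<^sup>2 \<and> K * dist x y ^ 4 \<le> B + 1 \<and>
          c * \<kappa> ^ ?N * dist x y ^ (?N + 2) \<le> (LINT u:ball y (\<kappa> * dist x y)|lborel. W u)"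
      if e: "0 < e" "e < e0" and W: "integrable lborel W" "\<And>y. 0 \<le> W y" "\<And>y. W y \<le> B"
        and ae1: "AE y in lborel. W y - C0 * e\<^sup>2 \<le> conv (Jeps e) W y"
        and ae2: "AE y in lborel. y \<in> ball x r0 \<longrightarrow> 0 < W y \<longrightarrow> W y + e\<^sup>2 \<le> conv (Jeps e) W y"
        and ne: "\<not> (AE y in lborel. y \<in> ball x (2 * R * e) \<longrightarrow> W y = 0)" for e W x
    proof -
      have Wm [measurable]: "W \<in> borel_measurable borel" using W(1) by (auto dest: borel_measurable_integrable)
      have e': "e \<le> 1" "e \<le> 1 / (46 * K * R ^ 4)" "e \<le> r0 / (8 * R)" "e \<le> \<kappa> * sqrt (a0 / K)"
        using e by (auto simp: e0_def)
      have eR: "e * R \<le> r0 / 8" using e'(3) R1 by (simp add: field_simps)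
      have e2: "e\<^sup>2 \<le> e" using e e' by (simp add: power2_eq_square mult_left_le)
      have Ke: "23 * K * R ^ 4 * e\<^sup>2 \<le> 1 / 2"
      proof -
        have "23 * K * R ^ 4 * e\<^sup>2 \<le> 23 * K * R ^ 4 * (1 / (46 * K * R ^ 4))"
          using e2 e' K R4 by (intro mult_left_mono) auto
        then show ?thesis using K R1 by simp
      qed
      define s where "s y = (y - x) \<bullet> (y - x)" for y
      have s: "s y = (dist x y)\<^sup>2" for y by (simp add: s_def dist_norm power2_norm_eq_inner[symmetric] norm_minus_commute)
      have s2: "(s y)\<^sup>2 = dist x y ^ 4" for y by (simp add: s)
      define q where "q y = K * (s y)\<^sup>2" for y
      have q0: "0 \<le> q y" for y using K by (simp add: q_def)
      have qc: "continuous_on UNIV q" unfolding q_def s_def by (intro continuous_intros)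
      have qm [measurable]: "q \<in> borel_measurable borel" by (rule borel_measurable_continuous_onI[OF qc])
      define G where "G y = W y - q y" for y
      define S where "S = {y \<in> ball x r0. 0 < W y}"
      \<comment> \<open>The essential upper bounds of \<open>G\<close> on the positivity set. As the
        inequalities hold only almost everywhere, the infimum of \<open>T\<close>, an essential
        supremum, replaces a maximum.\<close>
      define T where "T = {m. AE y in lborel. y \<in> S \<longrightarrow> G y \<le> m}"
      define b0 where "b0 = K * (16 * R ^ 4 * e ^ 4)"
      have small: "2 * R * e \<le> r0"
      proof -
        have "2 * R * e = 2 * (e * R)" by simp
        then show ?thesis using eR r0 by linarith
      qed
      have near: "- b0 \<le> G y" if "y \<in> ball x (2 * R * e)" for y
      proof -
        have "dist x y ^ 4 \<le> (2 * R * e) ^ 4" using that by (intro power_mono) auto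
        then have "q y \<le> K * (2 * R * e) ^ 4" unfolding q_def s2 using K by (intro mult_left_mono) auto
        also have "\<dots> = b0" by (simp add: b0_def power_mult_distrib)
        finally show ?thesis using W(2)[of y] by (simp add: G_def)
      qed
      \<comment> \<open>A bound below \<open>- b0\<close> would leave no positive values of
        \<open>W\<close> near \<open>x\<close> up to a null set, against \<open>ne\<close>.\<close>
      have Tb: "- b0 \<le> m" if "m \<in> T" for m
      proof (rule ccontr)
        assume m: "\<not> - b0 \<le> m"
        have "AE y in lborel. y \<in> ball x (2 * R * e) \<longrightarrow> W y = 0"
          using that unfolding T_def mem_Collect_eq
        proof eventually_elim
          fix y assume y: "y \<in> S \<longrightarrow> G y \<le> m"
          show "y \<in> ball x (2 * R * e) \<longrightarrow> W y = 0"
          proof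
            assume yb: "y \<in> ball x (2 * R * e)"
            then have "y \<notin> S" using near[OF yb] y m by auto
            then show "W y = 0" using yb small W(2)[of y] by (auto simp: S_def)
          qed
        qed
        with ne show False by simp
      qed
      have BT: "B \<in> T"
      proof -
        have "G y \<le> B" for y using W(3)[of y] q0[of y] by (simp add: G_def)
        then show ?thesis by (simp add: T_def)
      qed
      have Tbdd: "bdd_below T" by (rule bdd_belowI[of T "- b0"]) (rule Tb)
      define M where "M = Inf T"
      have M1: "- b0 \<le> M" unfolding M_def using BT Tb by (intro cInf_greatest) auto
      have M2: "M \<le> B" unfolding M_def by (rule cInf_lower[OF BT Tbdd])
      \<comment> \<open>The infimum is itself an essential bound: countably many exceptional null
        sets are united.\<close>
      have "AE y in lborel. \<forall>n::nat. y \<in> S \<longrightarrow> G y \<le> M + 1 / real (Suc n)"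
      proof (subst AE_all_countable, rule allI)
        fix n :: nat
        have "Inf T < M + 1 / real (Suc n)" by (simp add: M_def)
        then obtain m where m: "m \<in> T" "m < M + 1 / real (Suc n)"
          using cInf_less_iff[of T] BT Tbdd by auto
        from m(1) show "AE y in lborel. y \<in> S \<longrightarrow> G y \<le> M + 1 / real (Suc n)"
          unfolding T_def mem_Collect_eq by eventually_elim (use m(2) in auto)
      qed
      then have M3: "AE y in lborel. y \<in> S \<longrightarrow> G y \<le> M"
      proof eventually_elim
        fix y assume y: "\<forall>n::nat. y \<in> S \<longrightarrow> G y \<le> M + 1 / real (Suc n)"
        show "y \<in> S \<longrightarrow> G y \<le> M"
        proof
          assume "y \<in> S"
          with y have le: "\<And>n::nat. G y \<le> M + 1 / real (Suc n)" by blast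
          show "G y \<le> M"
          proof (rule field_le_epsilon)
            fix d :: real assume "0 < d"
            then obtain n where "inverse (real (Suc n)) < d" using reals_Archimedean by blast
            then show "G y \<le> M + d" using le[of n] by (simp add: inverse_eq_divide)
          qed
        qed
      qed
      \<comment> \<open>\<open>M\<close> may be slightly negative. Raising it to \<open>0\<close>
        makes the deficit nonnegative also where \<open>W\<close> vanishes and costs at most
        \<open>b0\<close>.\<close>
      define Mp where "Mp = max M 0"
      have Mp: "0 \<le> Mp" "Mp \<le> M + b0" "Mp \<le> B"
        using M1 M2 B K R1 by (auto simp: Mp_def b0_def)
      \<comment> \<open>The deficit to the essential supremum, cut off to the ball for
        integrability; inside the ball the maximum with \<open>0\<close> is inactive almost
        everywhere.\<close>
      define Z where "Z y = (if y \<in> ball x r0 then max 0 (Mp - W y + q y) else 0)" for y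
      have Z0: "0 \<le> Z y" for y by (simp add: Z_def)
      have Zm [measurable]: "Z \<in> borel_measurable borel"
      proof -
        have eq: "Z = (\<lambda>y. indicator (ball x r0) y *\<^sub>R max 0 (Mp - W y + q y))"
          by (auto simp: Z_def fun_eq_iff)
        show ?thesis
          unfolding eq by (rule borel_measurable_scaleR[OF borel_measurable_indicator], simp, measurable)
      qed
      have Zae: "AE y in lborel. y \<in> ball x r0 \<longrightarrow> Z y = Mp - W y + q y"
        using M3
      proof eventually_elim
        fix y assume y: "y \<in> S \<longrightarrow> G y \<le> M"
        show "y \<in> ball x r0 \<longrightarrow> Z y = Mp - W y + q y"
        proof
          assume yb: "y \<in> ball x r0"
          have "G y \<le> Mp"
          proof (cases "0 < W y")
            case True then show ?thesis using y yb by (auto simp: S_def Mp_def)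
          next
            case False then have "W y = 0" using W(2)[of y] by simp
            then show ?thesis using q0[of y] Mp by (simp add: G_def)
          qed
          then show "Z y = Mp - W y + q y" using yb by (simp add: Z_def G_def)
        qed
      qed
      have Zi: "integrable lborel Z"
      proof (rule Bochner_Integration.integrable_bound[of _ "\<lambda>y. (Mp + K * r0 ^ 4) * indicator (ball x r0) y"])
        show "integrable lborel (\<lambda>y. (Mp + K * r0 ^ 4) * indicator (ball x r0) y)"
          using ball_lborel_fin[of x r0] by (simp add: integrable_indicator_iff)
        show "AE y in lborel. norm (Z y) \<le> norm ((Mp + K * r0 ^ 4) * indicator (ball x r0) y)"
        proof (rule AE_I2)
          fix y
          show "norm (Z y) \<le> norm ((Mp + K * r0 ^ 4) * indicator (ball x r0) y)"
          proof (cases "y \<in> ball x r0")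
            case True
            have "dist x y ^ 4 \<le> r0 ^ 4" using True by (intro power_mono) auto
            then have "q y \<le> K * r0 ^ 4" unfolding q_def s2 using K by (intro mult_left_mono) auto
            then have "Z y \<le> Mp + K * r0 ^ 4" using True W(2)[of y] Mp q0[of y] by (simp add: Z_def)
            then show ?thesis using True Z0[of y] by simp
          qed (simp add: Z_def)
        qed
      qed measurable
      have kJ: "kern (Jeps e) (e * R)" by (rule kern_Jeps[OF e(1)])
      have Jm [measurable]: "Jeps e \<in> borel_measurable borel" by (rule kern_measurable[OF kJ])
      have convZ: "conv (Jeps e) Z y \<le> Mp - conv (Jeps e) W y + q y + K * (6 * R ^ 4 * (e\<^sup>2 * s y + e ^ 4))"
        if y: "dist x y + e * R \<le> r0" for y
      proof -
        have i: "integrable lborel (\<lambda>u. Jeps e (y - u) * Z u)" "integrable lborel (\<lambda>u. Jeps e (y - u) * W u)"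
          "integrable lborel (\<lambda>u. Jeps e (y - u) * q u)" "integrable lborel (\<lambda>u. Jeps e (y - u) * Mp)"
          by (rule conv_integrable_pt[OF kJ Zi] conv_integrable_pt[OF kJ W(1)] conv_integrable_cont[OF kJ qc]
            conv_integrable_cont[OF kJ continuous_on_const])+
        have "conv (Jeps e) Z y = (LINT u|lborel. Jeps e (y - u) * Mp - Jeps e (y - u) * W u + Jeps e (y - u) * q u)"
          unfolding conv_def
        proof (rule integral_cong_AE)
          show "AE u in lborel. Jeps e (y - u) * Z u = Jeps e (y - u) * Mp - Jeps e (y - u) * W u + Jeps e (y - u) * q u"
            using Zae
          proof eventually_elim
            fix u assume u: "u \<in> ball x r0 \<longrightarrow> Z u = Mp - W u + q u"
            show "Jeps e (y - u) * Z u = Jeps e (y - u) * Mp - Jeps e (y - u) * W u + Jeps e (y - u) * q u"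
            proof (cases "norm (y - u) < e * R")
              case True
              then have "dist x u < r0" using y dist_triangle[of x u y] by (simp add: dist_norm)
              then have "Z u = Mp - W u + q u" using u by simp
              then show ?thesis by (simp only: distrib_left right_diff_distrib)
            next
              case False
              then have "Jeps e (y - u) = 0" using kJ unfolding kern_def by simp
              then show ?thesis by simp
            qed
          qed
        qed measurable
        also have "\<dots> = (LINT u|lborel. Jeps e (y - u) * Mp) - conv (Jeps e) W y + conv (Jeps e) q y"
          unfolding conv_def using i by simp
        also have "(LINT u|lborel. Jeps e (y - u) * Mp) = Mp"
          using mass_Jeps[OF e(1)] lborel_integral_reflect[of "Jeps e" y] kern_measurable[OF kJ] by simp
        also have "conv (Jeps e) q y \<le> K * ((s y)\<^sup>2 + 6 * R ^ 4 * (e\<^sup>2 * s y + e ^ 4))"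
          unfolding q_def[abs_def] s_def using quartic_moment(2)[OF e(1), of y x] K
          by (subst quartic_moment(1)[OF e(1)]) (intro mult_left_mono, auto)
        finally show ?thesis by (simp add: q_def algebra_simps)
      qed
      \<comment> \<open>The slack \<open>K * e ^ 4\<close> is of the order of \<open>b0\<close>, so
        an almost maximal point adds no larger error. Such points form a set that is not null, hence
        one of them avoids every exceptional set.\<close>
      have "M - K * e ^ 4 \<notin> T"
      proof
        assume "M - K * e ^ 4 \<in> T"
        then have "M \<le> M - K * e ^ 4" unfolding M_def by (rule cInf_lower[OF _ Tbdd])
        then show False using K e by (simp add: mult_le_0_iff)
      qed
      then have "\<not> (AE y in lborel. y \<in> S \<longrightarrow> G y \<le> M - K * e ^ 4)" by (simp add: T_def)
      then have "\<exists>y. y \<in> S \<and> M - K * e ^ 4 < G y \<and> W y + e\<^sup>2 \<le> conv (Jeps e) W y \<and> Z y = Mp - W y + q y"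
      proof (rule contrapos_np)
        assume no: "\<not> (\<exists>y. y \<in> S \<and> M - K * e ^ 4 < G y \<and> W y + e\<^sup>2 \<le> conv (Jeps e) W y \<and> Z y = Mp - W y + q y)"
        show "AE y in lborel. y \<in> S \<longrightarrow> G y \<le> M - K * e ^ 4"
          using ae2 Zae
        proof eventually_elim
          fix y assume "y \<in> ball x r0 \<longrightarrow> 0 < W y \<longrightarrow> W y + e\<^sup>2 \<le> conv (Jeps e) W y"
            "y \<in> ball x r0 \<longrightarrow> Z y = Mp - W y + q y"
          with no show "y \<in> S \<longrightarrow> G y \<le> M - K * e ^ 4" by (auto simp: S_def not_less)
        qed
      qed
      then obtain y where y: "y \<in> S" "M - K * e ^ 4 < G y" "W y + e\<^sup>2 \<le> conv (Jeps e) W y" "Z y = Mp - W y + q y"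
        by blast
      define d where "d = dist x y"
      have sy: "s y = d\<^sup>2" "q y = K * d ^ 4" by (auto simp: s d_def q_def s2)
      have e4: "e ^ 4 = e\<^sup>2 * e\<^sup>2" by (simp add: power4_eq_xxxx power2_eq_square)
      have Zy: "Z y \<le> K * (17 * R ^ 4) * e ^ 4"
      proof -
        have "Z y \<le> b0 + K * e ^ 4" using y(2,4) Mp(2) by (simp add: G_def)
        also have "K * e ^ 4 \<le> K * (R ^ 4 * e ^ 4)" using K e R4 by (intro mult_left_mono) auto
        finally show ?thesis by (simp add: b0_def algebra_simps)
      qed
      have Zy2: "Z y \<le> e\<^sup>2"
      proof -
        have "K * (17 * R ^ 4) * e ^ 4 = (17 * K * R ^ 4 * e\<^sup>2) * e\<^sup>2" by (simp add: power4_eq_xxxx power2_eq_square)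
        also have "\<dots> \<le> (23 * K * R ^ 4 * e\<^sup>2) * e\<^sup>2" using K R4 by (intro mult_right_mono) auto
        also have "\<dots> \<le> 1 / 2 * e\<^sup>2" using Ke by (rule mult_right_mono) simp
        finally show ?thesis using Zy zero_le_power2[of e] by linarith
      qed
      have d4: "K * d ^ 4 \<le> B + 1"
      proof -
        have "K * d ^ 4 \<le> W y + (b0 + K * e ^ 4)" using y(2) M1 by (simp add: G_def sy)
        also have "b0 + K * e ^ 4 \<le> 1"
        proof -
          have "K * e ^ 4 \<le> K * (R ^ 4 * e ^ 4)" using K e R4 by (intro mult_left_mono) auto
          then have "b0 + K * e ^ 4 \<le> (17 * K * R ^ 4 * e\<^sup>2) * e\<^sup>2" by (simp add: b0_def power4_eq_xxxx power2_eq_square algebra_simps)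
          also have "\<dots> \<le> (23 * K * R ^ 4 * e\<^sup>2) * 1" using K R4 e2 e' by (intro mult_mono) auto
          finally show ?thesis using Ke by simp
        qed
        finally show ?thesis using W(3)[of y] by simp
      qed
      \<comment> \<open>The penalty at radius \<open>r0 / 2\<close> is at least
        \<open>B + 1\<close>, more than an almost maximal point can afford, so the point lies well
        inside the ball.\<close>
      have dr: "d \<le> r0 / 2"
      proof -
        have "K * d ^ 4 \<le> K * (r0 / 2) ^ 4" using d4 KB by linarith
        then have "d ^ 4 \<le> (r0 / 2) ^ 4" using K by simp
        then show ?thesis using r0 by (intro power_le_imp_le_base[of d 3]) (auto simp: numeral_eq_Suc)
      qed
      \<comment> \<open>The averaged deficit at \<open>y\<close> is nonnegative although averaging
        raises \<open>W\<close> there by at least \<open>e\<^sup>2\<close>. Up to the small deficit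
        at \<open>y\<close> itself, the Laplacian of the penalty has to compensate this, which it
        cannot if \<open>d\<close> is too small.\<close>
      have Kd: "a0 \<le> K * d\<^sup>2"
      proof -
        have "dist x y + e * R \<le> r0" using dr eR r0 by (simp add: d_def)
        from convZ[OF this] have "conv (Jeps e) Z y \<le> Mp - (W y + e\<^sup>2) + q y + K * (6 * R ^ 4 * (e\<^sup>2 * d\<^sup>2 + e ^ 4))"
          using y(3) by (simp add: sy)
        moreover have "0 \<le> conv (Jeps e) Z y"
          unfolding conv_def using Jeps_nonneg[OF e(1)] Z0 by (intro Bochner_Integration.integral_nonneg) auto
        ultimately have "e\<^sup>2 \<le> Z y + K * (6 * R ^ 4 * (e\<^sup>2 * d\<^sup>2 + e ^ 4))" using y(4) by simp
        also have "\<dots> \<le> K * (17 * R ^ 4) * e ^ 4 + K * (6 * R ^ 4 * (e\<^sup>2 * d\<^sup>2 + e ^ 4))" using Zy by simp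
        also have "\<dots> = (6 * K * R ^ 4 * d\<^sup>2 + 23 * K * R ^ 4 * e\<^sup>2) * e\<^sup>2" by (simp add: power4_eq_xxxx power2_eq_square algebra_simps)
        finally have "1 * e\<^sup>2 \<le> (6 * K * R ^ 4 * d\<^sup>2 + 23 * K * R ^ 4 * e\<^sup>2) * e\<^sup>2" by simp
        then have "1 \<le> 6 * K * R ^ 4 * d\<^sup>2 + 23 * K * R ^ 4 * e\<^sup>2"
          using e by (subst (asm) mult_le_cancel_right_pos) auto
        then have "1 \<le> 12 * R ^ 4 * (K * d\<^sup>2)" using Ke by (simp add: algebra_simps)
        then show ?thesis unfolding a0_def using R4 by (subst pos_divide_le_eq) (auto simp: mult.commute)
      qed
      have d0: "0 < d"
      proof -
        have "d \<noteq> 0" using Kd a0 by auto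
        then show ?thesis by (simp add: d_def)
      qed
      have ed: "e \<le> \<kappa> * d"
      proof -
        have "a0 / K \<le> d\<^sup>2" using Kd K by (simp add: divide_le_eq mult.commute)
        then have "sqrt (a0 / K) \<le> sqrt (d\<^sup>2)" by (rule real_sqrt_le_mono)
        then have "sqrt (a0 / K) \<le> d" using d0 by simp
        then have "\<kappa> * sqrt (a0 / K) \<le> \<kappa> * d" using \<kappa> by (intro mult_left_mono) auto
        then show ?thesis using e'(4) by simp
      qed
      define \<Lambda> where "\<Lambda> = A * (K * d\<^sup>2)"
      have \<Lambda>1: "C0 + K * (6 * R ^ 4 * (5 * d\<^sup>2)) \<le> \<Lambda>"
      proof -
        have "C0 * 1 \<le> C0 * (12 * R ^ 4 * (K * d\<^sup>2))"
        proof (rule mult_left_mono)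
          show "1 \<le> 12 * R ^ 4 * (K * d\<^sup>2)"
            using Kd R4 unfolding a0_def by (subst (asm) pos_divide_le_eq) (auto simp: mult.commute)
        qed (use C0 in simp)
        then show ?thesis by (simp add: \<Lambda>_def A_def algebra_simps)
      qed
      have \<Lambda>0: "1 \<le> \<Lambda>"
      proof -
        have "0 \<le> K * (6 * R ^ 4 * (5 * d\<^sup>2))" using K by simp
        then show ?thesis using \<Lambda>1 C0 by linarith
      qed
      have ed1: "e \<le> d"
      proof -
        have "\<kappa> * d \<le> 1 * d" using \<kappa>8 d0 by (intro mult_right_mono) auto
        then show ?thesis using ed by simp
      qed
      have convZ2: "conv (Jeps e) Z u \<le> Z u + \<Lambda> * e\<^sup>2"
        if u: "dist x u \<le> 2 * d" "dist x u + e * R \<le> r0" "W u - C0 * e\<^sup>2 \<le> conv (Jeps e) W u" "Z u = Mp - W u + q u" for u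
      proof -
        have "(dist x u)\<^sup>2 \<le> (2 * d)\<^sup>2" using u(1) by (intro power_mono) auto
        then have "s u + e\<^sup>2 \<le> 5 * d\<^sup>2" using power_mono[OF ed1, of 2] e by (simp add: s power_mult_distrib)
        then have "K * (6 * R ^ 4 * (s u + e\<^sup>2)) * e\<^sup>2 \<le> K * (6 * R ^ 4 * (5 * d\<^sup>2)) * e\<^sup>2"
          using K R4 by (intro mult_right_mono mult_left_mono) auto
        moreover have "K * (6 * R ^ 4 * (e\<^sup>2 * s u + e ^ 4)) = K * (6 * R ^ 4 * (s u + e\<^sup>2)) * e\<^sup>2"
          by (simp add: power4_eq_xxxx power2_eq_square algebra_simps)
        moreover have "(C0 + K * (6 * R ^ 4 * (5 * d\<^sup>2))) * e\<^sup>2 \<le> \<Lambda> * e\<^sup>2"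
          using \<Lambda>1 by (rule mult_right_mono) simp
        moreover have "(C0 + K * (6 * R ^ 4 * (5 * d\<^sup>2))) * e\<^sup>2 = C0 * e\<^sup>2 + K * (6 * R ^ 4 * (5 * d\<^sup>2)) * e\<^sup>2"
          by (rule distrib_right)
        ultimately show ?thesis using convZ[OF u(2)] u(3,4) by linarith
      qed
      have G1: "(LINT u:ball y (\<kappa> * d)|lborel. Z u) \<le> CG * \<Lambda> * (\<kappa> * d) ^ (?N + 2)"
      proof (rule gr[OF Zi Z0 _ e(1) ed])
        show "0 \<le> \<Lambda>" using \<Lambda>0 by simp
        have "conv (Jeps e) Z y \<le> Z y + \<Lambda> * e\<^sup>2"
        proof (rule convZ2[OF _ _ _ y(4)])
          have "0 \<le> C0 * e\<^sup>2" "0 \<le> e\<^sup>2" using C0 by auto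
          then show "W y - C0 * e\<^sup>2 \<le> conv (Jeps e) W y" using y(3) by linarith
        qed (use d0 dr eR r0 in \<open>auto simp: d_def\<close>)
        moreover have "1 * e\<^sup>2 \<le> \<Lambda> * e\<^sup>2" using \<Lambda>0 by (rule mult_right_mono) simp
        ultimately show "conv (Jeps e) Z y \<le> 2 * \<Lambda> * e\<^sup>2" using Zy2 by linarith
        show "AE u in lborel. u \<in> ball y (CG * (\<kappa> * d)) \<longrightarrow> conv (Jeps e) Z u \<le> Z u + \<Lambda> * e\<^sup>2"
          using ae1 Zae
        proof eventually_elim
          fix u assume u1: "W u - C0 * e\<^sup>2 \<le> conv (Jeps e) W u" and u2: "u \<in> ball x r0 \<longrightarrow> Z u = Mp - W u + q u"
          show "u \<in> ball y (CG * (\<kappa> * d)) \<longrightarrow> conv (Jeps e) Z u \<le> Z u + \<Lambda> * e\<^sup>2"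
          proof
            assume "u \<in> ball y (CG * (\<kappa> * d))"
            then have "dist y u < CG * (\<kappa> * d)" by simp
            also have "\<dots> \<le> CG * (1 / (4 * CG) * d)" using \<kappa>8 CG d0 by (intro mult_left_mono mult_right_mono) auto
            also have "\<dots> = d / 4" using CG by simp
            finally have "dist x u < d + d / 4" using dist_triangle[of x u y] by (simp add: d_def)
            then show "conv (Jeps e) Z u \<le> Z u + \<Lambda> * e\<^sup>2"
              using dr eR r0 d0 u2 by (intro convZ2 u1) auto
          qed
        qed
      qed
      have \<kappa>d: "\<kappa> * d \<le> d / 8" using \<kappa>8 d0 by simp
      \<comment> \<open>On this ball \<open>W = Mp + q - Z\<close> with \<open>Mp\<close>
        nonnegative, and distances to \<open>x\<close> are at least \<open>7 / 8 * d\<close>, whose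
        fourth power exceeds \<open>d ^ 4 / 2\<close>.\<close>
      have lower: "AE u in lborel. indicator (ball y (\<kappa> * d)) u *\<^sub>R (K * d ^ 4 / 2 - Z u) \<le> indicator (ball y (\<kappa> * d)) u *\<^sub>R W u"
        using Zae
      proof eventually_elim
        fix u assume u: "u \<in> ball x r0 \<longrightarrow> Z u = Mp - W u + q u"
        show "indicator (ball y (\<kappa> * d)) u *\<^sub>R (K * d ^ 4 / 2 - Z u) \<le> indicator (ball y (\<kappa> * d)) u *\<^sub>R W u"
        proof (cases "u \<in> ball y (\<kappa> * d)")
          case True
          have t: "dist x u \<le> d + dist y u" "d \<le> dist x u + dist y u"
            using dist_triangle[of x u y] dist_triangle[of x y u] by (auto simp: d_def dist_commute)
          then have "dist x u < r0" using True \<kappa>d dr r0 by auto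
          then have Zu: "Z u = Mp - W u + q u" using u by simp
          have "7 / 8 * d \<le> dist x u" using t True \<kappa>d by auto
          then have "(7 / 8 * d) ^ 4 \<le> dist x u ^ 4" using d0 by (intro power_mono) auto
          moreover have "d ^ 4 / 2 \<le> (7 / 8 * d) ^ 4" using d0 by (simp add: power_mult_distrib power_divide)
          ultimately have "d ^ 4 / 2 \<le> dist x u ^ 4" by linarith
          then have "K * (d ^ 4 / 2) \<le> q u" unfolding q_def s2 using K by (intro mult_left_mono) auto
          then show ?thesis using True Zu Mp by simp
        qed simp
      qed
      have mb: "measure lborel (ball y (\<kappa> * d)) = V * (\<kappa> * d) ^ ?N"
        using content_ball[of "\<kappa> * d" y] \<kappa> d0 by (simp add: V_def)
      have ii: "integrable lborel (\<lambda>u. indicator (ball y (\<kappa> * d)) u *\<^sub>R Z u)" "integrable lborel (\<lambda>u. indicator (ball y (\<kappa> * d)) u *\<^sub>R W u)"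
        "integrable lborel (\<lambda>u. indicator (ball y (\<kappa> * d)) u :: real)"
        using ball_lborel_fin[of y "\<kappa> * d"] integrable_mult_indicator[OF _ Zi, of "ball y (\<kappa> * d)"] integrable_mult_indicator[OF _ W(1), of "ball y (\<kappa> * d)"]
        by (simp_all add: integrable_indicator_iff)
      have "K * d ^ 4 / 2 * (V * (\<kappa> * d) ^ ?N) - (LINT u:ball y (\<kappa> * d)|lborel. Z u)
         = (LINT u|lborel. (K * d ^ 4 / 2) * indicator (ball y (\<kappa> * d)) u - indicator (ball y (\<kappa> * d)) u *\<^sub>R Z u)"
        unfolding set_lebesgue_integral_def using ii by (subst Bochner_Integration.integral_diff) (auto simp: mb)
      also have "\<dots> \<le> (LINT u:ball y (\<kappa> * d)|lborel. W u)"
        unfolding set_lebesgue_integral_def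
      proof (rule integral_mono_AE)
        show "integrable lborel (\<lambda>u. (K * d ^ 4 / 2) * indicator (ball y (\<kappa> * d)) u - indicator (ball y (\<kappa> * d)) u *\<^sub>R Z u)"
          by (intro Bochner_Integration.integrable_diff integrable_mult_right ii)
        show "AE u in lborel. (K * d ^ 4 / 2) * indicator (ball y (\<kappa> * d)) u - indicator (ball y (\<kappa> * d)) u *\<^sub>R Z u \<le> indicator (ball y (\<kappa> * d)) u *\<^sub>R W u"
          using lower by eventually_elim (simp add: algebra_simps)
      qed (rule ii)
      finally have fin: "K * d ^ 4 / 2 * (V * (\<kappa> * d) ^ ?N) - CG * \<Lambda> * (\<kappa> * d) ^ (?N + 2) \<le> (LINT u:ball y (\<kappa> * d)|lborel. W u)"
        using G1 by linarith
      \<comment> \<open>The common factor: the main term is \<open>P * (V / 2)\<close>, while the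
        growth error carries an additional \<open>\<kappa>\<^sup>2\<close>.\<close>
      define P where "P = K * d ^ 4 * (\<kappa> * d) ^ ?N"
      have P0: "0 \<le> P" using K \<kappa> d0 by (simp add: P_def)
      have "K * d ^ 4 / 2 * (V * (\<kappa> * d) ^ ?N) = P * (V / 2)" by (simp add: P_def)
      moreover have "CG * \<Lambda> * (\<kappa> * d) ^ (?N + 2) = P * (CG * A * \<kappa>\<^sup>2)"
        by (simp add: P_def \<Lambda>_def power_add power_mult_distrib power4_eq_xxxx power2_eq_square)
      ultimately have "P * (V / 2 - CG * A * \<kappa>\<^sup>2) \<le> (LINT u:ball y (\<kappa> * d)|lborel. W u)"
        using fin by (simp only: right_diff_distrib)
      moreover have "P * (V / 4) \<le> P * (V / 2 - CG * A * \<kappa>\<^sup>2)"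
      proof (intro mult_left_mono P0)
        have "CG * A * \<kappa>\<^sup>2 \<le> CG * A * \<kappa>"
          using CG A \<kappa> \<kappa>8 by (intro mult_left_mono) (auto simp: power2_eq_square mult_left_le)
        also have "\<dots> \<le> CG * A * (V / (4 * (CG * A)))" using CG A \<kappa>8 by (intro mult_left_mono) auto
        also have "\<dots> = V / 4" using CG A by simp
        finally show "V / 4 \<le> V / 2 - CG * A * \<kappa>\<^sup>2" by simp
      qed
      moreover have "c * \<kappa> ^ ?N * d ^ (?N + 2) \<le> P * (V / 4)"
      proof -
        have "c \<le> a0 * (V / 4)" by (simp add: c_def)
        also have "\<dots> \<le> (K * d\<^sup>2) * (V / 4)" using Kd V by (intro mult_right_mono) auto
        finally have "c * (\<kappa> ^ ?N * d ^ (?N + 2)) \<le> (K * d\<^sup>2) * (V / 4) * (\<kappa> ^ ?N * d ^ (?N + 2))"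
          using \<kappa> d0 by (intro mult_right_mono) auto
        also have "\<dots> = P * (V / 4)"
          by (simp add: P_def power_add power_mult_distrib power4_eq_xxxx power2_eq_square)
        finally show ?thesis by (simp add: mult.assoc)
      qed
      moreover have "c \<le> K * d\<^sup>2" using Kd by (simp add: c_def)
      ultimately show ?thesis using d4 by (intro exI[of _ y]) (auto simp: d_def)
    qed
    show "\<exists>e0>0. \<forall>e W x. 0 < e \<longrightarrow> e < e0 \<longrightarrow> integrable lborel W \<longrightarrow> (\<forall>y. 0 \<le> W y \<and> W y \<le> B) \<longrightarrow>
        (AE y in lborel. W y - C0 * e\<^sup>2 \<le> conv (Jeps e) W y) \<longrightarrow>
        (AE y in lborel. y \<in> ball x r0 \<longrightarrow> 0 < W y \<longrightarrow> W y + e\<^sup>2 \<le> conv (Jeps e) W y) \<longrightarrow>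
        \<not> (AE y in lborel. y \<in> ball x (2 * R * e) \<longrightarrow> W y = 0) \<longrightarrow>
        (\<exists>y. c \<le> K * (dist x y)\<^sup>2 \<and> K * dist x y ^ 4 \<le> B + 1 \<and>
          c * \<kappa> ^ CARD('n) * dist x y ^ (CARD('n) + 2) \<le> (LINT u:ball y (\<kappa> * dist x y)|lborel. W u))"
      by (intro exI[of _ e0] conjI e0 allI impI main) auto
  qed
qed

end

section \<open>Porous sets and distributional supports\<close>

text \<open>Each point of \<open>S\<close> has arbitrarily small balls, inside a tight open
  neighbourhood \<open>U\<close>, of which \<open>S\<close> misses at least the proportion \<theta>.
  Vitali selects disjoint ones covering almost all of \<open>S\<close>, so its measure is at most
  \<open>1 - \<theta>\<close> times that of \<open>U\<close>, hence at most
  \<open>1 - \<theta>\<^sup>2\<close> times its own.\<close>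

lemma porous_negligible_lmeasurable:
  fixes S :: "'a::euclidean_space set"
  assumes S: "S \<in> lmeasurable" and \<kappa>: "0 < \<kappa>" "\<kappa> \<le> 1"
    and por: "\<And>x r. x \<in> S \<Longrightarrow> 0 < r \<Longrightarrow> \<exists>y d. 0 < d \<and> d < r \<and> dist x y \<le> d \<and> ball y (\<kappa> * d) \<inter> S = {}"
  shows "negligible S"
proof (rule ccontr)
  let ?\<mu> = "measure lebesgue"
  assume "\<not> negligible S"
  then have m: "0 < ?\<mu> S" using S by (simp add: negligible_iff_measure zero_less_measure_iff)
  \<comment> \<open>The volume ratio of the hole of radius \<open>\<kappa> * d\<close> to the ball
    of radius \<open>2 * d\<close> about \<open>x\<close>, which contains it.\<close>
  define \<theta> where "\<theta> = (\<kappa> / 2) ^ DIM('a)"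
  have \<theta>: "0 < \<theta>" "\<theta> \<le> 1" using \<kappa> by (auto simp: \<theta>_def intro: power_le_one)
  have "0 < \<theta> * ?\<mu> S" using \<theta> m by simp
  then obtain U where U0: "open U" "S \<subseteq> U" "U - S \<in> lmeasurable" "emeasure lebesgue (U - S) < ennreal (\<theta> * ?\<mu> S)"
    using sets_lebesgue_outer_open[of S] S by (metis fmeasurableD)
  have US: "U = S \<union> (U - S)" using U0(2) by blast
  have "?\<mu> (U - S) < \<theta> * ?\<mu> S"
    using U0(3,4) \<open>0 < \<theta> * ?\<mu> S\<close> by (simp add: emeasure_eq_measure2 ennreal_less_iff)
  moreover have "?\<mu> U \<le> ?\<mu> S + ?\<mu> (U - S)"
    using S U0(3) by (subst US) (intro measure_Un_le, auto)
  moreover have "U \<in> lmeasurable" using S U0(3) by (subst US) (rule fmeasurable.Un)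
  ultimately have U: "open U" "S \<subseteq> U" "U \<in> lmeasurable" "?\<mu> U < ?\<mu> S + \<theta> * ?\<mu> S"
    using U0 by auto
  define K where "K = {(x, d). 0 < d \<and> ball x d \<subseteq> U \<and> ?\<mu> (S \<inter> ball x d) \<le> (1 - \<theta>) * ?\<mu> (ball x d)}"
  obtain C where C: "countable C" "C \<subseteq> K"
     "pairwise (\<lambda>i j. disjnt (ball (fst i) (snd i)) (ball (fst j) (snd j))) C"
     "negligible (S - (\<Union>i \<in> C. ball (fst i) (snd i)))"
  proof (rule Vitali_covering_theorem_balls[of S K fst snd])
    fix x and \<delta> :: real assume x: "x \<in> S" and \<delta>: "0 < \<delta>"
    obtain e where e: "0 < e" "ball x e \<subseteq> U" using U x by (meson openE subsetD)
    have "0 < min \<delta> e / 2" using \<delta> e by simp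
    from por[OF x this] obtain y d where d: "0 < d" "d < min \<delta> e / 2" "dist x y \<le> d" "ball y (\<kappa> * d) \<inter> S = {}"
      by blast
    have sub: "ball y (\<kappa> * d) \<subseteq> ball x (2 * d)"
    proof -
      have "\<kappa> * d \<le> 1 * d" using \<kappa> d by (intro mult_right_mono) auto
      then have "dist y x + \<kappa> * d \<le> 2 * d" using d(3) by (simp add: dist_commute)
      then show ?thesis by (simp add: ball_subset_ball_iff)
    qed
    have "?\<mu> (S \<inter> ball x (2 * d)) \<le> ?\<mu> (ball x (2 * d) - ball y (\<kappa> * d))"
      using d(4) S by (intro measure_mono_fmeasurable) (auto simp: fmeasurable.Diff)
    also have "\<dots> = ?\<mu> (ball x (2 * d)) - ?\<mu> (ball y (\<kappa> * d))"
      using sub by (intro measurable_measure_Diff) auto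
    also have "?\<mu> (ball y (\<kappa> * d)) = \<theta> * ?\<mu> (ball x (2 * d))"
      using d \<kappa> by (simp add: content_ball \<theta>_def power_mult_distrib power_divide)
    finally have "?\<mu> (S \<inter> ball x (2 * d)) \<le> (1 - \<theta>) * ?\<mu> (ball x (2 * d))" by (simp add: algebra_simps)
    moreover have "ball x (2 * d) \<subseteq> U" using e(2) d(2) by (auto intro: order_trans[OF _ e(2)] simp: ball_subset_ball_iff)
    ultimately show "\<exists>i. i \<in> K \<and> x \<in> ball (fst i) (snd i) \<and> snd i < \<delta>"
      using d by (intro exI[of _ "(x, 2 * d)"]) (auto simp: K_def)
  qed blast
  let ?B = "\<lambda>i::'a \<times> real. ball (fst i) (snd i)"
  have disj: "disjoint_family_on ?B C"
    using C(3) by (auto simp: disjoint_family_on_def pairwise_def disjnt_def)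
  then have disjS: "disjoint_family_on (\<lambda>i. S \<inter> ?B i) C"
    unfolding disjoint_family_on_def by blast
  have eS: "emeasure lebesgue (S \<inter> ?B i) \<le> ennreal (1 - \<theta>) * emeasure lebesgue (?B i)" if "i \<in> C" for i
  proof -
    have "?\<mu> (S \<inter> ?B i) \<le> (1 - \<theta>) * ?\<mu> (?B i)" using that C(2) by (auto simp: K_def)
    moreover have "S \<inter> ?B i \<in> lmeasurable" "?B i \<in> lmeasurable" using S by (auto simp: fmeasurable.Int)
    ultimately show ?thesis using \<theta> by (simp add: emeasure_eq_measure2 ennreal_mult[symmetric] ennreal_leI)
  qed
  have "emeasure lebesgue S \<le> emeasure lebesgue ((S - (\<Union>i\<in>C. ?B i)) \<union> (\<Union>i\<in>C. S \<inter> ?B i))"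
    using S C by (intro emeasure_mono) (auto intro!: sets.Un sets.countable_UN' sets.Diff)
  also have "\<dots> \<le> emeasure lebesgue (S - (\<Union>i\<in>C. ?B i)) + emeasure lebesgue (\<Union>i\<in>C. S \<inter> ?B i)"
    using S C by (intro emeasure_subadditive) (auto intro!: sets.countable_UN' sets.Diff)
  also have "emeasure lebesgue (S - (\<Union>i\<in>C. ?B i)) = 0"
    using C(4) by (simp only: negligible_iff_null_sets null_setsD1)
  also have "emeasure lebesgue (\<Union>i\<in>C. S \<inter> ?B i) = (\<integral>\<^sup>+i. emeasure lebesgue (S \<inter> ?B i) \<partial>count_space C)"
    using S disjS C(1) by (intro emeasure_UN_countable) auto
  also have "\<dots> \<le> (\<integral>\<^sup>+i. ennreal (1 - \<theta>) * emeasure lebesgue (?B i) \<partial>count_space C)"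
    using eS by (intro nn_integral_mono) auto
  also have "\<dots> = ennreal (1 - \<theta>) * (\<integral>\<^sup>+i. emeasure lebesgue (?B i) \<partial>count_space C)"
    by (intro nn_integral_cmult) auto
  also have "(\<integral>\<^sup>+i. emeasure lebesgue (?B i) \<partial>count_space C) = emeasure lebesgue (\<Union>i\<in>C. ?B i)"
    using disj C(1) by (intro emeasure_UN_countable[symmetric]) auto
  also have "\<dots> \<le> emeasure lebesgue U"
  proof (rule emeasure_mono)
    show "(\<Union>i\<in>C. ?B i) \<subseteq> U"
    proof (rule UN_least)
      fix i assume "i \<in> C"
      then have "i \<in> K" using C(2) by blast
      then show "?B i \<subseteq> U" by (simp add: K_def case_prod_beta)
    qed
  qed (use U in auto)
  finally have "emeasure lebesgue S \<le> ennreal (1 - \<theta>) * emeasure lebesgue U"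
    by (simp add: mult_left_mono)
  then have "?\<mu> S \<le> (1 - \<theta>) * ?\<mu> U"
    using S U \<theta> by (simp add: emeasure_eq_measure2 ennreal_mult[symmetric])
  also have "\<dots> \<le> (1 - \<theta>) * (?\<mu> S + \<theta> * ?\<mu> S)" using U \<theta> by (intro mult_left_mono) auto
  also have "\<dots> = ?\<mu> S - \<theta>\<^sup>2 * ?\<mu> S" by (simp add: algebra_simps power2_eq_square)
  also have "\<dots> < ?\<mu> S" using \<theta> m by simp
  finally show False by simp
qed

text \<open>Porosity passes to intersections with balls, where the measure is finite.\<close>

lemma porous_null_sets:
  fixes S :: "'a::euclidean_space set"
  assumes S: "S \<in> sets lebesgue" and \<kappa>: "0 < \<kappa>" "\<kappa> \<le> 1"
    and por: "\<And>x r. x \<in> S \<Longrightarrow> 0 < r \<Longrightarrow> \<exists>y d. 0 < d \<and> d < r \<and> dist x y \<le> d \<and> ball y (\<kappa> * d) \<inter> S = {}"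
  shows "S \<in> null_sets lebesgue"
proof -
  have "negligible (S \<inter> ball 0 (real n))" for n
  proof (rule porous_negligible_lmeasurable[OF _ \<kappa>])
    show "S \<inter> ball 0 (real n) \<in> lmeasurable" using S by (intro bounded_set_imp_lmeasurable) auto
    fix x r assume "x \<in> S \<inter> ball 0 (real n)" "(0::real) < r"
    then show "\<exists>y d. 0 < d \<and> d < r \<and> dist x y \<le> d \<and> ball y (\<kappa> * d) \<inter> (S \<inter> ball 0 (real n)) = {}"
      using por[of x r] by blast
  qed
  then have "negligible (\<Union>n. S \<inter> ball 0 (real n))" by (intro negligible_countable_Union) auto
  moreover have "(\<Union>n. S \<inter> ball 0 (real n)) = S"
  proof -
    have "\<exists>n. norm x < real n" for x :: 'a by (rule reals_Archimedean2)
    then show ?thesis by auto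
  qed
  ultimately show ?thesis by (simp add: negligible_iff_null_sets)
qed

text \<open>The parameter \<open>k\<close> absorbs the negative powers of \<open>s\<close> that
  differentiation produces, so the family is closed under derivatives up to linear
  combinations.\<close>

definition flat_exp :: "nat \<Rightarrow> real \<Rightarrow> real"
  where "flat_exp k s = (if s \<le> 0 then 0 else exp (- 1 / s) / s ^ k)"

text \<open>From \<open>(1 + x / n) ^ n \<le> exp x\<close> with \<open>x = 1 / s\<close> and
  \<open>n = k + 2\<close>. Quadratic decay is what yields the derivative at
  \<open>0\<close>.\<close>

lemma flat_exp_bound: "\<exists>C. \<forall>s. \<bar>flat_exp k s\<bar> \<le> C * s\<^sup>2"
proof (intro exI allI)
  fix s
  let ?n = "k + 2"
  show "\<bar>flat_exp k s\<bar> \<le> real ?n ^ ?n * s\<^sup>2"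
  proof (cases "s \<le> 0")
    case False
    define n where "n = k + 2"
    have n: "0 < n" by (simp add: n_def)
    have X: "0 < (s * real n) ^ n" using False n by simp
    have "1 / (s * real n) ^ n = (1 / s / real n) ^ n" by (simp add: power_divide power_mult_distrib)
    also have "\<dots> \<le> (1 + 1 / s / real n) ^ n"
      using False by (intro power_mono) auto
    also have "\<dots> \<le> exp (1 / s)"
    proof (rule exp_ge_one_plus_x_over_n_power_n)
      have "0 \<le> 1 / s" using False by simp
      then show "- real n \<le> 1 / s" by linarith
    qed (rule n)
    finally have "1 \<le> exp (1 / s) * (s * real n) ^ n" using X by (subst (asm) pos_divide_le_eq) auto
    then have "1 / exp (1 / s) \<le> (s * real n) ^ n" by (subst pos_divide_le_eq) (auto simp: mult.commute)
    then have "exp (- 1 / s) / s ^ k \<le> (s * real n) ^ n / s ^ k"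
      using False by (intro divide_right_mono) (auto simp: exp_minus inverse_eq_divide)
    also have "\<dots> = real ?n ^ ?n * s\<^sup>2"
    proof -
      have "(s * real n) ^ n = s ^ n * real n ^ n" by (rule power_mult_distrib)
      moreover have "s ^ n = s ^ k * s\<^sup>2" by (simp only: n_def power_add)
      ultimately have "(s * real n) ^ n / s ^ k = real n ^ n * s\<^sup>2" using False by simp
      then show ?thesis by (simp only: n_def)
    qed
    finally show ?thesis using False by (simp add: flat_exp_def)
  qed (simp add: flat_exp_def)
qed

lemma flat_exp_deriv:
  "(flat_exp k has_real_derivative flat_exp (k + 2) s - real k * flat_exp (k + 1) s) (at s)"
proof -
  consider "s < 0" | "s = 0" | "0 < s" by linarith
  then show ?thesis
  proof cases
    case 1
    have "((\<lambda>_. 0) has_real_derivative 0) (at s)" by simp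
    then have "(flat_exp k has_real_derivative 0) (at s)"
      by (rule has_field_derivative_transform_within_open[of _ _ _ "{..<0}"]) (use 1 in \<open>auto simp: flat_exp_def\<close>)
    then show ?thesis using 1 by (simp add: flat_exp_def)
  next
    case 2
    obtain C where C: "\<And>s. \<bar>flat_exp k s\<bar> \<le> C * s\<^sup>2" using flat_exp_bound by blast
    have "((\<lambda>h. flat_exp k h / h) \<longlongrightarrow> 0) (at 0)"
    proof (rule Lim_null_comparison)
      show "\<forall>\<^sub>F h in at 0. norm (flat_exp k h / h) \<le> \<bar>C\<bar> * \<bar>h\<bar>"
      proof (rule eventually_at_topological[THEN iffD2, OF exI[of _ UNIV]], intro conjI ballI impI)
        fix h :: real assume h: "h \<noteq> 0"
        have "\<bar>flat_exp k h\<bar> \<le> \<bar>C\<bar> * h\<^sup>2" using C[of h] by (meson abs_ge_self mult_right_mono order_trans zero_le_power2)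
        then show "norm (flat_exp k h / h) \<le> \<bar>C\<bar> * \<bar>h\<bar>"
          using h by (simp add: abs_divide pos_divide_le_eq power2_eq_square mult.assoc abs_mult_self_eq)
      qed auto
      show "((\<lambda>h. \<bar>C\<bar> * \<bar>h\<bar>) \<longlongrightarrow> 0) (at 0)" by (auto intro!: tendsto_eq_intros)
    qed
    then show ?thesis using 2 by (simp add: DERIV_def flat_exp_def)
  next
    case 3
    have e: "((\<lambda>s. exp (- inverse s)) has_real_derivative exp (- inverse s) * (inverse s)\<^sup>2) (at s)"
      using 3 by (auto intro!: derivative_eq_intros simp: power2_eq_square)
    have p: "((\<lambda>s. inverse s ^ k) has_real_derivative - (real k * inverse s ^ (k + 1))) (at s)"
      using 3 by (intro DERIV_cong[OF DERIV_power[OF DERIV_inverse]], simp) (cases k; simp)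
    have "((\<lambda>s. exp (- inverse s) * inverse s ^ k) has_real_derivative
        flat_exp (k + 2) s - real k * flat_exp (k + 1) s) (at s)"
      by (rule DERIV_cong[OF DERIV_mult[OF e p]])
        (use 3 in \<open>simp add: flat_exp_def divide_inverse power2_eq_square power_inverse algebra_simps\<close>)
    then show ?thesis
      by (rule has_field_derivative_transform_within_open[of _ _ _ "{0<..}"]) (use 3 in \<open>auto simp: flat_exp_def divide_inverse power_inverse\<close>)
  qed
qed

text \<open>The class is closed under differentiation, so smoothness of the bumps follows by iterating.\<close>

inductive bump_class :: "('a::euclidean_space \<Rightarrow> real) \<Rightarrow> bool" where
  const: "bump_class (\<lambda>_. c)"
| inner: "bump_class (\<lambda>x. x \<bullet> h)"
| flat: "bump_class (\<lambda>x. flat_exp k (b - (x - a) \<bullet> (x - a)))"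
| add: "bump_class F \<Longrightarrow> bump_class G \<Longrightarrow> bump_class (\<lambda>x. F x + G x)"
| mult: "bump_class F \<Longrightarrow> bump_class G \<Longrightarrow> bump_class (\<lambda>x. F x * G x)"

lemma bump_class_has_derivative:
  "bump_class F \<Longrightarrow> \<exists>D. (\<forall>x. (F has_derivative D x) (at x)) \<and> (\<forall>h. bump_class (\<lambda>x. D x h))"
proof (induction rule: bump_class.induct)
  case (const c)
  show ?case by (intro exI[of _ "\<lambda>_ _. 0"]) (auto intro: bump_class.const)
next
  case (inner h)
  show ?case by (intro exI[of _ "\<lambda>_ y. y \<bullet> h"]) (auto intro!: derivative_eq_intros bump_class.const)
next
  case (flat k b a)
  let ?s = "\<lambda>x. b - (x - a) \<bullet> (x - a)"
  let ?D = "\<lambda>x h. (flat_exp (k + 2) (?s x) + (- real k) * flat_exp (k + 1) (?s x)) * (- 2 * (x \<bullet> h + - (a \<bullet> h)))"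
  have D: "((\<lambda>x. flat_exp k (?s x)) has_derivative ?D x) (at x)" for x
  proof -
    have "(?s has_derivative (\<lambda>h. - 2 * (x \<bullet> h + - (a \<bullet> h)))) (at x)"
      by (auto intro!: derivative_eq_intros simp: algebra_simps inner_commute)
    from DERIV_compose_FDERIV[OF flat_exp_deriv this, of k] show ?thesis
      by (simp add: mult_ac)
  qed
  have B: "bump_class (\<lambda>x. ?D x h)" for h
    by (intro bump_class.add bump_class.mult bump_class.const bump_class.flat bump_class.inner)
  show ?case by (intro exI[of _ ?D] conjI allI D B)
next
  case (add F G)
  then obtain D E where "\<forall>x. (F has_derivative D x) (at x)" "\<forall>h. bump_class (\<lambda>x. D x h)"
     "\<forall>x. (G has_derivative E x) (at x)" "\<forall>h. bump_class (\<lambda>x. E x h)" by blast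
  then show ?case
    by (intro exI[of _ "\<lambda>x h. D x h + E x h"]) (auto intro!: derivative_intros bump_class.add)
next
  case (mult F G)
  then obtain D E where "\<forall>x. (F has_derivative D x) (at x)" "\<forall>h. bump_class (\<lambda>x. D x h)"
     "\<forall>x. (G has_derivative E x) (at x)" "\<forall>h. bump_class (\<lambda>x. E x h)" by blast
  then show ?case using mult.hyps
    by (intro exI[of _ "\<lambda>x h. F x * E x h + D x h * G x"]) (auto intro!: has_derivative_mult bump_class.add bump_class.mult)
qed

lemma bump_class_C_k: "bump_class F \<Longrightarrow> C_k k F"
proof (induction k arbitrary: F)
  case 0
  then obtain D where "\<forall>x. (F has_derivative D x) (at x)" using bump_class_has_derivative by blast
  then show ?case by (auto intro!: continuous_at_imp_continuous_on has_derivative_continuous)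
next
  case (Suc k)
  then obtain D where D: "\<forall>x. (F has_derivative D x) (at x)" "\<forall>h. bump_class (\<lambda>x. D x h)"
    using bump_class_has_derivative by blast
  have "frechet_derivative F (at x) = D x" for x using D(1) frechet_derivative_at[of F "D x" x] by metis
  then show ?case using D Suc.IH by (auto simp: differentiable_def)
qed

lemma ex_bump:
  fixes a :: "'a::euclidean_space"
  assumes r: "0 < r" "cball a r \<subseteq> O'"
  obtains \<phi> where "test_function_on O' \<phi>" "\<And>x. 0 \<le> \<phi> x" "\<And>x. x \<in> ball a r \<Longrightarrow> 0 < \<phi> x"
    "continuous_on UNIV \<phi>"
proof -
  define \<phi> where "\<phi> x = flat_exp 0 (r\<^sup>2 - (x - a) \<bullet> (x - a))" for x
  have C: "C_k k \<phi>" for k unfolding \<phi>_def by (intro bump_class_C_k bump_class.flat)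
  have n: "(x - a) \<bullet> (x - a) = (dist a x)\<^sup>2" for x
    by (simp add: dist_norm power2_norm_eq_inner[symmetric] norm_minus_commute)
  have "x \<in> cball a r" if "\<phi> x \<noteq> 0" for x
  proof (rule ccontr)
    assume "x \<notin> cball a r"
    then have "r\<^sup>2 \<le> (dist a x)\<^sup>2" using r by (intro power_mono) auto
    then show False using that by (simp add: \<phi>_def n flat_exp_def)
  qed
  then have sub: "closure {x. \<phi> x \<noteq> 0} \<subseteq> cball a r" by (intro closure_minimal) auto
  have "bounded (closure {x. \<phi> x \<noteq> 0})" using sub bounded_subset bounded_cball by blast
  then have "compact (closure {x. \<phi> x \<noteq> 0})" by (simp add: compact_eq_bounded_closed)
  then have "test_function_on O' \<phi>" using C sub r by (auto simp: test_function_on_def)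
  moreover have "0 < \<phi> x" if "x \<in> ball a r" for x
  proof -
    have "(dist a x)\<^sup>2 < r\<^sup>2" using that r by (intro power_strict_mono) auto
    then show ?thesis by (simp add: \<phi>_def n flat_exp_def)
  qed
  moreover have "0 \<le> \<phi> x" for x by (simp add: \<phi>_def flat_exp_def)
  moreover have "continuous_on UNIV \<phi>" using C[of 0] by simp
  ultimately show ?thesis using that by blast
qed

text \<open>Lindelof reduces an arbitrary union of open sets to a countable one, for which null sets
  can be united.\<close>

lemma AE_Union_open:
  fixes F :: "'a::euclidean_space set set"
  assumes "\<And>U. U \<in> F \<Longrightarrow> open U" and "\<And>U. U \<in> F \<Longrightarrow> AE x in M. x \<in> U \<longrightarrow> P x"
  shows "AE x in M. x \<in> \<Union>F \<longrightarrow> P x"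
proof -
  obtain F' where F': "F' \<subseteq> F" "countable F'" "\<Union>F' = \<Union>F" using Lindelof[of F] assms(1) by metis
  have "AE x in M. \<forall>U\<in>F'. x \<in> U \<longrightarrow> P x"
    using F' assms(2) by (subst AE_ball_countable) auto
  then show ?thesis by eventually_elim (use F' in auto)
qed

text \<open>The sign makes this direct: a nonnegative \<open>w\<close> integrates to zero against a
  bump that is positive on a ball only if it vanishes there almost everywhere. Such balls exhaust
  the open set.\<close>

lemma vanishing_AE_zero:
  fixes w :: "'a::euclidean_space \<Rightarrow> real"
  assumes w: "integrable lebesgue w" "AE x in lebesgue. 0 \<le> w x"
    and O': "open O'" and v: "distribution_vanishes_on w O'"
  shows "AE x in lebesgue. x \<in> O' \<longrightarrow> w x = 0"
proof -
  define F where "F = {ball a r | a r. 0 < r \<and> cball a r \<subseteq> O'}"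
  have "AE x in lebesgue. x \<in> U \<longrightarrow> w x = 0" if UF: "U \<in> F" for U
  proof -
    obtain a r where U: "U = ball a r" "0 < r" "cball a r \<subseteq> O'" using UF unfolding F_def by blast
    obtain \<phi> where \<phi>: "test_function_on O' \<phi>" "\<And>x. 0 \<le> \<phi> x" "\<And>x. x \<in> ball a r \<Longrightarrow> 0 < \<phi> x"
      "continuous_on UNIV \<phi>" using ex_bump[OF U(2,3)] by blast
    have [measurable]: "\<phi> \<in> borel_measurable lebesgue"
      using \<phi>(4) by (intro measurable_completion) (auto intro: borel_measurable_continuous_onI)
    have "bounded (\<phi> ` closure {x. \<phi> x \<noteq> 0})"
      using \<phi> by (intro compact_imp_bounded compact_continuous_image) (auto simp: test_function_on_def intro: continuous_on_subset)
    then obtain B where B: "\<And>x. x \<in> closure {x. \<phi> x \<noteq> 0} \<Longrightarrow> \<bar>\<phi> x\<bar> \<le> B"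
      unfolding bounded_iff by (auto simp: image_iff)
    have Bx: "\<bar>\<phi> x\<bar> \<le> max B 0" for x
      using B[of x] closure_subset[of "{x. \<phi> x \<noteq> 0}"] by (cases "\<phi> x = 0") auto
    have i: "integrable lebesgue (\<lambda>x. w x * \<phi> x)"
    proof (rule Bochner_Integration.integrable_bound[of _ "\<lambda>x. max B 0 * w x"])
      show "AE x in lebesgue. norm (w x * \<phi> x) \<le> norm (max B 0 * w x)"
        using Bx by (auto intro!: AE_I2 simp: abs_mult mult.commute[of "\<bar>w _\<bar>"] intro!: mult_right_mono)
    qed (use w in auto)
    have "(LINT x|lebesgue. w x * \<phi> x) = 0" using v \<phi>(1) by (simp add: distribution_vanishes_on_def)
    moreover have "AE x in lebesgue. 0 \<le> w x * \<phi> x"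
      using w(2) by eventually_elim (simp add: \<phi>(2))
    ultimately have "AE x in lebesgue. w x * \<phi> x = 0"
      using integral_nonneg_eq_0_iff_AE[OF i] by simp
    then show ?thesis
      by eventually_elim (use \<phi>(3) U in force)
  qed
  then have "AE x in lebesgue. x \<in> \<Union>F \<longrightarrow> w x = 0"
    by (intro AE_Union_open) (auto simp: F_def)
  moreover have sub: "O' \<subseteq> \<Union>F"
  proof
    fix x assume "x \<in> O'"
    then obtain r where "0 < r" "cball x r \<subseteq> O'" using O' open_contains_cball by blast
    then have "ball x r \<in> F" "x \<in> ball x r" by (auto simp: F_def)
    then show "x \<in> \<Union>F" by blast
  qed
  ultimately show ?thesis by (elim eventually_mono) blast
qed

lemma AE_zero_outside_supp_D:
  fixes w :: "'a::euclidean_space \<Rightarrow> real"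
  assumes "integrable lebesgue w" "AE x in lebesgue. 0 \<le> w x"
  shows "AE x in lebesgue. x \<notin> supp_D w \<longrightarrow> w x = 0"
proof -
  have "AE x in lebesgue. x \<in> \<Union>{O'. open O' \<and> distribution_vanishes_on w O'} \<longrightarrow> w x = 0"
    using vanishing_AE_zero[OF assms] by (intro AE_Union_open) auto
  then show ?thesis by eventually_elim (auto simp: supp_D_def)
qed

lemma supp_D_disjoint:
  assumes "open U" "AE x in lebesgue. x \<in> U \<longrightarrow> w x = 0"
  shows "U \<inter> supp_D w = {}"
proof -
  have "(LINT x|lebesgue. w x * \<phi> x) = 0" if "test_function_on U \<phi>" for \<phi>
  proof (rule integral_eq_zero_AE)
    show "AE x in lebesgue. w x * \<phi> x = 0"
      using assms(2)
    proof eventually_elim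
      fix x assume "x \<in> U \<longrightarrow> w x = 0"
      then show "w x * \<phi> x = 0"
        using that closure_subset[of "{x. \<phi> x \<noteq> 0}"] by (auto simp: test_function_on_def)
    qed
  qed
  then have "distribution_vanishes_on w U" by (simp add: distribution_vanishes_on_def)
  then show ?thesis using assms(1) by (auto simp: supp_D_def)
qed

lemma closed_supp_D: "closed (supp_D w)"
  unfolding supp_D_def by (intro closed_Compl open_Union) auto

section \<open>Integrable functions as a Banach space\<close>

lemma integrable_lebesgue_of_lborel: "integrable lborel g \<Longrightarrow> integrable lebesgue (g :: 'a::euclidean_space \<Rightarrow> real)"
  by (subst integrable_completion) (auto dest: borel_measurable_integrable)

lemma L1_rel_lborel: "integrable lborel g \<Longrightarrow> L1_rel g g"
  by (simp add: L1_rel_refl_iff integrable_lebesgue_of_lborel)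

text \<open>Every class is reached from a Borel function, so operations on classes can be computed
  over \<open>lborel\<close>, where the product measure is at hand.\<close>

lemma L1_cases:
  fixes u :: "'a::euclidean_space L1"
  obtains g where "integrable lborel g" "u = abs_L1 g" "AE x in lebesgue. rep_L1 u x = g x"
proof -
  obtain g where g: "integrable lborel g" "AE x in lebesgue. rep_L1 u x = g x"
    by (rule ex_borel_representative[OF integrable_rep_L1])
  have "L1_rel (rep_L1 u) g"
    using g by (simp add: L1_rel_def integrable_rep_L1 integrable_lebesgue_of_lborel)
  then have "abs_L1 (rep_L1 u) = abs_L1 g"
    using Quotient3_rel[OF Quotient3_L1, of "rep_L1 u" g] by simp
  then have "u = abs_L1 g" using Quotient3_abs_rep[OF Quotient3_L1, of u] by simp
  with g that show ?thesis by blast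
qed

lemma AE_lebesgue_iff: "(AE x in lebesgue. P x) \<longleftrightarrow> (AE x in lborel. P (x::'a::euclidean_space))"
  by (simp add: AE_completion_iff)

lemma integral_lebesgue_lborel:
  "g \<in> borel_measurable borel \<Longrightarrow> (LINT x|lebesgue. g x) = (LINT x|lborel. (g x :: real))"
  by (rule integral_completion) simp

lemma rep_abs_lborel: "integrable lborel g \<Longrightarrow> AE x in lebesgue. rep_L1 (abs_L1 g) x = g x"
  by (rule rep_abs_L1) (rule integrable_lebesgue_of_lborel)

lemma abs_L1_eq_iff:
  assumes "integrable lborel g" "integrable lborel h"
  shows "abs_L1 g = abs_L1 h \<longleftrightarrow> (AE x in lborel. g x = h x)"
proof -
  have "abs_L1 g = abs_L1 h \<longleftrightarrow> L1_rel g h"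
    using Quotient3_rel[OF Quotient3_L1, of g h] L1_rel_lborel assms by auto
  then show ?thesis using assms by (simp add: L1_rel_def integrable_lebesgue_of_lborel AE_lebesgue_iff)
qed

lemma
  fixes g h :: "'a::euclidean_space \<Rightarrow> real"
  assumes g: "integrable lborel g"
  shows norm_abs_L1: "norm (abs_L1 g) = (LINT x|lborel. \<bar>g x\<bar>)"
    and scaleR_abs_L1: "c *\<^sub>R abs_L1 g = abs_L1 (\<lambda>x. c * g x)"
    and pos_part_abs_L1: "pos_part_minus_one (abs_L1 g) = abs_L1 (\<lambda>x. max (g x - 1) 0)"
  using L1_rel_lborel[OF g] borel_measurable_integrable[OF g]
  by (simp_all add: norm_L1.abs_eq scaleR_L1.abs_eq pos_part_minus_one.abs_eq integral_completion)

lemma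
  fixes g h :: "'a::euclidean_space \<Rightarrow> real"
  assumes g: "integrable lborel g" and h: "integrable lborel h"
  shows plus_abs_L1: "abs_L1 g + abs_L1 h = abs_L1 (\<lambda>x. g x + h x)"
    and minus_abs_L1: "abs_L1 g - abs_L1 h = abs_L1 (\<lambda>x. g x - h x)"
  using L1_rel_lborel[OF g] L1_rel_lborel[OF h]
  by (simp_all add: plus_L1.abs_eq minus_L1.abs_eq)

lemma zero_abs_L1: "0 = abs_L1 (\<lambda>_. 0)"
  by (simp add: zero_L1_def)

lemma integrable_pos_part_lborel: "integrable lborel g \<Longrightarrow> integrable lborel (\<lambda>x. max (g x - 1) (0::real))"
proof (rule Bochner_Integration.integrable_bound[of lborel g])
  assume g: "integrable lborel g"
  have [measurable]: "g \<in> borel_measurable lborel" using g by (rule borel_measurable_integrable)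
  show "(\<lambda>x. max (g x - 1) 0) \<in> borel_measurable lborel" by measurable
qed (auto intro!: AE_I2)

lemma convolution_abs_L1:
  assumes k: "kern k R" and g: "integrable lborel g"
  shows "convolution_L1 (abs_L1 k) (abs_L1 g) = abs_L1 (conv k g)"
proof -
  have [measurable]: "k \<in> borel_measurable borel" "g \<in> borel_measurable borel"
    using kern_measurable[OF k] g by (auto dest: borel_measurable_integrable)
  have "convolution_L1 (abs_L1 k) (abs_L1 g) = abs_L1 (\<lambda>x. LINT y|lebesgue. k (x - y) * g y)"
    using L1_rel_lborel[OF g] L1_rel_lborel[OF kern_integrable[OF k]] by (rule convolution_L1.abs_eq[rotated])
  also have "(\<lambda>x. LINT y|lebesgue. k (x - y) * g y) = conv k g"
    unfolding conv_def by (intro ext integral_lebesgue_lborel) measurable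
  finally show ?thesis .
qed

text \<open>Completeness is what makes continuous curves integrable in time. As in the theorem of
  Riesz and Fischer, an almost everywhere convergent subsequence supplies the limit; Fatou's lemma
  then bounds the distance to it.\<close>

instance L1 :: (euclidean_space) banach
proof
  fix X :: "nat \<Rightarrow> 'a L1" assume X: "Cauchy X"
  have "\<exists>g. integrable lborel g \<and> u = abs_L1 g" for u :: "'a L1" using L1_cases[of u] by metis
  then have "\<exists>s. \<forall>n. integrable lborel (s n) \<and> X n = abs_L1 (s n)" by (intro choice) blast
  then obtain s where s: "\<And>n. integrable lborel (s n)" "\<And>n. X n = abs_L1 (s n)" by blast
  have [measurable]: "s n \<in> borel_measurable lborel" for n using s(1) by (rule borel_measurable_integrable)
  have d: "dist (X i) (X j) = (LINT x|lborel. \<bar>s i x - s j x\<bar>)" for i j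
    using s by (simp add: dist_norm minus_abs_L1 norm_abs_L1)
  have ca: "\<exists>N. \<forall>i\<ge>N. \<forall>j\<ge>N. LINT x|lborel. norm (s i x - s j x) < e" if "0 < e" for e
    using metric_CauchyD[OF X that] by (simp add: d)
  obtain r where r: "strict_mono r" "AE x in lborel. Cauchy (\<lambda>i. s (r i) x)"
    using cauchy_L1_AE_cauchy_subseq[OF s(1) ca] by blast
  define f where "f x = lim (\<lambda>i. s (r i) x)" for x
  have [measurable]: "f \<in> borel_measurable lborel" unfolding f_def by measurable
  have lim: "AE x in lborel. (\<lambda>i. s (r i) x) \<longlonglongrightarrow> f x"
    using r(2) by eventually_elim (simp add: f_def Cauchy_convergent convergent_LIMSEQ_iff[symmetric])
  have est: "\<exists>N. \<forall>i\<ge>N. (\<integral>\<^sup>+x. ennreal \<bar>s i x - f x\<bar> \<partial>lborel) \<le> ennreal e" if e: "0 < e" for e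
  proof -
    obtain N where N: "\<And>i j. N \<le> i \<Longrightarrow> N \<le> j \<Longrightarrow> (LINT x|lborel. norm (s i x - s j x)) < e" using ca[OF e] by blast
    have "(\<integral>\<^sup>+x. ennreal \<bar>s i x - f x\<bar> \<partial>lborel) \<le> ennreal e" if i: "N \<le> i" for i
    proof -
      have "(\<integral>\<^sup>+x. ennreal \<bar>s i x - f x\<bar> \<partial>lborel) = (\<integral>\<^sup>+x. liminf (\<lambda>j. ennreal \<bar>s i x - s (r j) x\<bar>) \<partial>lborel)"
      proof (rule nn_integral_cong_AE)
        show "AE x in lborel. ennreal \<bar>s i x - f x\<bar> = liminf (\<lambda>j. ennreal \<bar>s i x - s (r j) x\<bar>)"
          using lim
        proof eventually_elim
          fix x assume "(\<lambda>i. s (r i) x) \<longlonglongrightarrow> f x"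
          then have "(\<lambda>j. ennreal \<bar>s i x - s (r j) x\<bar>) \<longlonglongrightarrow> ennreal \<bar>s i x - f x\<bar>"
            by (intro tendsto_intros)
          then show "ennreal \<bar>s i x - f x\<bar> = liminf (\<lambda>j. ennreal \<bar>s i x - s (r j) x\<bar>)"
            by (rule lim_imp_Liminf[OF sequentially_bot, symmetric])
        qed
      qed
      also have "\<dots> \<le> liminf (\<lambda>j. \<integral>\<^sup>+x. ennreal \<bar>s i x - s (r j) x\<bar> \<partial>lborel)"
        by (rule nn_integral_liminf) measurable
      also have "\<dots> \<le> liminf (\<lambda>j. ennreal e)"
      proof (rule Liminf_mono)
        show "\<forall>\<^sub>F j in sequentially. (\<integral>\<^sup>+x. ennreal \<bar>s i x - s (r j) x\<bar> \<partial>lborel) \<le> ennreal e"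
          using eventually_ge_at_top[of N]
        proof eventually_elim
          fix j assume "N \<le> j"
          then have "N \<le> r j" using seq_suble[OF r(1), of j] by simp
          from N[OF i this] show "(\<integral>\<^sup>+x. ennreal \<bar>s i x - s (r j) x\<bar> \<partial>lborel) \<le> ennreal e"
            using s(1) by (subst nn_integral_eq_integral) (auto simp: ennreal_leI)
        qed
      qed
      also have "\<dots> = ennreal e" by (simp add: Liminf_const)
      finally show ?thesis .
    qed
    then show ?thesis by blast
  qed
  have fin: "\<exists>N. \<forall>i\<ge>N. integrable lborel (\<lambda>x. s i x - f x) \<and> (LINT x|lborel. \<bar>s i x - f x\<bar>) \<le> e" if e: "0 < e" for e
  proof -
    obtain N where N: "\<And>i. N \<le> i \<Longrightarrow> (\<integral>\<^sup>+x. ennreal \<bar>s i x - f x\<bar> \<partial>lborel) \<le> ennreal e" using est[OF e] by blast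
    have "integrable lborel (\<lambda>x. s i x - f x) \<and> (LINT x|lborel. \<bar>s i x - f x\<bar>) \<le> e" if "N \<le> i" for i
    proof
      show i: "integrable lborel (\<lambda>x. s i x - f x)"
        unfolding integrable_iff_bounded using N[OF that] by (auto intro: le_less_trans)
      have "ennreal (LINT x|lborel. \<bar>s i x - f x\<bar>) \<le> ennreal e"
        using N[OF that] i by (subst nn_integral_eq_integral[symmetric]) auto
      then show "(LINT x|lborel. \<bar>s i x - f x\<bar>) \<le> e" using e by (simp add: ennreal_le_iff)
    qed
    then show ?thesis by blast
  qed
  obtain N1 where N1: "integrable lborel (\<lambda>x. s N1 x - f x)" using fin[of 1] by auto
  have fi: "integrable lborel f"
    using Bochner_Integration.integrable_diff[OF s(1)[of N1] N1] by simp
  have "X \<longlonglongrightarrow> abs_L1 f"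
  proof (rule metric_LIMSEQ_I)
    fix e :: real assume e: "0 < e"
    then obtain N where N: "\<And>i. N \<le> i \<Longrightarrow> (LINT x|lborel. \<bar>s i x - f x\<bar>) \<le> e / 2" using fin[of "e / 2"] by auto
    have "dist (X i) (abs_L1 f) < e" if "N \<le> i" for i
      using N[OF that] e s fi by (simp add: dist_norm minus_abs_L1 norm_abs_L1)
    then show "\<exists>N. \<forall>i\<ge>N. dist (X i) (abs_L1 f) < e" by blast
  qed
  then show "convergent X" by (rule convergentI)
qed

text \<open>Scalar observations of a class. For bounded \<phi> they are bounded linear, hence
  commute with time integrals and derivatives; indicators and signs recover almost everywhere
  information from them.\<close>

definition pair :: "('a::euclidean_space \<Rightarrow> real) \<Rightarrow> 'a L1 \<Rightarrow> real"
  where "pair \<phi> u = (LINT x|lebesgue. \<phi> x * rep_L1 u x)"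

lemma pair_abs_L1:
  assumes g: "integrable lborel g" and [measurable]: "\<phi> \<in> borel_measurable borel"
  shows "pair \<phi> (abs_L1 g) = (LINT x|lborel. \<phi> x * g x)"
proof -
  have [measurable]: "g \<in> borel_measurable borel" using g by (auto dest: borel_measurable_integrable)
  have [measurable]: "\<phi> \<in> borel_measurable lebesgue" "g \<in> borel_measurable lebesgue" by (auto intro: measurable_completion)
  have [measurable]: "rep_L1 (abs_L1 g) \<in> borel_measurable lebesgue" by (rule borel_measurable_integrable[OF integrable_rep_L1])
  have "pair \<phi> (abs_L1 g) = (LINT x|lebesgue. \<phi> x * g x)"
    unfolding pair_def
  proof (rule integral_cong_AE)
    show "AE x in lebesgue. \<phi> x * rep_L1 (abs_L1 g) x = \<phi> x * g x"
      using rep_abs_lborel[OF g] by eventually_elim simp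
  qed measurable
  then show ?thesis by (simp add: integral_lebesgue_lborel)
qed

lemma pair_bounded_linear:
  assumes [measurable]: "\<phi> \<in> borel_measurable borel" and B: "\<And>x. \<bar>\<phi> x\<bar> \<le> B"
  shows "bounded_linear (pair \<phi>)" and "\<bar>pair \<phi> u\<bar> \<le> B * norm u"
proof -
  have i: "integrable lborel (\<lambda>x. \<phi> x * g x)" if "integrable lborel g" for g
    by (rule integrable_bounded_mult[OF that _ B]) measurable
  have bd: "\<bar>pair \<phi> u\<bar> \<le> B * norm u" for u
  proof -
    obtain g where g: "integrable lborel g" "u = abs_L1 g" using L1_cases by metis
    have "\<bar>LINT x|lborel. \<phi> x * g x\<bar> \<le> (LINT x|lborel. \<bar>\<phi> x * g x\<bar>)"
      using integral_norm_bound[of lborel "\<lambda>x. \<phi> x * g x"] by simp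
    also have "\<dots> \<le> (LINT x|lborel. B * \<bar>g x\<bar>)"
    proof (rule integral_mono)
      show "\<bar>\<phi> x * g x\<bar> \<le> B * \<bar>g x\<bar>" for x
        using mult_right_mono[OF B, of "\<bar>g x\<bar>" x] by (simp add: abs_mult)
    qed (use i[OF g(1)] g(1) in \<open>auto intro: integrable_abs\<close>)
    finally show ?thesis using g by (simp add: pair_abs_L1 norm_abs_L1)
  qed
  show "\<bar>pair \<phi> u\<bar> \<le> B * norm u" by (rule bd)
  show "bounded_linear (pair \<phi>)"
  proof (rule bounded_linear_intro)
    fix u v :: "'a L1" and c :: real
    obtain g where g: "integrable lborel g" "u = abs_L1 g" using L1_cases by metis
    obtain h where h: "integrable lborel h" "v = abs_L1 h" using L1_cases by metis
    show "pair \<phi> (u + v) = pair \<phi> u + pair \<phi> v"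
      using g h i by (simp add: plus_abs_L1 pair_abs_L1 distrib_left)
    show "pair \<phi> (c *\<^sub>R u) = c *\<^sub>R pair \<phi> u"
      using g i by (simp add: scaleR_abs_L1 pair_abs_L1 mult.left_commute)
    show "norm (pair \<phi> u) \<le> norm u * B" using bd[of u] by (simp add: mult.commute)
  qed
qed

lemma pos_part_lipschitz: "norm (pos_part_minus_one u - pos_part_minus_one v) \<le> norm (u - v)"
proof -
  obtain g where g: "integrable lborel g" "u = abs_L1 g" using L1_cases by metis
  obtain h where h: "integrable lborel h" "v = abs_L1 h" using L1_cases by metis
  note pg = integrable_pos_part_lborel[OF g(1)] and ph = integrable_pos_part_lborel[OF h(1)]
  have "(LINT x|lborel. \<bar>max (g x - 1) 0 - max (h x - 1) 0\<bar>) \<le> (LINT x|lborel. \<bar>g x - h x\<bar>)"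
  proof (rule integral_mono)
    show "\<bar>max (g x - 1) 0 - max (h x - 1) 0\<bar> \<le> \<bar>g x - h x\<bar>" for x by linarith
  qed (rule integrable_abs[OF Bochner_Integration.integrable_diff[OF pg ph]]
    integrable_abs[OF Bochner_Integration.integrable_diff[OF g(1) h(1)]])+
  then show ?thesis
    by (simp only: g(2) h(2) pos_part_abs_L1[OF g(1)] pos_part_abs_L1[OF h(1)] minus_abs_L1[OF g(1) h(1)]
      minus_abs_L1[OF pg ph] norm_abs_L1[OF Bochner_Integration.integrable_diff[OF pg ph]]
      norm_abs_L1[OF Bochner_Integration.integrable_diff[OF g(1) h(1)]])
qed

lemma continuous_on_pos_part: "continuous_on A pos_part_minus_one"
  unfolding continuous_on_iff
proof (intro ballI allI impI)
  fix u :: "'a L1" and e :: real assume "u \<in> A" "0 < e"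
  then show "\<exists>d>0. \<forall>v\<in>A. dist v u < d \<longrightarrow> dist (pos_part_minus_one v) (pos_part_minus_one u) < e"
    using pos_part_lipschitz[of _ u] by (intro exI[of _ e]) (auto simp: dist_norm intro: le_less_trans)
qed

lemma convolution_bounded_linear:
  assumes k: "kern k R"
  shows "bounded_linear (convolution_L1 (abs_L1 k))"
    and "norm (convolution_L1 (abs_L1 k) u) \<le> (LINT x|lborel. \<bar>k x\<bar>) * norm u"
proof -
  have bd: "norm (convolution_L1 (abs_L1 k) u) \<le> (LINT x|lborel. \<bar>k x\<bar>) * norm u" for u
  proof -
    obtain g where g: "integrable lborel g" "u = abs_L1 g" using L1_cases by metis
    then show ?thesis
      using conv_norm[OF k g(1)] conv_integrable[OF k g(1)] by (simp add: convolution_abs_L1[OF k] norm_abs_L1)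
  qed
  show "norm (convolution_L1 (abs_L1 k) u) \<le> (LINT x|lborel. \<bar>k x\<bar>) * norm u" by (rule bd)
  show "bounded_linear (convolution_L1 (abs_L1 k))"
  proof (rule bounded_linear_intro)
    fix u v :: "'a L1" and c :: real
    obtain g where g: "integrable lborel g" "u = abs_L1 g" using L1_cases by metis
    obtain h where h: "integrable lborel h" "v = abs_L1 h" using L1_cases by metis
    have "conv k (\<lambda>x. g x + h x) = (\<lambda>x. conv k g x + conv k h x)"
      using conv_integrable_pt[OF k g(1)] conv_integrable_pt[OF k h(1)]
      by (simp add: conv_def fun_eq_iff distrib_left)
    then show "convolution_L1 (abs_L1 k) (u + v) = convolution_L1 (abs_L1 k) u + convolution_L1 (abs_L1 k) v"
      using g h conv_integrable[OF k] by (simp add: plus_abs_L1 convolution_abs_L1[OF k])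
    have "conv k (\<lambda>x. c * g x) = (\<lambda>x. c * conv k g x)"
      by (simp add: conv_def fun_eq_iff mult.left_commute)
    then show "convolution_L1 (abs_L1 k) (c *\<^sub>R u) = c *\<^sub>R convolution_L1 (abs_L1 k) u"
      using g conv_integrable[OF k] by (simp add: scaleR_abs_L1 convolution_abs_L1[OF k])
    show "norm (convolution_L1 (abs_L1 k) u) \<le> norm u * (LINT x|lborel. \<bar>k x\<bar>)"
      using bd[of u] by (simp add: mult.commute)
  qed
qed

text \<open>Encoded through a chosen Borel representative; by \<open>trans_abs_L1\<close> every
  other one gives the same class.\<close>

definition trans_L1 :: "'a::euclidean_space \<Rightarrow> 'a L1 \<Rightarrow> 'a L1"
  where "trans_L1 a u = abs_L1 (\<lambda>x. (SOME g. integrable lborel g \<and> u = abs_L1 g) (x + a))"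

lemma trans_abs_L1:
  assumes g: "integrable lborel g"
  shows "trans_L1 a (abs_L1 g) = abs_L1 (\<lambda>x. g (x + a))"
proof -
  define h where "h = (SOME h. integrable lborel h \<and> abs_L1 g = abs_L1 h)"
  have "integrable lborel h \<and> abs_L1 g = abs_L1 h"
    unfolding h_def by (rule someI[of _ g]) (use g in simp)
  then have h: "integrable lborel h" "AE x in lborel. h x = g x"
    using g by (auto simp: abs_L1_eq_iff eq_commute)
  have [measurable]: "g \<in> borel_measurable borel" "h \<in> borel_measurable borel"
    using g h by (auto dest: borel_measurable_integrable)
  have eq: "distr lborel borel (\<lambda>y. y + a) = lborel"
    using lborel_distr_plus[of a] by (subst add.commute)
  have "AE x in distr lborel borel (\<lambda>y. y + a). h x = g x" unfolding eq by (rule h)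
  then have "AE x in lborel. h (x + a) = g (x + a)" by (subst (asm) AE_distr_iff) auto
  then show ?thesis
    unfolding trans_L1_def h_def[symmetric]
    using g h by (subst abs_L1_eq_iff) (auto simp: lborel_integrable_shift)
qed

lemma trans_norm: "norm (trans_L1 a u) = norm u"
proof -
  obtain g where g: "integrable lborel g" "u = abs_L1 g" using L1_cases by metis
  then show ?thesis
    using lborel_integral_shift[of "\<lambda>x. \<bar>g x\<bar>" a]
    by (auto simp: trans_abs_L1 norm_abs_L1 lborel_integrable_shift dest: borel_measurable_integrable)
qed

lemma trans_linear:
  "trans_L1 a (u + v) = trans_L1 a u + trans_L1 a v"
  "trans_L1 a (u - v) = trans_L1 a u - trans_L1 a v"
  "trans_L1 a (c *\<^sub>R u) = c *\<^sub>R trans_L1 a u"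
  "trans_L1 a (pos_part_minus_one u) = pos_part_minus_one (trans_L1 a u)"
proof -
  obtain g where g: "integrable lborel g" "u = abs_L1 g" using L1_cases by metis
  obtain h where h: "integrable lborel h" "v = abs_L1 h" using L1_cases by metis
  have [measurable]: "g \<in> borel_measurable borel" "h \<in> borel_measurable borel"
    using g h by (auto dest: borel_measurable_integrable)
  show
    "trans_L1 a (u + v) = trans_L1 a u + trans_L1 a v"
    "trans_L1 a (u - v) = trans_L1 a u - trans_L1 a v"
    "trans_L1 a (c *\<^sub>R u) = c *\<^sub>R trans_L1 a u"
    "trans_L1 a (pos_part_minus_one u) = pos_part_minus_one (trans_L1 a u)"
    using g h integrable_pos_part_lborel trans_abs_L1[OF integrable_pos_part_lborel[OF g(1)], of a]
    by (simp_all add: trans_abs_L1 plus_abs_L1 minus_abs_L1 scaleR_abs_L1 pos_part_abs_L1 lborel_integrable_shift)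
qed

lemma trans_bounded_linear: "bounded_linear (trans_L1 a)"
  by (rule bounded_linear_intro[of _ 1]) (simp_all add: trans_linear trans_norm)

lemma trans_convolution:
  assumes k: "kern k R"
  shows "trans_L1 a (convolution_L1 (abs_L1 k) u) = convolution_L1 (abs_L1 k) (trans_L1 a u)"
proof -
  obtain g where g: "integrable lborel g" "u = abs_L1 g" using L1_cases by metis
  have [measurable]: "g \<in> borel_measurable borel" "k \<in> borel_measurable borel"
    using g kern_measurable[OF k] by (auto dest: borel_measurable_integrable)
  have "conv k g (x + a) = conv k (\<lambda>x. g (x + a)) x" for x
    unfolding conv_def by (subst lborel_integral_shift[symmetric, of _ a]) (auto simp: algebra_simps)
  then show ?thesis
    using g conv_integrable[OF k g(1)] by (simp add: convolution_abs_L1[OF k] trans_abs_L1 lborel_integrable_shift)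
qed

section \<open>The flow at a fixed scale\<close>

text \<open>A continuous function whose right increments are at most \<open>e * h\<close> for every
  positive \<open>e\<close> cannot increase: after tilting by a small slope, the last point not
  above the starting level could still be moved to the right.\<close>

lemma dini_decreasing:
  fixes g :: "real \<Rightarrow> real"
  assumes ab: "a \<le> b" and cont: "continuous_on {a..b} g"
    and step: "\<And>s e. a \<le> s \<Longrightarrow> s < b \<Longrightarrow> 0 < e \<Longrightarrow> \<exists>d>0. \<forall>h. 0 < h \<longrightarrow> h < d \<longrightarrow> s + h \<le> b \<longrightarrow> g (s + h) \<le> g s + e * h"
  shows "g b \<le> g a"
proof (rule field_le_epsilon)
  fix e :: real assume e: "0 < e"
  \<comment> \<open>The slope is chosen so that the error over the whole interval stays below
    \<open>e\<close>; the \<open>+ 1\<close> covers \<open>a = b\<close>.\<close>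
  define e' where "e' = e / (b - a + 1)"
  have e': "0 < e'" "e' * (b - a) \<le> e" using e ab by (auto simp: e'_def field_simps)
  define k where "k s = g s - g a - e' * (s - a)" for s
  have kc: "continuous_on {a..b} k" unfolding k_def by (intro continuous_intros cont)
  have "k b \<le> 0"
  proof (rule ccontr)
    assume kb: "\<not> k b \<le> 0"
    define S where "S = {s \<in> {a..b}. k s \<le> 0}"
    have aS: "a \<in> S" using ab by (simp add: S_def k_def)
    have "closed S" unfolding S_def
      using continuous_on_closed_Collect_le[OF kc continuous_on_const[of _ 0]] by simp
    moreover have bd: "bdd_above S" by (rule bdd_aboveI[of _ b]) (simp add: S_def)
    ultimately have s0: "Sup S \<in> S" using aS closed_contains_Sup[of S] by auto
    define s where "s = Sup S"
    have s: "a \<le> s" "s \<le> b" "k s \<le> 0" using s0 by (auto simp: S_def s_def)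
    have sb: "s < b" using s kb by (cases "s = b") auto
    obtain d where d: "0 < d" "\<And>h. 0 < h \<Longrightarrow> h < d \<Longrightarrow> s + h \<le> b \<Longrightarrow> g (s + h) \<le> g s + e' * h"
      using step[OF s(1) sb e'(1)] by blast
    define h where "h = min (d / 2) (b - s)"
    have h: "0 < h" "h < d" "s + h \<le> b" using d sb by (auto simp: h_def min_def)
    have "k (s + h) \<le> 0" using d(2)[OF h] s(3) by (simp add: k_def algebra_simps)
    then have "s + h \<in> S" using s h by (simp add: S_def)
    then have "s + h \<le> s" unfolding s_def using bd by (rule cSup_upper)
    then show False using h by simp
  qed
  then show "g b \<le> g a + e" using e' by (simp add: k_def)
qed

lemma vector_derivative_step:
  assumes "(x has_vector_derivative D) (at s within {a..b})" "a \<le> s" "0 < e"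
  shows "\<exists>d>0. \<forall>h. 0 < h \<longrightarrow> h < d \<longrightarrow> s + h \<le> b \<longrightarrow> norm (x (s + h) - (x s + h *\<^sub>R D)) \<le> e * h"
proof -
  from assms obtain d where d: "0 < d"
    "\<And>y. y \<in> {a..b} \<Longrightarrow> norm (y - s) < d \<Longrightarrow> norm (x y - x s - (y - s) *\<^sub>R D) \<le> e * norm (y - s)"
    unfolding has_vector_derivative_def has_derivative_within_alt by blast
  show ?thesis
  proof (intro exI[of _ d] conjI d allI impI)
    fix h assume h: "0 < h" "h < d" "s + h \<le> b"
    then show "norm (x (s + h) - (x s + h *\<^sub>R D)) \<le> e * h"
      using d(2)[of "s + h"] assms(2) by (simp add: diff_diff_eq)
  qed
qed

text \<open>For a Lipschitz functional a true step differs from an explicit Euler step by a term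
  small compared with \<open>h\<close>, so it suffices to examine one Euler step. Contraction and
  the invariant band are obtained in this way.\<close>

lemma euler_decreasing:
  fixes x :: "real \<Rightarrow> 'b::real_normed_vector" and p :: "'b \<Rightarrow> real"
  assumes ab: "a \<le> b" and der: "\<And>s. a \<le> s \<Longrightarrow> s \<le> b \<Longrightarrow> (x has_vector_derivative D s) (at s within {a..b})"
    and lip: "\<And>y z. \<bar>p y - p z\<bar> \<le> L * norm (y - z)" and L: "0 < L" and \<eta>: "0 < \<eta>"
    and eul: "\<And>s h. a \<le> s \<Longrightarrow> s \<le> b \<Longrightarrow> 0 < h \<Longrightarrow> h < \<eta> \<Longrightarrow> p (x s + h *\<^sub>R D s) \<le> p (x s)"
  shows "p (x b) \<le> p (x a)"
proof (rule dini_decreasing[OF ab])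
  have "continuous_on {a..b} x"
    using der by (intro continuous_on_vector_derivative) auto
  moreover have "continuous_on UNIV p"
    unfolding continuous_on_iff
  proof (intro ballI allI impI)
    fix y and e :: real assume "0 < e"
    have "dist (p z) (p y) < e" if "dist z y < e / L" for z
    proof -
      have "\<bar>p z - p y\<bar> \<le> L * norm (z - y)" by (rule lip)
      also have "\<dots> < e" using that L by (simp add: dist_norm field_simps)
      finally show ?thesis by (simp add: dist_real_def)
    qed
    then show "\<exists>d>0. \<forall>z\<in>UNIV. dist z y < d \<longrightarrow> dist (p z) (p y) < e"
      using \<open>0 < e\<close> L by (intro exI[of _ "e / L"]) auto
  qed
  ultimately show "continuous_on {a..b} (\<lambda>s. p (x s))"
    using continuous_on_compose2[of UNIV p "{a..b}" x] by auto
  fix s e assume s: "a \<le> s" "s < b" and e: "(0::real) < e"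
  have eL: "0 < e / L" using e L by simp
  have sb: "s \<le> b" using s by simp
  from vector_derivative_step[OF der[OF s(1) sb] s(1) eL] obtain d where d: "0 < d"
    "\<And>h. 0 < h \<Longrightarrow> h < d \<Longrightarrow> s + h \<le> b \<Longrightarrow> norm (x (s + h) - (x s + h *\<^sub>R D s)) \<le> e / L * h" by blast
  show "\<exists>d>0. \<forall>h. 0 < h \<longrightarrow> h < d \<longrightarrow> s + h \<le> b \<longrightarrow> p (x (s + h)) \<le> p (x s) + e * h"
  proof (intro exI[of _ "min d \<eta>"] conjI allI impI)
    fix h assume h: "0 < h" "h < min d \<eta>" "s + h \<le> b"
    have "\<bar>p (x (s + h)) - p (x s + h *\<^sub>R D s)\<bar> \<le> L * norm (x (s + h) - (x s + h *\<^sub>R D s))" by (rule lip)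
    also have "\<dots> \<le> L * (e / L * h)" using d h L by (intro mult_left_mono) auto
    also have "\<dots> = e * h" using L by simp
    finally show "p (x (s + h)) \<le> p (x s) + e * h" using eul[OF s(1) sb h(1)] h by auto
  qed (use d \<eta> in auto)
qed

section \<open>The evolution equation as a flow in \<open>L1\<close>\<close>

context unit_kernel
begin

abbreviation Tconv :: "real \<Rightarrow> (real ^ 'n) L1 \<Rightarrow> (real ^ 'n) L1"
  where "Tconv e \<equiv> convolution_L1 (abs_L1 (Jeps e))"

definition rhs :: "real \<Rightarrow> (real ^ 'n) L1 \<Rightarrow> (real ^ 'n) L1"
  where "rhs e u = (1 / e\<^sup>2) *\<^sub>R (Tconv e (pos_part_minus_one u) - pos_part_minus_one u)"

text \<open>Only the differential equation, with a one-sided derivative at time \<open>0\<close>.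
  The initial value is left free so that translates of solutions and the zero curve qualify.\<close>

definition flow :: "real \<Rightarrow> (real \<Rightarrow> (real ^ 'n) L1) \<Rightarrow> bool"
  where "flow e u \<longleftrightarrow> (\<forall>b s. 0 \<le> s \<longrightarrow> s \<le> b \<longrightarrow> (u has_vector_derivative rhs e (u s)) (at s within {0..b}))"

text \<open>The Duvaut transform of the enthalpy equation: it turns the evolution into a relation at
  each single time, in which \<open>u\<close> minus the initial datum is a discrete
  Laplacian.\<close>

definition wint :: "(real \<Rightarrow> (real ^ 'n) L1) \<Rightarrow> real \<Rightarrow> (real ^ 'n) L1"
  where "wint u t = integral {0..t} (\<lambda>s. pos_part_minus_one (u s))"

lemma wint_0: "wint u 0 = 0"
  by (simp add: wint_def)

lemma wint_deriv:
  assumes u: "continuous_on {0..} u" and s: "0 \<le> s" "s \<le> b"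
  shows "(wint u has_vector_derivative pos_part_minus_one (u s)) (at s within {0..b})"
  unfolding wint_def
proof (rule integral_has_vector_derivative)
  show "continuous_on {0..b} (\<lambda>s. pos_part_minus_one (u s))"
    using u by (intro continuous_on_compose2[OF continuous_on_pos_part[of UNIV]] continuous_on_subset[OF u]) auto
qed (use s in auto)

text \<open>The linear operator commutes with the time integral, so the integral equation becomes a
  relation between \<open>u\<close> and \<open>wint\<close>; differentiating that relation gives the
  flow.\<close>

lemma
  assumes sol: "L1_solution J e f u" and e: "0 < e"
  shows solution_wint: "0 \<le> t \<Longrightarrow> u t = abs_L1 f + (1 / e\<^sup>2) *\<^sub>R (Tconv e (wint u t) - wint u t)"
    and solution_flow: "flow e u"
    and solution_cont: "continuous_on {0..} u"
proof -
  show uc: "continuous_on {0..} u" using sol by (simp add: L1_solution_def)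
  define A where "A v = (1 / e\<^sup>2) *\<^sub>R (Tconv e v - v)" for v
  have bl: "bounded_linear A"
    unfolding A_def
    by (intro bounded_linear_scaleR_right[THEN bounded_linear_compose] bounded_linear_sub
      convolution_bounded_linear(1)[OF kern_Jeps[OF e]] bounded_linear_ident)
  have vc: "continuous_on {0..b} (\<lambda>s. pos_part_minus_one (u s))" for b
    using uc by (intro continuous_on_compose2[OF continuous_on_pos_part[of UNIV]] continuous_on_subset[OF uc]) auto
  have pos: "u t = abs_L1 f + A (wint u t)" if t: "0 < t" for t
  proof -
    obtain I where I: "((\<lambda>s. Tconv e (pos_part_minus_one (u s)) - pos_part_minus_one (u s)) has_integral I) {0..t}"
      "u t = abs_L1 f + (1 / e\<^sup>2) *\<^sub>R I"
      using sol t unfolding L1_solution_def by blast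
    have "((\<lambda>s. pos_part_minus_one (u s)) has_integral wint u t) {0..t}"
      unfolding wint_def by (intro integrable_integral integrable_continuous_interval vc)
    from has_integral_linear[OF this bl]
    have "((\<lambda>s. A (pos_part_minus_one (u s))) has_integral A (wint u t)) {0..t}" by (simp add: o_def)
    moreover have "((\<lambda>s. (1 / e\<^sup>2) *\<^sub>R (Tconv e (pos_part_minus_one (u s)) - pos_part_minus_one (u s))) has_integral (1 / e\<^sup>2) *\<^sub>R I) {0..t}"
      by (rule has_integral_cmul[OF I(1)])
    ultimately have "A (wint u t) = (1 / e\<^sup>2) *\<^sub>R I"
      unfolding A_def by (rule has_integral_unique)
    then show ?thesis using I(2) by simp
  qed
  have wc: "continuous_on {0..1} (wint u)"
    using wint_deriv[OF uc] by (intro continuous_on_vector_derivative) auto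
  \<comment> \<open>The integral equation is given for positive times; continuity of both sides
    extends it to time \<open>0\<close>.\<close>
  have "u 0 = abs_L1 f + A (wint u 0)"
  proof -
    have c1: "((\<lambda>t. u t - (abs_L1 f + A (wint u t))) \<longlongrightarrow> u 0 - (abs_L1 f + A (wint u 0))) (at 0 within {0..1})"
    proof -
      have "continuous_on {0..1} (\<lambda>t. u t - (abs_L1 f + A (wint u t)))"
        by (intro continuous_intros continuous_on_subset[OF uc]
           continuous_on_compose2[OF linear_continuous_on[OF bl, of UNIV] wc]) auto
      then show ?thesis by (simp add: continuous_on_def)
    qed
    moreover have "((\<lambda>t. u t - (abs_L1 f + A (wint u t))) \<longlongrightarrow> 0) (at 0 within {0..1})"
      by (rule tendsto_eventually) (auto simp: eventually_at_topological intro!: exI[of _ UNIV] simp: pos)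
    moreover have "at (0::real) within {0..1} \<noteq> bot"
      by (simp add: at_within_Icc_at_right)
    ultimately have "u 0 - (abs_L1 f + A (wint u 0)) = 0" using tendsto_unique by blast
    then show ?thesis by simp
  qed
  with pos have all: "u t = abs_L1 f + A (wint u t)" if "0 \<le> t" for t
    using that by (cases "t = 0") auto
  then show "0 \<le> t \<Longrightarrow> u t = abs_L1 f + (1 / e\<^sup>2) *\<^sub>R (Tconv e (wint u t) - wint u t)"
    by (simp add: A_def)
  show "flow e u"
    unfolding flow_def
  proof (intro allI impI)
    fix b s :: real assume s: "0 \<le> s" "s \<le> b"
    have "((\<lambda>t. abs_L1 f + A (wint u t)) has_vector_derivative 0 + A (pos_part_minus_one (u s))) (at s within {0..b})"
      by (intro has_vector_derivative_add has_vector_derivative_const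
        bounded_linear.has_vector_derivative[OF bl] wint_deriv[OF uc s])
    then have "((\<lambda>t. abs_L1 f + A (wint u t)) has_vector_derivative rhs e (u s)) (at s within {0..b})"
      by (simp add: rhs_def A_def)
    then show "(u has_vector_derivative rhs e (u s)) (at s within {0..b})"
      by (rule has_vector_derivative_transform[rotated 2]) (use s all in auto)
  qed
qed

section \<open>Contraction, invariant bounds and retention\<close>

lemma euler_abs_L1:
  assumes e: "0 < e" and g: "integrable lborel g"
  shows "abs_L1 g + h *\<^sub>R rhs e (abs_L1 g)
    = abs_L1 (\<lambda>x. g x - h / e\<^sup>2 * max (g x - 1) 0 + h / e\<^sup>2 * conv (Jeps e) (\<lambda>x. max (g x - 1) 0) x)"
proof -
  note p = integrable_pos_part_lborel[OF g]
  note c = conv_integrable[OF kern_Jeps[OF e] p]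
  have "(\<lambda>x. g x + h * (1 / e\<^sup>2 * (conv (Jeps e) (\<lambda>x. max (g x - 1) 0) x - max (g x - 1) 0)))
    = (\<lambda>x. g x - h / e\<^sup>2 * max (g x - 1) 0 + h / e\<^sup>2 * conv (Jeps e) (\<lambda>x. max (g x - 1) 0) x)"
    by (simp add: fun_eq_iff algebra_simps)
  then show ?thesis
    unfolding rhs_def pos_part_abs_L1[OF g] convolution_abs_L1[OF kern_Jeps[OF e] p] minus_abs_L1[OF c p]
      scaleR_abs_L1[OF Bochner_Integration.integrable_diff[OF c p]]
    using g c p by (simp add: scaleR_abs_L1 plus_abs_L1)
qed

lemma norm_Jeps: "0 < e \<Longrightarrow> (LINT x|lborel. \<bar>Jeps e x\<bar>) = 1"
  using mass_Jeps[of e] by (simp add: Jeps_nonneg abs_of_nonneg)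

text \<open>The excess over \<open>1\<close> is a nondecreasing 1-Lipschitz function of
  \<open>u\<close>. Removing the fraction \<open>l = h / e\<^sup>2\<close> of it, at most all,
  lowers the \<open>L1\<close> distance by exactly \<open>l\<close> times the distance of the
  excesses; the convolution, of mass one, gives back no more than that.\<close>

lemma euler_nonexpansive:
  assumes e: "0 < e" and h: "0 \<le> h" "h \<le> e\<^sup>2"
  shows "norm ((u + h *\<^sub>R rhs e u) - (v + h *\<^sub>R rhs e v)) \<le> norm (u - v)"
proof -
  obtain g where g: "integrable lborel g" "u = abs_L1 g" using L1_cases by metis
  obtain k where k: "integrable lborel k" "v = abs_L1 k" using L1_cases by metis
  define l where "l = h / e\<^sup>2"
  have l: "0 \<le> l" "l \<le> 1" using h e by (auto simp: l_def)
  define P Q where "P x = max (g x - 1) 0" and "Q x = max (k x - 1) 0" for x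
  have PQ: "integrable lborel P" "integrable lborel Q"
    unfolding P_def Q_def using g k by (auto intro: integrable_pos_part_lborel)
  note kJ = kern_Jeps[OF e]
  define D where "D x = P x - Q x" for x
  have D: "integrable lborel D" unfolding D_def using PQ by simp
  have cD: "conv (Jeps e) D x = conv (Jeps e) P x - conv (Jeps e) Q x" for x
    unfolding conv_def D_def using conv_integrable_pt[OF kJ PQ(1)] conv_integrable_pt[OF kJ PQ(2)]
    by (simp add: right_diff_distrib)
  have pt: "\<bar>g x - k x - l * D x\<bar> = \<bar>g x - k x\<bar> - l * \<bar>D x\<bar>" for x
  proof -
    have mono: "\<bar>(a - b) - l * (max (a - 1) 0 - max (b - 1) 0)\<bar> = \<bar>a - b\<bar> - l * \<bar>max (a - 1) 0 - max (b - 1) 0\<bar>"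
      if "b \<le> a" for a b :: real
    proof -
      have "0 \<le> max (a - 1) 0 - max (b - 1) 0" "max (a - 1) 0 - max (b - 1) 0 \<le> a - b" using that by auto
      moreover from this l have "l * (max (a - 1) 0 - max (b - 1) 0) \<le> 1 * (a - b)" by (intro mult_mono) auto
      ultimately show ?thesis using that by simp
    qed
    show ?thesis
    proof (cases "k x \<le> g x")
      case True then show ?thesis using mono[OF True] by (simp add: D_def P_def Q_def)
    next
      case False
      then have "g x \<le> k x" by simp
      from mono[OF this] have "\<bar>k x - g x - l * (Q x - P x)\<bar> = \<bar>k x - g x\<bar> - l * \<bar>Q x - P x\<bar>"
        by (simp add: P_def Q_def)
      moreover have "g x - k x - l * D x = - (k x - g x - l * (Q x - P x))"
        by (simp add: D_def algebra_simps)
      ultimately show ?thesis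
        by (simp only: abs_minus_cancel abs_minus_commute[of "Q x" "P x"] abs_minus_commute[of "k x" "g x"] D_def)
    qed
  qed
  have GG: "integrable lborel (\<lambda>x. g x - l * P x + l * conv (Jeps e) P x)"
    "integrable lborel (\<lambda>x. k x - l * Q x + l * conv (Jeps e) Q x)"
    using g(1) k(1) PQ conv_integrable[OF kJ PQ(1)] conv_integrable[OF kJ PQ(2)] by auto
  have "norm ((u + h *\<^sub>R rhs e u) - (v + h *\<^sub>R rhs e v))
     = (LINT x|lborel. \<bar>(g x - l * P x + l * conv (Jeps e) P x) - (k x - l * Q x + l * conv (Jeps e) Q x)\<bar>)"
    unfolding g(2) k(2) euler_abs_L1[OF e g(1)] euler_abs_L1[OF e k(1)] P_def[symmetric] Q_def[symmetric] l_def[symmetric]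
    by (simp only: minus_abs_L1[OF GG] norm_abs_L1[OF Bochner_Integration.integrable_diff[OF GG]])
  also have "(\<lambda>x. \<bar>(g x - l * P x + l * conv (Jeps e) P x) - (k x - l * Q x + l * conv (Jeps e) Q x)\<bar>)
     = (\<lambda>x. \<bar>(g x - k x - l * D x) + l * conv (Jeps e) D x\<bar>)"
    unfolding cD D_def by (simp add: algebra_simps)
  also have "(LINT x|lborel. \<bar>(g x - k x - l * D x) + l * conv (Jeps e) D x\<bar>)
     \<le> (LINT x|lborel. (\<bar>g x - k x\<bar> - l * \<bar>D x\<bar>) + l * \<bar>conv (Jeps e) D x\<bar>)"
  proof (rule integral_mono)
    show "\<bar>(g x - k x - l * D x) + l * conv (Jeps e) D x\<bar> \<le> (\<bar>g x - k x\<bar> - l * \<bar>D x\<bar>) + l * \<bar>conv (Jeps e) D x\<bar>" for x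
      unfolding pt[symmetric] using l by (intro order_trans[OF abs_triangle_ineq]) (simp add: abs_mult)
  qed (use g(1) k(1) D conv_integrable[OF kJ D] in auto)
  also have "\<dots> = (LINT x|lborel. \<bar>g x - k x\<bar>) - l * (LINT x|lborel. \<bar>D x\<bar>) + l * (LINT x|lborel. \<bar>conv (Jeps e) D x\<bar>)"
    using g(1) k(1) D conv_integrable[OF kJ D] by simp
  also have "\<dots> \<le> (LINT x|lborel. \<bar>g x - k x\<bar>)"
    using mult_left_mono[OF conv_norm[OF kJ D] l(1)] norm_Jeps[OF e] by simp
  also have "\<dots> = norm (u - v)"
    by (simp only: g(2) k(2) minus_abs_L1[OF g(1) k(1)] norm_abs_L1[OF Bochner_Integration.integrable_diff[OF g(1) k(1)]])
  finally show ?thesis .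
qed

text \<open>Both solutions form one curve in the product space, to which the Euler criterion
  applies.\<close>

lemma flow_contraction:
  assumes e: "0 < e" and u: "flow e u" and v: "flow e v" and t: "0 \<le> t"
  shows "norm (u t - v t) \<le> norm (u 0 - v 0)"
proof -
  let ?p = "\<lambda>y :: (real ^ 'n) L1 \<times> (real ^ 'n) L1. norm (fst y - snd y)"
  have "?p (u t, v t) \<le> ?p (u 0, v 0)"
  proof (rule euler_decreasing[where x="\<lambda>s. (u s, v s)" and D="\<lambda>s. (rhs e (u s), rhs e (v s))" and L=2 and p="?p" and \<eta>="e\<^sup>2", OF t])
    fix s assume "0 \<le> s" "s \<le> t"
    then show "((\<lambda>s. (u s, v s)) has_vector_derivative (rhs e (u s), rhs e (v s))) (at s within {0..t})"
      using u v by (intro has_vector_derivative_Pair) (auto simp: flow_def)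
  next
    fix y z :: "(real ^ 'n) L1 \<times> (real ^ 'n) L1"
    have "\<bar>?p y - ?p z\<bar> \<le> norm ((fst y - snd y) - (fst z - snd z))" by (rule norm_triangle_ineq3)
    also have "\<dots> = norm (fst (y - z) - snd (y - z))" by (simp add: algebra_simps)
    also have "\<dots> \<le> norm (fst (y - z)) + norm (snd (y - z))" by (rule norm_triangle_ineq4)
    also have "\<dots> \<le> 2 * norm (y - z)"
      using norm_fst_le[of "fst (y - z)" "snd (y - z)"] norm_snd_le[of "snd (y - z)" "fst (y - z)"]
      unfolding prod.collapse by linarith
    finally show "\<bar>?p y - ?p z\<bar> \<le> 2 * norm (y - z)" .
  next
    fix s h assume "0 < h" "h < e\<^sup>2"
    then show "?p ((u s, v s) + h *\<^sub>R (rhs e (u s), rhs e (v s))) \<le> ?p (u s, v s)"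
      using euler_nonexpansive[OF e, of h "u s" "v s"] by simp
  qed (use e in auto)
  then show ?thesis by simp
qed

lemma pos_part_zero: "pos_part_minus_one 0 = (0 :: (real ^ 'n) L1)"
  unfolding zero_abs_L1 by (subst pos_part_abs_L1) auto

lemma flow_zero: "0 < e \<Longrightarrow> flow e (\<lambda>_. 0)"
  using linear_0[OF bounded_linear.linear[OF convolution_bounded_linear(1)[OF kern_Jeps, of e]]]
  by (simp add: flow_def rhs_def pos_part_zero)

lemma flow_norm: "0 < e \<Longrightarrow> flow e u \<Longrightarrow> 0 \<le> t \<Longrightarrow> norm (u t) \<le> norm (u 0)"
  using flow_contraction[OF _ _ flow_zero, of e u t] by simp

lemma flow_trans:
  assumes e: "0 < e" and u: "flow e u"
  shows "flow e (\<lambda>t. trans_L1 a (u t))"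
proof -
  have r: "trans_L1 a (rhs e v) = rhs e (trans_L1 a v)" for v
    by (simp add: rhs_def trans_linear trans_convolution[OF kern_Jeps[OF e]])
  show ?thesis
    using u bounded_linear.has_vector_derivative[OF trans_bounded_linear, of u _ _ a]
    unfolding flow_def r[symmetric] by blast
qed

text \<open>Translates solve the same equation, so the \<open>L1\<close> modulus of continuity of
  the initial value persists for all times, uniformly in the scale. The estimates for mollification
  rest on this regularity.\<close>

lemma flow_translate:
  assumes "0 < e" "flow e u" "0 \<le> t"
  shows "norm (trans_L1 a (u t) - u t) \<le> norm (trans_L1 a (u 0) - u 0)"
  using flow_contraction[OF assms(1) flow_trans[OF assms(1,2)] assms(2,3)] .

text \<open>Bounds hold everywhere for some representative, so that members can be handled
  pointwise.\<close>

definition band :: "real \<Rightarrow> (real ^ 'n) L1 set"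
  where "band C = {abs_L1 g | g. integrable lborel g \<and> (\<forall>x. 0 \<le> g x \<and> g x \<le> C)}"

text \<open>Maximum principle for one Euler step: the fraction \<open>l\<close> of the excess over
  \<open>1\<close> is replaced by the same fraction of an averaged excess, which lies between
  \<open>0\<close> and \<open>C - 1\<close>.\<close>

lemma band_euler:
  assumes e: "0 < e" and h: "0 \<le> h" "h \<le> e\<^sup>2" and C: "1 \<le> C" and u: "u \<in> band C"
  shows "u + h *\<^sub>R rhs e u \<in> band C"
proof -
  obtain g where g: "integrable lborel g" "u = abs_L1 g" "\<And>x. 0 \<le> g x" "\<And>x. g x \<le> C"
    using u by (auto simp: band_def)
  define l where "l = h / e\<^sup>2"
  have l: "0 \<le> l" "l \<le> 1" using h e by (auto simp: l_def)
  let ?P = "\<lambda>x. max (g x - 1) 0"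
  let ?G = "\<lambda>x. g x - l * ?P x + l * conv (Jeps e) ?P x"
  note kJ = kern_Jeps[OF e] and p = integrable_pos_part_lborel[OF g(1)]
  have [measurable]: "g \<in> borel_measurable borel" using g by (auto dest: borel_measurable_integrable)
  have c0: "0 \<le> conv (Jeps e) ?P x" for x
    unfolding conv_def using Jeps_nonneg[OF e] by (intro Bochner_Integration.integral_nonneg) auto
  have c1: "conv (Jeps e) ?P x \<le> C - 1" for x
  proof -
    have "conv (Jeps e) ?P x \<le> (LINT y|lborel. Jeps e (x - y) * (C - 1))"
      unfolding conv_def
    proof (rule integral_mono)
      show "Jeps e (x - y) * ?P y \<le> Jeps e (x - y) * (C - 1)" for y
        using g(4)[of y] C Jeps_nonneg[OF e] by (intro mult_left_mono) auto
      show "integrable lborel (\<lambda>y. Jeps e (x - y) * (C - 1))"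
        by (rule conv_integrable_cont[OF kJ continuous_on_const])
    qed (rule conv_integrable_pt[OF kJ p])
    also have "\<dots> = C - 1"
      using mass_Jeps[OF e] lborel_integral_reflect[of "Jeps e" x] kern_measurable[OF kJ] by simp
    finally show ?thesis .
  qed
  have "0 \<le> ?G x \<and> ?G x \<le> C" for x
  proof
    have "l * ?P x \<le> 1 * ?P x" using l by (intro mult_right_mono) auto
    then have "l * ?P x \<le> g x" using g(3)[of x] by auto
    then show "0 \<le> ?G x" using mult_nonneg_nonneg[OF l(1) c0[of x]] by linarith
    have lc: "l * conv (Jeps e) ?P x \<le> l * (C - 1)" using c1 l by (intro mult_left_mono) auto
    show "?G x \<le> C"
    proof (cases "1 \<le> g x")
      case True
      have "(1 - l) * (g x - 1) \<le> (1 - l) * (C - 1)" using l g(4)[of x] by (intro mult_left_mono) auto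
      then show ?thesis using lc True by (simp add: algebra_simps)
    next
      case False
      have "l * (C - 1) \<le> 1 * (C - 1)" using l C by (intro mult_right_mono) auto
      then show ?thesis using lc False by simp
    qed
  qed
  moreover have "integrable lborel ?G" using g p conv_integrable[OF kJ p] by simp
  ultimately show ?thesis
    unfolding g(2) euler_abs_L1[OF e g(1)] l_def[symmetric] band_def by blast
qed

text \<open>An Euler step is nonexpansive and maps the band into itself, so the distance to the band
  does not grow from its initial value zero. Distance zero forces the bounds because the violation
  \<open>G\<close> is dominated by the \<open>L1\<close> distance to any member.\<close>

lemma flow_band:
  assumes e: "0 < e" and u: "flow e u" and C: "1 \<le> C" and u0: "u 0 \<in> band C" and t: "0 \<le> t"
    and g: "integrable lborel g" "u t = abs_L1 g"
  shows "AE x in lborel. 0 \<le> g x \<and> g x \<le> C"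
proof -
  let ?p = "\<lambda>v. infdist v (band C)"
  have ne: "band C \<noteq> {}" using u0 by blast
  have "?p (u t) \<le> ?p (u 0)"
  proof (rule euler_decreasing[where D="\<lambda>s. rhs e (u s)" and L=1 and p="?p" and \<eta>="e\<^sup>2", OF t])
    fix s assume "0 \<le> s" "s \<le> t"
    then show "(u has_vector_derivative rhs e (u s)) (at s within {0..t})"
      using u by (auto simp: flow_def)
  next
    fix y z :: "(real ^ 'n) L1"
    show "\<bar>?p y - ?p z\<bar> \<le> 1 * norm (y - z)"
      using infdist_triangle[of y "band C" z] infdist_triangle[of z "band C" y]
      by (simp add: dist_norm norm_minus_commute abs_le_iff)
  next
    fix s h assume h: "0 < h" "h < e\<^sup>2"
    have "?p (u s + h *\<^sub>R rhs e (u s)) \<le> dist (u s) k" if k: "k \<in> band C" for k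
    proof -
      have "k + h *\<^sub>R rhs e k \<in> band C" using band_euler[OF e _ _ C k] h by simp
      then have "?p (u s + h *\<^sub>R rhs e (u s)) \<le> dist (u s + h *\<^sub>R rhs e (u s)) (k + h *\<^sub>R rhs e k)" by (rule infdist_le)
      also have "\<dots> \<le> dist (u s) k" using euler_nonexpansive[OF e, of h "u s" k] h by (simp add: dist_norm)
      finally show ?thesis .
    qed
    then show "?p (u s + h *\<^sub>R rhs e (u s)) \<le> ?p (u s)"
      using ne by (subst (2) infdist_notempty) (auto intro: cINF_greatest)
  qed (use e in auto)
  moreover have "?p (u 0) = 0" using u0 by simp
  ultimately have z: "?p (u t) = 0" using infdist_nonneg[of "u t" "band C"] by linarith
  define G where "G x = max (- g x) (max 0 (g x - C))" for x
  have G0: "0 \<le> G x" for x by (simp add: G_def)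
  have Gi: "integrable lborel G"
  proof (rule Bochner_Integration.integrable_bound[of _ g])
    have [measurable]: "g \<in> borel_measurable borel" using g by (auto dest: borel_measurable_integrable)
    show "G \<in> borel_measurable lborel" unfolding G_def by measurable
    show "AE x in lborel. norm (G x) \<le> norm (g x)" using C by (intro AE_I2) (auto simp: G_def)
  qed (rule g)
  have "(LINT x|lborel. G x) \<le> 0"
  proof (rule field_le_epsilon)
    fix d :: real assume "0 < d"
    then have "\<exists>k\<in>band C. dist (u t) k < d"
      using z ne cInf_less_iff[of "dist (u t) ` band C" d] by (auto simp: infdist_notempty intro: bdd_belowI2[of _ 0])
    then obtain k where k: "integrable lborel k" "\<And>x. 0 \<le> k x" "\<And>x. k x \<le> C" "dist (u t) (abs_L1 k) < d"
      by (auto simp: band_def)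
    have "(LINT x|lborel. G x) \<le> (LINT x|lborel. \<bar>g x - k x\<bar>)"
    proof (rule integral_mono[OF Gi integrable_abs[OF Bochner_Integration.integrable_diff[OF g(1) k(1)]]])
      show "G x \<le> \<bar>g x - k x\<bar>" for x using k(2)[of x] k(3)[of x] by (auto simp: G_def)
    qed
    also have "\<dots> = dist (u t) (abs_L1 k)"
      by (simp only: g(2) dist_norm minus_abs_L1[OF g(1) k(1)] norm_abs_L1[OF Bochner_Integration.integrable_diff[OF g(1) k(1)]])
    finally show "(LINT x|lborel. G x) \<le> 0 + d" using k(4) by simp
  qed
  then have "(LINT x|lborel. G x) = 0" using G0 by (intro antisym Bochner_Integration.integral_nonneg) auto
  then have "AE x in lborel. G x = 0" using integral_nonneg_eq_0_iff_AE[OF Gi] G0 by simp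
  then show ?thesis by eventually_elim (auto simp: G_def max_def split: if_splits)
qed

text \<open>Points where \<open>u\<close> exceeds \<open>1\<close> keep this property, since there \<open>u - 1\<close> decays at most exponentially.\<close>

lemma retention:
  assumes e: "0 < e" and u: "flow e u" and [measurable]: "A \<in> sets borel" and st: "0 \<le> s" "s \<le> t"
    and zero: "pair (indicator A) (pos_part_minus_one (u t)) = 0"
  shows "pair (indicator A) (pos_part_minus_one (u s)) = 0"
proof -
  let ?p = "\<lambda>v. pair (indicator A) (pos_part_minus_one v)"
  define c where "c = 1 / e\<^sup>2"
  have c: "0 < c" using e by (simp add: c_def)
  have lip: "\<bar>?p v - ?p w\<bar> \<le> norm (v - w)" for v w
  proof -
    have m: "(indicator A :: real ^ 'n \<Rightarrow> real) \<in> borel_measurable borel" by simp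
    have b: "\<bar>indicator A x :: real\<bar> \<le> 1" for x :: "real ^ 'n" by (simp add: indicator_def)
    note bl = pair_bounded_linear(1)[OF m b] and bd = pair_bounded_linear(2)[OF m b]
    have "\<bar>?p v - ?p w\<bar> = \<bar>pair (indicator A) (pos_part_minus_one v - pos_part_minus_one w)\<bar>"
      using linear_diff[OF bounded_linear.linear[OF bl]] by simp
    also have "\<dots> \<le> norm (v - w)" using bd[of "pos_part_minus_one v - pos_part_minus_one w"] pos_part_lipschitz[of v w] by simp
    finally show ?thesis .
  qed
  \<comment> \<open>One Euler step removes at most the fraction \<open>c * h\<close> of the excess,
    while the incoming average is nonnegative.\<close>
  have p0: "0 \<le> ?p v" and eul: "0 \<le> h \<Longrightarrow> h \<le> e\<^sup>2 \<Longrightarrow> (1 - c * h) * ?p v \<le> ?p (v + h *\<^sub>R rhs e v)" for v h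
  proof -
    obtain g where g: "integrable lborel g" "v = abs_L1 g" using L1_cases by metis
    note p = integrable_pos_part_lborel[OF g(1)] and kJ = kern_Jeps[OF e]
    have pv: "?p v = (LINT x|lborel. indicator A x * max (g x - 1) 0)"
      unfolding g(2) pos_part_abs_L1[OF g(1)] by (subst pair_abs_L1[OF p]) auto
    show "0 \<le> ?p v" unfolding pv by (intro Bochner_Integration.integral_nonneg) auto
    assume h: "0 \<le> h" "h \<le> e\<^sup>2"
    define l where "l = h / e\<^sup>2"
    have l: "0 \<le> l" "l \<le> 1" "c * h = l" using h e by (auto simp: l_def c_def)
    let ?P = "\<lambda>x. max (g x - 1) 0"
    let ?G = "\<lambda>x. g x - l * ?P x + l * conv (Jeps e) ?P x"
    have Gi: "integrable lborel ?G" using g p conv_integrable[OF kJ p] by simp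
    note pG = integrable_pos_part_lborel[OF Gi]
    have pe: "?p (v + h *\<^sub>R rhs e v) = (LINT x|lborel. indicator A x * max (?G x - 1) 0)"
      unfolding g(2) euler_abs_L1[OF e g(1)] l_def[symmetric] pos_part_abs_L1[OF Gi]
      by (subst pair_abs_L1[OF pG]) auto
    have ind: "integrable lborel (\<lambda>x. indicator A x * F x)" if "integrable lborel F" for F :: "real ^ 'n \<Rightarrow> real"
      using integrable_mult_indicator[OF _ that, of A] by simp
    have c0: "0 \<le> conv (Jeps e) ?P x" for x
      unfolding conv_def using Jeps_nonneg[OF e] by (intro Bochner_Integration.integral_nonneg) auto
    have "(1 - c * h) * ?p v = (LINT x|lborel. (1 - l) * (indicator A x * ?P x))"
      unfolding pv l by simp
    also have "\<dots> \<le> (LINT x|lborel. indicator A x * max (?G x - 1) 0)"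
    proof (rule integral_mono)
      fix x
      have "(1 - l) * ?P x \<le> max (?G x - 1) 0"
      proof (cases "1 \<le> g x")
        case True
        then show ?thesis using mult_nonneg_nonneg[OF l(1) c0[of x]] by (simp add: algebra_simps)
      qed simp
      then have "indicator A x * ((1 - l) * ?P x) \<le> indicator A x * max (?G x - 1) 0"
        by (rule mult_left_mono) simp
      then show "(1 - l) * (indicator A x * ?P x) \<le> indicator A x * max (?G x - 1) 0"
        by (simp only: mult.left_commute)
    qed (use ind[OF p] ind[OF pG] in auto)
    also have "\<dots> = ?p (v + h *\<^sub>R rhs e v)" by (rule pe[symmetric])
    finally show "(1 - c * h) * ?p v \<le> ?p (v + h *\<^sub>R rhs e v)" .
  qed
  have der: "(u has_vector_derivative rhs e (u r)) (at r within {s..t})" if "s \<le> r" "r \<le> t" for r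
  proof -
    have "0 \<le> r" using that st by linarith
    then have "(u has_vector_derivative rhs e (u r)) (at r within {0..t})"
      using u that(2) unfolding flow_def by blast
    then show ?thesis by (rule has_vector_derivative_within_subset) (use st in auto)
  qed
  have uc: "continuous_on {s..t} u"
    using der by (intro continuous_on_vector_derivative) auto
  have pc: "continuous_on UNIV ?p"
    unfolding continuous_on_iff
  proof (intro ballI allI impI)
    fix v :: "(real ^ 'n) L1" and d :: real assume "0 < d"
    then show "\<exists>d'>0. \<forall>w\<in>UNIV. dist w v < d' \<longrightarrow> dist (?p w) (?p v) < d"
      using lip by (intro exI[of _ d]) (auto simp: dist_real_def dist_norm intro: le_less_trans)
  qed
  \<comment> \<open>The exponential weight compensates the decay at rate \<open>c\<close>; the sign
    turns growth into the monotonicity that the criterion provides.\<close>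
  have "- exp (c * t) * ?p (u t) \<le> - exp (c * s) * ?p (u s)"
  proof (rule dini_decreasing[OF st(2)])
    show "continuous_on {s..t} (\<lambda>r. - exp (c * r) * ?p (u r))"
      by (intro continuous_intros continuous_on_compose2[OF pc uc]) auto
    fix r d assume r: "s \<le> r" "r < t" and d: "(0::real) < d"
    define E where "E = exp (c * (r + 1))"
    have E: "0 < E" by (simp add: E_def)
    have dE: "0 < d / (2 * E)" using d E by simp
    have rt: "r \<le> t" using r by simp
    from vector_derivative_step[OF der[OF r(1) rt] r(1) dE] obtain d1 where d1: "0 < d1"
      "\<And>h. 0 < h \<Longrightarrow> h < d1 \<Longrightarrow> r + h \<le> t \<Longrightarrow> norm (u (r + h) - (u r + h *\<^sub>R rhs e (u r))) \<le> d / (2 * E) * h" by blast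
    \<comment> \<open>Steps below \<open>d2\<close> keep the second-order loss
      \<open>c\<^sup>2 * h\<^sup>2\<close>, from \<open>(1 + c * h) * (1 - c * h)\<close>, within
      \<open>d / 2 * h\<close>. The \<open>+ 1\<close> keeps the denominator positive.\<close>
    define d2 where "d2 = d / (2 * (E * c\<^sup>2 * (?p (u r) + 1)))"
    have d2: "0 < d2" using d E c p0[of "u r"] by (simp add: d2_def add_nonneg_pos)
    show "\<exists>d'>0. \<forall>h. 0 < h \<longrightarrow> h < d' \<longrightarrow> r + h \<le> t \<longrightarrow> - exp (c * (r + h)) * ?p (u (r + h)) \<le> - exp (c * r) * ?p (u r) + d * h"
    proof (intro exI[of _ "min (min d1 d2) (min 1 (e\<^sup>2))"] conjI allI impI)
      fix h assume h: "0 < h" "h < min (min d1 d2) (min 1 (e\<^sup>2))" "r + h \<le> t"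
      have "\<bar>?p (u (r + h)) - ?p (u r + h *\<^sub>R rhs e (u r))\<bar> \<le> d / (2 * E) * h"
        using lip[of "u (r + h)" "u r + h *\<^sub>R rhs e (u r)"] d1(2)[of h] h by simp
      moreover have "(1 - c * h) * ?p (u r) \<le> ?p (u r + h *\<^sub>R rhs e (u r))" using h by (intro eul) auto
      ultimately have low: "(1 - c * h) * ?p (u r) - d / (2 * E) * h \<le> ?p (u (r + h))" by linarith
      have ex: "exp (c * (r + h)) = exp (c * r) * exp (c * h)" by (simp add: distrib_left exp_add)
      have exE: "exp (c * (r + h)) \<le> E" "exp (c * r) \<le> E" using h c by (auto simp: E_def)
      have ch: "0 \<le> 1 - c * h" using h e by (simp add: c_def field_simps)
      have "(1 + c * h) * (1 - c * h) \<le> exp (c * h) * (1 - c * h)"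
        using ch exp_ge_add_one_self[of "c * h"] by (intro mult_right_mono) auto
      then have e2: "1 - c\<^sup>2 * h\<^sup>2 \<le> exp (c * h) * (1 - c * h)" by (simp add: algebra_simps power2_eq_square)
      have "exp (c * r) * ?p (u r) - E * (c\<^sup>2 * h\<^sup>2) * ?p (u r) \<le> exp (c * r) * ?p (u r) - exp (c * r) * (c\<^sup>2 * h\<^sup>2) * ?p (u r)"
        using exE p0[of "u r"] by (intro diff_left_mono mult_right_mono) auto
      also have "\<dots> = exp (c * r) * ((1 - c\<^sup>2 * h\<^sup>2) * ?p (u r))" by (simp add: algebra_simps)
      also have "\<dots> \<le> exp (c * r) * ((exp (c * h) * (1 - c * h)) * ?p (u r))"
        using e2 p0[of "u r"] by (intro mult_left_mono mult_right_mono) auto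
      also have "\<dots> = exp (c * (r + h)) * ((1 - c * h) * ?p (u r))" by (simp add: ex)
      also have "\<dots> \<le> exp (c * (r + h)) * (?p (u (r + h)) + d / (2 * E) * h)"
        using low by (intro mult_left_mono) auto
      also have "\<dots> \<le> exp (c * (r + h)) * ?p (u (r + h)) + E * (d / (2 * E) * h)"
      proof -
        have "exp (c * (r + h)) * (d / (2 * E) * h) \<le> E * (d / (2 * E) * h)"
          by (rule mult_right_mono[OF exE(1)]) (use d E h in simp)
        moreover have "exp (c * (r + h)) * (?p (u (r + h)) + d / (2 * E) * h)
          = exp (c * (r + h)) * ?p (u (r + h)) + exp (c * (r + h)) * (d / (2 * E) * h)"
          by (rule distrib_left)
        ultimately show ?thesis by linarith
      qed
      also have "E * (d / (2 * E) * h) = d / 2 * h" using E by simp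
      finally have 1: "exp (c * r) * ?p (u r) - E * (c\<^sup>2 * h\<^sup>2) * ?p (u r) \<le> exp (c * (r + h)) * ?p (u (r + h)) + d / 2 * h" .
      have "E * (c\<^sup>2 * h\<^sup>2) * ?p (u r) = (E * c\<^sup>2 * ?p (u r) * h) * h" by (simp add: power2_eq_square)
      also have "\<dots> \<le> (E * c\<^sup>2 * (?p (u r) + 1) * d2) * h"
        using h E c p0[of "u r"] by (intro mult_right_mono mult_mono) auto
      also have "E * c\<^sup>2 * (?p (u r) + 1) * d2 = d / 2"
      proof -
        have "0 < E * c\<^sup>2 * (?p (u r) + 1)" using E c p0[of "u r"] by (simp add: add_nonneg_pos)
        moreover have "Y * (d / (2 * Y)) = d / 2" if "0 < Y" for Y using that by simp
        ultimately show ?thesis unfolding d2_def by blast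
      qed
      finally show "- exp (c * (r + h)) * ?p (u (r + h)) \<le> - exp (c * r) * ?p (u r) + d * h" using 1 by simp
    qed (use d1 d2 e in auto)
  qed
  then have "exp (c * s) * ?p (u s) \<le> 0" using zero by simp
  then show ?thesis using p0[of "u s"] by (simp add: mult_le_0_iff)
qed

end

section \<open>Mollification\<close>

text \<open>Take a compact \<open>K\<close> inside \<open>A\<close> and an open \<open>U\<close>
  around it with nearly the same measure. A shift shorter than the distance from \<open>K\<close> to
  the complement of \<open>U\<close> changes membership in \<open>A\<close> only on
  \<open>U - K\<close> or on its translate.\<close>

lemma translation_indicator:
  fixes A :: "'a::euclidean_space set"
  assumes A: "A \<in> sets lborel" "emeasure lborel A < \<infinity>" and e: "0 < (e::real)"
  shows "\<exists>d>0. \<forall>a. norm a < d \<longrightarrow> (LINT x|lborel. \<bar>indicator A (x + a) - indicator A x :: real\<bar>) < e"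
proof -
  have AL: "A \<in> lmeasurable" using A by (auto simp: fmeasurable_def)
  have e3: "0 < e / 3" using e by simp
  obtain U where U: "open U" "A \<subseteq> U" "U - A \<in> lmeasurable" "emeasure lebesgue (U - A) < ennreal (e / 6)"
    using sets_lebesgue_outer_open[of A "e / 6"] AL e by (auto simp: fmeasurableD)
  \<comment> \<open>Restricting Lebesgue measure to \<open>A\<close> gives a finite measure, as
    \<open>inner_regular\<close> requires.\<close>
  define M where "M = density lborel (indicator A)"
  have eM: "emeasure M B = emeasure lborel (A \<inter> B)" if "B \<in> sets borel" for B
    unfolding M_def using that A by (subst emeasure_density) (auto simp: indicator_inter_arith[symmetric] Int_commute)
  have "emeasure M A = (SUP K \<in> {K. K \<subseteq> A \<and> compact K}. emeasure M K)"
    using A eM[of UNIV] by (intro inner_regular) (auto simp: M_def)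
  moreover have "emeasure M A = emeasure lborel A" using eM[of A] A by simp
  ultimately have sup: "emeasure lborel A = (SUP K \<in> {K. K \<subseteq> A \<and> compact K}. emeasure M K)" by simp
  have "\<exists>K. K \<subseteq> A \<and> compact K \<and> measure lborel A - e / 6 < measure lborel K"
  proof (cases "measure lborel A - e / 6 < 0")
    case True
    then show ?thesis by (intro exI[of _ "{}"]) auto
  next
    case False
    have eA: "emeasure lborel A = ennreal (measure lborel A)" using A(2) by (simp add: emeasure_eq_ennreal_measure)
    have "ennreal (measure lborel A - e / 6) < emeasure lborel A"
      unfolding eA using e False by (simp add: ennreal_less_iff)
    then obtain K where K: "K \<subseteq> A" "compact K" "ennreal (measure lborel A - e / 6) < emeasure M K"
      unfolding sup less_SUP_iff by auto
    have "emeasure M K = emeasure lborel K"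
      using eM[of K] K by (simp add: Int_absorb1 borel_compact)
    moreover have "emeasure lborel K = ennreal (measure lborel K)"
      using K(2) emeasure_compact_finite[of K] by (simp add: emeasure_eq_ennreal_measure)
    ultimately show ?thesis using K False by (auto simp: ennreal_less_iff)
  qed
  then obtain K where K: "K \<subseteq> A" "compact K" "measure lborel A - e / 6 < measure lborel K" by blast
  define D where "D = U - K"
  have Dm: "D \<in> sets borel" using U K by (auto simp: D_def borel_compact)
  have KL: "K \<in> lmeasurable" using K(2) by (rule lmeasurable_compact)
  have DD: "D = (U - A) \<union> (A - K)" using U K by (auto simp: D_def)
  have DL: "D \<in> lmeasurable" unfolding DD by (intro fmeasurable.Un U(3) fmeasurable_Diff AL fmeasurableD[OF KL])
  have "measure lebesgue D \<le> measure lebesgue (U - A) + measure lebesgue (A - K)"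
    unfolding DD using U AL KL by (intro measure_Un_le) (auto simp: fmeasurableD)
  also have "measure lebesgue (U - A) < e / 6"
    using U(3,4) e by (simp add: emeasure_eq_measure2 ennreal_less_iff)
  also have "measure lebesgue (A - K) = measure lebesgue A - measure lebesgue K"
    using AL KL K(1) by (intro measurable_measure_Diff) (auto simp: fmeasurableD)
  finally have mD: "measure lborel D < e / 3"
    using K(3) A Dm K(2) by (simp add: borel_compact)
  have "K \<inter> - U = {}" using K U by auto
  then obtain d where d: "0 < d" "\<And>x y. x \<in> K \<Longrightarrow> y \<in> - U \<Longrightarrow> d \<le> dist x y"
    using separate_compact_closed[of K "- U"] K(2) U(1) by (auto simp: closed_Compl)
  show ?thesis
  proof (intro exI[of _ d] conjI d(1) allI impI)
    fix a :: 'a assume a: "norm a < d"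
    have DI: "integrable lborel (indicator D :: 'a \<Rightarrow> real)"
      using DL Dm by (auto simp: integrable_indicator_iff fmeasurable_def)
    have DI2: "integrable lborel (\<lambda>x. indicator D (x + a) :: real)"
      using DI lborel_integrable_shift[of "indicator D" a] Dm by simp
    have pt: "\<bar>indicator A (x + a) - indicator A x :: real\<bar> \<le> indicator D x + indicator D (x + a)" for x
    proof -
      have KU: "y \<in> U" if "x \<in> K" "dist x y < d" for x y using d(2)[OF that(1), of y] that(2) by force
      have "x + a \<in> A \<Longrightarrow> x \<notin> A \<Longrightarrow> x \<in> D \<or> x + a \<in> D"
        using KU[of "x + a" x] a U K by (auto simp: D_def dist_norm)
      moreover have "x + a \<notin> A \<Longrightarrow> x \<in> A \<Longrightarrow> x \<in> D \<or> x + a \<in> D"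
        using KU[of x "x + a"] a U K by (auto simp: D_def dist_norm)
      ultimately show ?thesis by (auto simp: indicator_def)
    qed
    have AI: "integrable lborel (indicator A :: 'a \<Rightarrow> real)" using A by (auto simp: integrable_indicator_iff)
    have "(LINT x|lborel. \<bar>indicator A (x + a) - indicator A x :: real\<bar>) \<le> (LINT x|lborel. indicator D x + indicator D (x + a))"
      using AI lborel_integrable_shift[of "indicator A" a] A DI DI2
      by (intro integral_mono pt integrable_abs Bochner_Integration.integrable_diff Bochner_Integration.integrable_add) auto
    also have "\<dots> = measure lborel D + measure lborel D"
      using DI DI2 lborel_integral_shift[of "indicator D" a] Dm by simp
    also have "\<dots> < e" using mD e by simp
    finally show "(LINT x|lborel. \<bar>indicator A (x + a) - indicator A x :: real\<bar>) < e" .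
  qed
qed

text \<open>The property holds for indicators and passes to sums and to \<open>L1\<close> limits,
  because a shift preserves the norm of the approximation error.\<close>

lemma translation_continuous:
  fixes g :: "'a::euclidean_space \<Rightarrow> real"
  assumes "integrable lborel g" and "0 < (e::real)"
  shows "\<exists>d>0. \<forall>a. norm a < d \<longrightarrow> (LINT x|lborel. \<bar>g (x + a) - g x\<bar>) < e"
  using assms
proof (induction arbitrary: e rule: integrable_induct)
  case (base A c)
  have A: "A \<in> sets lborel" "emeasure lborel A < \<infinity>" using base by auto
  have "0 < e / (\<bar>c\<bar> + 1)" using base by simp
  from translation_indicator[OF A this] obtain d where d: "0 < d"
    "\<And>a. norm a < d \<Longrightarrow> (LINT x|lborel. \<bar>indicator A (x + a) - indicator A x :: real\<bar>) < e / (\<bar>c\<bar> + 1)" by blast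
  show ?case
  proof (intro exI[of _ d] conjI d(1) allI impI)
    fix a :: 'a assume a: "norm a < d"
    have "\<bar>indicat_real A (x + a) *\<^sub>R c - indicat_real A x *\<^sub>R c\<bar> = \<bar>c\<bar> * \<bar>indicator A (x + a) - indicator A x\<bar>" for x
      by (simp add: indicator_def)
    then have "(LINT x|lborel. \<bar>indicat_real A (x + a) *\<^sub>R c - indicat_real A x *\<^sub>R c\<bar>)
      = (LINT x|lborel. \<bar>c\<bar> * \<bar>indicator A (x + a) - indicator A x\<bar>)"
      by (simp only:)
    also have "\<dots> = \<bar>c\<bar> * (LINT x|lborel. \<bar>indicator A (x + a) - indicator A x\<bar>)" by simp
    also have "\<dots> \<le> (\<bar>c\<bar> + 1) * (LINT x|lborel. \<bar>indicator A (x + a) - indicator A x\<bar>)"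
      by (intro mult_right_mono Bochner_Integration.integral_nonneg) auto
    also have "\<dots> < (\<bar>c\<bar> + 1) * (e / (\<bar>c\<bar> + 1))" using d(2)[OF a] by (intro mult_strict_left_mono) auto
    also have "\<dots> = e" by simp
    finally show "(LINT x|lborel. \<bar>indicat_real A (x + a) *\<^sub>R c - indicat_real A x *\<^sub>R c\<bar>) < e" .
  qed
next
  case (add f g)
  have "0 < e / 2" using add by simp
  from add.IH(1)[OF this] add.IH(2)[OF this] obtain d1 d2 where d: "0 < d1" "0 < d2"
    "\<And>a. norm a < d1 \<Longrightarrow> (LINT x|lborel. \<bar>f (x + a) - f x\<bar>) < e / 2"
    "\<And>a. norm a < d2 \<Longrightarrow> (LINT x|lborel. \<bar>g (x + a) - g x\<bar>) < e / 2" by blast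
  have [measurable]: "f \<in> borel_measurable borel" "g \<in> borel_measurable borel"
    using add by (auto dest: borel_measurable_integrable)
  show ?case
  proof (intro exI[of _ "min d1 d2"] conjI allI impI)
    fix a :: 'a assume a: "norm a < min d1 d2"
    have i: "integrable lborel (\<lambda>x. \<bar>f (x + a) - f x\<bar>)" "integrable lborel (\<lambda>x. \<bar>g (x + a) - g x\<bar>)"
      "integrable lborel (\<lambda>x. \<bar>(f (x + a) + g (x + a)) - (f x + g x)\<bar>)"
      using add.hyps by (auto simp: lborel_integrable_shift)
    have "(LINT x|lborel. \<bar>(f (x + a) + g (x + a)) - (f x + g x)\<bar>) \<le> (LINT x|lborel. \<bar>f (x + a) - f x\<bar> + \<bar>g (x + a) - g x\<bar>)"
      using i by (intro integral_mono) auto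
    also have "\<dots> < e" using i d(3)[of a] d(4)[of a] a by simp
    finally show "(LINT x|lborel. \<bar>(f (x + a) + g (x + a)) - (f x + g x)\<bar>) < e" .
  qed (use d in auto)
next
  case (lim g s)
  have [measurable]: "g \<in> borel_measurable borel" "s n \<in> borel_measurable borel" for n
    using lim by (auto dest: borel_measurable_integrable)
  have "(\<lambda>n. LINT x|lborel. \<bar>s n x - g x\<bar>) \<longlonglongrightarrow> (LINT x|(lborel :: 'a measure). 0)"
  proof (rule integral_dominated_convergence[where w="\<lambda>x. 3 * norm (g x)"])
    show "AE x in lborel. (\<lambda>n. \<bar>s n x - g x\<bar>) \<longlonglongrightarrow> 0"
    proof (rule AE_I2)
      fix x
      have "(\<lambda>n. s n x - g x) \<longlonglongrightarrow> g x - g x" using lim.hyps(2)[of x] by (intro tendsto_intros) simp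
      then show "(\<lambda>n. \<bar>s n x - g x\<bar>) \<longlonglongrightarrow> 0" by (intro tendsto_rabs_zero) simp
    qed
    show "AE x in lborel. norm \<bar>s n x - g x\<bar> \<le> 3 * norm (g x)" for n
    proof (rule AE_I2)
      fix x show "norm \<bar>s n x - g x\<bar> \<le> 3 * norm (g x)" using lim.hyps(3)[of x n] by simp
    qed
  qed (use lim.hyps in auto)
  moreover have "0 < e / 3" using lim by simp
  ultimately have "\<forall>\<^sub>F n in sequentially. (LINT x|lborel. \<bar>s n x - g x\<bar>) < e / 3"
    by (intro order_tendstoD(2)[where y=0]) auto
  then obtain n where n: "(LINT x|lborel. \<bar>s n x - g x\<bar>) < e / 3" by (auto simp: eventually_sequentially)
  from lim.IH[OF \<open>0 < e / 3\<close>] obtain d where d: "0 < d"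
    "\<And>a. norm a < d \<Longrightarrow> (LINT x|lborel. \<bar>s n (x + a) - s n x\<bar>) < e / 3" by blast
  show ?case
  proof (intro exI[of _ d] conjI d(1) allI impI)
    fix a :: 'a assume a: "norm a < d"
    have i: "integrable lborel (\<lambda>x. \<bar>s n x - g x\<bar>)" "integrable lborel (\<lambda>x. \<bar>s n (x + a) - s n x\<bar>)"
      "integrable lborel (\<lambda>x. \<bar>s n (x + a) - g (x + a)\<bar>)" "integrable lborel (\<lambda>x. \<bar>g (x + a) - g x\<bar>)"
      using lim.hyps by (auto simp: lborel_integrable_shift)
    have sh: "(LINT x|lborel. \<bar>s n (x + a) - g (x + a)\<bar>) = (LINT x|lborel. \<bar>s n x - g x\<bar>)"
      by (rule lborel_integral_shift[of "\<lambda>x. \<bar>s n x - g x\<bar>"]) measurable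
    have "(LINT x|lborel. \<bar>g (x + a) - g x\<bar>)
      \<le> (LINT x|lborel. \<bar>s n (x + a) - g (x + a)\<bar> + \<bar>s n (x + a) - s n x\<bar> + \<bar>s n x - g x\<bar>)"
      using i by (intro integral_mono) auto
    also have "\<dots> = (LINT x|lborel. \<bar>s n x - g x\<bar>) + (LINT x|lborel. \<bar>s n (x + a) - s n x\<bar>) + (LINT x|lborel. \<bar>s n x - g x\<bar>)"
      using i by (simp add: sh)
    also have "\<dots> < e" using n d(2)[OF a] by simp
    finally show "(LINT x|lborel. \<bar>g (x + a) - g x\<bar>) < e" .
  qed
qed

lemma trans_continuous:
  fixes u :: "'a::euclidean_space L1"
  assumes "0 < (e::real)"
  shows "\<exists>d>0. \<forall>a. norm a < d \<longrightarrow> norm (trans_L1 a u - u) < e"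
proof -
  obtain g where g: "integrable lborel g" "u = abs_L1 g" using L1_cases by metis
  have [measurable]: "g \<in> borel_measurable borel" using g by (auto dest: borel_measurable_integrable)
  have gs: "integrable lborel (\<lambda>x. g (x + a))" for a using g by (simp add: lborel_integrable_shift)
  have "norm (trans_L1 a u - u) = (LINT x|lborel. \<bar>g (x + a) - g x\<bar>)" for a
    unfolding g(2) trans_abs_L1[OF g(1)] minus_abs_L1[OF gs g(1)]
    by (rule norm_abs_L1) (intro Bochner_Integration.integrable_diff gs g)
  then show ?thesis using translation_continuous[OF g(1) assms] by simp
qed

text \<open>The mollification differs from \<open>g\<close> by the \<open>k\<close>-weighted mean of
  the differences between translates and \<open>g\<close>. Minkowski's integral inequality, here an
  exchange of nonnegative integrals, bounds its norm.\<close>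

lemma mollify_close:
  fixes k :: "'a::euclidean_space \<Rightarrow> real"
  assumes k: "kern k \<delta>" and ev: "\<And>x. k (- x) = k x" and pos: "\<And>x. 0 \<le> k x" and mass: "(LINT x|lborel. k x) = 1"
    and close: "\<And>a. norm a < \<delta> \<Longrightarrow> norm (trans_L1 a u - u) \<le> \<eta>"
  shows "norm (convolution_L1 (abs_L1 k) u - u) \<le> \<eta>"
proof -
  obtain g where g: "integrable lborel g" "u = abs_L1 g" using L1_cases by metis
  have [measurable]: "g \<in> borel_measurable borel" "k \<in> borel_measurable borel"
    using g kern_measurable[OF k] by (auto dest: borel_measurable_integrable)
  have gs: "integrable lborel (\<lambda>x. g (x + a))" for a using g by (simp add: lborel_integrable_shift)
  have d: "integrable lborel (\<lambda>x. g (x + a) - g x)" for a by (intro Bochner_Integration.integrable_diff gs g)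
  have nt: "(LINT x|lborel. \<bar>g (x + a) - g x\<bar>) = norm (trans_L1 a u - u)" for a
    unfolding g(2) trans_abs_L1[OF g(1)] minus_abs_L1[OF gs g(1)]
    by (rule norm_abs_L1[OF d, symmetric])
  have \<eta>: "0 \<le> \<eta>" using close[of 0] k by (simp add: kern_def) (metis norm_ge_zero order_trans)
  have nt2: "k z * (LINT x|lborel. \<bar>g (x + z) - g x\<bar>) \<le> k z * \<eta>" for z
  proof (cases "norm z < \<delta>")
    case True
    then show ?thesis unfolding nt using close pos by (intro mult_left_mono) auto
  next
    case False
    then show ?thesis using k by (simp add: kern_def)
  qed
  have kd: "integrable lborel (\<lambda>z. k z * (g (x + z) - g x))" for x
  proof -
    have "integrable lborel (\<lambda>z. k z * g (x + z))"
      using conv_integrable_pt[OF k g(1), of x] lborel_integrable_reflect[of "\<lambda>z. k (x - z) * g z" 0]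
        lborel_integrable_shift[of "\<lambda>z. k (x + z) * g (- z)" "- x"]
        lborel_integrable_reflect[of "\<lambda>z. k z * g (x - z)" 0] by (simp add: ev algebra_simps)
    then have "integrable lborel (\<lambda>z. k z * g (x + z) - g x * k z)"
      using kern_integrable[OF k] by simp
    then show ?thesis by (simp add: right_diff_distrib mult.commute)
  qed
  have cg: "conv k g x - g x = (LINT z|lborel. k z * (g (x + z) - g x))" for x
  proof -
    have "conv k g x - g x = (LINT z|lborel. k z * g (x + z)) - (LINT z|lborel. g x * k z)"
      using conv_plus[OF k ev, of g x] mass by simp
    also have "(LINT z|lborel. k z * g (x + z)) = (LINT z|lborel. k z * (g (x + z) - g x) + g x * k z)"
      by (simp add: algebra_simps)
    also have "\<dots> = (LINT z|lborel. k z * (g (x + z) - g x)) + (LINT z|lborel. g x * k z)"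
      using kd kern_integrable[OF k] by (intro Bochner_Integration.integral_add) auto
    finally show ?thesis by simp
  qed
  have "ennreal \<bar>conv k g x - g x\<bar> \<le> (\<integral>\<^sup>+z. ennreal (k z * \<bar>g (x + z) - g x\<bar>) \<partial>lborel)" for x
  proof -
    have "ennreal \<bar>conv k g x - g x\<bar> \<le> (\<integral>\<^sup>+z. ennreal (norm (k z * (g (x + z) - g x))) \<partial>lborel)"
      unfolding cg using integral_norm_bound_ennreal[OF kd[of x]] by simp
    then show ?thesis using pos by (simp add: abs_mult)
  qed
  then have "(\<integral>\<^sup>+x. ennreal \<bar>conv k g x - g x\<bar> \<partial>lborel) \<le> (\<integral>\<^sup>+x. \<integral>\<^sup>+z. ennreal (k z * \<bar>g (x + z) - g x\<bar>) \<partial>lborel \<partial>lborel)"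
    by (intro nn_integral_mono) auto
  also have "\<dots> = (\<integral>\<^sup>+z. \<integral>\<^sup>+x. ennreal (k z * \<bar>g (x + z) - g x\<bar>) \<partial>lborel \<partial>lborel)"
    by (rule lborel_pair.Fubini'[symmetric]) measurable
  also have "\<dots> = (\<integral>\<^sup>+z. ennreal (k z * (LINT x|lborel. \<bar>g (x + z) - g x\<bar>)) \<partial>lborel)"
  proof (rule nn_integral_cong)
    fix z
    show "(\<integral>\<^sup>+x. ennreal (k z * \<bar>g (x + z) - g x\<bar>) \<partial>lborel) = ennreal (k z * (LINT x|lborel. \<bar>g (x + z) - g x\<bar>))"
      using d[of z] pos by (subst nn_integral_eq_integral) auto
  qed
  also have "\<dots> \<le> (\<integral>\<^sup>+z. ennreal (k z * \<eta>) \<partial>lborel)"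
    using nt2 by (intro nn_integral_mono ennreal_leI) auto
  also have "\<dots> = ennreal \<eta>"
    using kern_integrable[OF k] pos \<eta> mass by (subst nn_integral_eq_integral) auto
  finally have le: "(\<integral>\<^sup>+x. ennreal \<bar>conv k g x - g x\<bar> \<partial>lborel) \<le> ennreal \<eta>" .
  have ci: "integrable lborel (\<lambda>x. conv k g x - g x)" using conv_integrable[OF k g(1)] g by simp
  have "ennreal (LINT x|lborel. \<bar>conv k g x - g x\<bar>) \<le> ennreal \<eta>"
    using le ci by (subst (asm) nn_integral_eq_integral) auto
  then have "(LINT x|lborel. \<bar>conv k g x - g x\<bar>) \<le> \<eta>" using \<eta> by (simp add: ennreal_le_iff)
  then show ?thesis
    unfolding g(2) convolution_abs_L1[OF k g(1)] minus_abs_L1[OF conv_integrable[OF k g(1)] g(1)]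
    by (simp add: norm_abs_L1[OF ci])
qed

text \<open>The cube of the positive part has a Lipschitz second derivative, so its second-order
  expansion keeps a cubic error even across the kink.\<close>

lemma cube_taylor:
  fixes p d :: real
  shows "\<bar>(max 0 (p - d)) ^ 3 - (max 0 p) ^ 3 + 3 * (max 0 p)\<^sup>2 * d - 3 * max 0 p * d\<^sup>2\<bar> \<le> \<bar>d\<bar> ^ 3"
proof -
  have ex: "(p - d) ^ 3 = p ^ 3 - 3 * p\<^sup>2 * d + 3 * p * d\<^sup>2 - d ^ 3"
    by (simp add: power3_eq_cube power2_eq_square algebra_simps)
  show ?thesis
  proof (cases "0 \<le> p")
    case p: True
    show ?thesis
    proof (cases "0 \<le> p - d")
      case True
      then show ?thesis using p ex by (simp add: max_def power_abs)
    next
      case False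
      have "(d - p) ^ 3 = - ((p - d) ^ 3)" by (simp add: power3_eq_cube algebra_simps)
      then have "- (p ^ 3) + 3 * p\<^sup>2 * d - 3 * p * d\<^sup>2 = (d - p) ^ 3 - d ^ 3" using ex by simp
      moreover have "0 \<le> (d - p) ^ 3" using False by (intro zero_le_power) auto
      moreover have "(d - p) ^ 3 \<le> d ^ 3" using False p by (intro power_mono) auto
      moreover have "(max 0 (p - d)) ^ 3 - (max 0 p) ^ 3 + 3 * (max 0 p)\<^sup>2 * d - 3 * max 0 p * d\<^sup>2
          = - (p ^ 3) + 3 * p\<^sup>2 * d - 3 * p * d\<^sup>2"
        using p False by (simp add: max_def)
      moreover have "\<bar>d\<bar> ^ 3 = d ^ 3" using p False by simp
      ultimately show ?thesis by (simp only: abs_le_iff) linarith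
    qed
  next
    case p: False
    show ?thesis
    proof (cases "0 \<le> p - d")
      case True
      have "(p - d) ^ 3 \<le> \<bar>d\<bar> ^ 3" using p True by (intro power_mono) auto
      moreover have "0 \<le> (p - d) ^ 3" using True by (rule zero_le_power)
      ultimately show ?thesis using p True by (simp add: max_def)
    next
      case False
      then show ?thesis using p by (simp add: max_def)
    qed
  qed
qed

text \<open>The exponent \<open>3\<close> is the least integer one with Lipschitz second
  derivatives, which makes the error of the discrete Laplacian linear in \<open>e\<close>; a power
  of a quadratic polynomial keeps the expansion explicit.\<close>

definition mollifier :: "real \<Rightarrow> 'a::euclidean_space \<Rightarrow> real"
  where "mollifier \<delta> x = (max 0 (\<delta>\<^sup>2 - x \<bullet> x)) ^ 3 / (LINT y|lborel. (max 0 (\<delta>\<^sup>2 - y \<bullet> (y :: 'a))) ^ 3)"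

lemma
  fixes \<delta> :: real
  assumes \<delta>: "0 < \<delta>"
  shows kern_mollifier: "kern (mollifier \<delta> :: 'a::euclidean_space \<Rightarrow> real) \<delta>"
    and mollifier_nonneg: "0 \<le> mollifier \<delta> (x :: 'a)"
    and mollifier_even: "mollifier \<delta> (- x) = mollifier \<delta> (x :: 'a)"
    and mollifier_mass: "(LINT x|lborel. mollifier \<delta> (x :: 'a)) = 1"
proof -
  let ?k = "\<lambda>x :: 'a. (max 0 (\<delta>\<^sup>2 - x \<bullet> x)) ^ 3"
  have k: "kern ?k \<delta>"
    unfolding kern_def
  proof (intro conjI allI impI \<delta>)
    show "continuous_on UNIV ?k" by (intro continuous_intros)
    fix x :: 'a assume "\<delta> \<le> norm x"
    then have "\<delta>\<^sup>2 \<le> (norm x)\<^sup>2" using \<delta> by (intro power_mono) auto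
    then show "?k x = 0" by (simp add: power2_norm_eq_inner)
  qed
  have ki: "integrable lborel ?k" by (rule kern_integrable[OF k])
  have "(LINT x|lborel. ?k x) \<noteq> 0"
  proof
    assume "(LINT x|lborel. ?k x) = 0"
    then have "AE x in lborel. ?k x = 0" using integral_nonneg_eq_0_iff_AE[OF ki] by simp
    then have "AE x in lborel. x \<notin> ball (0 :: 'a) \<delta>"
    proof eventually_elim
      fix x :: 'a assume x: "?k x = 0"
      show "x \<notin> ball 0 \<delta>"
      proof
        assume "x \<in> ball 0 \<delta>"
        then have "(norm x)\<^sup>2 < \<delta>\<^sup>2" by (intro power_strict_mono) auto
        then show False using x by (simp add: power2_norm_eq_inner)
      qed
    qed
    then have "emeasure lborel (ball (0 :: 'a) \<delta>) = 0"
      by (subst (asm) AE_iff_measurable[of "ball (0 :: 'a) \<delta>"]) auto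
    then have "measure lborel (ball (0 :: 'a) \<delta>) = 0" by (simp add: measure_def)
    then show False using content_ball_pos'[OF \<delta>, of 0] by simp
  qed
  moreover have "0 \<le> (LINT x|lborel. ?k x)" by (intro Bochner_Integration.integral_nonneg) auto
  ultimately have m: "0 < (LINT x|lborel. ?k x)" by linarith
  show "kern (mollifier \<delta> :: 'a \<Rightarrow> real) \<delta>"
    using k m unfolding kern_def mollifier_def[abs_def] by (auto intro!: continuous_intros)
  show "0 \<le> mollifier \<delta> (x :: 'a)" using m by (simp add: mollifier_def)
  show "mollifier \<delta> (- x) = mollifier \<delta> (x :: 'a)" by (simp add: mollifier_def)
  show "(LINT x|lborel. mollifier \<delta> (x :: 'a)) = 1" using m by (simp add: mollifier_def)
qed

context unit_kernel
begin

definition lap :: "real \<Rightarrow> (real ^ 'n \<Rightarrow> real) \<Rightarrow> real ^ 'n \<Rightarrow> real"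
  where "lap e g x = (1 / e\<^sup>2) * (conv (Jeps e) g x - g x)"

text \<open>\<open>l\<close> is \<open>m1 / 2\<close> times the Laplacian of the mollifier, written
  out. The odd moments vanish, the second ones are isotropic, and the fourth enters only the
  error.\<close>

lemma lap_mollifier_consistent:
  assumes \<delta>: "0 < \<delta>"
  obtains C l where "0 < C" "\<And>e x. 0 < e \<Longrightarrow> e \<le> 1 \<Longrightarrow> \<bar>lap e (mollifier \<delta>) x - l x\<bar> \<le> C * e"
    "\<And>x. \<delta> + R \<le> norm x \<Longrightarrow> l x = 0"
proof -
  define m where "m = (LINT y|lborel. (max 0 (\<delta>\<^sup>2 - y \<bullet> (y :: real ^ 'n))) ^ 3)"
  have m0: "0 \<le> m" unfolding m_def by (intro Bochner_Integration.integral_nonneg) auto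
  define b where "b x = max 0 (\<delta>\<^sup>2 - x \<bullet> (x :: real ^ 'n))" for x
  have b: "0 \<le> b x" "b x \<le> \<delta>\<^sup>2" for x by (auto simp: b_def)
  let ?N = "real CARD('n)"
  define l where "l x = (- 3 * (b x)\<^sup>2 * (?N * m1) + 3 * b x * (4 * m1 * (x \<bullet> x))) / m" for x
  \<comment> \<open>For \<open>norm x < \<delta> + R\<close>, \<open>norm z < R\<close> and
    \<open>e \<le> 1\<close>, the squared norm changes by at most \<open>e * Q\<close> between
    \<open>x\<close> and \<open>x + e *\<^sub>R z\<close>.\<close>
  define Q where "Q = 2 * (\<delta> + R) * R + R\<^sup>2"
  have Q: "0 < Q" using \<delta> R1 by (simp add: Q_def add_pos_pos)
  \<comment> \<open>\<open>3 * \<delta>\<^sup>2 * R ^ 4\<close> bounds the fourth-moment term and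
    \<open>Q ^ 3\<close> the remainder of the expansion of the cube.\<close>
  define C where "C = (3 * \<delta>\<^sup>2 * R ^ 4 + Q ^ 3) / m + 1"
  have C: "0 < C" using m0 Q by (simp add: C_def add_nonneg_pos)
  have mol: "mollifier \<delta> x = b x ^ 3 / m" for x by (simp add: mollifier_def b_def m_def)
  have bc: "continuous_on UNIV b" unfolding b_def by (intro continuous_intros)
  have lout: "b x = 0" if "\<delta> \<le> norm x" for x
  proof -
    have "\<delta>\<^sup>2 \<le> (norm x)\<^sup>2" using \<delta> that by (intro power_mono) auto
    then show ?thesis by (simp add: b_def power2_norm_eq_inner)
  qed
  have "\<bar>lap e (mollifier \<delta>) x - l x\<bar> \<le> C * e" if e: "0 < e" "e \<le> 1" for e x
  proof (cases "norm x < \<delta> + R")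
    case False
    have "b (x + e *\<^sub>R z) = 0" if "norm z < R" for z
    proof (rule lout)
      have "norm (e *\<^sub>R z) \<le> 1 * norm z" using mult_right_mono[OF e(2), of "norm z"] e(1) by simp
      moreover have "norm x \<le> norm (x + e *\<^sub>R z) + norm (e *\<^sub>R z)" using norm_triangle_ineq4[of "x + e *\<^sub>R z" "e *\<^sub>R z"] by simp
      ultimately show "\<delta> \<le> norm (x + e *\<^sub>R z)" using that False by linarith
    qed
    then have z0: "(\<lambda>z. J z * mollifier \<delta> (x + e *\<^sub>R z)) = (\<lambda>z. 0)"
      by (intro ext, case_tac "norm z < R") (auto simp: mol J_outside)
    then have "conv (Jeps e) (mollifier \<delta>) x = 0"
      unfolding conv_Jeps[OF e(1) kern_measurable[OF kern_mollifier[OF \<delta>]]] z0 by simp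
    moreover have "b x = 0" using False R1 by (intro lout) auto
    ultimately show ?thesis using C e by (simp add: lap_def mol l_def)
  next
    case True
    let ?d = "\<lambda>z. 2 * e * (x \<bullet> z) + e\<^sup>2 * (z \<bullet> z)"
    let ?T = "\<lambda>z. b x ^ 3 - 3 * (b x)\<^sup>2 * ?d z + 3 * b x * (?d z)\<^sup>2"
    have sq: "(x + e *\<^sub>R z) \<bullet> (x + e *\<^sub>R z) = x \<bullet> x + ?d z" for z
      by (simp add: algebra_simps inner_commute power2_eq_square)
    have dle: "\<bar>?d z\<bar> \<le> e * Q" if z: "norm z < R" for z
    proof -
      have "\<bar>x \<bullet> z\<bar> \<le> norm x * norm z" by (rule Cauchy_Schwarz_ineq2)
      also have "\<dots> \<le> (\<delta> + R) * R" using True z \<delta> R1 by (intro mult_mono) auto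
      finally have 1: "\<bar>2 * e * (x \<bullet> z)\<bar> \<le> 2 * e * ((\<delta> + R) * R)" using e by (simp add: abs_mult)
      have "z \<bullet> z \<le> R\<^sup>2" unfolding power2_norm_eq_inner[symmetric] using z by (intro power_mono) auto
      then have "e\<^sup>2 * (z \<bullet> z) \<le> e * R\<^sup>2"
        using e by (intro mult_mono) (auto simp: power2_eq_square mult_left_le)
      then have 2: "\<bar>e\<^sup>2 * (z \<bullet> z)\<bar> \<le> e * R\<^sup>2" by simp
      have "e * Q = 2 * e * ((\<delta> + R) * R) + e * R\<^sup>2" by (simp add: Q_def algebra_simps)
      then show ?thesis using 1 2 by linarith
    qed
    have pt: "\<bar>J z * b (x + e *\<^sub>R z) ^ 3 - J z * ?T z\<bar> \<le> J z * (e * Q) ^ 3" for z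
    proof (cases "norm z < R")
      case z: True
      have "b (x + e *\<^sub>R z) = max 0 ((\<delta>\<^sup>2 - x \<bullet> x) - ?d z)" unfolding b_def sq by (simp add: diff_diff_eq)
      then have "\<bar>b (x + e *\<^sub>R z) ^ 3 - ?T z\<bar> \<le> \<bar>?d z\<bar> ^ 3"
        using cube_taylor[of "\<delta>\<^sup>2 - x \<bullet> x" "?d z"] by (simp add: b_def algebra_simps)
      also have "\<dots> \<le> (e * Q) ^ 3" using dle[OF z] by (intro power_mono) auto
      finally have "J z * \<bar>b (x + e *\<^sub>R z) ^ 3 - ?T z\<bar> \<le> J z * (e * Q) ^ 3" by (intro mult_left_mono J_nonneg)
      then show ?thesis by (simp add: right_diff_distrib[symmetric] abs_mult J_nonneg)
    qed (simp add: J_outside)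
    have i: "integrable lborel (\<lambda>z. J z * 1)" "integrable lborel (\<lambda>z. J z * (x \<bullet> z))"
      "integrable lborel (\<lambda>z. J z * (z \<bullet> z))" "integrable lborel (\<lambda>z. J z * (x \<bullet> z)\<^sup>2)"
      "integrable lborel (\<lambda>z. J z * ((x \<bullet> z) * (z \<bullet> z)))" "integrable lborel (\<lambda>z. J z * (z \<bullet> z)\<^sup>2)"
      "integrable lborel (\<lambda>z. J z * (e * Q) ^ 3)" "integrable lborel (\<lambda>z. J z * ?T z)"
      by (intro J_integrable_mult continuous_intros)+
    have ib: "integrable lborel (\<lambda>z. J z * b (x + e *\<^sub>R z) ^ 3)"
      by (intro J_integrable_mult continuous_intros continuous_on_compose2[OF bc, of UNIV "\<lambda>z. x + e *\<^sub>R z"]) auto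
    define m4 where "m4 = (LINT z|lborel. J z * (z \<bullet> z)\<^sup>2)"
    have m4: "0 \<le> m4" "m4 \<le> R ^ 4"
    proof -
      show "0 \<le> m4" unfolding m4_def using J_nonneg by (intro Bochner_Integration.integral_nonneg) auto
      have "m4 \<le> (LINT z|lborel. J z * R ^ 4)"
        unfolding m4_def
      proof (rule integral_mono[OF i(6)])
        show "integrable lborel (\<lambda>z. J z * R ^ 4)" by (intro J_integrable_mult continuous_intros)
        fix z show "J z * (z \<bullet> z)\<^sup>2 \<le> J z * R ^ 4"
        proof (cases "norm z < R")
          case True
          have "norm z ^ 4 \<le> R ^ 4" using True by (intro power_mono) auto
          then have "(z \<bullet> z)\<^sup>2 \<le> R ^ 4" unfolding power2_norm_eq_inner[symmetric] by simp
          from mult_left_mono[OF this J_nonneg] show ?thesis .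
        qed (simp add: J_outside)
      qed
      then show "m4 \<le> R ^ 4" using mass by simp
    qed
    have Tz: "J z * ?T z = b x ^ 3 * (J z * 1) + (- 6 * (b x)\<^sup>2 * e) * (J z * (x \<bullet> z)) + (- 3 * (b x)\<^sup>2 * e\<^sup>2) * (J z * (z \<bullet> z))
       + (12 * b x * e\<^sup>2) * (J z * (x \<bullet> z)\<^sup>2) + (12 * b x * e ^ 3) * (J z * ((x \<bullet> z) * (z \<bullet> z))) + (3 * b x * e ^ 4) * (J z * (z \<bullet> z)\<^sup>2)" for z
      by (simp add: power2_eq_square power3_eq_cube power4_eq_xxxx algebra_simps)
    have "(LINT z|lborel. J z * ?T z) = b x ^ 3 + (- 3 * (b x)\<^sup>2 * e\<^sup>2) * (?N * m1) + (12 * b x * e\<^sup>2) * (m1 * (x \<bullet> x)) + (3 * b x * e ^ 4) * m4"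
    proof -
      have o: "(LINT z|lborel. J z * (x \<bullet> z)) = 0" "(LINT z|lborel. J z * ((x \<bullet> z) * (z \<bullet> z))) = 0"
        "(LINT z|lborel. J z * 1) = 1"
        using odd_moment[of "\<lambda>z. x \<bullet> z"] odd_moment[of "\<lambda>z. (x \<bullet> z) * (z \<bullet> z)"] mass by simp_all
      have lin: "(LINT z|lborel. c1 * F1 z + c2 * F2 z + c3 * F3 z + c4 * F4 z + c5 * F5 z + c6 * F6 z)
        = c1 * (LINT z|lborel. F1 z) + c2 * (LINT z|lborel. F2 z) + c3 * (LINT z|lborel. F3 z)
          + c4 * (LINT z|lborel. F4 z) + c5 * (LINT z|lborel. F5 z) + c6 * (LINT z|lborel. F6 z)"
        if "integrable lborel F1" "integrable lborel F2" "integrable lborel F3" "integrable lborel F4"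
          "integrable lborel F5" "integrable lborel F6"
        for F1 F2 F3 F4 F5 F6 :: "real ^ 'n \<Rightarrow> real" and c1 c2 c3 c4 c5 c6 :: real
        using that by simp
      show ?thesis
        unfolding Tz lin[OF i(1) i(2) i(3) i(4) i(5) i(6)] o norm_moment second_moment m4_def by simp
    qed
    also have "\<dots> = b x ^ 3 + e\<^sup>2 * (- 3 * (b x)\<^sup>2 * (?N * m1) + 3 * b x * (4 * m1 * (x \<bullet> x))) + e\<^sup>2 * (3 * b x * e\<^sup>2 * m4)"
      by (simp add: power2_eq_square power4_eq_xxxx algebra_simps)
    finally have ET: "(LINT z|lborel. J z * ?T z) = b x ^ 3 + e\<^sup>2 * (- 3 * (b x)\<^sup>2 * (?N * m1) + 3 * b x * (4 * m1 * (x \<bullet> x))) + e\<^sup>2 * (3 * b x * e\<^sup>2 * m4)" .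
    define E where "E = (LINT z|lborel. J z * b (x + e *\<^sub>R z) ^ 3)"
    have "\<bar>E - (LINT z|lborel. J z * ?T z)\<bar> = \<bar>LINT z|lborel. J z * b (x + e *\<^sub>R z) ^ 3 - J z * ?T z\<bar>"
      unfolding E_def using ib i(8) by (subst Bochner_Integration.integral_diff) auto
    also have "\<dots> \<le> (LINT z|lborel. \<bar>J z * b (x + e *\<^sub>R z) ^ 3 - J z * ?T z\<bar>)"
      by (rule integral_abs_bound)
    also have "\<dots> \<le> (LINT z|lborel. J z * (e * Q) ^ 3)"
      using ib i by (intro integral_mono pt integrable_abs Bochner_Integration.integrable_diff) auto
    also have "\<dots> = e\<^sup>2 * (e * Q ^ 3)" using mass by (simp add: power_mult_distrib power3_eq_cube power2_eq_square)
    finally have est: "\<bar>E - (LINT z|lborel. J z * ?T z)\<bar> \<le> e\<^sup>2 * (e * Q ^ 3)" .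
    have "conv (Jeps e) (mollifier \<delta>) x = (LINT z|lborel. J z * mollifier \<delta> (x + e *\<^sub>R z))"
      by (rule conv_Jeps[OF e(1) kern_measurable[OF kern_mollifier[OF \<delta>]]])
    also have "\<dots> = E / m" by (simp add: mol E_def)
    finally have cE: "conv (Jeps e) (mollifier \<delta>) x = E / m" .
    define L where "L = - 3 * (b x)\<^sup>2 * (?N * m1) + 3 * b x * (4 * m1 * (x \<bullet> x))"
    have e2: "0 < e\<^sup>2" using e by simp
    define IT where "IT = (LINT z|lborel. J z * ?T z)"
    define r where "r = E - IT"
    have "IT = b x ^ 3 + e\<^sup>2 * L + e\<^sup>2 * (3 * b x * e\<^sup>2 * m4)" unfolding IT_def ET L_def ..
    then have "E - b x ^ 3 = e\<^sup>2 * (L + 3 * b x * e\<^sup>2 * m4) + r" by (simp add: r_def distrib_left)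
    then have "(1 / e\<^sup>2) * (E - b x ^ 3) = L + 3 * b x * e\<^sup>2 * m4 + r / e\<^sup>2"
      using e by (simp add: add_divide_distrib)
    then have "lap e (mollifier \<delta>) x - l x = (3 * b x * e\<^sup>2 * m4 + r / e\<^sup>2) / m"
      unfolding lap_def cE mol l_def L_def[symmetric] by (simp add: diff_divide_distrib[symmetric] add_divide_distrib)
    moreover have "\<bar>3 * b x * e\<^sup>2 * m4 + r / e\<^sup>2\<bar> \<le> e * (3 * \<delta>\<^sup>2 * R ^ 4) + e * Q ^ 3"
    proof -
      have "\<bar>r\<bar> \<le> e\<^sup>2 * (e * Q ^ 3)" using est by (simp only: r_def IT_def)
      then have r1: "\<bar>r / e\<^sup>2\<bar> \<le> e * Q ^ 3"
        using e2 by (simp add: abs_divide pos_divide_le_eq mult.commute)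
      have r2: "3 * b x * e\<^sup>2 * m4 \<le> 3 * \<delta>\<^sup>2 * e * R ^ 4"
        using b[of x] m4 e by (intro mult_mono) (auto simp: power2_eq_square mult_left_le)
      have r3: "0 \<le> 3 * b x * e\<^sup>2 * m4" using b[of x] m4 by simp
      have r4: "e * (3 * \<delta>\<^sup>2 * R ^ 4) = 3 * \<delta>\<^sup>2 * e * R ^ 4" by simp
      show ?thesis
        using abs_triangle_ineq[of "3 * b x * e\<^sup>2 * m4" "r / e\<^sup>2"] r1 r2 abs_of_nonneg[OF r3] unfolding r4 by linarith
    qed
    ultimately have "\<bar>lap e (mollifier \<delta>) x - l x\<bar> \<le> (e * (3 * \<delta>\<^sup>2 * R ^ 4) + e * Q ^ 3) / m"
      using m0 by (simp add: abs_divide divide_right_mono)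
    also have "\<dots> \<le> C * e" using e by (simp add: C_def add_divide_distrib algebra_simps)
    finally show ?thesis .
  qed
  moreover have "l x = 0" if "\<delta> + R \<le> norm x" for x
    using that R1 by (simp add: l_def lout)
  ultimately show ?thesis using that[OF C, of l] by blast
qed

end

section \<open>Comparison of two scales\<close>

definition borel_rep :: "'a::euclidean_space L1 \<Rightarrow> 'a \<Rightarrow> real"
  where "borel_rep u = (SOME g. integrable lborel g \<and> u = abs_L1 g)"

lemma borel_rep: "integrable lborel (borel_rep u)" "abs_L1 (borel_rep u) = u"
proof -
  have "\<exists>g. integrable lborel g \<and> u = abs_L1 g" using L1_cases by metis
  from someI_ex[OF this] show "integrable lborel (borel_rep u)" "abs_L1 (borel_rep u) = u"
    by (auto simp: borel_rep_def)
qed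

lemma conv_cong_AE:
  assumes k: "kern k R" and g: "integrable lborel g" "integrable lborel h" "AE x in lborel. g x = h x"
  shows "conv k g = conv k h"
proof
  fix x
  show "conv k g x = conv k h x"
    unfolding conv_def
  proof (rule integral_cong_AE)
    show "AE y in lborel. k (x - y) * g y = k (x - y) * h y"
      using g(3) by eventually_elim simp
  qed (use borel_measurable_integrable[OF conv_integrable_pt[OF k g(1)]] borel_measurable_integrable[OF conv_integrable_pt[OF k g(2)]] in auto)
qed

text \<open>The inner product of two mollifications. Classes in \<open>L1\<close> need not be square
  integrable, but their mollifications are bounded as well as integrable.\<close>

definition sform :: "('a::euclidean_space \<Rightarrow> real) \<Rightarrow> 'a L1 \<Rightarrow> 'a L1 \<Rightarrow> real"
  where "sform k u v = (LINT x|lborel. conv k (borel_rep u) x * conv k (borel_rep v) x)"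

lemma sform_abs_L1:
  assumes k: "kern k R" and g: "integrable lborel g" and h: "integrable lborel h"
  shows "sform k (abs_L1 g) (abs_L1 h) = (LINT x|lborel. conv k g x * conv k h x)"
proof -
  have "AE x in lborel. borel_rep (abs_L1 g) x = g x" "AE x in lborel. borel_rep (abs_L1 h) x = h x"
    using borel_rep[of "abs_L1 g"] borel_rep[of "abs_L1 h"] g h by (auto simp: abs_L1_eq_iff[symmetric])
  then have "conv k (borel_rep (abs_L1 g)) = conv k g" "conv k (borel_rep (abs_L1 h)) = conv k h"
    using g h borel_rep by (auto intro!: conv_cong_AE[OF k])
  then show ?thesis by (simp add: sform_def)
qed

lemma conv_add: "kern k R \<Longrightarrow> integrable lborel g \<Longrightarrow> integrable lborel h \<Longrightarrow>
    conv k (\<lambda>x. g x + h x) x = conv k g x + conv k h x"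
  using conv_integrable_pt[of k R g x] conv_integrable_pt[of k R h x] by (simp add: conv_def distrib_left)

lemma conv_diff: "kern k R \<Longrightarrow> integrable lborel g \<Longrightarrow> integrable lborel h \<Longrightarrow>
    conv k (\<lambda>x. g x - h x) x = conv k g x - conv k h x"
  using conv_integrable_pt[of k R g x] conv_integrable_pt[of k R h x] by (simp add: conv_def right_diff_distrib)

lemma conv_scale: "conv k (\<lambda>x. c * g x) x = c * conv k g x"
  by (simp add: conv_def mult.left_commute)

lemma conv_prod_integrable:
  assumes k: "kern k R" and g: "integrable lborel g" and h: "integrable lborel h"
  shows "integrable lborel (\<lambda>x. conv k g x * conv k h x)"
proof -
  obtain B where B: "0 < B" "\<And>x. \<bar>k x\<bar> \<le> B" using kern_bounded[OF k] by metis
  show ?thesis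
    using conv_measurable[OF k, of g] g
    by (intro integrable_bounded_mult[OF conv_integrable[OF k h] _ conv_bound[OF k g B(2)]]) (auto dest: borel_measurable_integrable)
qed

text \<open>Boundedness gives access to the product rule, which makes the quadratic energy
  differentiable along curves in \<open>L1\<close>.\<close>

lemma sform_bilinear:
  assumes k: "kern k R"
  shows "bounded_bilinear (sform k)"
proof -
  obtain B where B: "0 < B" "\<And>x. \<bar>k x\<bar> \<le> B" using kern_bounded[OF k] by metis
  note pi = conv_prod_integrable[OF k]
  show ?thesis
  proof (rule bounded_bilinear.intro)
    fix u u' v v' :: "'a L1" and c :: real
    obtain g where g: "integrable lborel g" "u = abs_L1 g" using L1_cases by metis
    obtain g' where g': "integrable lborel g'" "u' = abs_L1 g'" using L1_cases by metis
    obtain h where h: "integrable lborel h" "v = abs_L1 h" using L1_cases by metis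
    obtain h' where h': "integrable lborel h'" "v' = abs_L1 h'" using L1_cases by metis
    show "sform k (u + u') v = sform k u v + sform k u' v"
      using g g' h by (simp add: plus_abs_L1 sform_abs_L1[OF k] conv_add[OF k] distrib_right pi)
    show "sform k u (v + v') = sform k u v + sform k u v'"
      using g h h' by (simp add: plus_abs_L1 sform_abs_L1[OF k] conv_add[OF k] distrib_left pi)
    show "sform k (c *\<^sub>R u) v = c *\<^sub>R sform k u v"
      using g h by (simp add: scaleR_abs_L1 sform_abs_L1[OF k] conv_scale mult.assoc pi)
    show "sform k u (c *\<^sub>R v) = c *\<^sub>R sform k u v"
      using g h by (simp add: scaleR_abs_L1 sform_abs_L1[OF k] conv_scale mult.left_commute pi)
  next
    show "\<exists>K. \<forall>u v. norm (sform k u v) \<le> norm u * norm v * K"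
    proof (intro exI allI)
      fix u v :: "'a L1"
      obtain g where g: "integrable lborel g" "u = abs_L1 g" using L1_cases by metis
      obtain h where h: "integrable lborel h" "v = abs_L1 h" using L1_cases by metis
      have "norm (sform k u v) \<le> (LINT x|lborel. \<bar>conv k g x * conv k h x\<bar>)"
        unfolding g(2) h(2) sform_abs_L1[OF k g(1) h(1)] using integral_abs_bound by simp
      also have "\<dots> \<le> (LINT x|lborel. (B * norm u) * \<bar>conv k h x\<bar>)"
      proof (rule integral_mono)
        show "\<bar>conv k g x * conv k h x\<bar> \<le> (B * norm u) * \<bar>conv k h x\<bar>" for x
          using mult_right_mono[OF conv_bound[OF k g(1) B(2), of x], of "\<bar>conv k h x\<bar>"]
          by (simp add: abs_mult g(2) norm_abs_L1[OF g(1)])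
        show "integrable lborel (\<lambda>x. \<bar>conv k g x * conv k h x\<bar>)" by (intro integrable_abs pi g h)
        show "integrable lborel (\<lambda>x. (B * norm u) * \<bar>conv k h x\<bar>)"
          by (intro integrable_mult_right integrable_abs conv_integrable[OF k h(1)])
      qed
      also have "\<dots> = (B * norm u) * (LINT x|lborel. \<bar>conv k h x\<bar>)" by simp
      also have "\<dots> \<le> (B * norm u) * ((LINT x|lborel. \<bar>k x\<bar>) * norm v)"
        unfolding h(2) norm_abs_L1[OF h(1)] using B conv_norm[OF k h(1)] by (intro mult_left_mono) auto
      also have "\<dots> = norm u * norm v * (B * (LINT x|lborel. \<bar>k x\<bar>))" by simp
      finally show "norm (sform k u v) \<le> norm u * norm v * (B * (LINT x|lborel. \<bar>k x\<bar>))" .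
    qed
  qed
qed

lemma derivative_nonpos_decreasing:
  fixes g :: "real \<Rightarrow> real"
  assumes T: "0 \<le> T" and der: "\<And>s. 0 \<le> s \<Longrightarrow> s \<le> T \<Longrightarrow> (g has_vector_derivative D s) (at s within {0..T})"
    and D: "\<And>s. 0 \<le> s \<Longrightarrow> s \<le> T \<Longrightarrow> D s \<le> 0"
  shows "g T \<le> g 0"
proof (rule dini_decreasing[OF T])
  show "continuous_on {0..T} g" using der by (intro continuous_on_vector_derivative) auto
  fix s e :: real assume s: "0 \<le> s" "s < T" and e: "0 < e"
  then have sT: "s \<le> T" by simp
  from vector_derivative_step[OF der[OF s(1) sT] s(1) e] obtain d where d: "0 < d"
    "\<And>h. 0 < h \<Longrightarrow> h < d \<Longrightarrow> s + h \<le> T \<Longrightarrow> norm (g (s + h) - (g s + h *\<^sub>R D s)) \<le> e * h" by blast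
  show "\<exists>d>0. \<forall>h. 0 < h \<longrightarrow> h < d \<longrightarrow> s + h \<le> T \<longrightarrow> g (s + h) \<le> g s + e * h"
  proof (intro exI[of _ d] conjI d(1) allI impI)
    fix h assume h: "0 < h" "h < d" "s + h \<le> T"
    have "h * D s \<le> 0" using D[OF s(1) sT] h by (intro mult_nonneg_nonpos) auto
    then show "g (s + h) \<le> g s + e * h" using d(2)[OF h] by simp
  qed
qed

section \<open>The discrete Laplacian on classes and the energy estimate\<close>

context unit_kernel
begin

definition Lap :: "real \<Rightarrow> (real ^ 'n) L1 \<Rightarrow> (real ^ 'n) L1"
  where "Lap e w = (1 / e\<^sup>2) *\<^sub>R (Tconv e w - w)"

lemma Lap_abs_L1: "0 < e \<Longrightarrow> integrable lborel g \<Longrightarrow> Lap e (abs_L1 g) = abs_L1 (lap e g)"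
  using conv_integrable[OF kern_Jeps, of e g]
  by (simp add: Lap_def lap_def[abs_def] convolution_abs_L1[OF kern_Jeps] minus_abs_L1 scaleR_abs_L1)

lemma lap_integrable: "0 < e \<Longrightarrow> integrable lborel g \<Longrightarrow> integrable lborel (lap e g)"
  unfolding lap_def using conv_integrable[OF kern_Jeps, of e g] by simp

lemma Lap_bounded_linear: "0 < e \<Longrightarrow> bounded_linear (Lap e)"
  unfolding Lap_def
  by (intro bounded_linear_scaleR_right[THEN bounded_linear_compose] bounded_linear_sub
      convolution_bounded_linear(1)[OF kern_Jeps] bounded_linear_ident)

lemma conv_lap:
  assumes e: "0 < e" and k: "kern k S" and g: "integrable lborel g"
  shows "conv k (lap e g) x = lap e (conv k g) x"
proof -
  have "conv k (lap e g) x = (1 / e\<^sup>2) * conv k (\<lambda>x. conv (Jeps e) g x - g x) x"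
    unfolding lap_def by (rule conv_scale)
  then show ?thesis
    unfolding conv_diff[OF k conv_integrable[OF kern_Jeps[OF e] g] g] conv_left_commute[OF k kern_Jeps[OF e] g] lap_def .
qed

text \<open>Symmetry is that of the even kernel. The sign comes from bounding
  \<open>G x * G y\<close> by half the sum of the squares and averaging with a kernel of mass
  one.\<close>

lemma sform_Lap:
  assumes e: "0 < e" and k: "kern k S"
  shows sform_Lap_symmetric: "sform k (Lap e u) v = sform k (Lap e v) u"
    and sform_Lap_nonpos: "sform k (Lap e u) u \<le> 0"
proof -
  note kJ = kern_Jeps[OF e]
  obtain B where B: "0 < B" "\<And>x. \<bar>k x\<bar> \<le> B" using kern_bounded[OF k] by metis
  have eq: "sform k (Lap e (abs_L1 g)) (abs_L1 h)
      = (1 / e\<^sup>2) * ((LINT x|lborel. conv k h x * conv (Jeps e) (conv k g) x) - (LINT x|lborel. conv k g x * conv k h x))"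
    if g: "integrable lborel g" and h: "integrable lborel h" for g h
  proof -
    have cg: "integrable lborel (conv k g)" by (rule conv_integrable[OF k g])
    have i1: "integrable lborel (\<lambda>x. conv k h x * conv (Jeps e) (conv k g) x)"
      using h by (intro conv_Fubini(2)[OF kJ cg _ conv_bound[OF k h B(2)]] conv_measurable[OF k]) (auto dest: borel_measurable_integrable)
    have "sform k (Lap e (abs_L1 g)) (abs_L1 h) = (LINT x|lborel. lap e (conv k g) x * conv k h x)"
      unfolding Lap_abs_L1[OF e g] sform_abs_L1[OF k lap_integrable[OF e g] h] conv_lap[OF e k g] ..
    also have "\<dots> = (LINT x|lborel. (1 / e\<^sup>2) * (conv k h x * conv (Jeps e) (conv k g) x - conv k g x * conv k h x))"
      by (rule Bochner_Integration.integral_cong) (simp_all add: lap_def algebra_simps diff_divide_distrib)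
    also have "\<dots> = (1 / e\<^sup>2) * (LINT x|lborel. conv k h x * conv (Jeps e) (conv k g) x - conv k g x * conv k h x)"
      by (rule integral_mult_right_zero)
    also have "(LINT x|lborel. conv k h x * conv (Jeps e) (conv k g) x - conv k g x * conv k h x)
      = (LINT x|lborel. conv k h x * conv (Jeps e) (conv k g) x) - (LINT x|lborel. conv k g x * conv k h x)"
      using i1 conv_prod_integrable[OF k g h] by (rule Bochner_Integration.integral_diff)
    finally show ?thesis .
  qed
  obtain g where g: "integrable lborel g" "u = abs_L1 g" using L1_cases by metis
  obtain h where h: "integrable lborel h" "v = abs_L1 h" using L1_cases by metis
  have cg: "integrable lborel (conv k g)" "integrable lborel (conv k h)" using conv_integrable[OF k] g h by auto
  have cm: "conv k g \<in> borel_measurable borel" "conv k h \<in> borel_measurable borel"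
    using cg by (auto dest: borel_measurable_integrable)
  have "(LINT x|lborel. conv k h x * conv (Jeps e) (conv k g) x) = (LINT x|lborel. conv (Jeps e) (conv k h) x * conv k g x)"
    by (rule conv_symmetric[OF kJ Jeps_even cg(1) cm(2) conv_bound[OF k h(1) B(2)]])
  then show "sform k (Lap e u) v = sform k (Lap e v) u"
    unfolding g(2) h(2) eq[OF g(1) h(1)] eq[OF h(1) g(1)] by (simp add: mult.commute)
  define G where "G = conv k g"
  define BG where "BG = B * (LINT x|lborel. \<bar>g x\<bar>)"
  have G: "integrable lborel G" "\<And>x. \<bar>G x\<bar> \<le> BG"
    using cg conv_bound[OF k g(1) B(2)] by (auto simp: G_def BG_def)
  have [measurable]: "G \<in> borel_measurable borel" using cm by (simp add: G_def)
  have G2: "integrable lborel (\<lambda>x. G x * G x)"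
    by (rule integrable_bounded_mult[OF G(1) _ G(2)]) simp
  have pt: "G x * conv (Jeps e) G x \<le> (conv (Jeps e) (\<lambda>x. G x * G x) x + G x * G x) / 2" for x
  proof -
    have "G x * conv (Jeps e) G x = (LINT y|lborel. G x * (Jeps e (x - y) * G y))" by (simp add: conv_def)
    also have "\<dots> \<le> (LINT y|lborel. (Jeps e (x - y) * (G y * G y) + Jeps e (x - y) * (G x * G x)) / 2)"
    proof (rule integral_mono)
      show "integrable lborel (\<lambda>y. G x * (Jeps e (x - y) * G y))"
        by (intro integrable_mult_right conv_integrable_pt[OF kJ G(1)])
      show "integrable lborel (\<lambda>y. (Jeps e (x - y) * (G y * G y) + Jeps e (x - y) * (G x * G x)) / 2)"
        by (intro integrable_divide Bochner_Integration.integrable_add conv_integrable_pt[OF kJ G2] conv_integrable_cont[OF kJ continuous_on_const])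
      fix y
      have "0 \<le> (G y - G x)\<^sup>2" by simp
      then have "G x * G y \<le> (G y * G y + G x * G x) / 2" by (simp add: power2_eq_square algebra_simps)
      from mult_left_mono[OF this Jeps_nonneg[OF e, of "x - y"]]
      show "G x * (Jeps e (x - y) * G y) \<le> (Jeps e (x - y) * (G y * G y) + Jeps e (x - y) * (G x * G x)) / 2"
        by (simp add: algebra_simps add_divide_distrib)
    qed
    also have "\<dots> = ((LINT y|lborel. Jeps e (x - y) * (G y * G y)) + (LINT y|lborel. Jeps e (x - y) * (G x * G x))) / 2"
      using conv_integrable_pt[OF kJ G2, of x] conv_integrable_cont[OF kJ continuous_on_const, of x "G x * G x"]
      by (simp only: integral_divide_zero Bochner_Integration.integral_add)
    also have "(LINT y|lborel. Jeps e (x - y) * (G x * G x)) = G x * G x"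
      using mass_Jeps[OF e] lborel_integral_reflect[of "Jeps e" x] kern_measurable[OF kJ] by simp
    finally show ?thesis by (simp add: conv_def)
  qed
  have "(LINT x|lborel. G x * conv (Jeps e) G x) \<le> (LINT x|lborel. (conv (Jeps e) (\<lambda>x. G x * G x) x + G x * G x) / 2)"
    using conv_Fubini(2)[OF kJ G(1) _ G(2)] conv_integrable[OF kJ G2] G2
    by (intro integral_mono pt) auto
  also have "\<dots> = ((LINT x|lborel. conv (Jeps e) (\<lambda>x. G x * G x) x) + (LINT x|lborel. G x * G x)) / 2"
    using conv_integrable[OF kJ G2] G2 by (simp only: integral_divide_zero Bochner_Integration.integral_add)
  also have "(LINT x|lborel. conv (Jeps e) (\<lambda>x. G x * G x) x) = (LINT x|lborel. G x * G x)"
  proof -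
    have "(LINT x|lborel. Jeps e (x - y)) = 1" for y
      using mass_Jeps[OF e] lborel_integral_shift[of "Jeps e" "- y"] kern_measurable[OF kJ] by simp
    then show ?thesis using conv_Fubini(1)[OF kJ G2, of "\<lambda>_. 1" 1] by simp
  qed
  finally have "(LINT x|lborel. conv k g x * conv (Jeps e) (conv k g) x) - (LINT x|lborel. conv k g x * conv k g x) \<le> 0"
    by (simp add: G_def)
  then show "sform k (Lap e u) u \<le> 0"
    unfolding g(2) eq[OF g(1) g(1)] by (intro mult_nonneg_nonpos) auto
qed

text \<open>For \<open>e \<le> 1\<close> the support grows by at most \<open>R\<close>, uniformly in
  \<open>e\<close>; continuity is dominated convergence.\<close>

lemma kern_lap:
  assumes k: "kern k S" and e: "0 < e" "e \<le> 1"
  shows "kern (lap e k) (S + R)"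
proof -
  have kc: "continuous_on UNIV k" and S: "0 < S" and k0: "\<And>x. S \<le> norm x \<Longrightarrow> k x = 0" using k by (auto simp: kern_def)
  obtain B where B: "0 < B" "\<And>x. \<bar>k x\<bar> \<le> B" using kern_bounded[OF k] by metis
  have ceq: "conv (Jeps e) k x = (LINT z|lborel. J z * k (x + e *\<^sub>R z))" for x
    by (rule conv_Jeps[OF e(1) kern_measurable[OF k]])
  have "continuous_on UNIV (conv (Jeps e) k)"
    unfolding continuous_on_sequentially
  proof (intro allI ballI impI, elim conjE)
    fix X and x :: "real ^ 'n" assume X: "X \<longlonglongrightarrow> x"
    have "(\<lambda>n. LINT z|lborel. J z * k (X n + e *\<^sub>R z)) \<longlonglongrightarrow> (LINT z|lborel. J z * k (x + e *\<^sub>R z))"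
    proof (rule integral_dominated_convergence[where w="\<lambda>z. B * J z"])
      have m: "(\<lambda>z. J z * k (x + e *\<^sub>R z)) \<in> borel_measurable lborel" for x
        using kern_measurable[OF k] by measurable
      show "(\<lambda>z. J z * k (x + e *\<^sub>R z)) \<in> borel_measurable lborel" by (rule m)
      show "(\<lambda>z. J z * k (X n + e *\<^sub>R z)) \<in> borel_measurable lborel" for n by (rule m)
      show "integrable lborel (\<lambda>z. B * J z)" using kern_integrable[OF kern] by simp
      show "AE z in lborel. (\<lambda>n. J z * k (X n + e *\<^sub>R z)) \<longlonglongrightarrow> J z * k (x + e *\<^sub>R z)"
      proof (rule AE_I2)
        fix z
        have "(\<lambda>n. X n + e *\<^sub>R z) \<longlonglongrightarrow> x + e *\<^sub>R z" by (intro tendsto_intros X)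
        moreover have "isCont k (x + e *\<^sub>R z)" using kc by (simp add: continuous_on_eq_continuous_at)
        ultimately have "(\<lambda>n. k (X n + e *\<^sub>R z)) \<longlonglongrightarrow> k (x + e *\<^sub>R z)" by (rule isCont_tendsto_compose[rotated])
        then show "(\<lambda>n. J z * k (X n + e *\<^sub>R z)) \<longlonglongrightarrow> J z * k (x + e *\<^sub>R z)" by (intro tendsto_intros)
      qed
      show "AE z in lborel. norm (J z * k (X n + e *\<^sub>R z)) \<le> B * J z" for n
      proof (rule AE_I2)
        fix z show "norm (J z * k (X n + e *\<^sub>R z)) \<le> B * J z"
          using mult_left_mono[OF B(2)[of "X n + e *\<^sub>R z"] J_nonneg[of z]] by (simp add: abs_mult J_nonneg mult.commute)
      qed
    qed
    then show "(conv (Jeps e) k \<circ> X) \<longlonglongrightarrow> conv (Jeps e) k x" by (simp add: ceq o_def)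
  qed
  then have "continuous_on UNIV (lap e k)"
    unfolding lap_def by (intro continuous_intros kc)
  moreover have "lap e k x = 0" if x: "S + R \<le> norm x" for x
  proof -
    have "J z * k (x + e *\<^sub>R z) = 0" for z
    proof (cases "norm z < R")
      case True
      have "norm (e *\<^sub>R z) \<le> 1 * norm z" using mult_right_mono[OF e(2), of "norm z"] e(1) by simp
      moreover have "norm x \<le> norm (x + e *\<^sub>R z) + norm (e *\<^sub>R z)" using norm_triangle_ineq4[of "x + e *\<^sub>R z" "e *\<^sub>R z"] by simp
      ultimately have "S \<le> norm (x + e *\<^sub>R z)" using True x by linarith
      then show ?thesis by (simp add: k0)
    qed (simp add: J_outside)
    then have "conv (Jeps e) k x = (LINT z|(lborel :: (real ^ 'n) measure). 0)" unfolding ceq by (simp only:)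
    then show ?thesis using k0[of x] x R1 by (simp add: lap_def)
  qed
  ultimately show ?thesis using S R1 by (simp add: kern_def)
qed

text \<open>The discrete Laplacian may act on the mollifier instead of the function, so two scales
  are compared through their effect on one fixed regular function.\<close>

lemma conv_lap_right:
  assumes e: "0 < e" and k: "kern k S" and g: "integrable lborel g"
  shows "conv k (lap e g) x = conv (lap e k) g x"
proof -
  obtain B where B: "\<And>x. \<bar>Jeps e x\<bar> \<le> B" using kern_bounded[OF kern_Jeps[OF e]] by metis
  have [measurable]: "Jeps e \<in> borel_measurable borel" "k \<in> borel_measurable borel"
    using kern_measurable[OF kern_Jeps[OF e]] kern_measurable[OF k] by auto
  have "conv (Jeps e) (conv k g) x = (LINT z|lborel. (LINT y|lborel. Jeps e (x - y) * k (y - z)) * g z)"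
    using conv_Fubini(1)[OF k g, of "\<lambda>y. Jeps e (x - y)" B] B by (simp add: conv_def[of "Jeps e"])
  moreover have inner: "(LINT y|lborel. Jeps e (x - y) * k (y - z)) = conv (Jeps e) k (x - z)" for z
    unfolding conv_def by (subst lborel_integral_shift[symmetric, of _ z]) (auto simp: algebra_simps)
  ultimately have 1: "conv (Jeps e) (conv k g) x = (LINT z|lborel. conv (Jeps e) k (x - z) * g z)" by (simp only:)
  obtain C where C: "0 < C" "\<And>x. \<bar>k x\<bar> \<le> C" using kern_bounded[OF k] by metis
  have i: "integrable lborel (\<lambda>z. conv (Jeps e) k (x - z) * g z)"
    using conv_bound[OF kern_Jeps[OF e] kern_integrable[OF k] B] conv_measurable[OF kern_Jeps[OF e] kern_measurable[OF k]]
    by (intro integrable_bounded_mult[OF g, where B="B * (LINT x|lborel. \<bar>k x\<bar>)"]) auto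
  have "conv (lap e k) g x = (LINT z|lborel. (1 / e\<^sup>2) * (conv (Jeps e) k (x - z) * g z - k (x - z) * g z))"
    unfolding conv_def[of "lap e k"] lap_def by (rule Bochner_Integration.integral_cong) (simp_all add: algebra_simps)
  also have "\<dots> = (1 / e\<^sup>2) * ((LINT z|lborel. conv (Jeps e) k (x - z) * g z) - conv k g x)"
    unfolding conv_def[of k] using i conv_integrable_pt[OF k g, of x] by simp
  also have "\<dots> = lap e (conv k g) x" unfolding 1[symmetric] lap_def ..
  finally show ?thesis using conv_lap[OF e k g, of x] by simp
qed

lemma flow_in_band:
  assumes "0 < e" "flow e u" "1 \<le> C" "u 0 \<in> band C" "0 \<le> t"
  shows "u t \<in> band C"
proof -
  obtain g where g: "integrable lborel g" "u t = abs_L1 g" using L1_cases by metis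
  define h where "h x = max 0 (min C (g x))" for x
  have ae: "AE x in lborel. 0 \<le> g x \<and> g x \<le> C" by (rule flow_band[OF assms g])
  have [measurable]: "g \<in> borel_measurable lborel" using g by auto
  have h: "integrable lborel h"
  proof (rule Bochner_Integration.integrable_bound[OF g(1)])
    show "h \<in> borel_measurable lborel" unfolding h_def by measurable
    show "AE x in lborel. norm (h x) \<le> norm (g x)" using assms(3) by (intro AE_I2) (auto simp: h_def)
  qed
  have "AE x in lborel. g x = h x" using ae by eventually_elim (auto simp: h_def)
  then have "u t = abs_L1 h" using g h by (simp add: abs_L1_eq_iff)
  moreover have "0 \<le> h x \<and> h x \<le> C" for x using assms(3) by (auto simp: h_def)
  ultimately show ?thesis using h unfolding band_def by blast
qed

lemma wint_norm:
  assumes e: "0 < e" and u: "flow e u" "continuous_on {0..} u" and t: "0 \<le> t"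
  shows "norm (wint u t) \<le> t * norm (u 0)"
proof -
  have "norm (wint u t) \<le> norm (u 0) * (t - 0)"
    unfolding wint_def
  proof (rule integral_bound[OF t])
    show "continuous_on {0..t} (\<lambda>s. pos_part_minus_one (u s))"
      by (intro continuous_on_compose2[OF continuous_on_pos_part[of UNIV]] continuous_on_subset[OF u(2)]) auto
    fix s assume "s \<in> {0..t}"
    then have "norm (u s) \<le> norm (u 0)" using flow_norm[OF e u(1), of s] by simp
    then show "norm (pos_part_minus_one (u s)) \<le> norm (u 0)"
      using pos_part_lipschitz[of "u s" 0] by (simp add: pos_part_zero)
  qed
  then show ?thesis by (simp add: mult.commute)
qed

text \<open>
  The energy estimate behind the convergence as \<open>\<epsilon>\<close> tends to zero: \<open>\<integral>(u1 - u2) (v1 - v2) \<ge> \<integral>(v1 - v2)\<^sup>2\<close>, while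
  \<open>u1 - u2\<close> is, after mollification, the discrete Laplacian of \<open>w1 - w2\<close>, whose time derivative is \<open>v1 - v2\<close>.
  Mollification is harmless because the flow contracts differences of translates.
\<close>

lemma comparison:
  fixes \<sigma> :: "real ^ 'n \<Rightarrow> real"
  assumes e: "0 < e1" "0 < e2" "e1 \<le> 1" "e2 \<le> 1"
    and u1: "flow e1 u1" "continuous_on {0..} u1" and u2: "flow e2 u2" "continuous_on {0..} u2"
    and eq1: "\<And>t. 0 \<le> t \<Longrightarrow> u1 t = F0 + Lap e1 (wint u1 t)"
    and eq2: "\<And>t. 0 \<le> t \<Longrightarrow> u2 t = F0 + Lap e2 (wint u2 t)"
    and C: "1 \<le> C" "F0 \<in> band C"
    and \<sigma>: "kern \<sigma> \<delta>" "\<And>x. \<sigma> (- x) = \<sigma> x" "\<And>x. 0 \<le> \<sigma> x" "(LINT x|lborel. \<sigma> x) = 1"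
    and tr: "\<And>a. norm a < \<delta> \<Longrightarrow> norm (trans_L1 a F0 - F0) \<le> \<eta>"
    and \<zeta>: "(LINT x|lborel. \<bar>lap e1 \<sigma> x - lap e2 \<sigma> x\<bar>) \<le> \<zeta>"
    and T: "0 \<le> T" and A: "A \<in> sets borel" "emeasure lborel A < \<infinity>" and \<gamma>: "0 < \<gamma>"
    and \<theta>: "\<theta> \<in> borel_measurable borel" "\<And>x. \<bar>\<theta> x\<bar> \<le> indicator A x"
  shows "pair \<theta> (wint u1 T - wint u2 T) \<le> T * (\<gamma> * measure lborel A / 2 + C * (8 * \<eta> + \<zeta> * (T * norm F0)) / (2 * \<gamma>))"
proof -
  define M where "M = convolution_L1 (abs_L1 \<sigma>)"
  have Mbl: "bounded_linear M" unfolding M_def by (rule convolution_bounded_linear(1)[OF \<sigma>(1)])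
  have Mn: "norm (M v) \<le> norm v" for v
    using convolution_bounded_linear(2)[OF \<sigma>(1), of v] \<sigma>(3,4) by (simp add: M_def)
  note Md = linear_diff[OF bounded_linear.linear[OF Mbl]]
  have z: "u1 0 = F0" "u2 0 = F0"
    using eq1[of 0] eq2[of 0] linear_0[OF bounded_linear.linear[OF Lap_bounded_linear[OF e(1)]]]
      linear_0[OF bounded_linear.linear[OF Lap_bounded_linear[OF e(2)]]] by (simp_all add: wint_0)
  have \<eta>F: "norm (M F0 - F0) \<le> \<eta>" unfolding M_def by (rule mollify_close[OF \<sigma> tr])
  have mc: "norm (M (u t) - u t) \<le> \<eta>" if "0 < e'" "flow e' u" "u 0 = F0" "0 \<le> t" for u t e'
    unfolding M_def
  proof (rule mollify_close[OF \<sigma>])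
    fix a :: "real ^ 'n" assume a: "norm a < \<delta>"
    show "norm (trans_L1 a (u t) - u t) \<le> \<eta>"
      using flow_translate[OF that(1,2,4), of a] tr[OF a] that(3) by simp
  qed
  \<comment> \<open>The energy form mollifies both arguments, hence the double mollification. Each
    layer costs \<open>2 * \<eta>\<close>, one \<eta> for the solution and one for its initial
    value.\<close>
  have MM: "norm ((u t - F0) - M (M (u t - F0))) \<le> 4 * \<eta>" if "0 < e'" "flow e' u" "u 0 = F0" "0 \<le> t" for u t e'
  proof -
    let ?D = "u t - F0"
    have "?D - M ?D = (M F0 - F0) - (M (u t) - u t)" by (simp add: Md)
    then have "norm (?D - M ?D) \<le> norm (M F0 - F0) + norm (M (u t) - u t)" by (simp only: norm_triangle_ineq4)
    then have 1: "norm (?D - M ?D) \<le> 2 * \<eta>" using mc[OF that] \<eta>F by simp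
    have "?D - M (M ?D) = (?D - M ?D) + M (?D - M ?D)" by (simp add: Md)
    then have "norm (?D - M (M ?D)) \<le> norm (?D - M ?D) + norm (M (?D - M ?D))" by (simp only: norm_triangle_ineq)
    then show ?thesis using 1 Mn[of "?D - M ?D"] by simp
  qed
  define W where "W s = wint u1 s - wint u2 s" for s
  define V where "V s = pos_part_minus_one (u1 s) - pos_part_minus_one (u2 s)" for s
  define err where "err = C * (8 * \<eta> + \<zeta> * (T * norm F0))"
  have key: "pair \<theta> (V s) \<le> \<gamma> * measure lborel A / 2 + (sform \<sigma> (Lap e1 (W s)) (V s) + err) / (2 * \<gamma>)"
    if s: "0 \<le> s" "s \<le> T" for s
  proof -
    obtain g1 where g1: "integrable lborel g1" "u1 s = abs_L1 g1" "\<And>x. 0 \<le> g1 x" "\<And>x. g1 x \<le> C"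
      using flow_in_band[OF e(1) u1(1) C(1) _ s(1)] C(2) z unfolding band_def by auto
    obtain g2 where g2: "integrable lborel g2" "u2 s = abs_L1 g2" "\<And>x. 0 \<le> g2 x" "\<And>x. g2 x \<le> C"
      using flow_in_band[OF e(2) u2(1) C(1) _ s(1)] C(2) z unfolding band_def by auto
    define \<phi> where "\<phi> x = max (g1 x - 1) 0 - max (g2 x - 1) 0" for x
    note p1 = integrable_pos_part_lborel[OF g1(1)] and p2 = integrable_pos_part_lborel[OF g2(1)]
    have \<phi>i: "integrable lborel \<phi>" unfolding \<phi>_def using p1 p2 by simp
    have [measurable]: "\<phi> \<in> borel_measurable borel" using \<phi>i by (auto dest: borel_measurable_integrable)
    have \<phi>C: "\<bar>\<phi> x\<bar> \<le> C" for x using g1(3,4)[of x] g2(3,4)[of x] C(1) by (auto simp: \<phi>_def)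
    have Vs: "V s = abs_L1 \<phi>"
      unfolding V_def g1(2) g2(2) pos_part_abs_L1[OF g1(1)] pos_part_abs_L1[OF g2(1)] minus_abs_L1[OF p1 p2] \<phi>_def ..
    have \<phi>2: "integrable lborel (\<lambda>x. \<phi> x * \<phi> x)" by (rule integrable_bounded_mult[OF \<phi>i _ \<phi>C]) simp
    have gd: "integrable lborel (\<lambda>x. g1 x - g2 x)" using g1 g2 by simp
    \<comment> \<open>The excess is a nondecreasing 1-Lipschitz function of \<open>u\<close>: \<phi>
      has the sign of \<open>g1 - g2\<close> wherever it is not zero, and is no larger in absolute
      value.\<close>
    have "(LINT x|lborel. \<phi> x * \<phi> x) \<le> (LINT x|lborel. \<phi> x * (g1 x - g2 x))"
    proof (rule integral_mono[OF \<phi>2])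
      show "integrable lborel (\<lambda>x. \<phi> x * (g1 x - g2 x))" by (rule integrable_bounded_mult[OF gd _ \<phi>C]) simp
      show "\<phi> x * \<phi> x \<le> \<phi> x * (g1 x - g2 x)" for x
      proof (cases "g2 x \<le> g1 x")
        case True
        then have "0 \<le> \<phi> x" "\<phi> x \<le> g1 x - g2 x" by (auto simp: \<phi>_def)
        then show ?thesis by (simp add: mult_left_mono)
      next
        case False
        then have "\<phi> x \<le> 0" "g1 x - g2 x \<le> \<phi> x" by (auto simp: \<phi>_def)
        then show ?thesis by (simp add: mult_left_mono_neg)
      qed
    qed
    also have "\<dots> = pair \<phi> (u1 s - u2 s)"
      unfolding g1(2) g2(2) minus_abs_L1[OF g1(1) g2(1)] by (rule pair_abs_L1[OF gd, symmetric]) simp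
    finally have e0: "(LINT x|lborel. \<phi> x * \<phi> x) \<le> pair \<phi> (u1 s - u2 s)" .
    have \<phi>m: "\<phi> \<in> borel_measurable borel" by simp
    note pbl = pair_bounded_linear(1)[OF \<phi>m \<phi>C] and pbd = pair_bounded_linear(2)[OF \<phi>m \<phi>C]
    note pl = linear_add[OF bounded_linear.linear[OF pbl]] linear_diff[OF bounded_linear.linear[OF pbl]]
    define w1 w2 where "w1 = wint u1 s" and "w2 = wint u2 s"
    define D1 D2 where "D1 = u1 s - F0" and "D2 = u2 s - F0"
    have D: "D1 = Lap e1 w1" "D2 = Lap e2 w2"
      using eq1[OF s(1)] eq2[OF s(1)] by (auto simp: D1_def D2_def w1_def w2_def)
    define E2 where "E2 = M (Lap e1 w2) - M (Lap e2 w2)"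
    have L1d: "Lap e1 (w1 - w2) = Lap e1 w1 - Lap e1 w2"
      using linear_diff[OF bounded_linear.linear[OF Lap_bounded_linear[OF e(1)]]] .
    \<comment> \<open>Apart from two mollification errors, the difference is the Laplacian at scale
      \<open>e1\<close> of \<open>W\<close>, plus the error \<open>E2\<close> made by letting scale
      \<open>e1\<close> instead of \<open>e2\<close> act on \<open>w2\<close>.\<close>
    have splt: "u1 s - u2 s = (D1 - M (M D1)) - (D2 - M (M D2)) + M (M (Lap e1 (W s))) + M E2"
      unfolding W_def w1_def[symmetric] w2_def[symmetric] L1d E2_def D
      by (simp add: Md D[symmetric]) (simp add: D1_def D2_def)
    have nE2: "norm (M E2) \<le> \<zeta> * (T * norm F0)"
    proof -
      obtain h where h: "integrable lborel h" "w2 = abs_L1 h" using L1_cases by metis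
      define \<kappa> where "\<kappa> x = lap e1 \<sigma> x - lap e2 \<sigma> x" for x
      have k1: "kern (lap e1 \<sigma>) (\<delta> + R)" "kern (lap e2 \<sigma>) (\<delta> + R)" using kern_lap[OF \<sigma>(1)] e by auto
      then have k\<kappa>: "kern \<kappa> (\<delta> + R)" unfolding kern_def \<kappa>_def by (auto intro!: continuous_intros)
      have MLap: "M (Lap e' w2) = abs_L1 (conv (lap e' \<sigma>) h)" if "0 < e'" for e'
      proof -
        have "conv \<sigma> (lap e' h) = conv (lap e' \<sigma>) h"
          by (rule ext) (rule conv_lap_right[OF that \<sigma>(1) h(1)])
        then show ?thesis
          by (simp only: h(2) Lap_abs_L1[OF that h(1)] M_def convolution_abs_L1[OF \<sigma>(1) lap_integrable[OF that h(1)]])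
      qed
      have i: "integrable lborel (conv (lap e1 \<sigma>) h)" "integrable lborel (conv (lap e2 \<sigma>) h)"
        using conv_integrable k1 h(1) by auto
      have "conv (lap e1 \<sigma>) h x - conv (lap e2 \<sigma>) h x = conv \<kappa> h x" for x
        unfolding conv_def \<kappa>_def using conv_integrable_pt[OF k1(1) h(1), of x] conv_integrable_pt[OF k1(2) h(1), of x]
        by (simp add: left_diff_distrib)
      then have "E2 = abs_L1 (conv \<kappa> h)"
        unfolding E2_def MLap[OF e(1)] MLap[OF e(2)] minus_abs_L1[OF i] by (simp only:)
      then have "norm E2 = (LINT x|lborel. \<bar>conv \<kappa> h x\<bar>)" using norm_abs_L1[OF conv_integrable[OF k\<kappa> h(1)]] by simp
      also have "\<dots> \<le> (LINT x|lborel. \<bar>\<kappa> x\<bar>) * (LINT x|lborel. \<bar>h x\<bar>)" by (rule conv_norm[OF k\<kappa> h(1)])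
      also have "\<dots> \<le> \<zeta> * (T * norm F0)"
      proof (rule mult_mono)
        show "(LINT x|lborel. \<bar>\<kappa> x\<bar>) \<le> \<zeta>" using \<zeta> by (simp add: \<kappa>_def)
        have "0 \<le> (LINT x|lborel. \<bar>lap e1 \<sigma> x - lap e2 \<sigma> x\<bar>)" by (intro Bochner_Integration.integral_nonneg) auto
        then show "0 \<le> \<zeta>" using \<zeta> by linarith
        have "(LINT x|lborel. \<bar>h x\<bar>) = norm w2" using norm_abs_L1[OF h(1)] h(2) by simp
        also have "\<dots> \<le> s * norm F0" using wint_norm[OF e(2) u2 s(1)] z by (simp add: w2_def)
        also have "\<dots> \<le> T * norm F0" using s by (intro mult_right_mono) auto
        finally show "(LINT x|lborel. \<bar>h x\<bar>) \<le> T * norm F0" .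
      qed (intro Bochner_Integration.integral_nonneg, auto)
      finally show ?thesis using Mn[of E2] by simp
    qed
    have sf: "pair \<phi> (M (M (Lap e1 (W s)))) = sform \<sigma> (Lap e1 (W s)) (V s)"
    proof -
      obtain y where y: "integrable lborel y" "Lap e1 (W s) = abs_L1 y" using L1_cases by metis
      note cy = conv_integrable[OF \<sigma>(1) y(1)]
      have "pair \<phi> (M (M (Lap e1 (W s)))) = (LINT x|lborel. \<phi> x * conv \<sigma> (conv \<sigma> y) x)"
        unfolding y(2) M_def convolution_abs_L1[OF \<sigma>(1) y(1)] convolution_abs_L1[OF \<sigma>(1) cy]
        by (rule pair_abs_L1[OF conv_integrable[OF \<sigma>(1) cy] \<phi>m])
      also have "\<dots> = (LINT x|lborel. conv \<sigma> \<phi> x * conv \<sigma> y x)"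
        by (rule conv_symmetric[OF \<sigma>(1,2) cy \<phi>m \<phi>C])
      also have "\<dots> = sform \<sigma> (Lap e1 (W s)) (V s)"
        unfolding y(2) Vs sform_abs_L1[OF \<sigma>(1) y(1) \<phi>i] by (simp add: mult.commute)
      finally show ?thesis .
    qed
    have C0: "0 \<le> C" using C by simp
    have b1: "\<bar>pair \<phi> (D1 - M (M D1))\<bar> \<le> C * (4 * \<eta>)"
      using pbd[of "D1 - M (M D1)"] mult_left_mono[OF MM[OF e(1) u1(1) z(1) s(1)] C0] by (simp add: D1_def)
    have b2: "\<bar>pair \<phi> (D2 - M (M D2))\<bar> \<le> C * (4 * \<eta>)"
      using pbd[of "D2 - M (M D2)"] mult_left_mono[OF MM[OF e(2) u2(1) z(2) s(1)] C0] by (simp add: D2_def)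
    have b3: "\<bar>pair \<phi> (M E2)\<bar> \<le> C * (\<zeta> * (T * norm F0))"
      using pbd[of "M E2"] mult_left_mono[OF nE2 C0] by simp
    have "pair \<phi> (u1 s - u2 s) = pair \<phi> (D1 - M (M D1)) - pair \<phi> (D2 - M (M D2)) + sform \<sigma> (Lap e1 (W s)) (V s) + pair \<phi> (M E2)"
      unfolding splt sf[symmetric] by (simp only: pl)
    then have e1': "(LINT x|lborel. \<phi> x * \<phi> x) \<le> sform \<sigma> (Lap e1 (W s)) (V s) + err"
      using e0 b1 b2 b3 unfolding err_def abs_le_iff by (simp add: algebra_simps)
    have "pair \<theta> (V s) = (LINT x|lborel. \<theta> x * \<phi> x)"
      unfolding Vs by (rule pair_abs_L1[OF \<phi>i \<theta>(1)])
    also have "\<dots> \<le> (LINT x|lborel. (\<gamma> / 2) * indicator A x + (\<phi> x * \<phi> x) / (2 * \<gamma>))"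
    proof (rule integral_mono)
      have "\<bar>\<theta> x\<bar> \<le> 1" for x using \<theta>(2)[of x] by (cases "x \<in> A") auto
      then show "integrable lborel (\<lambda>x. \<theta> x * \<phi> x)" using \<theta>(1) by (intro integrable_bounded_mult[OF \<phi>i]) auto
      show "integrable lborel (\<lambda>x. (\<gamma> / 2) * indicator A x + (\<phi> x * \<phi> x) / (2 * \<gamma>))"
        using A \<phi>2 by (auto simp: integrable_indicator_iff)
      fix x
      have "\<theta> x * \<phi> x \<le> \<bar>\<theta> x\<bar> * \<bar>\<phi> x\<bar>" by (simp add: abs_mult[symmetric])
      also have "\<dots> \<le> indicator A x * \<bar>\<phi> x\<bar>" using \<theta>(2) by (intro mult_right_mono) auto
      \<comment> \<open>Young's inequality with weight \<gamma> passes from the linear quantity to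
        the square that the energy controls.\<close>
      also have "\<dots> \<le> (\<gamma> / 2) * indicator A x + (\<phi> x * \<phi> x) / (2 * \<gamma>)"
      proof -
        have "0 \<le> (\<gamma> - \<bar>\<phi> x\<bar>)\<^sup>2" by simp
        then have "2 * \<gamma> * \<bar>\<phi> x\<bar> \<le> \<gamma> * \<gamma> + \<phi> x * \<phi> x" by (simp add: power2_eq_square algebra_simps)
        then have "\<bar>\<phi> x\<bar> \<le> (\<gamma> * \<gamma> + \<phi> x * \<phi> x) / (2 * \<gamma>)" using \<gamma> by (simp add: field_simps)
        also have "\<dots> = \<gamma> / 2 + (\<phi> x * \<phi> x) / (2 * \<gamma>)" using \<gamma> by (simp add: field_simps)
        finally show ?thesis using \<gamma> by (simp add: indicator_def)
      qed
      finally show "\<theta> x * \<phi> x \<le> (\<gamma> / 2) * indicator A x + (\<phi> x * \<phi> x) / (2 * \<gamma>)" .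
    qed
    also have "\<dots> = \<gamma> * measure lborel A / 2 + (LINT x|lborel. \<phi> x * \<phi> x) / (2 * \<gamma>)"
      using A \<phi>2 by (simp add: integrable_indicator_iff)
    also have "\<dots> \<le> \<gamma> * measure lborel A / 2 + (sform \<sigma> (Lap e1 (W s)) (V s) + err) / (2 * \<gamma>)"
      using e1' \<gamma> by (intro add_left_mono divide_right_mono) auto
    finally show ?thesis .
  qed
  interpret sf: bounded_bilinear "sform \<sigma>" by (rule sform_bilinear[OF \<sigma>(1)])
  have \<theta>1: "\<bar>\<theta> x\<bar> \<le> 1" for x using \<theta>(2)[of x] by (cases "x \<in> A") auto
  note \<theta>bl = pair_bounded_linear(1)[OF \<theta>(1) \<theta>1]
  define G where "G s = pair \<theta> (W s) - s * (\<gamma> * measure lborel A / 2 + err / (2 * \<gamma>)) - (1 / (4 * \<gamma>)) * sform \<sigma> (Lap e1 (W s)) (W s)" for s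
  have "G T \<le> G 0"
  proof (rule derivative_nonpos_decreasing[OF T])
    fix s assume s: "0 \<le> s" "s \<le> T"
    have Wd: "(W has_vector_derivative V s) (at s within {0..T})"
      unfolding W_def V_def by (intro has_vector_derivative_diff wint_deriv[OF u1(2) s] wint_deriv[OF u2(2) s])
    have Ld: "((\<lambda>s. Lap e1 (W s)) has_vector_derivative Lap e1 (V s)) (at s within {0..T})"
      by (rule bounded_linear.has_vector_derivative[OF Lap_bounded_linear[OF e(1)] Wd])
    have Sd: "((\<lambda>s. sform \<sigma> (Lap e1 (W s)) (W s)) has_vector_derivative
        sform \<sigma> (Lap e1 (W s)) (V s) + sform \<sigma> (Lap e1 (V s)) (W s)) (at s within {0..T})"
      by (rule sf.has_vector_derivative[OF Ld Wd])
    have idd: "((\<lambda>s. s * (\<gamma> * measure lborel A / 2 + err / (2 * \<gamma>))) has_vector_derivative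
        1 * (\<gamma> * measure lborel A / 2 + err / (2 * \<gamma>))) (at s within {0..T})"
      by (rule has_vector_derivative_mult_left[OF has_vector_derivative_id])
    show "(G has_vector_derivative (pair \<theta> (V s) - 1 * (\<gamma> * measure lborel A / 2 + err / (2 * \<gamma>))
        - (1 / (4 * \<gamma>)) * (sform \<sigma> (Lap e1 (W s)) (V s) + sform \<sigma> (Lap e1 (V s)) (W s)))) (at s within {0..T})"
      unfolding G_def
      by (intro has_vector_derivative_diff bounded_linear.has_vector_derivative[OF \<theta>bl Wd] idd
         has_vector_derivative_mult_right Sd)
    have sym: "sform \<sigma> (Lap e1 (V s)) (W s) = sform \<sigma> (Lap e1 (W s)) (V s)"
      by (rule sform_Lap_symmetric[OF e(1) \<sigma>(1)])
    have "(1 / (4 * \<gamma>)) * (x + x) = x / (2 * \<gamma>)" for x using \<gamma> by (simp add: field_simps)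
    then show "pair \<theta> (V s) - 1 * (\<gamma> * measure lborel A / 2 + err / (2 * \<gamma>))
        - (1 / (4 * \<gamma>)) * (sform \<sigma> (Lap e1 (W s)) (V s) + sform \<sigma> (Lap e1 (V s)) (W s)) \<le> 0"
      unfolding sym using key[OF s] by (simp add: add_divide_distrib)
  qed
  moreover have "G 0 = 0"
    using linear_0[OF bounded_linear.linear[OF \<theta>bl]] by (simp add: G_def W_def wint_0 sf.zero_right)
  moreover have "(1 / (4 * \<gamma>)) * sform \<sigma> (Lap e1 (W T)) (W T) \<le> 0"
    using sform_Lap_nonpos[OF e(1) \<sigma>(1), of "W T"] \<gamma> by (intro mult_nonneg_nonpos) auto
  ultimately show ?thesis by (simp add: G_def W_def err_def)
qed

text \<open>The parameters of \<open>comparison\<close> are fixed in the order \<gamma>, \<eta>,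
  \<delta>, and the scale last, because consistency of the discrete Laplacian is available only for
  a mollifier already chosen.\<close>

lemma wint_cauchy:
  fixes f :: "real ^ 'n \<Rightarrow> real"
  assumes C: "1 \<le> C" "abs_L1 f \<in> band C" and T: "0 < T" and A: "A \<in> sets borel" "emeasure lborel A < \<infinity>"
    and r: "0 < r"
  obtains e0 where "0 < e0" "\<And>e1 e2 u1 u2 W1 W2. 0 < e1 \<Longrightarrow> e1 < e0 \<Longrightarrow> 0 < e2 \<Longrightarrow> e2 < e0 \<Longrightarrow>
    L1_solution J e1 f u1 \<Longrightarrow> L1_solution J e2 f u2 \<Longrightarrow> integrable lborel W1 \<Longrightarrow> integrable lborel W2 \<Longrightarrow>
    wint u1 T = abs_L1 W1 \<Longrightarrow> wint u2 T = abs_L1 W2 \<Longrightarrow> (LINT x:A|lborel. \<bar>W1 x - W2 x\<bar>) \<le> r"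
proof -
  define F0 where "F0 = abs_L1 f"
  define mA where "mA = measure lborel A"
  have mA: "0 \<le> mA" by (simp add: mA_def)
  \<comment> \<open>Half of \<open>r\<close> is reserved for the term with the measure of
    \<open>A\<close>, and a quarter each for the mollification error and for the difference of
    scales. The \<open>+ 1\<close> covers a null set \<open>A\<close>.\<close>
  define \<gamma> where "\<gamma> = r / (T * (mA + 1))"
  have \<gamma>: "0 < \<gamma>" using r T mA by (simp add: \<gamma>_def)
  have \<gamma>1: "T * (\<gamma> * mA / 2) \<le> r / 2"
  proof -
    have "T * (\<gamma> * mA / 2) = r / 2 * (mA / (mA + 1))" using T mA by (simp add: \<gamma>_def)
    also have "\<dots> \<le> r / 2 * 1" using r mA by (intro mult_left_mono) auto
    finally show ?thesis by simp
  qed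
  define \<eta> where "\<eta> = \<gamma> * r / (16 * T * C)"
  have \<eta>: "0 < \<eta>" using \<gamma> r T C by (simp add: \<eta>_def)
  obtain \<delta> where \<delta>: "0 < \<delta>" "\<And>a. norm a < \<delta> \<Longrightarrow> norm (trans_L1 a F0 - F0) < \<eta>"
    using trans_continuous[OF \<eta>, of F0] by blast
  obtain K l where K: "0 < K" "\<And>e x. 0 < e \<Longrightarrow> e \<le> 1 \<Longrightarrow> \<bar>lap e (mollifier \<delta>) x - l x\<bar> \<le> K * e"
    "\<And>x. \<delta> + R \<le> norm x \<Longrightarrow> l x = 0"
    using lap_mollifier_consistent[OF \<delta>(1)] by blast
  define vb where "vb = measure lborel (ball (0 :: real ^ 'n) (\<delta> + R))"
  have vb: "0 \<le> vb" by (simp add: vb_def)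
  define q where "q = vb * K * (T * norm F0) * (T * C) + 1"
  have q: "0 < q" using vb K T C by (simp add: q_def add_nonneg_pos)
  define e0 where "e0 = min 1 (\<gamma> * r / (4 * q))"
  have e0: "0 < e0" using \<gamma> r q by (simp add: e0_def)
  show ?thesis
  proof (rule that[OF e0])
    fix e1 e2 u1 u2 W1 W2
    assume e: "0 < e1" "e1 < e0" "0 < e2" "e2 < e0" and s1: "L1_solution J e1 f u1" and s2: "L1_solution J e2 f u2"
      and W: "integrable lborel W1" "integrable lborel W2" "wint u1 T = abs_L1 W1" "wint u2 T = abs_L1 W2"
    have e': "e1 \<le> 1" "e2 \<le> 1" using e by (auto simp: e0_def)
    define \<zeta> where "\<zeta> = (2 * e0 * K) * vb"
    let ?\<sigma> = "mollifier \<delta> :: real ^ 'n \<Rightarrow> real"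
    note \<sigma> = kern_mollifier[OF \<delta>(1)] mollifier_even[OF \<delta>(1)] mollifier_nonneg[OF \<delta>(1)] mollifier_mass[OF \<delta>(1)]
    have k1: "kern (lap e1 ?\<sigma>) (\<delta> + R)" "kern (lap e2 ?\<sigma>) (\<delta> + R)" using kern_lap[OF \<sigma>(1)] e e' by auto
    have \<zeta>: "(LINT x|lborel. \<bar>lap e1 ?\<sigma> x - lap e2 ?\<sigma> x\<bar>) \<le> \<zeta>"
    proof -
      have ib: "integrable lborel (\<lambda>x. (2 * e0 * K) * indicator (ball (0 :: real ^ 'n) (\<delta> + R)) x)"
        using ball_lborel_fin[of "0 :: real ^ 'n" "\<delta> + R"] by (simp add: integrable_indicator_iff)
      have "(LINT x|lborel. \<bar>lap e1 ?\<sigma> x - lap e2 ?\<sigma> x\<bar>) \<le> (LINT x|lborel. (2 * e0 * K) * indicator (ball (0 :: real ^ 'n) (\<delta> + R)) x)"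
      proof (rule integral_mono[OF _ ib])
        show "integrable lborel (\<lambda>x. \<bar>lap e1 ?\<sigma> x - lap e2 ?\<sigma> x\<bar>)"
          using kern_integrable[OF k1(1)] kern_integrable[OF k1(2)] by simp
        fix x :: "real ^ 'n"
        show "\<bar>lap e1 ?\<sigma> x - lap e2 ?\<sigma> x\<bar> \<le> (2 * e0 * K) * indicator (ball 0 (\<delta> + R)) x"
        proof (cases "norm x < \<delta> + R")
          case True
          have "\<bar>lap e1 ?\<sigma> x - l x\<bar> \<le> K * e0" using K(2)[OF e(1) e'(1), of x] mult_left_mono[of e1 e0 K] e K(1) by linarith
          moreover have "\<bar>lap e2 ?\<sigma> x - l x\<bar> \<le> K * e0" using K(2)[OF e(3) e'(2), of x] mult_left_mono[of e2 e0 K] e K(1) by linarith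
          ultimately have "\<bar>lap e1 ?\<sigma> x - lap e2 ?\<sigma> x\<bar> \<le> K * e0 + K * e0" by linarith
          then show ?thesis using True by (simp add: mult_ac)
        next
          case False
          then show ?thesis using k1 unfolding kern_def by simp
        qed
      qed
      also have "\<dots> = \<zeta>" by (simp add: \<zeta>_def vb_def)
      finally show ?thesis .
    qed
    \<comment> \<open>Testing with the sign of the difference turns the bound for functionals into
      one for the \<open>L1\<close> norm over \<open>A\<close>.\<close>
    define \<theta> where "\<theta> x = indicator A x * sgn (W1 x - W2 x)" for x
    have [measurable]: "W1 \<in> borel_measurable borel" "W2 \<in> borel_measurable borel" "A \<in> sets borel"
      using W A by (auto dest: borel_measurable_integrable)
    have \<theta>: "\<theta> \<in> borel_measurable borel" "\<And>x. \<bar>\<theta> x\<bar> \<le> indicator A x"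
      unfolding \<theta>_def by (measurable, auto simp: indicator_def sgn_if)
    have eq: "\<And>t. 0 \<le> t \<Longrightarrow> u1 t = F0 + Lap e1 (wint u1 t)" "\<And>t. 0 \<le> t \<Longrightarrow> u2 t = F0 + Lap e2 (wint u2 t)"
      using solution_wint[OF s1 e(1)] solution_wint[OF s2 e(3)] by (auto simp: F0_def Lap_def)
    have CF: "F0 \<in> band C" using C by (simp add: F0_def)
    have tr: "norm a < \<delta> \<Longrightarrow> norm (trans_L1 a F0 - F0) \<le> \<eta>" for a using \<delta>(2)[of a] by simp
    have T0: "0 \<le> T" using T by simp
    have "(LINT x:A|lborel. \<bar>W1 x - W2 x\<bar>) = (LINT x|lborel. \<theta> x * (W1 x - W2 x))"
      unfolding set_lebesgue_integral_def \<theta>_def by (simp add: abs_sgn mult_ac)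
    also have "\<dots> = pair \<theta> (wint u1 T - wint u2 T)"
      unfolding W(3,4) minus_abs_L1[OF W(1,2)] by (rule pair_abs_L1[symmetric]) (use W \<theta> in auto)
    also have "\<dots> \<le> T * (\<gamma> * mA / 2 + C * (8 * \<eta> + \<zeta> * (T * norm F0)) / (2 * \<gamma>))"
      unfolding mA_def
      by (rule comparison[OF e(1,3) e' solution_flow[OF s1 e(1)] solution_cont[OF s1 e(1)] solution_flow[OF s2 e(3)] solution_cont[OF s2 e(3)]
         eq C(1) CF \<sigma> tr \<zeta> T0 A \<gamma> \<theta>])
    also have "\<dots> = T * (\<gamma> * mA / 2) + (T * C * 8 * \<eta>) / (2 * \<gamma>) + (T * C * (\<zeta> * (T * norm F0))) / (2 * \<gamma>)"
      using \<gamma> by (simp add: field_simps)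
    also have "(T * C * 8 * \<eta>) / (2 * \<gamma>) = r / 4"
      using T C \<gamma> by (simp add: \<eta>_def field_simps)
    also have "(T * C * (\<zeta> * (T * norm F0))) / (2 * \<gamma>) \<le> r / 4"
    proof -
      have "T * C * (\<zeta> * (T * norm F0)) = 2 * e0 * (vb * K * (T * norm F0) * (T * C))" by (simp add: \<zeta>_def)
      also have "\<dots> \<le> 2 * e0 * q" using e0 by (intro mult_left_mono) (auto simp: q_def)
      also have "\<dots> \<le> 2 * (\<gamma> * r / (4 * q)) * q" using q by (intro mult_right_mono) (auto simp: e0_def)
      also have "\<dots> = r / 4 * (2 * \<gamma>)" using q by simp
      finally have fin: "T * C * (\<zeta> * (T * norm F0)) \<le> r / 4 * (2 * \<gamma>)" .
      have g2: "0 < 2 * \<gamma>" using \<gamma> by simp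
      show ?thesis unfolding pos_divide_le_eq[OF g2] by (rule fin)
    qed
    finally show "(LINT x:A|lborel. \<bar>W1 x - W2 x\<bar>) \<le> r" using \<gamma>1 by simp
  qed
qed

end

section \<open>The limit of the mushy regions\<close>

text \<open>A bounded functional passes under the time integral, so bounds for the excess at each
  time yield almost everywhere bounds for \<open>w\<close> without a representative chosen jointly
  in space and time.\<close>

lemma pair_wint_bound:
  fixes D :: "real \<Rightarrow> real"
  assumes u: "continuous_on {0..} u" and T: "0 \<le> T"
    and \<theta>: "\<theta> \<in> borel_measurable borel" "\<And>x. \<bar>\<theta> x\<bar> \<le> 1"
    and bd: "\<And>s. 0 \<le> s \<Longrightarrow> s \<le> T \<Longrightarrow> pair \<theta> (pos_part_minus_one (u s)) \<le> m"
  shows "pair \<theta> (integral {0..T} (\<lambda>s. pos_part_minus_one (u s))) \<le> m * T"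
proof -
  have vc: "continuous_on {0..T} (\<lambda>s. pos_part_minus_one (u s))"
    by (intro continuous_on_compose2[OF continuous_on_pos_part[of UNIV]] continuous_on_subset[OF u]) auto
  have "((\<lambda>s. pos_part_minus_one (u s)) has_integral integral {0..T} (\<lambda>s. pos_part_minus_one (u s))) {0..T}"
    by (intro integrable_integral integrable_continuous_interval vc)
  from has_integral_linear[OF this pair_bounded_linear(1)[OF \<theta>]]
  have "((\<lambda>s. pair \<theta> (pos_part_minus_one (u s))) has_integral
      pair \<theta> (integral {0..T} (\<lambda>s. pos_part_minus_one (u s)))) {0..T}" by (simp add: o_def)
  moreover have "((\<lambda>s. m) has_integral m * T) {0..T}"
    using has_integral_const_real[of m 0 T] T by (simp add: mult.commute)
  ultimately show ?thesis by (rule has_integral_le) (use bd in auto)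
qed

section \<open>Pointwise data at a fixed time and porosity of the limit set\<close>

context unit_kernel
begin

text \<open>Gathers, for one time, representatives bounded everywhere, together with the discrete
  Poisson equation between \<open>U\<close> and \<open>W\<close> and the consequence of retention on
  the set where \<open>U \<le> 1\<close>.\<close>

lemma profile:
  assumes sol: "L1_solution J e f u" and e: "0 < e" and T: "0 < T"
    and C: "1 \<le> C" and fb: "integrable lborel fb" "abs_L1 f = abs_L1 fb" "\<And>x. 0 \<le> fb x" "\<And>x. fb x \<le> C"
  obtains U W where "integrable lborel U" "u T = abs_L1 U" "\<And>x. 0 \<le> U x" "\<And>x. U x \<le> C"
    "integrable lborel W" "wint u T = abs_L1 W" "\<And>x. 0 \<le> W x" "\<And>x. W x \<le> T * C"
    "AE x in lborel. U x = fb x + lap e W x" "AE x in lborel. U x \<le> 1 \<longrightarrow> W x = 0 \<and> fb x \<le> 1"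
proof -
  note fl = solution_flow[OF sol e] and uc = solution_cont[OF sol e] and eq = solution_wint[OF sol e]
  have T0: "0 \<le> T" using T by simp
  have u0: "u 0 = abs_L1 fb"
    using eq[of 0] linear_0[OF bounded_linear.linear[OF convolution_bounded_linear(1)[OF kern_Jeps[OF e]]]]
    by (simp add: wint_0 fb(2))
  have band0: "u 0 \<in> band C" using fb unfolding u0 band_def by blast
  have bd: "\<exists>g. integrable lborel g \<and> u s = abs_L1 g \<and> (\<forall>x. 0 \<le> g x \<and> g x \<le> C)" if "0 \<le> s" for s
    using flow_in_band[OF e fl C band0 that] by (auto simp: band_def)
  obtain U where U: "integrable lborel U" "u T = abs_L1 U" "\<And>x. 0 \<le> U x" "\<And>x. U x \<le> C"
    using bd[OF T0] by blast
  obtain W0 where W0: "integrable lborel W0" "wint u T = abs_L1 W0" using L1_cases by metis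
  have [measurable]: "U \<in> borel_measurable borel" "W0 \<in> borel_measurable borel"
    using U W0 by (auto dest: borel_measurable_integrable)
  have vbound: "pair \<theta> (pos_part_minus_one (u s)) = (LINT x|lborel. \<theta> x * max (g x - 1) 0)"
    if "\<theta> \<in> borel_measurable borel" "u s = abs_L1 g" "integrable lborel g" for \<theta> s g
    unfolding that(2) pos_part_abs_L1[OF that(3)] by (rule pair_abs_L1[OF integrable_pos_part_lborel[OF that(3)] that(1)])
  have W0eq: "pair \<theta> (integral {0..T} (\<lambda>s. pos_part_minus_one (u s))) = (LINT x|lborel. \<theta> x * W0 x)"
    if "\<theta> \<in> borel_measurable borel" for \<theta>
    using pair_abs_L1[OF W0(1) that] W0(2) by (simp add: wint_def)
  have pos: "AE x in lborel. 0 \<le> W0 x"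
  proof -
    let ?A = "{x. W0 x < 0}"
    let ?\<theta> = "\<lambda>x. - indicator ?A x :: real"
    have m: "?\<theta> \<in> borel_measurable borel" by measurable
    have "pair ?\<theta> (integral {0..T} (\<lambda>s. pos_part_minus_one (u s))) \<le> 0 * T"
    proof (rule pair_wint_bound[OF uc T0 m])
      fix s assume s: "0 \<le> s" "s \<le> T"
      obtain g where g: "integrable lborel g" "u s = abs_L1 g" using bd[OF s(1)] by blast
      have "0 \<le> (LINT x|lborel. indicator ?A x * max (g x - 1) 0)"
        by (intro Bochner_Integration.integral_nonneg) auto
      then show "pair ?\<theta> (pos_part_minus_one (u s)) \<le> 0" unfolding vbound[OF m g(2,1)] by simp
    qed (simp add: indicator_def)
    then have le: "0 \<le> (LINT x|lborel. indicator ?A x * W0 x)" unfolding W0eq[OF m] by simp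
    have i: "integrable lborel (\<lambda>x. - (indicator ?A x * W0 x))"
      using integrable_mult_indicator[OF _ W0(1), of ?A] by simp
    have "0 \<le> (LINT x|lborel. - (indicator ?A x * W0 x))"
      by (intro Bochner_Integration.integral_nonneg) (auto simp: indicator_def)
    then have "(LINT x|lborel. - (indicator ?A x * W0 x)) = 0" using le by simp
    then have "AE x in lborel. - (indicator ?A x * W0 x) = 0"
      by (subst (asm) integral_nonneg_eq_0_iff_AE[OF i]) (auto simp: indicator_def)
    then show ?thesis by eventually_elim (auto simp: indicator_def split: if_splits)
  qed
  have upper: "AE x in lborel. W0 x \<le> T * C"
  proof -
    let ?A = "{x. T * C < W0 x}"
    let ?\<theta> = "\<lambda>x. indicator ?A x :: real"
    have m: "?\<theta> \<in> borel_measurable borel" by measurable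
    have TC: "0 < T * C" using T C by simp
    \<comment> \<open>By Chebyshev the set has finite measure, since \<open>W0\<close> exceeds the
      positive constant \<open>T * C\<close> on it.\<close>
    have iA: "integrable lborel ?\<theta>"
    proof (rule Bochner_Integration.integrable_bound[of _ "\<lambda>x. W0 x / (T * C)"])
      show "AE x in lborel. norm (?\<theta> x) \<le> norm (W0 x / (T * C))"
        using TC by (intro AE_I2) (auto simp: indicator_def abs_divide pos_le_divide_eq)
    qed (use W0 in auto)
    have "pair ?\<theta> (integral {0..T} (\<lambda>s. pos_part_minus_one (u s))) \<le> (C * (LINT x|lborel. ?\<theta> x)) * T"
    proof (rule pair_wint_bound[OF uc T0 m])
      fix s assume s: "0 \<le> s" "s \<le> T"
      obtain g where g: "integrable lborel g" "u s = abs_L1 g" "\<And>x. g x \<le> C" using bd[OF s(1)] by blast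
      have "(LINT x|lborel. ?\<theta> x * max (g x - 1) 0) \<le> (LINT x|lborel. C * ?\<theta> x)"
      proof (rule integral_mono)
        show "integrable lborel (\<lambda>x. ?\<theta> x * max (g x - 1) 0)"
          using integrable_mult_indicator[OF _ integrable_pos_part_lborel[OF g(1)], of ?A] by simp
        show "integrable lborel (\<lambda>x. C * ?\<theta> x)" using iA by simp
        show "?\<theta> x * max (g x - 1) 0 \<le> C * ?\<theta> x" for x using g(3)[of x] C by (simp add: indicator_def)
      qed
      then show "pair ?\<theta> (pos_part_minus_one (u s)) \<le> C * (LINT x|lborel. ?\<theta> x)" unfolding vbound[OF m g(2,1)] by simp
    qed (simp add: indicator_def)
    then have le: "(LINT x|lborel. ?\<theta> x * W0 x) \<le> T * C * (LINT x|lborel. ?\<theta> x)" unfolding W0eq[OF m] by (simp add: mult_ac)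
    have i0: "integrable lborel (\<lambda>x. ?\<theta> x * W0 x)" using integrable_mult_indicator[OF _ W0(1), of ?A] by simp
    have i: "integrable lborel (\<lambda>x. ?\<theta> x * W0 x - T * C * ?\<theta> x)" using i0 iA by simp
    have nn: "0 \<le> ?\<theta> x * W0 x - T * C * ?\<theta> x" for x by (simp add: indicator_def)
    have "(LINT x|lborel. ?\<theta> x * W0 x - T * C * ?\<theta> x) \<le> 0" using le i0 iA by simp
    moreover have "0 \<le> (LINT x|lborel. ?\<theta> x * W0 x - T * C * ?\<theta> x)" using nn by (rule Bochner_Integration.integral_nonneg)
    ultimately have "(LINT x|lborel. ?\<theta> x * W0 x - T * C * ?\<theta> x) = 0" by (rule antisym)
    then have "AE x in lborel. ?\<theta> x * W0 x - T * C * ?\<theta> x = 0"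
      using integral_nonneg_eq_0_iff_AE[OF i] nn by blast
    then show ?thesis by eventually_elim (auto simp: indicator_def split: if_splits)
  qed
  define W where "W x = max 0 (min (T * C) (W0 x))" for x
  have TC: "0 < T * C" using T C by simp
  have Wi: "integrable lborel W"
  proof (rule Bochner_Integration.integrable_bound[OF W0(1)])
    show "W \<in> borel_measurable lborel" unfolding W_def by measurable
    show "AE x in lborel. norm (W x) \<le> norm (W0 x)" using TC by (intro AE_I2) (auto simp: W_def)
  qed
  have "AE x in lborel. W0 x = W x" using pos upper by eventually_elim (auto simp: W_def)
  then have Weq: "wint u T = abs_L1 W" using W0 Wi by (simp add: abs_L1_eq_iff)
  have Wb: "0 \<le> W x" "W x \<le> T * C" for x using TC by (auto simp: W_def)
  have "abs_L1 U = abs_L1 (\<lambda>x. fb x + lap e W x)"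
    using eq[OF T0] plus_abs_L1[OF fb(1) lap_integrable[OF e Wi]] Lap_abs_L1[OF e Wi]
    unfolding U(2) Weq fb(2) by (simp add: Lap_def)
  then have UW: "AE x in lborel. U x = fb x + lap e W x"
    using U(1) fb(1) lap_integrable[OF e Wi] by (simp add: abs_L1_eq_iff)
  \<comment> \<open>Retention is applied backwards from time \<open>T\<close> on the set where
    \<open>U \<le> 1\<close>. All earlier times together give \<open>W = 0\<close>, and time
    \<open>0\<close> gives \<open>fb \<le> 1\<close>.\<close>
  have ret: "AE x in lborel. U x \<le> 1 \<longrightarrow> W x = 0 \<and> fb x \<le> 1"
  proof -
    let ?A = "{x. U x \<le> 1}"
    let ?\<theta> = "indicator ?A :: real ^ 'n \<Rightarrow> real"
    have As: "?A \<in> sets borel" by measurable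
    have m: "?\<theta> \<in> borel_measurable borel" by measurable
    have "(\<lambda>x. ?\<theta> x * max (U x - 1) 0) = (\<lambda>x. 0)" by (auto simp: indicator_def)
    then have "pair ?\<theta> (pos_part_minus_one (u T)) = 0" unfolding vbound[OF m U(2,1)] by simp
    then have z: "pair ?\<theta> (pos_part_minus_one (u s)) = 0" if "0 \<le> s" "s \<le> T" for s
      using retention[OF e fl As that] by blast
    have "pair ?\<theta> (integral {0..T} (\<lambda>s. pos_part_minus_one (u s))) \<le> 0 * T"
      by (rule pair_wint_bound[OF uc T0 m]) (simp_all add: z indicator_def)
    then have "pair ?\<theta> (abs_L1 W) \<le> 0" using Weq by (simp add: wint_def)
    then have le: "(LINT x|lborel. ?\<theta> x * W x) \<le> 0" unfolding pair_abs_L1[OF Wi m] .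
    have i1: "integrable lborel (\<lambda>x. ?\<theta> x * W x)" using integrable_mult_indicator[OF _ Wi, of ?A] by simp
    have "0 \<le> (LINT x|lborel. ?\<theta> x * W x)" using Wb by (intro Bochner_Integration.integral_nonneg) auto
    then have "(LINT x|lborel. ?\<theta> x * W x) = 0" using le by simp
    then have a1: "AE x in lborel. ?\<theta> x * W x = 0"
      by (subst (asm) integral_nonneg_eq_0_iff_AE[OF i1]) (auto simp: Wb)
    have "(LINT x|lborel. ?\<theta> x * max (fb x - 1) 0) = 0"
      using z[of 0] T vbound[OF m u0 fb(1)] by simp
    moreover have i2: "integrable lborel (\<lambda>x. ?\<theta> x * max (fb x - 1) 0)"
      using integrable_mult_indicator[OF _ integrable_pos_part_lborel[OF fb(1)], of ?A] by simp
    ultimately have a2: "AE x in lborel. ?\<theta> x * max (fb x - 1) 0 = 0"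
      by (subst (asm) integral_nonneg_eq_0_iff_AE[OF i2]) auto
    from a1 a2 show ?thesis
    proof eventually_elim
      fix x assume "?\<theta> x * W x = 0" "?\<theta> x * max (fb x - 1) 0 = 0"
      then show "U x \<le> 1 \<longrightarrow> W x = 0 \<and> fb x \<le> 1" by (auto simp: indicator_def max_def split: if_splits)
    qed
  qed
  show ?thesis using that[OF U Wi Weq Wb UW ret] .
qed

text \<open>Translates between distributional supports and almost everywhere statements. Openness of
  the region allows the way back, from an excess of \<open>f\<close> that vanishes almost everywhere
  to a set that misses the support.\<close>

lemma mushy_region_D:
  assumes U: "integrable lborel U" "u = abs_L1 U" "\<And>x. 0 \<le> U x"
    and fb: "integrable lborel fb" "AE x in lebesgue. f x = fb x"
    and supp: "supp_D f = supp_D (\<lambda>x. max (f x - 1) 0)"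
    and ret: "AE x in lborel. U x \<le> 1 \<longrightarrow> W x = 0 \<and> fb x \<le> 1"
  shows "AE x in lborel. x \<in> mushy_region u \<longrightarrow> W x = 0"
    and "mushy_region u \<inter> supp_D f = {}"
    and "x \<in> mushy_region u \<Longrightarrow> open N \<Longrightarrow> x \<in> N \<Longrightarrow> \<not> (AE y in lborel. y \<in> N \<longrightarrow> U y = 0)"
proof -
  let ?M = "mushy_region u"
  have oM: "open ?M" by (simp add: mushy_region_def)
  have sub: "?M \<subseteq> supp_D (rep_L1 u) - supp_D (rep_L1 (pos_part_minus_one u))"
    unfolding mushy_region_def by (rule interior_subset)
  have ru: "AE x in lebesgue. rep_L1 u x = U x" unfolding U(2) by (rule rep_abs_lborel[OF U(1)])
  have rv: "AE x in lebesgue. rep_L1 (pos_part_minus_one u) x = max (U x - 1) 0"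
    unfolding U(2) pos_part_abs_L1[OF U(1)] by (rule rep_abs_lborel[OF integrable_pos_part_lborel[OF U(1)]])
  have "AE x in lebesgue. 0 \<le> rep_L1 (pos_part_minus_one u) x" using rv by eventually_elim simp
  from AE_zero_outside_supp_D[OF integrable_rep_L1 this]
  have M1: "AE x in lebesgue. x \<in> ?M \<longrightarrow> U x \<le> 1"
    using rv by eventually_elim (use sub in \<open>auto simp: max_def split: if_splits\<close>)
  have ret': "AE x in lebesgue. U x \<le> 1 \<longrightarrow> W x = 0 \<and> fb x \<le> 1"
    using ret unfolding AE_lebesgue_iff .
  have "AE x in lebesgue. x \<in> ?M \<longrightarrow> W x = 0" using M1 ret' by eventually_elim auto
  then show "AE x in lborel. x \<in> ?M \<longrightarrow> W x = 0" unfolding AE_lebesgue_iff .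
  have "AE x in lebesgue. x \<in> ?M \<longrightarrow> max (f x - 1) 0 = 0" using M1 ret' fb(2) by eventually_elim auto
  from supp_D_disjoint[OF oM this] show "?M \<inter> supp_D f = {}" by (simp add: supp)
  show "\<not> (AE y in lborel. y \<in> N \<longrightarrow> U y = 0)" if x: "x \<in> ?M" and N: "open N" "x \<in> N"
  proof
    assume "AE y in lborel. y \<in> N \<longrightarrow> U y = 0"
    then have "AE y in lebesgue. y \<in> N \<longrightarrow> U y = 0" unfolding AE_lebesgue_iff .
    with ru have "AE y in lebesgue. y \<in> N \<longrightarrow> rep_L1 u y = 0" by eventually_elim auto
    from supp_D_disjoint[OF N(1) this] N(2) x sub show False by auto
  qed
qed

text \<open>The order of choices is what matters: \<kappa> precedes the point, the tolerance \<rho>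
  precedes both scales, and the second scale \<open>eb\<close> may depend on the ball found with the
  first.\<close>

lemma limsup_mushy_region_null:
  fixes f :: "real ^ 'n \<Rightarrow> real" and u :: "real \<Rightarrow> real \<Rightarrow> (real ^ 'n) L1"
  assumes C: "1 \<le> C" and fb: "integrable lborel fb" "AE x in lebesgue. f x = fb x" "\<And>x. 0 \<le> fb x" "\<And>x. fb x \<le> C"
    and fi: "integrable lebesgue f"
    and supp: "supp_D f = supp_D (\<lambda>x. max (f x - 1) 0)"
    and sol: "\<And>e. 0 < e \<Longrightarrow> L1_solution J e f (u e)" and T: "0 < T"
  shows "(\<Inter>\<eta>\<in>{0<..}. \<Union>e\<in>{0<..<\<eta>}. mushy_region (u e T)) \<in> null_sets lebesgue"
proof -
  let ?N = "CARD('n)"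
  define E where "E = (\<Inter>\<eta>\<in>{0<..}. \<Union>e\<in>{0<..<\<eta>}. mushy_region (u e T))"
  have absf: "abs_L1 f = abs_L1 fb"
    using Quotient3_rel[OF Quotient3_L1, of f fb] fi fb by (simp add: L1_rel_def integrable_lebesgue_of_lborel)
  have band: "abs_L1 f \<in> band C" unfolding absf band_def using fb by blast
  have f0: "AE x in lebesgue. 0 \<le> f x" using fb(2) by eventually_elim (simp add: fb(3))
  have fout: "AE x in lborel. x \<notin> supp_D f \<longrightarrow> fb x = 0"
  proof -
    have "AE x in lebesgue. x \<notin> supp_D f \<longrightarrow> fb x = 0"
      using AE_zero_outside_supp_D[OF fi f0] fb(2) by eventually_elim auto
    then show ?thesis unfolding AE_lebesgue_iff .
  qed
  have small: "\<exists>e. 0 < e \<and> e < \<eta> \<and> x \<in> mushy_region (u e T)" if "x \<in> E" "0 < \<eta>" for x \<eta>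
  proof -
    have "x \<in> (\<Union>e\<in>{0<..<\<eta>}. mushy_region (u e T))"
      using that(1) unfolding E_def by (rule INT_D) (use that(2) in simp)
    then show ?thesis by auto
  qed
  obtain CG where CG: "1 \<le> CG" and gr: "\<And>Z y \<Lambda> r e. integrable lborel Z \<Longrightarrow> (\<And>x. 0 \<le> Z x) \<Longrightarrow> 0 \<le> \<Lambda> \<Longrightarrow> 0 < e \<Longrightarrow> e \<le> r \<Longrightarrow>
       conv (Jeps e) Z y \<le> 2 * \<Lambda> * e\<^sup>2 \<Longrightarrow>
       (AE x in lborel. x \<in> ball y (CG * r) \<longrightarrow> conv (Jeps e) Z x \<le> Z x + \<Lambda> * e\<^sup>2) \<Longrightarrow>
       (LINT x:ball y r|lborel. Z x) \<le> CG * \<Lambda> * r ^ (?N + 2)"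
    using growth by blast
  obtain \<kappa>0 c where c: "0 < \<kappa>0" "\<kappa>0 < 1" "0 < c" and nd:
    "\<And>\<kappa> r0 B K. 0 < \<kappa> \<Longrightarrow> \<kappa> \<le> \<kappa>0 \<Longrightarrow> 0 < r0 \<Longrightarrow> 0 \<le> B \<Longrightarrow> 0 < K \<Longrightarrow> B + 1 \<le> K * (r0 / 2) ^ 4 \<Longrightarrow>
      \<exists>e0>0. \<forall>e W x. 0 < e \<longrightarrow> e < e0 \<longrightarrow> integrable lborel W \<longrightarrow> (\<forall>y. 0 \<le> W y \<and> W y \<le> B) \<longrightarrow>
        (AE y in lborel. W y - C * e\<^sup>2 \<le> conv (Jeps e) W y) \<longrightarrow>
        (AE y in lborel. y \<in> ball x r0 \<longrightarrow> 0 < W y \<longrightarrow> W y + e\<^sup>2 \<le> conv (Jeps e) W y) \<longrightarrow>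
        \<not> (AE y in lborel. y \<in> ball x (2 * R * e) \<longrightarrow> W y = 0) \<longrightarrow>
        (\<exists>y. c \<le> K * (dist x y)\<^sup>2 \<and> K * dist x y ^ 4 \<le> B + 1 \<and>
          c * \<kappa> ^ ?N * dist x y ^ (?N + 2) \<le> (LINT u:ball y (\<kappa> * dist x y)|lborel. W u))"
    using nondegeneracy[OF C] by blast
  \<comment> \<open>The constant of the growth estimate on a ball of radius
    \<open>2 * (\<kappa> * d)\<close>.\<close>
  define q where "q = CG * C * 2 ^ (?N + 2)"
  have q: "0 < q" using CG C by (simp add: q_def)
  define \<kappa> where "\<kappa> = min \<kappa>0 (c / (4 * q))"
  have \<kappa>: "0 < \<kappa>" "\<kappa> \<le> \<kappa>0" "\<kappa> \<le> 1" "\<kappa> \<le> c / (4 * q)" using c q by (auto simp: \<kappa>_def)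
  have q\<kappa>: "q * \<kappa>\<^sup>2 \<le> c / 4"
  proof -
    have "\<kappa>\<^sup>2 \<le> \<kappa>" using \<kappa> by (simp add: power2_eq_square mult_left_le)
    then have "q * \<kappa>\<^sup>2 \<le> q * (c / (4 * q))" using \<kappa>(4) q by (intro mult_left_mono) auto
    also have "\<dots> = c / 4" using q by simp
    finally show ?thesis .
  qed
  define B where "B = T * C"
  have B: "0 \<le> B" using T C by (simp add: B_def)
  have "E \<in> null_sets lebesgue"
  proof (rule porous_null_sets[OF _ \<kappa>(1,3)])
    \<comment> \<open>For measurability: the regions are open, so with thresholds
      \<open>1 / real (Suc n)\<close> the set is a countable intersection of open sets.\<close>
    have eqE: "E = (\<Inter>n::nat. \<Union>e\<in>{0<..<1 / real (Suc n)}. mushy_region (u e T))"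
    proof
      show "E \<subseteq> (\<Inter>n::nat. \<Union>e\<in>{0<..<1 / real (Suc n)}. mushy_region (u e T))"
        unfolding E_def by (intro INT_greatest INT_lower) simp
      show "(\<Inter>n::nat. \<Union>e\<in>{0<..<1 / real (Suc n)}. mushy_region (u e T)) \<subseteq> E"
        unfolding E_def
      proof (rule INT_greatest)
        fix \<eta> :: real assume "\<eta> \<in> {0<..}"
        then obtain n where n: "inverse (real (Suc n)) < \<eta>" using reals_Archimedean by auto
        have "(\<Inter>n::nat. \<Union>e\<in>{0<..<1 / real (Suc n)}. mushy_region (u e T))
           \<subseteq> (\<Union>e\<in>{0<..<1 / real (Suc n)}. mushy_region (u e T))" by (rule INT_lower) simp
        also have "\<dots> \<subseteq> (\<Union>e\<in>{0<..<\<eta>}. mushy_region (u e T))"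
          using n by (intro UN_mono) (auto simp: inverse_eq_divide)
        finally show "(\<Inter>n::nat. \<Union>e\<in>{0<..<1 / real (Suc n)}. mushy_region (u e T)) \<subseteq> (\<Union>e\<in>{0<..<\<eta>}. mushy_region (u e T))" .
      qed
    qed
    have Um: "(\<Union>e\<in>{0<..<r}. mushy_region (u e T)) \<in> sets lebesgue" for r
    proof -
      have "open (\<Union>e\<in>{0<..<r}. mushy_region (u e T))" by (intro open_UN) (simp add: mushy_region_def)
      then have "(\<Union>e\<in>{0<..<r}. mushy_region (u e T)) \<in> sets lborel" by simp
      then show ?thesis by (rule sets_completionI_sets)
    qed
    show "E \<in> sets lebesgue"
      unfolding eqE by (rule sets.countable_INT) (use Um in auto)
  next
    fix x and r :: real assume x: "x \<in> E" and r: "0 < r"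
    have xS: "x \<notin> supp_D f"
    proof -
      obtain e where e: "0 < e" "x \<in> mushy_region (u e T)" using small[OF x, of 1] by auto
      obtain U W where U: "integrable lborel U" "u e T = abs_L1 U" "\<And>x. 0 \<le> U x" "\<And>x. U x \<le> C"
        and "integrable lborel W" "wint (u e) T = abs_L1 W" "\<And>x. 0 \<le> W x" "\<And>x. W x \<le> T * C"
        and "AE x in lborel. U x = fb x + lap e W x" and ret: "AE x in lborel. U x \<le> 1 \<longrightarrow> W x = 0 \<and> fb x \<le> 1"
        by (rule profile[OF sol[OF e(1)] e(1) T C fb(1) absf fb(3,4)]) (use that in blast)
      show ?thesis using mushy_region_D(2)[OF U(1-3) fb(1,2) supp ret] e(2) by auto
    qed
    obtain r1 where r1: "0 < r1" "ball x r1 \<inter> supp_D f = {}"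
    proof -
      have "open (- supp_D f)" "x \<in> - supp_D f" using closed_supp_D[of f] xS by auto
      then obtain r1 where "0 < r1" "ball x r1 \<subseteq> - supp_D f" by (meson openE)
      then show ?thesis using that[of r1] by blast
    qed
    define r0 where "r0 = min r r1"
    have r0: "0 < r0" "r0 \<le> r" "ball x r0 \<inter> supp_D f = {}" using r r1 by (auto simp: r0_def)
    \<comment> \<open>The least admissible coefficient: the penalty at radius \<open>r0 / 2\<close>
      equals \<open>B + 1\<close>.\<close>
    define K where "K = (B + 1) / (r0 / 2) ^ 4"
    have K: "0 < K" using B r0 by (simp add: K_def add_nonneg_pos)
    have KB: "B + 1 = K * (r0 / 2) ^ 4" using r0 by (simp add: K_def)
    obtain e0 where e0: "0 < e0" and nd1: "\<And>e W x. 0 < e \<Longrightarrow> e < e0 \<Longrightarrow> integrable lborel W \<Longrightarrow> (\<forall>y. 0 \<le> W y \<and> W y \<le> B) \<Longrightarrow>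
        (AE y in lborel. W y - C * e\<^sup>2 \<le> conv (Jeps e) W y) \<Longrightarrow>
        (AE y in lborel. y \<in> ball x r0 \<longrightarrow> 0 < W y \<longrightarrow> W y + e\<^sup>2 \<le> conv (Jeps e) W y) \<Longrightarrow>
        \<not> (AE y in lborel. y \<in> ball x (2 * R * e) \<longrightarrow> W y = 0) \<Longrightarrow>
        (\<exists>y. c \<le> K * (dist x y)\<^sup>2 \<and> K * dist x y ^ 4 \<le> B + 1 \<and>
          c * \<kappa> ^ ?N * dist x y ^ (?N + 2) \<le> (LINT u:ball y (\<kappa> * dist x y)|lborel. W u))"
      using nd[OF \<kappa>(1,2) r0(1) B K eq_refl[OF KB]] by blast
    \<comment> \<open>Every centre that nondegeneracy provides satisfies
      \<open>c \<le> K * d\<^sup>2\<close>, so its distance is at least \<open>dm\<close> at any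
      scale; this permits fixing \<rho> before the scales.\<close>
    define dm where "dm = sqrt (c / K)"
    have dm: "0 < dm" using c K by (simp add: dm_def)
    define \<rho> where "\<rho> = c / 4 * \<kappa> ^ ?N * dm ^ (?N + 2)"
    have \<rho>: "0 < \<rho>" using c \<kappa> dm by (simp add: \<rho>_def)
    define A where "A = ball x (2 * r0)"
    have A: "A \<in> sets borel" "emeasure lborel A < \<infinity>" using ball_lborel_fin by (auto simp: A_def)
    obtain e1 where e1: "0 < e1" and ca: "\<And>ea eb ua ub W1 W2. 0 < ea \<Longrightarrow> ea < e1 \<Longrightarrow> 0 < eb \<Longrightarrow> eb < e1 \<Longrightarrow>
      L1_solution J ea f ua \<Longrightarrow> L1_solution J eb f ub \<Longrightarrow> integrable lborel W1 \<Longrightarrow> integrable lborel W2 \<Longrightarrow>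
      wint ua T = abs_L1 W1 \<Longrightarrow> wint ub T = abs_L1 W2 \<Longrightarrow> (LINT x:A|lborel. \<bar>W1 x - W2 x\<bar>) \<le> \<rho>"
      using wint_cauchy[OF C band T A \<rho>] by blast
    obtain ea where ea: "0 < ea" "ea < min e0 e1" "x \<in> mushy_region (u ea T)"
      using small[OF x, of "min e0 e1"] e0 e1 by auto
    obtain U1 W1 where U1: "integrable lborel U1" "u ea T = abs_L1 U1" "\<And>x. 0 \<le> U1 x" "\<And>x. U1 x \<le> C"
      and W1: "integrable lborel W1" "wint (u ea) T = abs_L1 W1" "\<And>x. 0 \<le> W1 x" "\<And>x. W1 x \<le> T * C"
      and eq1: "AE x in lborel. U1 x = fb x + lap ea W1 x" and ret1: "AE x in lborel. U1 x \<le> 1 \<longrightarrow> W1 x = 0 \<and> fb x \<le> 1"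
      by (rule profile[OF sol[OF ea(1)] ea(1) T C fb(1) absf fb(3,4)]) (use that in blast)
    have lapc: "conv (Jeps e) W y = W y + e\<^sup>2 * lap e W y" if "0 < e" for e W y
      using that by (simp add: lap_def)
    have "\<exists>y. c \<le> K * (dist x y)\<^sup>2 \<and> K * dist x y ^ 4 \<le> B + 1 \<and>
          c * \<kappa> ^ ?N * dist x y ^ (?N + 2) \<le> (LINT u:ball y (\<kappa> * dist x y)|lborel. W1 u)"
    proof (rule nd1[OF ea(1) _ W1(1)])
      show "ea < e0" using ea by simp
      show "\<forall>y. 0 \<le> W1 y \<and> W1 y \<le> B" using W1 by (simp add: B_def)
      show "AE y in lborel. W1 y - C * ea\<^sup>2 \<le> conv (Jeps ea) W1 y"
        using eq1
      proof eventually_elim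
        fix y assume "U1 y = fb y + lap ea W1 y"
        then have "- C \<le> lap ea W1 y" using U1(3)[of y] fb(4)[of y] by simp
        then have "ea\<^sup>2 * - C \<le> ea\<^sup>2 * lap ea W1 y" by (rule mult_left_mono) simp
        then show "W1 y - C * ea\<^sup>2 \<le> conv (Jeps ea) W1 y" unfolding lapc[OF ea(1)] by (simp add: mult.commute)
      qed
      show "AE y in lborel. y \<in> ball x r0 \<longrightarrow> 0 < W1 y \<longrightarrow> W1 y + ea\<^sup>2 \<le> conv (Jeps ea) W1 y"
        using eq1 ret1 fout
      proof eventually_elim
        fix y assume a: "U1 y = fb y + lap ea W1 y" "U1 y \<le> 1 \<longrightarrow> W1 y = 0 \<and> fb y \<le> 1" "y \<notin> supp_D f \<longrightarrow> fb y = 0"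
        show "y \<in> ball x r0 \<longrightarrow> 0 < W1 y \<longrightarrow> W1 y + ea\<^sup>2 \<le> conv (Jeps ea) W1 y"
        proof (intro impI)
          assume y: "y \<in> ball x r0" "0 < W1 y"
          then have "y \<notin> supp_D f" using r0(3) by blast
          then have "1 \<le> lap ea W1 y" using a y(2) by auto
          then have "ea\<^sup>2 * 1 \<le> ea\<^sup>2 * lap ea W1 y" by (rule mult_left_mono) simp
          then show "W1 y + ea\<^sup>2 \<le> conv (Jeps ea) W1 y" unfolding lapc[OF ea(1)] by simp
        qed
      qed
      \<comment> \<open>If \<open>W1\<close> vanished within \<open>2 * R * ea\<close> of
        \<open>x\<close>, its discrete Laplacian would vanish within \<open>R * ea\<close>, and so
        would \<open>U1\<close>, because \<open>fb = 0\<close> near \<open>x\<close>. But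
        \<open>x\<close> lies in the support of the solution.\<close>
      show "\<not> (AE y in lborel. y \<in> ball x (2 * R * ea) \<longrightarrow> W1 y = 0)"
      proof
        assume z: "AE y in lborel. y \<in> ball x (2 * R * ea) \<longrightarrow> W1 y = 0"
        let ?Nb = "ball x (R * ea) \<inter> ball x r0"
        have kJ: "kern (Jeps ea) (ea * R)" by (rule kern_Jeps[OF ea(1)])
        have c0: "conv (Jeps ea) W1 y = 0" if y: "y \<in> ball x (R * ea)" for y
          unfolding conv_def
        proof (rule integral_eq_zero_AE)
          show "AE w in lborel. Jeps ea (y - w) * W1 w = 0"
            using z
          proof eventually_elim
            fix w assume w: "w \<in> ball x (2 * R * ea) \<longrightarrow> W1 w = 0"
            show "Jeps ea (y - w) * W1 w = 0"
            proof (cases "norm (y - w) < ea * R")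
              case True
              have "dist x w \<le> dist x y + dist y w" by (rule dist_triangle)
              moreover have "dist x y < R * ea" using y by simp
              moreover have "dist y w < R * ea" using True by (simp add: dist_norm mult.commute)
              moreover have "2 * R * ea = R * ea + R * ea" by simp
              ultimately have "dist x w < 2 * R * ea" by linarith
              then show ?thesis using w by simp
            next
              case False
              then have "Jeps ea (y - w) = 0" using kJ unfolding kern_def by simp
              then show ?thesis by simp
            qed
          qed
        qed
        have sub2: "R * ea \<le> 2 * R * ea" using R1 ea by simp
        have "AE y in lborel. y \<in> ?Nb \<longrightarrow> U1 y = 0"
          using z eq1 fout
        proof eventually_elim
          fix y assume a: "y \<in> ball x (2 * R * ea) \<longrightarrow> W1 y = 0" "U1 y = fb y + lap ea W1 y" "y \<notin> supp_D f \<longrightarrow> fb y = 0"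
          show "y \<in> ?Nb \<longrightarrow> U1 y = 0"
          proof
            assume y: "y \<in> ?Nb"
            then have "W1 y = 0" using a(1) sub2 by auto
            moreover have "fb y = 0" using y a(3) r0(3) by blast
            ultimately show "U1 y = 0" using a(2) c0[of y] y by (simp add: lap_def)
          qed
        qed
        moreover have "open ?Nb" "x \<in> ?Nb" using R1 ea r0 by auto
        ultimately show False using mushy_region_D(3)[OF U1(1-3) fb(1,2) supp ret1 ea(3)] by blast
      qed
    qed
    then obtain y where y: "c \<le> K * (dist x y)\<^sup>2" "K * dist x y ^ 4 \<le> B + 1"
      "c * \<kappa> ^ ?N * dist x y ^ (?N + 2) \<le> (LINT u:ball y (\<kappa> * dist x y)|lborel. W1 u)" by blast
    define d where "d = dist x y"
    have d0: "0 \<le> d" by (simp add: d_def)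
    have dmd: "dm \<le> d"
    proof -
      have "c / K \<le> d\<^sup>2" using y(1) K by (simp add: d_def divide_le_eq mult.commute)
      then have "sqrt (c / K) \<le> sqrt (d\<^sup>2)" by (rule real_sqrt_le_mono)
      then show ?thesis using d0 by (simp add: dm_def)
    qed
    have d: "0 < d" using dmd dm by simp
    have dr: "d \<le> r0 / 2"
    proof -
      have "K * d ^ 4 \<le> K * (r0 / 2) ^ 4" using y(2) KB by (simp add: d_def)
      then have "d ^ 4 \<le> (r0 / 2) ^ 4" using K by simp
      then show ?thesis using r0 by (intro power_le_imp_le_base[of d 3]) (auto simp: numeral_eq_Suc)
    qed
    define X where "X = \<kappa> ^ ?N * d ^ (?N + 2)"
    have \<kappa>d: "0 < \<kappa> * d" "\<kappa> * d \<le> d" using \<kappa> d by (auto simp: mult_left_le_one_le)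
    have "ball y (\<kappa> * d) \<inter> E = {}"
    proof (rule ccontr)
      assume "ball y (\<kappa> * d) \<inter> E \<noteq> {}"
      then obtain z where z: "z \<in> ball y (\<kappa> * d)" "z \<in> E" by blast
      \<comment> \<open>The growth estimate needs a scale below the radius of its ball;
        \<open>eb < \<kappa> * d\<close> ensures this.\<close>
      obtain eb where eb: "0 < eb" "eb < min e1 (\<kappa> * d)" "z \<in> mushy_region (u eb T)"
        using small[OF z(2), of "min e1 (\<kappa> * d)"] e1 \<kappa>d by auto
      obtain U2 W2 where U2: "integrable lborel U2" "u eb T = abs_L1 U2" "\<And>x. 0 \<le> U2 x" "\<And>x. U2 x \<le> C"
        and W2: "integrable lborel W2" "wint (u eb) T = abs_L1 W2" "\<And>x. 0 \<le> W2 x" "\<And>x. W2 x \<le> T * C"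
        and eq2: "AE x in lborel. U2 x = fb x + lap eb W2 x" and ret2: "AE x in lborel. U2 x \<le> 1 \<longrightarrow> W2 x = 0 \<and> fb x \<le> 1"
        by (rule profile[OF sol[OF eb(1)] eb(1) T C fb(1) absf fb(3,4)]) (use that in blast)
      have up: "AE w in lborel. conv (Jeps eb) W2 w \<le> W2 w + C * eb\<^sup>2"
        using eq2
      proof eventually_elim
        fix w assume "U2 w = fb w + lap eb W2 w"
        then have "lap eb W2 w \<le> C" using U2(4)[of w] fb(3)[of w] by simp
        then have "eb\<^sup>2 * lap eb W2 w \<le> eb\<^sup>2 * C" by (rule mult_left_mono) simp
        then show "conv (Jeps eb) W2 w \<le> W2 w + C * eb\<^sup>2" unfolding lapc[OF eb(1)] by (simp add: mult.commute)
      qed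
      have W20: "AE w in lborel. w \<in> mushy_region (u eb T) \<longrightarrow> W2 w = 0"
        by (rule mushy_region_D(1)[OF U2(1-3) fb(1,2) supp ret2])
      have op: "open (mushy_region (u eb T) \<inter> ball y (\<kappa> * d))" by (auto simp: mushy_region_def)
      obtain s where s: "0 < s" "ball z s \<subseteq> mushy_region (u eb T) \<inter> ball y (\<kappa> * d)"
        using openE[OF op, of z] z eb by blast
      have gae: "AE w in lborel. w \<in> ball z s \<longrightarrow> W2 w = 0 \<and> conv (Jeps eb) W2 w \<le> C * eb\<^sup>2"
        using up W20 by eventually_elim (use s in auto)
      \<comment> \<open>\<open>z\<close> itself may belong to an exceptional null set; a nearby
        point in its mushy region has the required bound for the average of
        \<open>W2\<close>.\<close>
      obtain z' where z': "z' \<in> ball z s" "conv (Jeps eb) W2 z' \<le> C * eb\<^sup>2"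
        using ex_good_point[OF W2(1,3) gae s(1)] by blast
      have z'y: "dist y z' < \<kappa> * d" using z'(1) s(2) by auto
      have "(LINT w:ball z' (2 * (\<kappa> * d))|lborel. W2 w) \<le> CG * C * (2 * (\<kappa> * d)) ^ (?N + 2)"
      proof (rule gr[OF W2(1,3) _ eb(1)])
        have "0 \<le> C * eb\<^sup>2" using C by simp
        then show "conv (Jeps eb) W2 z' \<le> 2 * C * eb\<^sup>2" using z'(2) by linarith
        show "AE w in lborel. w \<in> ball z' (CG * (2 * (\<kappa> * d))) \<longrightarrow> conv (Jeps eb) W2 w \<le> W2 w + C * eb\<^sup>2"
          using up by eventually_elim simp
      qed (use C eb \<kappa>d in auto)
      also have "CG * C * (2 * (\<kappa> * d)) ^ (?N + 2) = q * \<kappa>\<^sup>2 * (\<kappa> ^ ?N * d ^ (?N + 2))"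
        unfolding q_def power_mult_distrib power_add by (simp only: mult_ac)
      also have "\<dots> \<le> c / 4 * (\<kappa> ^ ?N * d ^ (?N + 2))"
        using q\<kappa> \<kappa> d by (intro mult_right_mono) auto
      finally have I2: "(LINT w:ball z' (2 * (\<kappa> * d))|lborel. W2 w) \<le> c / 4 * (\<kappa> ^ ?N * d ^ (?N + 2))" .
      have "ball y (\<kappa> * d) \<subseteq> ball z' (2 * (\<kappa> * d))"
      proof
        fix w assume "w \<in> ball y (\<kappa> * d)"
        then show "w \<in> ball z' (2 * (\<kappa> * d))" using z'y dist_triangle[of z' w y] by (simp add: dist_commute)
      qed
      then have I3: "(LINT w:ball y (\<kappa> * d)|lborel. W2 w) \<le> (LINT w:ball z' (2 * (\<kappa> * d))|lborel. W2 w)"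
        using W2 by (intro set_integral_mono_sets) auto
      have bA: "ball y (\<kappa> * d) \<subseteq> A"
      proof
        fix w assume "w \<in> ball y (\<kappa> * d)"
        then show "w \<in> A" using dist_triangle[of x w y] \<kappa>d dr r0 unfolding A_def by (simp add: d_def)
      qed
      have Wd: "integrable lborel (\<lambda>w. \<bar>W1 w - W2 w\<bar>)" using W1 W2 by auto
      have iy: "integrable lborel (\<lambda>w. indicator (ball y (\<kappa> * d)) w *\<^sub>R F w)" if "integrable lborel F" for F :: "real ^ 'n \<Rightarrow> real"
        by (rule integrable_mult_indicator[OF _ that]) simp
      have "(LINT w:ball y (\<kappa> * d)|lborel. W1 w)
        \<le> (LINT w|lborel. indicator (ball y (\<kappa> * d)) w *\<^sub>R W2 w + indicator (ball y (\<kappa> * d)) w *\<^sub>R \<bar>W1 w - W2 w\<bar>)"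
        unfolding set_lebesgue_integral_def
        by (intro integral_mono Bochner_Integration.integrable_add iy W1 W2 Wd) (auto simp: indicator_def)
      also have "\<dots> = (LINT w:ball y (\<kappa> * d)|lborel. W2 w) + (LINT w:ball y (\<kappa> * d)|lborel. \<bar>W1 w - W2 w\<bar>)"
        unfolding set_lebesgue_integral_def by (intro Bochner_Integration.integral_add iy W2 Wd)
      also have "(LINT w:ball y (\<kappa> * d)|lborel. \<bar>W1 w - W2 w\<bar>) \<le> (LINT w:A|lborel. \<bar>W1 w - W2 w\<bar>)"
        using bA A by (intro set_integral_mono_sets Wd) auto
      also have "\<dots> \<le> \<rho>"
        by (rule ca[OF ea(1) _ eb(1) _ sol[OF ea(1)] sol[OF eb(1)] W1(1) W2(1) W1(2) W2(2)]) (use ea eb in auto)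
      also have "\<rho> \<le> c / 4 * (\<kappa> ^ ?N * d ^ (?N + 2))"
        unfolding \<rho>_def mult.assoc using c \<kappa> dm dmd by (intro mult_left_mono power_mono) auto
      \<comment> \<open>Growth and the Cauchy bound each contribute at most a quarter of
        \<open>c * X\<close>, whereas nondegeneracy demands all of it.\<close>
      finally have "(LINT w:ball y (\<kappa> * d)|lborel. W1 w) \<le> c / 4 * X + c / 4 * X"
        using I2 I3 unfolding X_def by linarith
      moreover have "c * X \<le> (LINT w:ball y (\<kappa> * d)|lborel. W1 w)"
        using y(3) unfolding d_def X_def by (simp only: mult.assoc)
      moreover have "0 < c * X" using \<kappa> d c by (simp add: X_def)
      ultimately show False by (simp add: field_simps)
    qed
    moreover have "d < r" using dr r0 d by simp
    ultimately show "\<exists>y d. 0 < d \<and> d < r \<and> dist x y \<le> d \<and> ball y (\<kappa> * d) \<inter> E = {}"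
      using d by (intro exI[of _ y] exI[of _ d]) (auto simp: d_def)
  qed
  then show ?thesis by (simp add: E_def)
qed

end

section \<open>Passage to the hypotheses of the theorem\<close>

lemma admissible_kernel_unit_kernel:
  fixes J :: "real ^ 'n \<Rightarrow> real"
  assumes "admissible_kernel J"
  obtains R where "unit_kernel J R"
proof -
  have J: "continuous_on UNIV J" "\<And>x. 0 \<le> J x" "compact (closure {x. J x \<noteq> 0})"
    "\<And>x y. norm x = norm y \<Longrightarrow> J x = J y" "(LINT x|lebesgue. J x) = 1"
    using assms unfolding admissible_kernel_def by blast+
  have "bounded {x. J x \<noteq> 0}"
    using compact_imp_bounded[OF J(3)] bounded_subset closure_subset by blast
  then obtain b where b: "\<And>x. J x \<noteq> 0 \<Longrightarrow> norm x \<le> b" by (auto simp: bounded_iff)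
  \<comment> \<open>The \<open>+ 1\<close> makes \<open>J\<close> vanish at the radius itself and
    not only beyond it.\<close>
  have "unit_kernel J (max 1 (b + 1))"
  proof
    show "kern J (max 1 (b + 1))"
      unfolding kern_def
    proof (intro conjI allI impI)
      fix x :: "real ^ 'n" assume x: "max 1 (b + 1) \<le> norm x"
      show "J x = 0"
      proof (rule ccontr)
        assume "J x \<noteq> 0"
        then show False using b[of x] x by simp
      qed
    qed (use J(1) in auto)
    show "(LINT x|lborel. J x) = 1"
      using J(5) integral_lebesgue_lborel[OF borel_measurable_continuous_onI[OF J(1)]] by simp
  qed (simp, fact J(2), fact J(4))
  then show ?thesis using that by blast
qed

theorem corollary4p4:
  fixes J f :: "real ^ 'n \<Rightarrow> real"
    and u :: "real \<Rightarrow> real \<Rightarrow> (real ^ 'n) L1"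
    and t :: real
  assumes "admissible_kernel J"
    and "integrable lebesgue f"
    and "\<exists>C. AE x in lebesgue. \<bar>f x\<bar> \<le> C"
    and "AE x in lebesgue. 0 \<le> f x"
    and "supp_D f = supp_D (\<lambda>x. max (f x - 1) 0)"
    and "\<And>\<epsilon>. 0 < \<epsilon> \<Longrightarrow> L1_solution J \<epsilon> f (u \<epsilon>)"
    and "0 < t"
  shows "(\<Inter>\<eta>\<in>{0<..}. \<Union>\<epsilon>\<in>{0<..<\<eta>}. mushy_region (u \<epsilon> t)) \<in> null_sets lebesgue"
proof -
  obtain R where "unit_kernel J R" using admissible_kernel_unit_kernel[OF assms(1)] .
  then interpret unit_kernel J R .
  obtain C0 where C0: "AE x in lebesgue. \<bar>f x\<bar> \<le> C0" using assms(3) by blast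
  define C where "C = max 1 C0"
  obtain g where g: "integrable lborel g" "AE x in lebesgue. f x = g x"
    by (rule ex_borel_representative[OF assms(2)])
  \<comment> \<open>Clipping carries the almost everywhere bounds over to every point of a Borel
    representative.\<close>
  define fb where "fb x = max 0 (min C (g x))" for x
  have [measurable]: "g \<in> borel_measurable lborel" using g by (auto dest: borel_measurable_integrable)
  have C1: "1 \<le> C" by (simp add: C_def)
  have fb: "integrable lborel fb"
  proof (rule Bochner_Integration.integrable_bound[OF g(1)])
    show "fb \<in> borel_measurable lborel" unfolding fb_def by measurable
    show "AE x in lborel. norm (fb x) \<le> norm (g x)" using C1 by (intro AE_I2) (auto simp: fb_def)
  qed
  have ae: "AE x in lebesgue. f x = fb x"
    using g(2) C0 assms(4) by eventually_elim (auto simp: fb_def C_def)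
  have fb0: "0 \<le> fb x" and fbC: "fb x \<le> C" for x using C1 by (auto simp: fb_def)
  show ?thesis
    using assms(2,5,6,7) by (intro limsup_mushy_region_null[OF C1 fb ae fb0 fbC]) auto
qed

end
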